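(* Let $H$ be a torsion-free mixed Hodge structure (over $\mathbb{Z}$) with positive weights, let $p$ be a positive integer, and assume that $\mathrm{gr}^W_{2p-1}H$ is polarizable. Let $H'\subseteq W_{2p-1}H\subseteq H''\subseteq W_{2p}H$, $H^e=H''/W_{2p-2}H$, the extension class map $e^p: H^{p,p}_{\mathbb{Z}}\to J^p(H)$ and the extension class map $$h^p:\ \mathrm{Hom}\bigl(\mathbb{Z}(-p),\,H''/H'\bigr)\to \mathrm{Ext}\bigl(\mathbb{Z}(-p),\,H'/W_{2p-2}H\bigr)$$ be as defined in the context. Then $h^p$ yields a 1-motive over $\mathbb{C}$ which is just the restriction of $e^p:H^{p,p}_{\mathbb{Z}}\to J^p(H)$ to the largest abelian subvariety of $J^p(H)$; that is, $\mathrm{Ext}(\mathbb{Z}(-p),H'/W_{2p-2}H)$ is identified with the largest abelian subvariety $A$ of the complex torus $J^p(H)$, $\mathrm{Hom}(\mathbb{Z}(-p),H''/H')$ is identified with the subgroup $(e^p)^{-1}(A)\subseteq H^{p,p}_{\mathbb{Z}}$, and under these (natural) identifications $h^p$ is the restriction of $e^p$. In particular, $\ker(h^p)=\ker(e^p)$.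
   Context: Mixed Hodge structures are Deligne's: $H=(H_{\mathbb{Z}},W,F)$ with $H_{\mathbb{Z}}$ a finitely generated abelian group, $W$ a finite increasing filtration on $H_{\mathbb{Q}}$, $F$ a finite decreasing filtration on $H_{\mathbb{C}}$, such that $W,F,\overline F$ are opposed. $\mathrm{Hom}$ and $\mathrm{Ext}=\mathrm{Ext}^1$ are taken in the abelian category $\mathrm{MHS}$ of mixed Hodge structures. For $H$ torsion free, $W_*H$ denotes the sub-structures obtained by intersecting the weight filtration with $H_{\mathbb{Z}}$. The extension $0\to \mathrm{gr}^W_{2p-1}H\to W_{2p}H/W_{2p-2}H\to \mathrm{gr}^W_{2p}H\to 0$ gives, by applying $\mathrm{Hom}(\mathbb{Z}(-p),-)$, the connecting homomorphism $e^p:\mathrm{Hom}(\mathbb{Z}(-p),\mathrm{gr}^W_{2p}H)\to \mathrm{Ext}(\mathbb{Z}(-p),\mathrm{gr}^W_{2p-1}H)$. Here $H^{p,p}_{\mathbb{Z}}:=\mathrm{Hom}(\mathbb{Z}(-p),\mathrm{gr}^W_{2p}H)$ is the group (sub-structure) of integral $(p,p)$-classes in $\mathrm{gr}^W_{2p}H$, and $J^p(H):=\mathrm{Ext}(\mathbb{Z}(-p),\mathrm{gr}^W_{2p-1}H)\cong \mathrm{gr}^W_{2p-1}H_{\mathbb{C}}/(F^p+\mathrm{gr}^W_{2p-1}H_{\mathbb{Z}})$ is a compact complex torus. Let $H^{2p-1}_a:=(H^{p-1,p}+H^{p,p-1})_{\mathbb{Z}}$ be the largest sub-Hodge structure of $\mathrm{gr}^W_{2p-1}H$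 purely of type $\{(p-1,p),(p,p-1)\}$ (it is polarizable). Let $H'\subseteq W_{2p-1}H$ be the preimage of $H^{2p-1}_a$ under the projection $W_{2p-1}H\to\mathrm{gr}^W_{2p-1}H$, so that $H'/W_{2p-2}H=H^{2p-1}_a$. Let $H''\subseteq W_{2p}H$ be the preimage of the sub-structure $H^{p,p}_{\mathbb{Z}}$ under the projection $W_{2p}H\to\mathrm{gr}^W_{2p}H$. Put $H^e:=H''/W_{2p-2}H$. The map $h^p$ is the connecting homomorphism obtained by applying $\mathrm{Hom}(\mathbb{Z}(-p),-)$ to the extension $0\to H'/W_{2p-2}H\to H^e\to H''/H'\to 0$. A 1-motive over $\mathbb{C}$ is a homomorphism $[L\to G]$ with $L$ a finitely generated free abelian group and $G$ a semi-abelian variety over $\mathbb{C}$.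
   Formalization: "Largest abelian subvariety of J^p(H)" is taken among abelian subvarieties with tangent space in H^{p-1,p}=F^{p-1}/F^p; literally the claim fails, e.g. p=2, H of rank 2 and type {(3,0),(0,3)} with lattice Z[i], where J^2(H) is an elliptic curve but the Ext group is 0. *)

theory Defs
  imports Complex_Main "HOL-Algebra.Algebra" "HOL-Algebra.Algebraic_Closure_Type"
begin

section \<open>Complex vector spaces with carriers, lattices\<close>

abbreviation C_ring :: "complex ring" where
  "C_ring \<equiv> ring_of_type_algebra"

definition C_space :: "(complex, 'v, 'm) module_scheme \<Rightarrow> bool" where
  "C_space V \<longleftrightarrow> Module.module C_ring V"

abbreviation C_subspace :: "'v set \<Rightarrow> (complex, 'v, 'm) module_scheme \<Rightarrow> bool" where
  "C_subspace U V \<equiv> submodule U C_ring V"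

definition C_span :: "(complex, 'v, 'm) module_scheme \<Rightarrow> 'v set \<Rightarrow> 'v set" where
  "C_span V S = \<Inter>{U. C_subspace U V \<and> S \<subseteq> U}"

definition C_linear ::
  "(complex, 'v, 'm) module_scheme \<Rightarrow> (complex, 'w, 'n) module_scheme \<Rightarrow> ('v \<Rightarrow> 'w) set" where
  "C_linear V V' = {f \<in> carrier V \<rightarrow> carrier V'.
     (\<forall>x\<in>carrier V. \<forall>y\<in>carrier V. f (x \<oplus>\<^bsub>V\<^esub> y) = f x \<oplus>\<^bsub>V'\<^esub> f y) \<and>
     (\<forall>c. \<forall>x\<in>carrier V. f (c \<odot>\<^bsub>V\<^esub> x) = c \<odot>\<^bsub>V'\<^esub> f x)}"

definition sub_space ::
  "(complex, 'v, 'm) module_scheme \<Rightarrow> 'v set \<Rightarrow> (complex, 'v, 'm) module_scheme" where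
  "sub_space V U = V\<lparr>carrier := U\<rparr>"

definition quot_space ::
  "(complex, 'v, 'm) module_scheme \<Rightarrow> 'v set \<Rightarrow> (complex, 'v set) module" where
  "quot_space V N =
     \<lparr>carrier = a_rcosets\<^bsub>V\<^esub> N, monoid.mult = undefined, one = undefined,
      ring.zero = N, ring.add = set_add V,
      module.smult = (\<lambda>c P. \<Union>x\<in>P. N +>\<^bsub>V\<^esub> (c \<odot>\<^bsub>V\<^esub> x))\<rparr>"

definition lin_comb :: "(complex, 'v, 'm) module_scheme \<Rightarrow> 'v set \<Rightarrow> ('v \<Rightarrow> complex) \<Rightarrow> 'v" where
  "lin_comb V B c = (\<Oplus>\<^bsub>V\<^esub>b\<in>B. c b \<odot>\<^bsub>V\<^esub> b)"

text \<open>\<open>full_lattice K V L\<close> says that \<open>L\<close> is a free abelian group of finite rank with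
  \<open>L \<otimes> K = V\<close>; it is used for \<open>K = UNIV\<close> and for \<open>K = \<real>\<close>.\<close>

definition full_lattice ::
  "complex set \<Rightarrow> (complex, 'v, 'm) module_scheme \<Rightarrow> 'v set \<Rightarrow> bool" where
  "full_lattice K V L \<longleftrightarrow> (\<exists>B. finite B \<and> B \<subseteq> carrier V \<and>
     (\<forall>x\<in>carrier V. \<exists>!c. c \<in> B \<rightarrow>\<^sub>E K \<and> x = lin_comb V B c) \<and>
     L = lin_comb V B ` (B \<rightarrow>\<^sub>E \<int>))"


section \<open>Torsion-free mixed Hodge structures\<close>

text \<open>The underlying module of the record is \<open>H\<^sub>C\<close>.  A torsion-free \<open>H\<^sub>Z\<close> is identified with its
  image in \<open>H\<^sub>C = H\<^sub>Z \<otimes> C\<close>, and \<open>H\<^sub>Q\<close> with \<open>Q \<cdot> H\<^sub>Z\<close>.\<close>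

record 'a mhs = "(complex, 'a) module" +
  HZ :: "'a set"
  Wt :: "int \<Rightarrow> 'a set"
  Fil :: "int \<Rightarrow> 'a set"

definition HQ :: "'a mhs \<Rightarrow> 'a set" where
  "HQ H = {x \<in> carrier H. \<exists>n::nat. n > 0 \<and> of_nat n \<odot>\<^bsub>H\<^esub> x \<in> HZ H}"

text \<open>Complex conjugation on \<open>H\<^sub>Z \<otimes> C\<close>.\<close>

definition cconj :: "'a mhs \<Rightarrow> 'a \<Rightarrow> 'a" where
  "cconj H = (THE \<sigma>. \<sigma> \<in> carrier H \<rightarrow>\<^sub>E carrier H \<and>
     (\<forall>x\<in>carrier H. \<forall>y\<in>carrier H. \<sigma> (x \<oplus>\<^bsub>H\<^esub> y) = \<sigma> x \<oplus>\<^bsub>H\<^esub> \<sigma> y) \<and>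
     (\<forall>c. \<forall>x\<in>carrier H. \<sigma> (c \<odot>\<^bsub>H\<^esub> x) = cnj c \<odot>\<^bsub>H\<^esub> \<sigma> x) \<and>
     (\<forall>x\<in>HZ H. \<sigma> x = x))"

definition sub_mhs :: "'a mhs \<Rightarrow> 'a set \<Rightarrow> 'a mhs" where
  "sub_mhs H U = H\<lparr>carrier := U, HZ := HZ H \<inter> U,
     Wt := (\<lambda>k. Wt H k \<inter> U), Fil := (\<lambda>k. Fil H k \<inter> U)\<rparr>"

definition quot_mhs :: "'a mhs \<Rightarrow> 'a set \<Rightarrow> 'a set mhs" where
  "quot_mhs H N = module.extend (quot_space H N)
     \<lparr>HZ = (\<lambda>x. N +>\<^bsub>H\<^esub> x) ` HZ H,
      Wt = (\<lambda>k. (\<lambda>x. N +>\<^bsub>H\<^esub> x) ` Wt H k),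
      Fil = (\<lambda>k. (\<lambda>x. N +>\<^bsub>H\<^esub> x) ` Fil H k)\<rparr>"

definition WC :: "'a mhs \<Rightarrow> int \<Rightarrow> 'a set" where
  "WC H k = C_span H (Wt H k)"

definition gr :: "'a mhs \<Rightarrow> int \<Rightarrow> 'a set mhs" where
  "gr H k = quot_mhs (sub_mhs H (WC H k)) (WC H (k - 1))"

definition opposed :: "'a mhs \<Rightarrow> int \<Rightarrow> bool" where
  "opposed G n \<longleftrightarrow> (\<forall>a b. a + b = n + 1 \<longrightarrow>
     Fil G a \<inter> cconj G ` Fil G b = {\<zero>\<^bsub>G\<^esub>} \<and>
     set_add G (Fil G a) (cconj G ` Fil G b) = carrier G)"

definition MHS :: "'a mhs \<Rightarrow> bool" where
  "MHS H \<longleftrightarrow> C_space H \<and> full_lattice UNIV H (HZ H) \<and>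
     (\<forall>k. Wt H k \<subseteq> HQ H \<and> subgroup (Wt H k) (add_monoid H) \<and>
          (\<forall>r. \<forall>x\<in>Wt H k. of_rat r \<odot>\<^bsub>H\<^esub> x \<in> Wt H k)) \<and>
     mono (Wt H) \<and> (\<exists>k. Wt H k = {\<zero>\<^bsub>H\<^esub>}) \<and> (\<exists>k. Wt H k = HQ H) \<and>
     (\<forall>k. C_subspace (Fil H k) H) \<and>
     antimono (Fil H) \<and> (\<exists>k. Fil H k = {\<zero>\<^bsub>H\<^esub>}) \<and> (\<exists>k. Fil H k = carrier H) \<and>
     (\<forall>k. opposed (gr H k) k)"

definition mhs_hom :: "'a mhs \<Rightarrow> 'b mhs \<Rightarrow> ('a \<Rightarrow> 'b) set" where
  "mhs_hom A B = {f \<in> extensional (carrier A). f \<in> C_linear A B \<and> f ` HZ A \<subseteq> HZ B \<and>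
     (\<forall>k. f ` Wt A k \<subseteq> Wt B k \<and> f ` Fil A k \<subseteq> Fil B k)}"

definition Hom :: "'a mhs \<Rightarrow> 'b mhs \<Rightarrow> ('a \<Rightarrow> 'b) monoid" where
  "Hom A B = \<lparr>carrier = mhs_hom A B,
     monoid.mult = (\<lambda>f g. \<lambda>x\<in>carrier A. f x \<oplus>\<^bsub>B\<^esub> g x),
     one = (\<lambda>x\<in>carrier A. \<zero>\<^bsub>B\<^esub>)\<rparr>"

text \<open>\<open>Z(m)\<close> with \<open>Z(m)\<^sub>Z = (2\<pi>i)\<^sup>m Z\<close>, pure of weight \<open>-2m\<close> and type \<open>(-m,-m)\<close>.\<close>

definition tate_gen :: "int \<Rightarrow> complex" where
  "tate_gen m = (2 * of_real pi * \<i>) powi m"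

definition tate :: "int \<Rightarrow> complex mhs" where
  "tate m = \<lparr>carrier = UNIV, monoid.mult = (*), one = 1, ring.zero = 0, ring.add = (+), module.smult = (*),
     HZ = range (\<lambda>n::int. of_int n * tate_gen m),
     Wt = (\<lambda>k. if - 2 * m \<le> k then range (\<lambda>r::rat. of_rat r * tate_gen m) else {0}),
     Fil = (\<lambda>k. if k \<le> - m then UNIV else {0})\<rparr>"


section \<open>Hodge types and polarizations\<close>

text \<open>\<open>H\<^sup>a\<^sup>,\<^sup>b\<close>, to be used for \<open>G\<close> pure of weight \<open>a + b\<close>.\<close>

definition hodge_comp :: "'a mhs \<Rightarrow> int \<Rightarrow> int \<Rightarrow> 'a set" where
  "hodge_comp G a b = Fil G a \<inter> cconj G ` Fil G b"

text \<open>The form \<open>S\<close> is \<open>(2\<pi>i)\<^sup>n Q\<close> for a morphism \<open>Q : G \<otimes> G \<rightarrow> Z(-n)\<close>.\<close>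

definition polarization :: "'a mhs \<Rightarrow> int \<Rightarrow> ('a \<Rightarrow> 'a \<Rightarrow> complex) \<Rightarrow> bool" where
  "polarization G n S \<longleftrightarrow>
     (\<forall>x\<in>carrier G. \<forall>y\<in>carrier G. \<forall>z\<in>carrier G. S (x \<oplus>\<^bsub>G\<^esub> y) z = S x z + S y z) \<and>
     (\<forall>c. \<forall>x\<in>carrier G. \<forall>y\<in>carrier G. S (c \<odot>\<^bsub>G\<^esub> x) y = c * S x y) \<and>
     (\<forall>x\<in>carrier G. \<forall>y\<in>carrier G. S y x = (- 1) powi n * S x y) \<and>
     (\<forall>x\<in>HZ G. \<forall>y\<in>HZ G. S x y \<in> \<int>) \<and>
     (\<forall>a b a' b'. a + b = n \<and> a' + b' = n \<and> (a', b') \<noteq> (b, a) \<longrightarrow>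
        (\<forall>x\<in>hodge_comp G a b. \<forall>y\<in>hodge_comp G a' b'. S x y = 0)) \<and>
     (\<forall>a b. a + b = n \<longrightarrow> (\<forall>x\<in>hodge_comp G a b - {\<zero>\<^bsub>G\<^esub>}.
        \<i> powi (a - b) * S x (cconj G x) \<in> \<real> \<and> Re (\<i> powi (a - b) * S x (cconj G x)) > 0))"

definition polarizable :: "'a mhs \<Rightarrow> int \<Rightarrow> bool" where
  "polarizable G n \<longleftrightarrow> (\<exists>S. polarization G n S)"


section \<open>Yoneda extensions of mixed Hodge structures\<close>

definition prod_mhs :: "'a mhs \<Rightarrow> 'b mhs \<Rightarrow> ('a \<times> 'b) mhs" where
  "prod_mhs A B = \<lparr>carrier = carrier A \<times> carrier B, monoid.mult = undefined, one = undefined,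
     ring.zero = (\<zero>\<^bsub>A\<^esub>, \<zero>\<^bsub>B\<^esub>),
     ring.add = (\<lambda>(x, y) (x', y'). (x \<oplus>\<^bsub>A\<^esub> x', y \<oplus>\<^bsub>B\<^esub> y')),
     module.smult = (\<lambda>c (x, y). (c \<odot>\<^bsub>A\<^esub> x, c \<odot>\<^bsub>B\<^esub> y)),
     HZ = HZ A \<times> HZ B, Wt = (\<lambda>k. Wt A k \<times> Wt B k), Fil = (\<lambda>k. Fil A k \<times> Fil B k)\<rparr>"

definition fibre_prod ::
  "'a mhs \<Rightarrow> ('a \<Rightarrow> 'c) \<Rightarrow> 'b mhs \<Rightarrow> ('b \<Rightarrow> 'c) \<Rightarrow> ('a \<times> 'b) mhs" where
  "fibre_prod A f B g =
     sub_mhs (prod_mhs A B) {(x, y). x \<in> carrier A \<and> y \<in> carrier B \<and> f x = g y}"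

text \<open>Exactness of \<open>0 \<rightarrow> A \<rightarrow> E \<rightarrow> C \<rightarrow> 0\<close>: \<open>i\<close> is an isomorphism onto the kernel of \<open>q\<close>, which carries
  the induced structure, and \<open>q\<close> identifies \<open>C\<close> with the quotient structure.\<close>

definition short_exact ::
  "'a mhs \<Rightarrow> ('a \<Rightarrow> 'e) \<Rightarrow> 'e mhs \<Rightarrow> ('e \<Rightarrow> 'c) \<Rightarrow> 'c mhs \<Rightarrow> bool" where
  "short_exact A i E q C \<longleftrightarrow> i \<in> mhs_hom A E \<and> q \<in> mhs_hom E C \<and>
     inj_on i (carrier A) \<and> i ` carrier A = {x \<in> carrier E. q x = \<zero>\<^bsub>C\<^esub>} \<and>
     q ` carrier E = carrier C \<and>
     i ` HZ A = i ` carrier A \<inter> HZ E \<and> q ` HZ E = HZ C \<and>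
     (\<forall>k. i ` Wt A k = i ` carrier A \<inter> Wt E k \<and> q ` Wt E k = Wt C k \<and>
          i ` Fil A k = i ` carrier A \<inter> Fil E k \<and> q ` Fil E k = Fil C k)"

type_synonym ('a, 'e, 't) ext_data = "'e mhs \<times> ('a \<Rightarrow> 'e) \<times> ('e \<Rightarrow> 't)"

text \<open>Extensions of \<open>T\<close> by \<open>A\<close>.  The middle term of any extension, in whatever type, has
  \<open>E\<^sub>C \<cong> A\<^sub>C \<times> T\<^sub>C\<close>, so that every equivalence class is represented in the type \<open>'a \<times> 't\<close>.
  An extension of \<open>T\<close> by \<open>A\<close> with torsion-free \<open>T\<^sub>Z\<close> and \<open>A\<^sub>Z\<close> has torsion-free \<open>E\<^sub>Z\<close>.\<close>

definition extensions :: "'t mhs \<Rightarrow> 'a mhs \<Rightarrow> ('a, 'a \<times> 't, 't) ext_data set" where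
  "extensions T A = {(E, i, q). MHS E \<and> short_exact A i E q T}"

text \<open>Morphisms of extensions of one and the same \<open>T\<close>, over \<open>f\<close> on the kernels and over the
  identity of \<open>T\<close>.\<close>

definition ext_morphism ::
  "'a mhs \<Rightarrow> ('a \<Rightarrow> 'b) \<Rightarrow> ('a, 'e, 't) ext_data \<Rightarrow> ('b, 'd, 't) ext_data \<Rightarrow> bool" where
  "ext_morphism A f D P \<longleftrightarrow> (case D of (E, i, q) \<Rightarrow> case P of (E', i', q') \<Rightarrow>
     \<exists>\<phi>\<in>mhs_hom E E'. (\<forall>a\<in>carrier A. \<phi> (i a) = i' (f a)) \<and> (\<forall>x\<in>carrier E. q' (\<phi> x) = q x))"

text \<open>The class in \<open>Ext(T, B)\<close> of the push-out along \<open>f : A \<rightarrow> B\<close> of an extension \<open>D\<close> of \<open>T\<close> by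
  \<open>A\<close>: by the five lemma it consists of the extensions that receive a morphism from \<open>D\<close> over
  \<open>f\<close>.  For \<open>f = id\<close> it is the equivalence class of \<open>D\<close>.\<close>

definition push_class ::
  "'t mhs \<Rightarrow> 'a mhs \<Rightarrow> ('a \<Rightarrow> 'b) \<Rightarrow> 'b mhs \<Rightarrow> ('a, 'e, 't) ext_data
     \<Rightarrow> ('b, 'b \<times> 't, 't) ext_data set" where
  "push_class T A f B D = {P \<in> extensions T B. ext_morphism A f D P}"

definition ext_rel ::
  "'t mhs \<Rightarrow> 'a mhs \<Rightarrow> (('a, 'a \<times> 't, 't) ext_data \<times> ('a, 'a \<times> 't, 't) ext_data) set" where
  "ext_rel T A = {(D, P). D \<in> extensions T A \<and> P \<in> extensions T A \<and> ext_morphism A id D P}"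

definition fibre_ext ::
  "('a, 'e, 't) ext_data \<Rightarrow> ('a, 'd, 't) ext_data \<Rightarrow> ('a \<times> 'a, 'e \<times> 'd, 't) ext_data" where
  "fibre_ext D D' = (case D of (E, i, q) \<Rightarrow> case D' of (E', i', q') \<Rightarrow>
     (fibre_prod E q E' q', (\<lambda>(a, b). (i a, i' b)), (\<lambda>(x, y). q x)))"

text \<open>The group law is the Baer sum, and the zero element is the class of split extensions.\<close>

definition Ext ::
  "'t mhs \<Rightarrow> 'a mhs \<Rightarrow> ('a, 'a \<times> 't, 't) ext_data set monoid" where
  "Ext T A = \<lparr>carrier = extensions T A // ext_rel T A,
     monoid.mult = (\<lambda>P Q. \<Union>D\<in>P. \<Union>D'\<in>Q.
        push_class T (prod_mhs A A) (\<lambda>(a, b). a \<oplus>\<^bsub>A\<^esub> b) A (fibre_ext D D')),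
     one = {(E, i, q) \<in> extensions T A. \<exists>s\<in>mhs_hom T E. \<forall>t\<in>carrier T. q (s t) = t}\<rparr>"

definition Ext_map ::
  "'t mhs \<Rightarrow> 'a mhs \<Rightarrow> ('a \<Rightarrow> 'b) \<Rightarrow> 'b mhs \<Rightarrow> ('a, 'a \<times> 't, 't) ext_data set
     \<Rightarrow> ('b, 'b \<times> 't, 't) ext_data set" where
  "Ext_map T A f B P = (\<Union>D\<in>P. push_class T A f B D)"

text \<open>The connecting map \<open>Hom(T, C) \<rightarrow> Ext(T, A)\<close> of \<open>0 \<rightarrow> A \<rightarrow> E \<rightarrow> C \<rightarrow> 0\<close>: pull the extension back
  along \<open>f : T \<rightarrow> C\<close>.\<close>

definition connecting ::
  "'t mhs \<Rightarrow> 'a mhs \<Rightarrow> ('a \<Rightarrow> 'e) \<Rightarrow> 'e mhs \<Rightarrow> ('e \<Rightarrow> 'c) \<Rightarrow> ('t \<Rightarrow> 'c)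
     \<Rightarrow> ('a, 'a \<times> 't, 't) ext_data set" where
  "connecting T A i E q f = push_class T A id A (fibre_prod E q T f, (\<lambda>a. (i a, \<zero>\<^bsub>T\<^esub>)), snd)"


section \<open>Complex tori, abelian and semi-abelian varieties, 1-motives\<close>

text \<open>The complex torus \<open>V/L\<close> is given by the pair \<open>(V, L)\<close>; its group of points is
  \<open>V A_Mod L\<close>.\<close>

definition complex_torus :: "(complex, 'v, 'm) module_scheme \<Rightarrow> 'v set \<Rightarrow> bool" where
  "complex_torus V L \<longleftrightarrow> C_space V \<and> full_lattice \<real> V L"

text \<open>Homomorphisms of complex tori, given on points, are those that lift to linear maps.\<close>

definition torus_hom ::
  "(complex, 'v, 'm) module_scheme \<Rightarrow> 'v set \<Rightarrow> (complex, 'w, 'n) module_scheme \<Rightarrow> 'w set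
     \<Rightarrow> ('v set \<Rightarrow> 'w set) \<Rightarrow> bool" where
  "torus_hom V L V' L' \<phi> \<longleftrightarrow> (\<exists>l\<in>C_linear V V'. \<forall>v\<in>carrier V. \<phi> (L +>\<^bsub>V\<^esub> v) = L' +>\<^bsub>V'\<^esub> l v)"

definition riemann_form ::
  "(complex, 'v, 'm) module_scheme \<Rightarrow> 'v set \<Rightarrow> ('v \<Rightarrow> 'v \<Rightarrow> complex) \<Rightarrow> bool" where
  "riemann_form V L h \<longleftrightarrow>
     (\<forall>x\<in>carrier V. \<forall>y\<in>carrier V. \<forall>z\<in>carrier V. h (x \<oplus>\<^bsub>V\<^esub> y) z = h x z + h y z) \<and>
     (\<forall>c. \<forall>x\<in>carrier V. \<forall>y\<in>carrier V. h (c \<odot>\<^bsub>V\<^esub> x) y = c * h x y) \<and>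
     (\<forall>x\<in>carrier V. \<forall>y\<in>carrier V. h y x = cnj (h x y)) \<and>
     (\<forall>x\<in>carrier V - {\<zero>\<^bsub>V\<^esub>}. Re (h x x) > 0) \<and>
     (\<forall>x\<in>L. \<forall>y\<in>L. Im (h x y) \<in> \<int>)"

definition abelian_variety :: "(complex, 'v, 'm) module_scheme \<Rightarrow> 'v set \<Rightarrow> bool" where
  "abelian_variety V L \<longleftrightarrow> complex_torus V L \<and> (\<exists>h. riemann_form V L h)"

text \<open>\<open>abelian_subvariety V L M A\<close>: the set of points \<open>A\<close> is an abelian subvariety of \<open>V/L\<close>
  whose tangent space at the origin is contained in \<open>M\<close>.  For \<open>M = carrier V\<close> the condition on
  tangent spaces is void.\<close>

definition abelian_subvariety ::
  "(complex, 'v, 'm) module_scheme \<Rightarrow> 'v set \<Rightarrow> 'v set \<Rightarrow> 'v set set \<Rightarrow> bool" where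
  "abelian_subvariety V L M A \<longleftrightarrow> (\<exists>U. C_subspace U V \<and> U \<subseteq> M \<and>
     abelian_variety (sub_space V U) (L \<inter> U) \<and> A = (\<lambda>u. L +>\<^bsub>V\<^esub> u) ` U)"

text \<open>A semi-abelian variety over \<open>C\<close> in uniformized form: \<open>G = V/L\<close>, with \<open>T/(L \<inter> T)\<close> an
  algebraic torus and \<open>V/(T + L)\<close> an abelian variety.\<close>

definition semi_abelian_variety ::
  "(complex, 'v, 'm) module_scheme \<Rightarrow> 'v set \<Rightarrow> 'v set \<Rightarrow> bool" where
  "semi_abelian_variety V T L \<longleftrightarrow> C_space V \<and> C_subspace T V \<and> subgroup L (add_monoid V) \<and>
     full_lattice UNIV (sub_space V T) (L \<inter> T) \<and>
     abelian_variety (quot_space V T) ((\<lambda>x. T +>\<^bsub>V\<^esub> x) ` L)"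

definition one_motive ::
  "('l, 'k) monoid_scheme \<Rightarrow> ('l \<Rightarrow> 'v set) \<Rightarrow> (complex, 'v, 'm) module_scheme \<Rightarrow> 'v set \<Rightarrow> 'v set
     \<Rightarrow> bool" where
  "one_motive M u V T L \<longleftrightarrow> comm_group M \<and>
     (\<exists>S::nat set. finite S \<and> M \<cong> free_Abelian_group S) \<and>
     semi_abelian_variety V T L \<and> u \<in> hom M (V A_Mod L)"


section \<open>The torus structure on \<open>Ext(Z(-p), A)\<close>\<close>

text \<open>\<open>Ext(Z(-p), A) \<cong> A\<^sub>C/(F\<^sup>p + A\<^sub>Z)\<close>, presented as the quotient of \<open>V = A\<^sub>C/F\<^sup>p\<close> by the image of
  \<open>A\<^sub>Z\<close>.

  When \<open>A\<close> is pure of weight \<open>2p - 1\<close>, the subspace \<open>F\<^sup>p\<^sup>-\<^sup>1/F\<^sup>p\<close> of the tangent space \<open>V\<close> is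
  \<open>A\<^sup>p\<^sup>-\<^sup>1\<^sup>,\<^sup>p\<close>.  The subtori of \<open>V/L\<close> with tangent space in it are those which come from
  sub-Hodge structures of \<open>A\<close> of type \<open>{(p-1,p), (p,p-1)}\<close>.  Without this condition an abelian
  subvariety of \<open>V/L\<close> need not be related to such sub-Hodge structures: for \<open>p = 2\<close> and \<open>A\<close> of
  rank 2 and type \<open>{(3,0), (0,3)}\<close>, \<open>V/L\<close> is an elliptic curve.\<close>

definition J_space :: "int \<Rightarrow> 'a mhs \<Rightarrow> (complex, 'a set) module" where
  "J_space p A = quot_space A (Fil A p)"

definition J_lattice :: "int \<Rightarrow> 'a mhs \<Rightarrow> 'a set set" where
  "J_lattice p A = (\<lambda>x. Fil A p +>\<^bsub>A\<^esub> x) ` HZ A"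

definition J_horizontal :: "int \<Rightarrow> 'a mhs \<Rightarrow> 'a set set" where
  "J_horizontal p A = (\<lambda>x. Fil A p +>\<^bsub>A\<^esub> x) ` Fil A (p - 1)"

text \<open>Carlson's isomorphism: the difference of a lift in \<open>F\<^sup>p E\<close> and a lift in \<open>E\<^sub>Z\<close> of the
  generator of \<open>Z(-p)\<close>.\<close>

definition carlson ::
  "int \<Rightarrow> 'a mhs \<Rightarrow> ('a, 'a \<times> complex, complex) ext_data set \<Rightarrow> 'a set set" where
  "carlson p A P = (THE t. \<exists>(E, i, q)\<in>P. \<exists>s\<in>Fil E p. \<exists>z\<in>HZ E. \<exists>a\<in>carrier A.
     q s = tate_gen (- p) \<and> q z = tate_gen (- p) \<and> i a = s \<ominus>\<^bsub>E\<^esub> z \<and>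
     t = J_lattice p A +>\<^bsub>J_space p A\<^esub> (Fil A p +>\<^bsub>A\<^esub> a))"


section \<open>The maps \<open>e\<^sup>p\<close> and \<open>h\<^sup>p\<close>\<close>

definition Hpp_sub :: "int \<Rightarrow> 'a mhs \<Rightarrow> 'a set" where
  "Hpp_sub p G = C_span G {f t | f t. f \<in> mhs_hom (tate (- p)) G \<and> t \<in> carrier (tate (- p))}"

text \<open>The largest sub-Hodge structure purely of type \<open>{(p-1,p), (p,p-1)}\<close>; \<open>Greatest\<close> refers to
  inclusion of sets.\<close>

definition Ha_sub :: "int \<Rightarrow> 'a mhs \<Rightarrow> 'a set" where
  "Ha_sub p G = (GREATEST U. C_subspace U G \<and> MHS (sub_mhs G U) \<and>
     U = set_add G (hodge_comp (sub_mhs G U) (p - 1) p) (hodge_comp (sub_mhs G U) p (p - 1)))"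

definition H1 :: "'a mhs \<Rightarrow> int \<Rightarrow> 'a set" where
  "H1 H p = {x \<in> WC H (2 * p - 1). WC H (2 * p - 2) +>\<^bsub>H\<^esub> x \<in> Ha_sub p (gr H (2 * p - 1))}"

definition H2 :: "'a mhs \<Rightarrow> int \<Rightarrow> 'a set" where
  "H2 H p = {x \<in> WC H (2 * p). WC H (2 * p - 1) +>\<^bsub>H\<^esub> x \<in> Hpp_sub p (gr H (2 * p))}"

definition subquot :: "'a mhs \<Rightarrow> 'a set \<Rightarrow> 'a set \<Rightarrow> 'a set mhs" where
  "subquot H U N = quot_mhs (sub_mhs H U) N"

text \<open>The map \<open>U/N \<rightarrow> U'/N'\<close> induced by the identity of \<open>H\<close>, for \<open>U \<subseteq> U'\<close> and \<open>N \<subseteq> N'\<close>.\<close>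

definition induced :: "'a mhs \<Rightarrow> 'a set \<Rightarrow> 'a set \<Rightarrow> 'a set \<Rightarrow> 'a set \<Rightarrow> 'a set" where
  "induced H U N N' = (\<lambda>P\<in>carrier (subquot H U N). set_add H N' P)"

definition e_map ::
  "'a mhs \<Rightarrow> int \<Rightarrow> (complex \<Rightarrow> 'a set) \<Rightarrow> ('a set, 'a set \<times> complex, complex) ext_data set" where
  "e_map H p = connecting (tate (- p)) (gr H (2 * p - 1))
     (induced H (WC H (2 * p - 1)) (WC H (2 * p - 2)) (WC H (2 * p - 2)))
     (subquot H (WC H (2 * p)) (WC H (2 * p - 2)))
     (induced H (WC H (2 * p)) (WC H (2 * p - 2)) (WC H (2 * p - 1)))"

definition h_map ::
  "'a mhs \<Rightarrow> int \<Rightarrow> (complex \<Rightarrow> 'a set) \<Rightarrow> ('a set, 'a set \<times> complex, complex) ext_data set" where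
  "h_map H p = connecting (tate (- p)) (subquot H (H1 H p) (WC H (2 * p - 2)))
     (induced H (H1 H p) (WC H (2 * p - 2)) (WC H (2 * p - 2)))
     (subquot H (H2 H p) (WC H (2 * p - 2)))
     (induced H (H2 H p) (WC H (2 * p - 2)) (H1 H p))"

text \<open>The natural maps \<open>Ext(Z(-p), H'/W\<^sub>2\<^sub>p\<^sub>-\<^sub>2) \<rightarrow> Ext(Z(-p), gr\<^sub>2\<^sub>p\<^sub>-\<^sub>1)\<close> and
  \<open>Hom(Z(-p), H''/H') \<rightarrow> Hom(Z(-p), gr\<^sub>2\<^sub>p)\<close>.\<close>

definition ext_incl ::
  "'a mhs \<Rightarrow> int \<Rightarrow> ('a set, 'a set \<times> complex, complex) ext_data set
     \<Rightarrow> ('a set, 'a set \<times> complex, complex) ext_data set" where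
  "ext_incl H p = Ext_map (tate (- p)) (subquot H (H1 H p) (WC H (2 * p - 2)))
     (induced H (H1 H p) (WC H (2 * p - 2)) (WC H (2 * p - 2))) (gr H (2 * p - 1))"

definition hom_incl :: "'a mhs \<Rightarrow> int \<Rightarrow> (complex \<Rightarrow> 'a set) \<Rightarrow> (complex \<Rightarrow> 'a set)" where
  "hom_incl H p f = compose (carrier (tate (- p))) (induced H (H2 H p) (H1 H p) (WC H (2 * p - 1))) f"

end

theory Submission
  imports Defs
begin

text \<open>Write \<open>G = gr\<^sub>2\<^sub>p\<^sub>-\<^sub>1 H\<close>. Sending an extension to the difference of a lift of the generator of \<open>Z(-p)\<close>
  in \<open>F\<^sup>p\<close> and an integral lift is Carlson's isomorphism of \<open>Ext(Z(-p), G)\<close> with the torus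
  \<open>G/(F\<^sup>p + G\<^sub>Z)\<close>, and the connecting homomorphisms \<open>e\<^sup>p\<close> and \<open>h\<^sup>p\<close> are given by the same
  difference of lifts to \<open>H\<close>. Let \<open>HA\<close> be the largest sub-Hodge structure of \<open>G\<close> of type
  \<open>{(p-1,p), (p,p-1)}\<close>. Its torus carries the Riemann form of the polarization, hence is an abelian
  variety, and it embeds into that of \<open>G\<close> because an integral class of \<open>G\<close> in \<open>F\<^sup>p + HA\<close> lies in \<open>HA\<close>.
  Conversely, the lattice of an abelian subvariety spans a sub-Hodge structure of this type.
  Finally, a class in \<open>gr\<^sub>2\<^sub>p H\<close> whose lifts differ by an element of \<open>HA\<close> modulo \<open>F\<^sup>p + G\<^sub>Z\<close> can be lifted
  to \<open>H''/H'\<close> by changing the two lifts within \<open>F\<^sup>p\<close> and the lattice.\<close>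

subsection \<open>Complex vector spaces\<close>

text \<open>Only the extensions that make up a class are genuine mixed Hodge structures. A push-out
  class collects the extensions that receive a morphism; the source of that morphism, be it a
  pull-back of \<open>H''/W\<^sub>2\<^sub>p\<^sub>-\<^sub>2\<close> or the fibre product in a Baer
  sum, enters through its lattice, its filtrations and the strictness of the kernel
  (\<open>tate_ext\<close>), so opposedness is never checked for it. An explicit extension, the
  direct sum with a tilted Hodge filtration, shows that no class is empty.

  The saturation of \<open>HA\<close> rests on reality: in weight 2p - 1 every vector is uniquely
  \<open>f \<oplus> \<sigma> f'\<close> with \<open>f\<close> and \<open>f'\<close> in
  \<open>F\<^sup>p\<close>, and a vector fixed by conjugation has \<open>f = f'\<close>. The same
  splitting identifies the tangent space with the real points, which is why a complex subspace of it
  can say something about Hodge types.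

  The remaining obstacle is integral. A lattice is given by a basis that is independent over the
  complex numbers, so subgroups and quotients by rational subspaces need such bases as well.
  Quotients are reduced to subgroups by an integral endomorphism with prescribed kernel.\<close>

lemma C_ring_simps [simp]:
  "carrier C_ring = UNIV" "x \<oplus>\<^bsub>C_ring\<^esub> y = x + y" "x \<otimes>\<^bsub>C_ring\<^esub> y = x * y"
  "\<one>\<^bsub>C_ring\<^esub> = 1" "\<zero>\<^bsub>C_ring\<^esub> = 0"
  by (simp_all add: ring_of_type_algebra_def)

lemma cring_C_ring: "cring C_ring"
  by (rule cring_from_type_algebra)

text \<open>The last assumption replaces the existence of additive inverses: since 0 acts as zero,
  \<open>(-1) \<odot> x\<close> is an inverse of \<open>x\<close>.\<close>

lemma C_spaceI:
  fixes V (structure)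
  assumes "\<And>x y. x \<in> carrier V \<Longrightarrow> y \<in> carrier V \<Longrightarrow> x \<oplus> y \<in> carrier V"
    and "\<zero> \<in> carrier V"
    and "\<And>x y z. x \<in> carrier V \<Longrightarrow> y \<in> carrier V \<Longrightarrow> z \<in> carrier V \<Longrightarrow>
      (x \<oplus> y) \<oplus> z = x \<oplus> (y \<oplus> z)"
    and "\<And>x y. x \<in> carrier V \<Longrightarrow> y \<in> carrier V \<Longrightarrow> x \<oplus> y = y \<oplus> x"
    and "\<And>x. x \<in> carrier V \<Longrightarrow> \<zero> \<oplus> x = x"
    and "\<And>c x. x \<in> carrier V \<Longrightarrow> c \<odot> x \<in> carrier V"
    and "\<And>c d x. x \<in> carrier V \<Longrightarrow> (c + d) \<odot> x = c \<odot> x \<oplus> d \<odot> x"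
    and "\<And>c x y. x \<in> carrier V \<Longrightarrow> y \<in> carrier V \<Longrightarrow> c \<odot> (x \<oplus> y) = c \<odot> x \<oplus> c \<odot> y"
    and "\<And>c d x. x \<in> carrier V \<Longrightarrow> (c * d) \<odot> x = c \<odot> (d \<odot> x)"
    and "\<And>x. x \<in> carrier V \<Longrightarrow> 1 \<odot> x = x"
    and "\<And>x. x \<in> carrier V \<Longrightarrow> 0 \<odot> x = \<zero>"
  shows "C_space V"
  unfolding C_space_def
proof (rule moduleI)
  show "abelian_group V"
  proof (rule abelian_groupI)
    fix x assume x: "x \<in> carrier V"
    have "(-1) \<odot> x \<oplus> x = (-1 + 1) \<odot> x" using assms x by metis
    then have "(-1) \<odot> x \<oplus> x = \<zero>" using assms(11)[OF x] by simp
    with assms(6)[OF x] show "\<exists>y\<in>carrier V. y \<oplus> x = \<zero>" by blast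
  qed (fact assms)+
qed (auto simp only: C_ring_simps cring_C_ring assms(6-10))

locale complex_space =
  fixes V (structure)
  assumes C_space: "C_space V"
begin

sublocale abelian_group V
  using C_space by (simp add: C_space_def Module.module_def)

declare a_closed [rule del] zero_closed [rule del] minus_closed [rule del] a_inv_closed [rule del]

lemma smult_closed [simp]: "x \<in> carrier V \<Longrightarrow> c \<odot> x \<in> carrier V"
  using module.smult_closed[OF C_space[unfolded C_space_def]] by simp

lemma smult_l_distr: "x \<in> carrier V \<Longrightarrow> (c + d) \<odot> x = c \<odot> x \<oplus> d \<odot> x"
  using module.smult_l_distr[OF C_space[unfolded C_space_def]] by simp

lemma smult_r_distr:
  "x \<in> carrier V \<Longrightarrow> y \<in> carrier V \<Longrightarrow> c \<odot> (x \<oplus> y) = c \<odot> x \<oplus> c \<odot> y"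
  using module.smult_r_distr[OF C_space[unfolded C_space_def]] by simp

lemma smult_smult [simp]: "x \<in> carrier V \<Longrightarrow> c \<odot> (d \<odot> x) = (c * d) \<odot> x"
  using module.smult_assoc1[OF C_space[unfolded C_space_def], of c d] by simp

lemma smult_1 [simp]: "x \<in> carrier V \<Longrightarrow> 1 \<odot> x = x"
  using module.smult_one[OF C_space[unfolded C_space_def]] by simp

lemma smult_0_left [simp]: "x \<in> carrier V \<Longrightarrow> 0 \<odot> x = \<zero>"
  using module.smult_l_null[OF C_space[unfolded C_space_def]] by simp

lemma smult_0_right [simp]: "c \<odot> \<zero> = \<zero>"
  using module.smult_r_null[OF C_space[unfolded C_space_def]] by simp

lemma neg_eq: "x \<in> carrier V \<Longrightarrow> \<ominus> x = (-1) \<odot> x"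
proof -
  assume x: "x \<in> carrier V"
  have "(-1) \<odot> x \<oplus> x = \<zero>"
    using smult_l_distr[OF x, of "-1" 1] x by simp
  then show ?thesis using x minus_equality by simp
qed

lemma diff_eq: "x \<in> carrier V \<Longrightarrow> y \<in> carrier V \<Longrightarrow> x \<ominus> y = x \<oplus> (-1) \<odot> y"
  by (simp add: minus_eq neg_eq)

lemma diff_zero [simp]: "x \<in> carrier V \<Longrightarrow> x \<ominus> \<zero> = x"
  by (simp add: diff_eq)

lemma diff_self [simp]: "x \<in> carrier V \<Longrightarrow> x \<ominus> x = \<zero>"
  by (simp add: minus_eq r_neg)

lemma diff_eq_zero_iff: "x \<in> carrier V \<Longrightarrow> y \<in> carrier V \<Longrightarrow> x \<ominus> y = \<zero> \<longleftrightarrow> x = y"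
  by (auto simp: minus_eq r_neg intro: minus_unique dest: minus_equality minus_minus)

lemma add_diff_cancel: "x \<in> carrier V \<Longrightarrow> y \<in> carrier V \<Longrightarrow> (x \<oplus> y) \<ominus> y = x"
  by (simp add: minus_eq a_assoc r_neg)

lemma diff_add_cancel: "x \<in> carrier V \<Longrightarrow> y \<in> carrier V \<Longrightarrow> (x \<ominus> y) \<oplus> y = x"
  by (simp add: minus_eq a_assoc l_neg)

text \<open>A frame turns a linear identity in \<open>x\<close>, \<open>y\<close>, \<open>z\<close>, \<open>w\<close> into identities of the
  coefficients, which the simplifier decides.\<close>

definition frame ::
  "(complex \<Rightarrow> complex \<Rightarrow> complex \<Rightarrow> complex \<Rightarrow> 'a) \<Rightarrow> 'a \<Rightarrow> 'a \<Rightarrow> 'a \<Rightarrow> 'a \<Rightarrow> bool" where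
  "frame F x y z w \<longleftrightarrow> (\<forall>a b c d. F a b c d \<in> carrier V) \<and>
     (\<forall>a b c d a' b' c' d'. F a b c d \<oplus> F a' b' c' d' = F (a + a') (b + b') (c + c') (d + d')) \<and>
     (\<forall>k a b c d. k \<odot> F a b c d = F (k * a) (k * b) (k * c) (k * d)) \<and>
     x = F 1 0 0 0 \<and> y = F 0 1 0 0 \<and> z = F 0 0 1 0 \<and> w = F 0 0 0 1"

lemma frame_exists:
  assumes "x \<in> carrier V" "y \<in> carrier V" "z \<in> carrier V" "w \<in> carrier V"
  obtains F where "frame F x y z w"
proof (rule that[of "\<lambda>a b c d. a \<odot> x \<oplus> (b \<odot> y \<oplus> (c \<odot> z \<oplus> d \<odot> w))"])
qed (use assms in \<open>simp_all add: frame_def smult_l_distr smult_r_distr a_ac\<close>)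

lemma
  assumes "frame F x y z w"
  shows frame_closed: "F a b c d \<in> carrier V"
    and frame_add: "F a b c d \<oplus> F a' b' c' d' = F (a + a') (b + b') (c + c') (d + d')"
    and frame_smult: "k \<odot> F a b c d = F (k * a) (k * b) (k * c) (k * d)"
    and frame_zero: "\<zero> = F 0 0 0 0"
    and frame_atoms: "x = F 1 0 0 0" "y = F 0 1 0 0" "z = F 0 0 1 0" "w = F 0 0 0 1"
proof -
  have *: "\<And>a b c d. F a b c d \<in> carrier V"
    "\<And>a b c d a' b' c' d'. F a b c d \<oplus> F a' b' c' d' = F (a + a') (b + b') (c + c') (d + d')"
    "\<And>k a b c d. k \<odot> F a b c d = F (k * a) (k * b) (k * c) (k * d)"
    and atoms: "x = F 1 0 0 0 \<and> y = F 0 1 0 0 \<and> z = F 0 0 1 0 \<and> w = F 0 0 0 1"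
    using assms[unfolded frame_def] by (simp_all only: simp_thms)
  show "F a b c d \<in> carrier V"
    "F a b c d \<oplus> F a' b' c' d' = F (a + a') (b + b') (c + c') (d + d')"
    "k \<odot> F a b c d = F (k * a) (k * b) (k * c) (k * d)" by (rule *)+
  have "0 \<odot> F 0 0 0 0 = F (0 * 0) (0 * 0) (0 * 0) (0 * 0)" by (rule *)
  then show "\<zero> = F 0 0 0 0" using *(1) by simp
  from atoms show "x = F 1 0 0 0" "y = F 0 1 0 0" "z = F 0 0 1 0" "w = F 0 0 0 1"
    by (auto simp only: simp_thms)
qed

lemma frame_diff: "frame F x y z w \<Longrightarrow>
  F a b c d \<ominus> F a' b' c' d' = F (a - a') (b - b') (c - c') (d - d')"
  by (simp add: diff_eq frame_closed frame_add frame_smult)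

lemmas frame_simps = frame_closed frame_add frame_smult frame_diff

lemma subspace_iff:
  "C_subspace U V \<longleftrightarrow> U \<subseteq> carrier V \<and> \<zero> \<in> U \<and> (\<forall>x\<in>U. \<forall>y\<in>U. x \<oplus> y \<in> U) \<and> (\<forall>c. \<forall>x\<in>U. c \<odot> x \<in> U)"
proof
  assume "C_subspace U V"
  then interpret submodule U C_ring V .
  show "U \<subseteq> carrier V \<and> \<zero> \<in> U \<and> (\<forall>x\<in>U. \<forall>y\<in>U. x \<oplus> y \<in> U) \<and> (\<forall>c. \<forall>x\<in>U. c \<odot> x \<in> U)"
    using subset one_closed m_closed by auto
next
  assume *: "U \<subseteq> carrier V \<and> \<zero> \<in> U \<and> (\<forall>x\<in>U. \<forall>y\<in>U. x \<oplus> y \<in> U) \<and> (\<forall>c. \<forall>x\<in>U. c \<odot> x \<in> U)"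
  then have "\<And>x. x \<in> U \<Longrightarrow> \<ominus> x \<in> U" by (metis neg_eq subsetD)
  with * show "C_subspace U V"
    by (intro module.submoduleI[OF C_space[unfolded C_space_def]]) auto
qed

lemma subspaceI:
  assumes "U \<subseteq> carrier V" "\<zero> \<in> U" "\<And>x y. x \<in> U \<Longrightarrow> y \<in> U \<Longrightarrow> x \<oplus> y \<in> U"
    "\<And>c x. x \<in> U \<Longrightarrow> c \<odot> x \<in> U"
  shows "C_subspace U V"
  using assms by (auto simp: subspace_iff)

lemma
  assumes "C_subspace U V"
  shows subspace_subset: "U \<subseteq> carrier V"
    and subspace_zero: "\<zero> \<in> U"
    and subspace_add: "x \<in> U \<Longrightarrow> y \<in> U \<Longrightarrow> x \<oplus> y \<in> U"
    and subspace_smult: "x \<in> U \<Longrightarrow> c \<odot> x \<in> U"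
  using assms by (auto simp: subspace_iff)

lemma subspace_diff: "C_subspace U V \<Longrightarrow> x \<in> U \<Longrightarrow> y \<in> U \<Longrightarrow> x \<ominus> y \<in> U"
proof -
  assume U: "C_subspace U V" and xy: "x \<in> U" "y \<in> U"
  then have "x \<in> carrier V" "y \<in> carrier V" using subspace_subset[OF U] by (simp_all add: subset_iff)
  then have "x \<ominus> y = x \<oplus> (-1) \<odot> y" by (rule diff_eq)
  also have "\<dots> \<in> U" by (intro subspace_add[OF U] subspace_smult[OF U] xy)
  finally show ?thesis .
qed

lemma subspace_carrier: "C_subspace (carrier V) V"
  by (rule subspaceI) auto

lemma subspace_trivial: "C_subspace {\<zero>} V"
  by (rule subspaceI) auto

lemma subspace_Int: "C_subspace U V \<Longrightarrow> C_subspace U' V \<Longrightarrow> C_subspace (U \<inter> U') V"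
  by (auto simp: subspace_iff)

text \<open>Inverses are expressed by the scalar -1, so that lattices and subspaces are handled by
  the same scalar arithmetic.\<close>

lemma subgroup_iff:
  "subgroup L (add_monoid V) \<longleftrightarrow> L \<subseteq> carrier V \<and> \<zero> \<in> L \<and> (\<forall>x\<in>L. \<forall>y\<in>L. x \<oplus> y \<in> L) \<and>
     (\<forall>x\<in>L. (-1) \<odot> x \<in> L)" (is "_ \<longleftrightarrow> ?R")
proof
  assume "subgroup L (add_monoid V)"
  then interpret subgroup L "add_monoid V" .
  have "(-1) \<odot> x \<in> L" if "x \<in> L" for x
  proof -
    have "x \<in> carrier V" using subset that by auto
    then show ?thesis using m_inv_closed[OF that] neg_eq[of x, unfolded a_inv_def] by simp
  qed
  then show ?R using subset one_closed m_closed by auto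
next
  assume ?R
  then have "\<And>x. x \<in> L \<Longrightarrow> \<ominus> x \<in> L" by (metis neg_eq subsetD)
  with \<open>?R\<close> show "subgroup L (add_monoid V)"
    by (intro subgroup.intro) (auto simp: a_inv_def)
qed

lemma subspace_imp_subgroup: "C_subspace U V \<Longrightarrow> subgroup U (add_monoid V)"
  by (auto simp: subspace_iff subgroup_iff)

lemma subgroup_Int:
  "subgroup L (add_monoid V) \<Longrightarrow> subgroup M (add_monoid V) \<Longrightarrow> subgroup (L \<inter> M) (add_monoid V)"
  by (auto simp: subgroup_iff)

lemma subgroup_diff:
  "subgroup L (add_monoid V) \<Longrightarrow> x \<in> L \<Longrightarrow> y \<in> L \<Longrightarrow> x \<ominus> y \<in> L"
  using diff_eq[of x y] by (auto simp: subgroup_iff subset_iff)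

lemma subgroup_int_smult:
  assumes "subgroup L (add_monoid V)" "x \<in> L"
  shows "of_int k \<odot> x \<in> L"
proof -
  have x: "x \<in> carrier V" and neg: "\<And>y. y \<in> L \<Longrightarrow> (-1) \<odot> y \<in> L"
    using assms by (auto simp: subgroup_iff)
  have nat: "of_nat n \<odot> x \<in> L" for n :: nat
  proof (induction n)
    case (Suc n)
    then show ?case using assms x by (simp add: subgroup_iff smult_l_distr)
  qed (use assms x in \<open>auto simp: subgroup_iff\<close>)
  show ?thesis
  proof (cases k)
    case (nonneg n)
    then show ?thesis using nat by simp
  next
    case (neg n)
    then show ?thesis using \<open>\<And>y. y \<in> L \<Longrightarrow> _\<close>[OF nat[of "Suc n"]] x by simp
  qed
qed

lemma C_span_subspace: "S \<subseteq> carrier V \<Longrightarrow> C_subspace (C_span V S) V"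
  using subspace_carrier by (auto simp: C_span_def subspace_iff)

lemma C_span_superset: "S \<subseteq> C_span V S"
  by (auto simp: C_span_def)

lemma C_span_minimal: "C_subspace U V \<Longrightarrow> S \<subseteq> U \<Longrightarrow> C_span V S \<subseteq> U"
  by (auto simp: C_span_def)

lemma C_span_mono: "S \<subseteq> T \<Longrightarrow> C_span V S \<subseteq> C_span V T"
  by (auto simp: C_span_def)

lemma C_span_eq: "C_subspace U V \<Longrightarrow> C_span V U = U"
  using C_span_minimal[of U U] C_span_superset by blast

lemma C_span_carrier: "S \<subseteq> carrier V \<Longrightarrow> C_span V S \<subseteq> carrier V"
  by (rule C_span_minimal[OF subspace_carrier])

text \<open>The induction hypotheses retain membership in the span. Rules for linear and antilinear
  maps ask for arguments in the carrier, and this is where such arguments come from.\<close>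

lemma C_span_induct [consumes 2, case_names base zero add smult]:
  assumes "x \<in> C_span V S" "S \<subseteq> carrier V"
    and "\<And>x. x \<in> S \<Longrightarrow> P x" "P \<zero>"
    and "\<And>x y. x \<in> C_span V S \<Longrightarrow> y \<in> C_span V S \<Longrightarrow> P x \<Longrightarrow> P y \<Longrightarrow> P (x \<oplus> y)"
    and "\<And>c x. x \<in> C_span V S \<Longrightarrow> P x \<Longrightarrow> P (c \<odot> x)"
  shows "P x"
proof -
  note sp = C_span_subspace[OF assms(2)]
  have "C_subspace {x \<in> C_span V S. P x} V"
    using sp assms by (auto simp: subspace_iff)
  then have "C_span V S \<subseteq> {x \<in> C_span V S. P x}"
    using C_span_superset assms by (intro C_span_minimal) auto
  then show ?thesis using assms by blast
qed

lemma C_space_sub: "C_subspace U V \<Longrightarrow> C_space (V\<lparr>carrier := U\<rparr>)"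
  by (rule C_spaceI) (auto simp: subspace_iff subset_iff a_ac smult_l_distr smult_r_distr)

end

section \<open>Cosets of a subspace and the quotient space\<close>

lemma sub_coset_simps [simp]:
  "a_r_coset (V\<lparr>carrier := U\<rparr>) = a_r_coset V"
  "set_add (V\<lparr>carrier := U\<rparr>) = set_add V"
  by (simp_all add: fun_eq_iff a_r_coset_def r_coset_def set_add_def set_mult_def)

lemma set_add_eq: "set_add V A B = {x \<oplus>\<^bsub>V\<^esub> y | x y. x \<in> A \<and> y \<in> B}"
  by (auto simp: set_add_def set_mult_def)

locale quotient_space = complex_space +
  fixes N
  assumes N: "C_subspace N V"
begin

lemma N_carrier [simp]: "x \<in> N \<Longrightarrow> x \<in> carrier V"
  using subspace_subset[OF N] by auto

lemma mem_coset: "x \<in> carrier V \<Longrightarrow> y \<in> N +> x \<longleftrightarrow> y \<in> carrier V \<and> y \<ominus> x \<in> N"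
proof (safe)
  assume x: "x \<in> carrier V" and "y \<in> N +> x"
  then obtain n where n: "n \<in> N" "y = n \<oplus> x" by (auto simp: a_r_coset_def')
  then show "y \<in> carrier V" using x by simp
  have "y \<ominus> x = n" using n x by (simp add: minus_eq a_assoc r_neg)
  then show "y \<ominus> x \<in> N" using n by simp
next
  assume xy: "x \<in> carrier V" "y \<in> carrier V" and *: "y \<ominus> x \<in> N"
  have "y = (y \<ominus> x) \<oplus> x" using xy by (simp add: minus_eq a_assoc l_neg)
  then show "y \<in> N +> x" using * by (auto simp: a_r_coset_def')
qed

lemma coset_eq_iff:
  assumes [simp]: "x \<in> carrier V" "y \<in> carrier V"
  shows "N +> x = N +> y \<longleftrightarrow> x \<ominus> y \<in> N"
proof
  assume "N +> x = N +> y"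
  moreover have "x \<in> N +> x" by (simp add: mem_coset minus_eq r_neg subspace_zero[OF N])
  ultimately show "x \<ominus> y \<in> N" by (simp add: mem_coset)
next
  assume *: "x \<ominus> y \<in> N"
  have "z \<ominus> x \<in> N \<longleftrightarrow> z \<ominus> y \<in> N" if [simp]: "z \<in> carrier V" for z
  proof -
    obtain F where F: "frame F x y z z" using frame_exists[of x y z z] by auto
    have "z \<ominus> y = (z \<ominus> x) \<oplus> (x \<ominus> y)" "z \<ominus> x = (z \<ominus> y) \<ominus> (x \<ominus> y)"
      unfolding frame_atoms[OF F] by (simp_all add: frame_simps[OF F])
    then show ?thesis using * subspace_add[OF N] subspace_diff[OF N] by metis
  qed
  then show "N +> x = N +> y" by (auto simp: mem_coset)
qed

lemma coset_add:
  assumes [simp]: "x \<in> carrier V" "y \<in> carrier V"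
  shows "set_add V (N +> x) (N +> y) = N +> (x \<oplus> y)" 
proof (rule Set.set_eqI)
  fix z
  have "z \<in> set_add V (N +> x) (N +> y) \<longleftrightarrow> (\<exists>m\<in>N. \<exists>n\<in>N. z = (m \<oplus> x) \<oplus> (n \<oplus> y))"
    by (auto simp: set_add_eq a_r_coset_def')
  also have "\<dots> \<longleftrightarrow> (\<exists>m\<in>N. \<exists>n\<in>N. z = (m \<oplus> n) \<oplus> (x \<oplus> y))"
    by (intro bex_cong refl) (simp add: a_ac)
  also have "\<dots> \<longleftrightarrow> (\<exists>m\<in>N. z = m \<oplus> (x \<oplus> y))"
    using subspace_add[OF N] subspace_zero[OF N] by (metis N_carrier l_zero)
  finally show "z \<in> set_add V (N +> x) (N +> y) \<longleftrightarrow> z \<in> N +> (x \<oplus> y)"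
    by (auto simp: a_r_coset_def')
qed

lemma coset_zero: "x \<in> N \<Longrightarrow> N +> x = N"
proof -
  assume x: "x \<in> N"
  have "N +> \<zero> = N" by (auto simp: a_r_coset_def')
  moreover have "N +> x = N +> \<zero>"
    using x by (subst coset_eq_iff) auto
  ultimately show ?thesis by simp
qed

lemma coset_eq_N_iff: "x \<in> carrier V \<Longrightarrow> N +> x = N \<longleftrightarrow> x \<in> N"
  using coset_eq_iff[of x \<zero>] coset_zero[OF subspace_zero[OF N]] by simp

lemma coset_smult:
  assumes [simp]: "x \<in> carrier V"
  shows "(\<Union>y\<in>N +> x. N +> (c \<odot> y)) = N +> (c \<odot> x)"
proof -
  have eq: "N +> (c \<odot> y) = N +> (c \<odot> x)" if y: "y \<in> N +> x" for y
  proof -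
    have [simp]: "y \<in> carrier V" and yx: "y \<ominus> x \<in> N" using y by (auto simp: mem_coset)
    have "c \<odot> y \<ominus> c \<odot> x = c \<odot> (y \<ominus> x)"
      by (simp add: diff_eq smult_r_distr mult.commute)
    then show ?thesis using subspace_smult[OF N yx] by (subst coset_eq_iff) auto
  qed
  have "x \<in> N +> x" by (simp add: mem_coset subspace_zero[OF N])
  then have "N +> x \<noteq> {}" by blast
  from SUP_eq_const[OF this eq] show ?thesis .
qed

lemma quot_carrier: "carrier (quot_space V N) = (\<lambda>x. N +> x) ` carrier V"
  by (auto simp: quot_space_def A_RCOSETS_def')

lemma quot_zero: "\<zero>\<^bsub>quot_space V N\<^esub> = N"
  by (simp add: quot_space_def)

lemma quot_add:
  "x \<in> carrier V \<Longrightarrow> y \<in> carrier V \<Longrightarrow> (N +> x) \<oplus>\<^bsub>quot_space V N\<^esub> (N +> y) = N +> (x \<oplus> y)"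
  by (simp add: quot_space_def coset_add)

lemma quot_smult: "x \<in> carrier V \<Longrightarrow> c \<odot>\<^bsub>quot_space V N\<^esub> (N +> x) = N +> (c \<odot> x)"
  by (simp add: quot_space_def coset_smult)

lemma quot_zero': "\<zero>\<^bsub>quot_space V N\<^esub> = N +> \<zero>"
  by (simp add: quot_zero coset_zero[OF subspace_zero[OF N]])

lemma C_space_quot: "C_space (quot_space V N)"
  by (rule C_spaceI)
    (auto simp: quot_carrier quot_zero' quot_add quot_smult a_ac smult_l_distr smult_r_distr)

end

subsection \<open>Linear combinations\<close>

text \<open>Linear combinations of a finite sequence instead of a finite set: the arguments about
  lattices are inductions on the number of vectors, and repetitions do no harm.
  \<open>lin_comb_image\<close> is the translation to \<open>lin_comb\<close>.\<close>

primrec comb ::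
  "(complex, 'v, 'm) module_scheme \<Rightarrow> (nat \<Rightarrow> 'v) \<Rightarrow> (nat \<Rightarrow> complex) \<Rightarrow> nat \<Rightarrow> 'v" where
  "comb V v c 0 = \<zero>\<^bsub>V\<^esub>"
| "comb V v c (Suc n) = comb V v c n \<oplus>\<^bsub>V\<^esub> (c n \<odot>\<^bsub>V\<^esub> v n)"

definition indep :: "(complex, 'v, 'm) module_scheme \<Rightarrow> (nat \<Rightarrow> 'v) \<Rightarrow> nat \<Rightarrow> bool" where
  "indep V v n \<longleftrightarrow> (\<forall>i<n. v i \<in> carrier V) \<and> (\<forall>c. comb V v c n = \<zero>\<^bsub>V\<^esub> \<longrightarrow> (\<forall>i<n. c i = 0))"

definition zspan :: "(complex, 'v, 'm) module_scheme \<Rightarrow> (nat \<Rightarrow> 'v) \<Rightarrow> nat \<Rightarrow> 'v set" where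
  "zspan V v n = range (\<lambda>k. comb V v (\<lambda>i. of_int (k i)) n)"

lemma comb_cong:
  "(\<And>i. i < n \<Longrightarrow> c i = d i) \<Longrightarrow> (\<And>i. i < n \<Longrightarrow> v i = w i) \<Longrightarrow> comb V v c n = comb V w d n"
  by (induction n) auto

lemma comb_sub [simp]: "comb (V\<lparr>carrier := U\<rparr>) = comb V"
proof (intro ext)
  fix v c n show "comb (V\<lparr>carrier := U\<rparr>) v c n = comb V v c n" by (induction n) auto
qed

lemma zspanE:
  assumes "x \<in> zspan V v n"
  obtains k where "x = comb V v (\<lambda>i. of_int (k i)) n"
  using assms by (auto simp: zspan_def)

lemma zspanI: "comb V v (\<lambda>i. of_int (k i)) n \<in> zspan V v n"
  by (auto simp: zspan_def)

context complex_space
begin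

lemma comb_closed: "\<forall>i<n. v i \<in> carrier V \<Longrightarrow> comb V v c n \<in> carrier V"
  by (induction n) auto

lemma comb_add:
  "\<forall>i<n. v i \<in> carrier V \<Longrightarrow>
   comb V v (\<lambda>i. c i + d i) n = comb V v c n \<oplus> comb V v d n"
  by (induction n) (simp_all add: comb_closed smult_l_distr a_ac)

lemma comb_smult:
  "\<forall>i<n. v i \<in> carrier V \<Longrightarrow> comb V v (\<lambda>i. k * c i) n = k \<odot> comb V v c n"
  by (induction n) (simp_all add: comb_closed smult_r_distr)

lemma comb_zero: "\<forall>i<n. v i \<in> carrier V \<Longrightarrow> comb V v (\<lambda>i. 0) n = \<zero>"
  by (induction n) simp_all

lemma comb_diff:
  "\<forall>i<n. v i \<in> carrier V \<Longrightarrow>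
   comb V v (\<lambda>i. c i - d i) n = comb V v c n \<ominus> comb V v d n"
  using comb_add[of n v c "\<lambda>i. (-1) * d i"] comb_smult[of n v "-1" d]
  by (simp add: diff_eq comb_closed)

lemma comb_unit:
  assumes "\<forall>i<n. v i \<in> carrier V"
  shows "comb V v (\<lambda>j. if j = i then 1 else 0) n = (if i < n then v i else \<zero>)"
  using assms
proof (induction n)
  case (Suc n)
  then show ?case by (auto simp: less_Suc_eq)
qed simp

lemma comb_subspace:
  "C_subspace U V \<Longrightarrow> (\<And>i. i < n \<Longrightarrow> v i \<in> U) \<Longrightarrow> comb V v c n \<in> U"
  by (induction n) (auto simp: subspace_iff)

lemma comb_subgroup:
  assumes "subgroup L (add_monoid V)" "\<And>i. i < n \<Longrightarrow> v i \<in> L"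
  shows "comb V v (\<lambda>i. of_int (k i)) n \<in> L"
  using assms(2)
proof (induction n)
  case (Suc n)
  then show ?case
    using assms(1) subgroup_int_smult[OF assms(1)] by (simp add: subgroup_iff)
qed (use assms(1) in \<open>simp add: subgroup_iff\<close>)

lemma indep_closed: "indep V v n \<Longrightarrow> \<forall>i<n. v i \<in> carrier V"
  by (simp add: indep_def)

lemma indep_unique:
  assumes "indep V v n" "comb V v c n = comb V v d n" "i < n"
  shows "c i = d i"
proof -
  note cl = indep_closed[OF assms(1)]
  have "comb V v (\<lambda>i. c i - d i) n = \<zero>"
    using assms(2) comb_closed[OF cl] by (simp add: comb_diff[OF cl] minus_eq r_neg)
  then have "c i - d i = 0" using assms(1,3) unfolding indep_def by blast
  then show ?thesis by simp
qed

lemma comb_of_combs: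
  assumes "\<forall>i<n. v i \<in> carrier V" "\<And>j. j < m \<Longrightarrow> \<exists>c. w j = comb V v c n"
  shows "\<exists>e. comb V w d m = comb V v e n"
  using assms(2)
proof (induction m)
  case 0
  show ?case using comb_zero[OF assms(1)] by (intro exI[of _ "\<lambda>i. 0"]) simp
next
  case (Suc m)
  then obtain e c where e: "comb V w d m = comb V v e n" and c: "w m = comb V v c n"
    by (meson lessI less_SucI)
  have "comb V w d (Suc m) = comb V v (\<lambda>i. e i + d m * c i) n"
    using assms(1) by (simp add: e c comb_add comb_smult)
  then show ?case by blast
qed

lemma zspan_subgroup:
  assumes "\<forall>i<n. v i \<in> carrier V"
  shows "subgroup (zspan V v n) (add_monoid V)"
  unfolding subgroup_iff
proof (intro conjI ballI subsetI)
  show "x \<in> carrier V" if "x \<in> zspan V v n" for x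
    using that comb_closed[OF assms] by (auto elim: zspanE)
  show "\<zero> \<in> zspan V v n"
    using zspanI[of V v "\<lambda>i. 0" n] comb_zero[OF assms] by simp
  fix x assume "x \<in> zspan V v n"
  then obtain k where k: "x = comb V v (\<lambda>i. of_int (k i)) n" by (rule zspanE)
  show "(-1) \<odot> x \<in> zspan V v n"
    using zspanI[of V v "\<lambda>i. - k i" n] comb_smult[OF assms, where k="-1" and c="\<lambda>i. of_int (k i)"]
    by (simp add: k)
  fix y assume "y \<in> zspan V v n"
  then obtain l where l: "y = comb V v (\<lambda>i. of_int (l i)) n" by (rule zspanE)
  show "x \<oplus> y \<in> zspan V v n"
    using zspanI[of V v "\<lambda>i. k i + l i" n]
      comb_add[OF assms, where c="\<lambda>i. of_int (k i)" and d="\<lambda>i. of_int (l i)"]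
    by (simp add: k l)
qed

lemma zspan_mem: "\<forall>i<n. v i \<in> carrier V \<Longrightarrow> i < n \<Longrightarrow> v i \<in> zspan V v n"
  using comb_unit[of n v i] zspanI[of V v "\<lambda>j. if j = i then 1 else 0" n]
  by (simp add: if_distrib cong: if_cong)

lemma comb_range_subspace:
  assumes "\<forall>i<n. v i \<in> carrier V"
  shows "C_subspace (range (\<lambda>c. comb V v c n)) V"
proof (rule subspaceI)
  show "range (\<lambda>c. comb V v c n) \<subseteq> carrier V" using comb_closed[OF assms] by auto
  show "\<zero> \<in> range (\<lambda>c. comb V v c n)"
    using comb_zero[OF assms] by (intro range_eqI[of _ _ "\<lambda>i. 0"]) simp
  fix x assume x: "x \<in> range (\<lambda>c. comb V v c n)"
  then show "c \<odot> x \<in> range (\<lambda>c. comb V v c n)" for c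
    by (auto simp flip: comb_smult[OF assms])
  fix y assume "y \<in> range (\<lambda>c. comb V v c n)"
  with x show "x \<oplus> y \<in> range (\<lambda>c. comb V v c n)"
    by (auto simp flip: comb_add[OF assms])
qed

lemma C_span_zspan:
  assumes "\<forall>i<n. v i \<in> carrier V"
  shows "C_span V (zspan V v n) = range (\<lambda>c. comb V v c n)"
proof (rule equalityI)
  show "C_span V (zspan V v n) \<subseteq> range (\<lambda>c. comb V v c n)"
    by (rule C_span_minimal[OF comb_range_subspace[OF assms]]) (auto simp: zspan_def)
  have sub: "C_subspace (C_span V (zspan V v n)) V"
    using zspan_subgroup[OF assms] by (intro C_span_subspace) (auto simp: subgroup_iff)
  have "v i \<in> C_span V (zspan V v n)" if "i < n" for i
    by (rule subsetD[OF C_span_superset zspan_mem[OF assms that]])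
  then have "comb V v c n \<in> C_span V (zspan V v n)" for c by (rule comb_subspace[OF sub])
  then show "range (\<lambda>c. comb V v c n) \<subseteq> C_span V (zspan V v n)" by auto
qed

text \<open>Induction on \<open>n\<close>: the last coordinates of \<open>M\<close> form a subgroup \<open>dZ\<close> of \<open>Z\<close>, and an element
  with last coordinate \<open>d\<close> completes a basis of the elements with last coordinate \<open>0\<close>.\<close>

lemma subgroup_of_zspan:
  assumes "indep V v n" "subgroup M (add_monoid V)" "M \<subseteq> zspan V v n"
  shows "\<exists>m w. indep V w m \<and> M = zspan V w m"
  using assms
proof (induction n arbitrary: M)
  case 0
  have "M = {\<zero>}" using 0 by (auto simp: zspan_def subgroup_iff)
  then have "indep V undefined 0 \<and> M = zspan V undefined 0" by (auto simp: indep_def zspan_def)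
  then show ?case by blast
next
  case (Suc n)
  note cl = indep_closed[OF Suc.prems(1)]
  have ind: "indep V v n"
    unfolding indep_def
  proof (intro conjI allI impI)
    fix c i assume c: "comb V v c n = \<zero>" and "i < n"
    have "comb V v (\<lambda>j. if j = n then 0 else c j) (Suc n) = \<zero>"
      using c cl comb_cong[of n "\<lambda>j. if j = n then 0 else c j" c v v V] by simp
    then have "\<forall>i<Suc n. (if i = n then 0 else c i) = 0"
      using Suc.prems(1) unfolding indep_def by blast
    then show "c i = 0" using \<open>i < n\<close> by (auto dest: spec[of _ i])
  qed (use cl in auto)
  have sub0: "subgroup (zspan V v n) (add_monoid V)" by (rule zspan_subgroup) (use cl in auto)
  define M0 where "M0 = M \<inter> zspan V v n"
  have M0: "subgroup M0 (add_monoid V)"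
    unfolding M0_def by (intro subgroup_Int Suc.prems sub0)
  obtain m w where w: "indep V w m" "M0 = zspan V w m"
    using Suc.IH[OF ind M0] by (auto simp: M0_def)
  define D where "D = {k. \<exists>y\<in>zspan V v n. y \<oplus> of_int k \<odot> v n \<in> M}"
  have vn: "v n \<in> carrier V" using cl by simp
  have zc: "y \<in> carrier V" if "y \<in> zspan V v n" for y
    using sub0 that by (auto simp: subgroup_iff)
  have Mc: "x \<in> carrier V" if "x \<in> M" for x
    using Suc.prems(2) that by (auto simp: subgroup_iff)
  have decomp: "\<exists>k\<in>D. \<exists>y\<in>zspan V v n. x = y \<oplus> of_int k \<odot> v n" if "x \<in> M" for x
  proof -
    from that Suc.prems(3) have "x \<in> zspan V v (Suc n)" by blast
    then obtain k where k: "x = comb V v (\<lambda>i. of_int (k i)) (Suc n)" by (rule zspanE)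
    then have "x = comb V v (\<lambda>i. of_int (k i)) n \<oplus> of_int (k n) \<odot> v n" by simp
    with that show ?thesis unfolding D_def using zspanI by blast
  qed
  \<comment> \<open>One closure property gives both negatives and remainders of divisions, hence
    that the least positive element divides all others.\<close>
  have Dcomb: "a - q * b \<in> D" if ab: "a \<in> D" "b \<in> D" for a b q
  proof -
    from ab obtain y z where y: "y \<in> zspan V v n" "y \<oplus> of_int a \<odot> v n \<in> M"
      and z: "z \<in> zspan V v n" "z \<oplus> of_int b \<odot> v n \<in> M" by (auto simp: D_def)
    have "of_int (-q) \<odot> z \<in> zspan V v n" by (rule subgroup_int_smult[OF sub0 z(1)])
    then have 1: "y \<oplus> of_int (-q) \<odot> z \<in> zspan V v n" using sub0 y by (auto simp: subgroup_iff)
    have "of_int (-q) \<odot> (z \<oplus> of_int b \<odot> v n) \<in> M"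
      by (rule subgroup_int_smult[OF Suc.prems(2) z(2)])
    then have "(y \<oplus> of_int a \<odot> v n) \<oplus> of_int (-q) \<odot> (z \<oplus> of_int b \<odot> v n) \<in> M"
      using Suc.prems(2) y by (auto simp: subgroup_iff)
    also obtain F where F: "frame F y z (v n) (v n)"
      using frame_exists zc[OF y(1)] zc[OF z(1)] vn by metis
    have "(y \<oplus> of_int a \<odot> v n) \<oplus> of_int (-q) \<odot> (z \<oplus> of_int b \<odot> v n)
        = (y \<oplus> of_int (-q) \<odot> z) \<oplus> of_int (a - q * b) \<odot> v n"
      unfolding frame_atoms[OF F] by (simp add: frame_simps[OF F])
    finally show ?thesis unfolding D_def using 1 by blast
  qed
  show ?case
  proof (cases "D \<subseteq> {0}")
    case True
    have "M = M0"
    proof -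
      have "x \<in> zspan V v n" if "x \<in> M" for x
      proof -
        from decomp[OF that] True obtain y where "y \<in> zspan V v n" "x = y \<oplus> of_int 0 \<odot> v n" by blast
        then show ?thesis using zc vn by simp
      qed
      then show ?thesis by (auto simp: M0_def)
    qed
    then show ?thesis using w by blast
  next
    case False
    have "\<zero> \<in> zspan V v n" "\<zero> \<in> M" using sub0 Suc.prems(2) by (simp_all add: subgroup_iff)
    then have zD: "0 \<in> D" using vn unfolding D_def by (auto intro: bexI[of _ "\<zero>"])
    obtain e where e: "e \<in> D" "e \<noteq> 0" using False by blast
    have "- e \<in> D" using Dcomb[OF zD e(1), of 1] by simp
    with e have "\<exists>d>0. d \<in> D" by (cases "e > 0") (auto intro: exI[of _ e] exI[of _ "- e"])
    then have ex: "\<exists>k::nat. 0 < int k \<and> int k \<in> D" by (metis zero_less_imp_eq_int)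
    define d where "d = int (LEAST k::nat. 0 < int k \<and> int k \<in> D)"
    have d: "d > 0" "d \<in> D" using LeastI_ex[OF ex] by (auto simp: d_def)
    have min: "d \<le> k" if "k > 0" "k \<in> D" for k
      using Least_le[of "\<lambda>k::nat. 0 < int k \<and> int k \<in> D" "nat k"] that unfolding d_def
      by (simp add: nat_le_iff le_nat_iff)
    have dvd: "d dvd k" if "k \<in> D" for k
    proof -
      have "k mod d \<in> D" using Dcomb[OF that d(2), of "k div d"] by (simp add: minus_div_mult_eq_mod)
      then have "\<not> k mod d > 0" using min[of "k mod d"] pos_mod_bound[OF d(1), of k] by linarith
      then show ?thesis using pos_mod_sign[OF d(1), of k] by (simp add: dvd_eq_mod_eq_0)
    qed
    from d obtain y0 where y0: "y0 \<in> zspan V v n" "y0 \<oplus> of_int d \<odot> v n \<in> M" by (auto simp: D_def)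
    define x0 where "x0 = y0 \<oplus> of_int d \<odot> v n"
    have x0: "x0 \<in> M" using y0 by (simp add: x0_def)
    define w' where "w' = w(m := x0)"
    have combw': "comb V w' c (Suc m) = comb V w c m \<oplus> c m \<odot> x0" for c
      using comb_cong[of m c c w' w V] by (simp add: w'_def)
    note wcl = indep_closed[OF w(1)]
    have wM: "w i \<in> M0" if "i < m" for i
      unfolding w(2) by (rule zspan_mem[OF wcl that])
    then have wz: "w i \<in> zspan V v n" if "i < m" for i
      using that by (simp add: M0_def)
    have "indep V w' (Suc m)"
      unfolding indep_def
    proof (intro conjI allI impI)
      show "w' i \<in> carrier V" if "i < Suc m" for i
        using that wcl Mc[OF x0] by (auto simp: w'_def less_Suc_eq)
      fix c i assume c: "comb V w' c (Suc m) = \<zero>" and i: "i < Suc m"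
      have vcl: "\<forall>i<n. v i \<in> carrier V" using cl by simp
      have "\<exists>e. comb V w c m = comb V v e n"
      proof (rule comb_of_combs[OF vcl])
        show "\<exists>c. w j = comb V v c n" if "j < m" for j using wz[OF that] by (auto elim: zspanE)
      qed
      then obtain e where e: "comb V w c m = comb V v e n" by blast
      from y0(1) obtain k where k: "y0 = comb V v (\<lambda>i. of_int (k i)) n" by (rule zspanE)
      \<comment> \<open>These are the coefficients of the combination in terms of \<open>v\<close>.
        The one at \<open>v n\<close> is \<open>c m * of_int d\<close>, and its vanishing forces
        \<open>c m = 0\<close> because \<open>d\<close> is positive.\<close>
      let ?f = "\<lambda>i. if i = n then c m * of_int d else e i + c m * of_int (k i)"
      have "comb V v ?f (Suc n) = comb V v (\<lambda>i. e i + c m * of_int (k i)) n \<oplus> (c m * of_int d) \<odot> v n"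
        using comb_cong[of n ?f "\<lambda>i. e i + c m * of_int (k i)" v v V] by simp
      also have "\<dots> = comb V w c m \<oplus> c m \<odot> x0"
        using vcl vn by (simp add: comb_add comb_smult e x0_def k comb_closed smult_r_distr a_assoc)
      also have "\<dots> = \<zero>" using c combw' by simp
      finally have "\<forall>i<Suc n. ?f i = 0" using Suc.prems(1) unfolding indep_def by blast
      then have "c m * of_int d = 0" by (auto dest: spec[of _ n])
      then have cm: "c m = 0" using d by simp
      then have "comb V w c m = \<zero>"
        using c combw'[of c] Mc[OF x0] comb_closed[OF wcl] by (simp del: comb.simps)
      then have "\<forall>i<m. c i = 0" using w(1) unfolding indep_def by blast
      then show "c i = 0" using i cm by (auto simp: less_Suc_eq)
    qed
    moreover have "M = zspan V w' (Suc m)"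
    proof (rule equalityI; rule subsetI)
      fix x assume "x \<in> zspan V w' (Suc m)"
      then obtain k where "x = comb V w' (\<lambda>i. of_int (k i)) (Suc m)" by (rule zspanE)
      moreover have "w' i \<in> M" if "i < Suc m" for i
        using that x0 wM[of i] by (auto simp: w'_def M0_def less_Suc_eq)
      ultimately show "x \<in> M" using comb_subgroup[OF Suc.prems(2)] by blast
    next
      fix x assume x: "x \<in> M"
      from decomp[OF x] obtain k y where k: "k \<in> D" and y: "y \<in> zspan V v n"
        and xy: "x = y \<oplus> of_int k \<odot> v n" by blast
      from dvd[OF k] obtain q where q: "k = d * q" by (auto elim: dvdE)
      have M1: "x \<oplus> of_int (-q) \<odot> x0 \<in> M"
        using Suc.prems(2) x subgroup_int_smult[OF Suc.prems(2) x0, of "-q"] by (auto simp: subgroup_iff)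
      obtain F where F: "frame F y y0 (v n) (v n)"
        using frame_exists zc[OF y] zc[OF y0(1)] vn by metis
      have "x \<oplus> of_int (-q) \<odot> x0 = y \<oplus> of_int (-q) \<odot> y0"
        unfolding xy x0_def q frame_atoms[OF F] by (simp add: frame_simps[OF F])
      also have "\<dots> \<in> zspan V v n"
        using sub0 y subgroup_int_smult[OF sub0 y0(1), of "-q"] by (auto simp: subgroup_iff)
      finally have "x \<oplus> of_int (-q) \<odot> x0 \<in> zspan V w m" using M1 w(2) by (auto simp: M0_def)
      then obtain l where l: "x \<oplus> of_int (-q) \<odot> x0 = comb V w (\<lambda>i. of_int (l i)) m" by (rule zspanE)
      have "comb V w' (\<lambda>i. of_int ((l(m := q)) i)) (Suc m) = comb V w (\<lambda>i. of_int (l i)) m \<oplus> of_int q \<odot> x0"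
        unfolding combw' using comb_cong[of m "\<lambda>i. of_int ((l(m := q)) i)" "\<lambda>i. of_int (l i)" w w V] by simp
      also have "\<dots> = x"
      proof -
        obtain F where F: "frame F x x0 x x" using frame_exists Mc[OF x] Mc[OF x0] by metis
        show ?thesis unfolding l[symmetric] frame_atoms[OF F] by (simp add: frame_simps[OF F])
      qed
      finally show "x \<in> zspan V w' (Suc m)" using zspanI by metis
    qed
    ultimately show ?thesis by blast
  qed
qed

end

subsection \<open>Full lattices\<close>

lemma C_linearD:
  assumes "f \<in> C_linear V V'"
  shows "x \<in> carrier V \<Longrightarrow> f x \<in> carrier V'"
    and "x \<in> carrier V \<Longrightarrow> y \<in> carrier V \<Longrightarrow> f (x \<oplus>\<^bsub>V\<^esub> y) = f x \<oplus>\<^bsub>V'\<^esub> f y"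
    and "x \<in> carrier V \<Longrightarrow> f (c \<odot>\<^bsub>V\<^esub> x) = c \<odot>\<^bsub>V'\<^esub> f x"
  using assms by (auto simp: C_linear_def)

lemma C_linearI:
  assumes "\<And>x. x \<in> carrier V \<Longrightarrow> f x \<in> carrier V'"
    and "\<And>x y. x \<in> carrier V \<Longrightarrow> y \<in> carrier V \<Longrightarrow> f (x \<oplus>\<^bsub>V\<^esub> y) = f x \<oplus>\<^bsub>V'\<^esub> f y"
    and "\<And>c x. x \<in> carrier V \<Longrightarrow> f (c \<odot>\<^bsub>V\<^esub> x) = c \<odot>\<^bsub>V'\<^esub> f x"
  shows "f \<in> C_linear V V'"
  using assms by (auto simp: C_linear_def)

lemma
  assumes "f \<in> C_linear V V'" "C_space V" "C_space V'"
  shows C_linear_zero: "f \<zero>\<^bsub>V\<^esub> = \<zero>\<^bsub>V'\<^esub>"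
    and C_linear_comb: "\<forall>i<n. v i \<in> carrier V \<Longrightarrow> f (comb V v c n) = comb V' (\<lambda>i. f (v i)) c n"
    and C_linear_diff: "x \<in> carrier V \<Longrightarrow> y \<in> carrier V \<Longrightarrow> f (x \<ominus>\<^bsub>V\<^esub> y) = f x \<ominus>\<^bsub>V'\<^esub> f y"
proof -
  interpret V: complex_space V by (rule complex_space.intro) fact
  interpret V': complex_space V' by (rule complex_space.intro) fact
  note f = C_linearD[OF assms(1)]
  have "f (0 \<odot>\<^bsub>V\<^esub> \<zero>\<^bsub>V\<^esub>) = 0 \<odot>\<^bsub>V'\<^esub> f \<zero>\<^bsub>V\<^esub>" by (rule f) simp
  then show 0: "f \<zero>\<^bsub>V\<^esub> = \<zero>\<^bsub>V'\<^esub>" using f(1)[of "\<zero>\<^bsub>V\<^esub>"] by simp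
  show "f (comb V v c n) = comb V' (\<lambda>i. f (v i)) c n" if "\<forall>i<n. v i \<in> carrier V"
    using that by (induction n) (simp_all add: 0 f V.comb_closed)
  show "f (x \<ominus>\<^bsub>V\<^esub> y) = f x \<ominus>\<^bsub>V'\<^esub> f y" if "x \<in> carrier V" "y \<in> carrier V"
    using that by (simp add: V.diff_eq V'.diff_eq f)
qed

context complex_space
begin

lemma finsum_comb:
  "\<forall>i<n. v i \<in> carrier V \<Longrightarrow> finsum V (\<lambda>i. c i \<odot> v i) {..<n} = comb V v c n"
proof (induction n)
  case (Suc n)
  then show ?case
    by (simp add: lessThan_Suc finsum_insert Pi_def a_comm comb_closed)
qed simp

lemma lin_comb_image:
  assumes "\<forall>i<n. v i \<in> carrier V" "inj_on v {..<n}"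
  shows "lin_comb V (v ` {..<n}) c = comb V v (\<lambda>i. c (v i)) n"
proof -
  have "lin_comb V (v ` {..<n}) c = finsum V (\<lambda>i. c (v i) \<odot> v i) {..<n}"
    unfolding lin_comb_def using assms by (intro finsum_reindex) auto
  then show ?thesis using finsum_comb[OF assms(1)] by simp
qed

text \<open>Closure of \<open>K\<close> under differences turns independence over \<open>K\<close>
  into uniqueness of coefficients. Applied to unit vectors, uniqueness also shows that the
  \<open>v i\<close> are distinct, so that the sequence is a basis in the set-indexed sense of
  \<open>full_lattice\<close>.\<close>

lemma full_latticeI:
  assumes K: "\<int> \<subseteq> K" "\<forall>a\<in>K. \<forall>b\<in>K. a - b \<in> K"
    and v: "\<forall>i<n. v i \<in> carrier V"
    and span: "\<forall>x\<in>carrier V. \<exists>c. (\<forall>i<n. c i \<in> K) \<and> x = comb V v c n"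
    and ind: "\<forall>c. (\<forall>i<n. c i \<in> K) \<longrightarrow> comb V v c n = \<zero> \<longrightarrow> (\<forall>i<n. c i = 0)"
  shows "full_lattice K V (zspan V v n)"
proof -
  have eq: "c i = d i" if "\<forall>i<n. c i \<in> K" "\<forall>i<n. d i \<in> K" "comb V v c n = comb V v d n" "i < n" for c d i
  proof -
    have "comb V v (\<lambda>i. c i - d i) n = \<zero>"
      using that comb_closed[OF v] by (simp add: comb_diff[OF v] minus_eq r_neg)
    then have "\<forall>i<n. c i - d i = 0" using ind K that by (auto dest!: spec[of _ "\<lambda>i. c i - d i"])
    then show ?thesis using \<open>i < n\<close> by simp
  qed
  have K01: "0 \<in> K" "1 \<in> K" using K by auto
  have inj: "inj_on v {..<n}"
  proof (rule inj_onI)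
    fix i j assume ij: "i \<in> {..<n}" "j \<in> {..<n}" "v i = v j"
    have "(if i = i then 1 else 0 :: complex) = (if i = j then 1 else 0)"
      by (rule eq[of "\<lambda>k. if k = i then 1 else 0" "\<lambda>k. if k = j then 1 else 0" i])
        (use ij K01 in \<open>auto simp: comb_unit[OF v]\<close>)
    then show "i = j" by (auto split: if_splits)
  qed
  define r where "r = inv_into {..<n} v"
  have r: "r (v i) = i" if "i < n" for i using inj that by (simp add: r_def)
  let ?B = "v ` {..<n}"
  have lc: "lin_comb V ?B (\<lambda>b\<in>?B. c (r b)) = comb V v c n" for c
    unfolding lin_comb_image[OF v inj] by (rule comb_cong) (auto simp: r)
  show ?thesis
    unfolding full_lattice_def
  proof (intro exI[of _ ?B] conjI ballI)
    show "finite ?B" "?B \<subseteq> carrier V" using v by auto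
    fix x assume "x \<in> carrier V"
    with span obtain c where c: "\<forall>i<n. c i \<in> K" "x = comb V v c n" by blast
    show "\<exists>!c. c \<in> ?B \<rightarrow>\<^sub>E K \<and> x = lin_comb V ?B c"
    proof (rule ex1I[of _ "\<lambda>b\<in>?B. c (r b)"])
      show "(\<lambda>b\<in>?B. c (r b)) \<in> ?B \<rightarrow>\<^sub>E K \<and> x = lin_comb V ?B (\<lambda>b\<in>?B. c (r b))"
        using c lc r by auto
      fix d assume d: "d \<in> ?B \<rightarrow>\<^sub>E K \<and> x = lin_comb V ?B d"
      then have "comb V v (\<lambda>i. d (v i)) n = comb V v c n" using c lin_comb_image[OF v inj] by simp
      then have "d (v i) = c i" if "i < n" for i
        using eq[of "\<lambda>i. d (v i)" c i] d c that by (auto simp: PiE_def Pi_def)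
      then show "d = (\<lambda>b\<in>?B. c (r b))"
        using d r c(1) by (intro PiE_ext[of d ?B "\<lambda>_. K"]) auto
    qed
  next
    show "zspan V v n = lin_comb V ?B ` (?B \<rightarrow>\<^sub>E \<int>)"
    proof (rule equalityI; rule subsetI)
      fix x assume "x \<in> zspan V v n"
      then obtain k where "x = comb V v (\<lambda>i. of_int (k i)) n" by (rule zspanE)
      then have "x = lin_comb V ?B (\<lambda>b\<in>?B. of_int (k (r b)))"
        using lc[of "\<lambda>i. of_int (k i)"] by simp
      then show "x \<in> lin_comb V ?B ` (?B \<rightarrow>\<^sub>E \<int>)" by (auto intro!: image_eqI)
    next
      fix x assume "x \<in> lin_comb V ?B ` (?B \<rightarrow>\<^sub>E \<int>)"
      then obtain c where c: "c \<in> ?B \<rightarrow>\<^sub>E \<int>" "x = lin_comb V ?B c" by blast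
      have "\<forall>i\<in>{..<n}. \<exists>k. c (v i) = of_int k" using c by (auto elim!: Ints_cases)
      then obtain k where k: "\<forall>i\<in>{..<n}. c (v i) = of_int (k i)" by metis
      have "x = comb V v (\<lambda>i. of_int (k i)) n"
        unfolding c(2) lin_comb_image[OF v inj] by (rule comb_cong) (use k in auto)
      then show "x \<in> zspan V v n" by (simp add: zspanI)
    qed
  qed
qed

lemma full_latticeE:
  assumes "full_lattice K V L" and K0: "0 \<in> K"
  obtains n v where "\<forall>i<n. v i \<in> carrier V" "L = zspan V v n"
    "\<forall>x\<in>carrier V. \<exists>c. (\<forall>i<n. c i \<in> K) \<and> x = comb V v c n"
    "\<forall>c. (\<forall>i<n. c i \<in> K) \<longrightarrow> comb V v c n = \<zero> \<longrightarrow> (\<forall>i<n. c i = 0)"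
proof -
  from assms(1) obtain B where B: "finite B" "B \<subseteq> carrier V"
    and ex1: "\<forall>x\<in>carrier V. \<exists>!c. c \<in> B \<rightarrow>\<^sub>E K \<and> x = lin_comb V B c"
    and L: "L = lin_comb V B ` (B \<rightarrow>\<^sub>E \<int>)" by (auto simp: full_lattice_def)
  from ex_bij_betw_nat_finite[OF B(1)] obtain v where v: "bij_betw v {..<card B} B"
    by (auto simp: atLeast0LessThan)
  let ?n = "card B"
  have Bv: "B = v ` {..<?n}" and inj: "inj_on v {..<?n}" using v by (auto simp: bij_betw_def)
  have cl: "\<forall>i<?n. v i \<in> carrier V" using B Bv by auto
  define r where "r = inv_into {..<?n} v"
  have r: "r (v i) = i" if "i < ?n" for i using inj that by (simp add: r_def)
  have lin: "lin_comb V B c = comb V v (\<lambda>i. c (v i)) ?n" for c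
    using lin_comb_image[OF cl inj] Bv by simp
  have lc: "lin_comb V B (\<lambda>b\<in>B. c (r b)) = comb V v c ?n" for c
    unfolding lin by (rule comb_cong) (use r Bv in auto)
  have ind: "\<forall>c. (\<forall>i<?n. c i \<in> K) \<longrightarrow> comb V v c ?n = \<zero> \<longrightarrow> (\<forall>i<?n. c i = 0)"
  proof (intro allI impI)
    fix c i assume K: "\<forall>i<?n. c i \<in> K" and c: "comb V v c ?n = \<zero>" and i: "i < ?n"
    \<comment> \<open>Independence is read off from the uniqueness of the coefficients of the zero
      vector.\<close>
    have "\<exists>!c. c \<in> B \<rightarrow>\<^sub>E K \<and> \<zero> = lin_comb V B c" using ex1 by simp
    have "\<forall>b\<in>B. c (r b) \<in> K" using K r by (subst Bv) auto
    then have "(\<lambda>b\<in>B. c (r b)) \<in> B \<rightarrow>\<^sub>E K \<and> \<zero> = lin_comb V B (\<lambda>b\<in>B. c (r b))"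
      using c lc by auto
    moreover note \<open>\<exists>!c. c \<in> B \<rightarrow>\<^sub>E K \<and> \<zero> = lin_comb V B c\<close>
    moreover have "(\<lambda>b\<in>B. 0) \<in> B \<rightarrow>\<^sub>E K \<and> \<zero> = lin_comb V B (\<lambda>b\<in>B. 0)"
      using lc[of "\<lambda>_. 0"] comb_zero[OF cl] K0 by simp
    ultimately have "(\<lambda>b\<in>B. c (r b)) = (\<lambda>b\<in>B. 0)" by blast
    moreover have "v i \<in> B" using i by (subst Bv) simp
    ultimately have "c (r (v i)) = 0" by (metis (mono_tags, lifting) restrict_apply')
    then show "c i = 0" using r[OF i] by simp
  qed
  have Lz: "L = zspan V v ?n"
  proof (rule equalityI; rule subsetI)
    fix x assume "x \<in> zspan V v ?n"
    then obtain k where "x = comb V v (\<lambda>i. of_int (k i)) ?n" by (rule zspanE)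
    then have "x = lin_comb V B (\<lambda>b\<in>B. of_int (k (r b)))"
      using lc[of "\<lambda>i. of_int (k i)"] by simp
    then show "x \<in> L" unfolding L by (auto intro!: image_eqI)
  next
    fix x assume "x \<in> L"
    then obtain c where c: "c \<in> B \<rightarrow>\<^sub>E \<int>" "x = lin_comb V B c" unfolding L by blast
    have "\<forall>i\<in>{..<?n}. \<exists>k. c (v i) = of_int k" using c Bv by (auto elim!: Ints_cases)
    then obtain k where k: "\<forall>i\<in>{..<?n}. c (v i) = of_int (k i)" by metis
    have "x = comb V v (\<lambda>i. of_int (k i)) ?n"
      unfolding c(2) lin by (rule comb_cong) (use k in auto)
    then show "x \<in> zspan V v ?n" by (simp add: zspanI)
  qed
  have "\<exists>c. (\<forall>i<?n. c i \<in> K) \<and> x = comb V v c ?n" if x: "x \<in> carrier V" for x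
  proof -
    obtain c where "c \<in> B \<rightarrow>\<^sub>E K" "x = lin_comb V B c" using ex1 x by blast
    then show ?thesis using lin Bv by (intro exI[of _ "\<lambda>i. c (v i)"]) auto
  qed
  then show ?thesis using that[OF cl Lz _ ind] by blast
qed

lemma full_lattice_UNIV_iff:
  "full_lattice UNIV V L \<longleftrightarrow>
     (\<exists>n v. indep V v n \<and> L = zspan V v n \<and> (\<forall>x\<in>carrier V. \<exists>c. x = comb V v c n))"
proof
  assume "\<exists>n v. indep V v n \<and> L = zspan V v n \<and> (\<forall>x\<in>carrier V. \<exists>c. x = comb V v c n)"
  then show "full_lattice UNIV V L" by (auto intro!: full_latticeI simp: indep_def)
next
  assume "full_lattice UNIV V L"
  then obtain n v where "\<forall>i<n. v i \<in> carrier V" "L = zspan V v n" "\<forall>x\<in>carrier V. \<exists>c. x = comb V v c n"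
    "\<forall>c. comb V v c n = \<zero> \<longrightarrow> (\<forall>i<n. c i = 0)" by (rule full_latticeE) auto
  then show "\<exists>n v. indep V v n \<and> L = zspan V v n \<and> (\<forall>x\<in>carrier V. \<exists>c. x = comb V v c n)"
    unfolding indep_def by blast
qed

lemma full_lattice_subgroup: "full_lattice UNIV V L \<Longrightarrow> subgroup L (add_monoid V)"
  unfolding full_lattice_UNIV_iff using zspan_subgroup[OF indep_closed] by blast

lemma full_lattice_span:
  assumes "full_lattice UNIV V L"
  shows "C_span V L = carrier V"
proof -
  from assms obtain n v where v: "indep V v n" "L = zspan V v n"
    and sp: "\<forall>x\<in>carrier V. \<exists>c. x = comb V v c n" unfolding full_lattice_UNIV_iff by blast
  note cl = indep_closed[OF v(1)]
  show ?thesis unfolding v(2) C_span_zspan[OF cl] using sp comb_closed[OF cl] by auto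
qed

text \<open>A subgroup of a lattice has an integral basis that stays independent over the complex
  numbers (\<open>subgroup_of_zspan\<close>), and such a basis is a complex basis of the span of the
  subgroup.\<close>

lemma full_lattice_sub:
  assumes L: "full_lattice UNIV V L" and M: "subgroup M (add_monoid V)" "M \<subseteq> L"
    and U: "C_subspace U V" "U = C_span V M"
  shows "full_lattice UNIV (V\<lparr>carrier := U\<rparr>) M"
proof -
  from L obtain n v where "indep V v n" "L = zspan V v n" unfolding full_lattice_UNIV_iff by blast
  with subgroup_of_zspan[of v n M] M obtain m w where w: "indep V w m" "M = zspan V w m" by blast
  note cl = indep_closed[OF w(1)]
  have Ur: "U = range (\<lambda>c. comb V w c m)" using U(2) w(2) C_span_zspan[OF cl] by simp
  interpret U: complex_space "V\<lparr>carrier := U\<rparr>"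
    by (rule complex_space.intro) (rule C_space_sub[OF U(1)])
  have "w i \<in> U" if "i < m" for i
    using zspan_mem[OF cl that] w(2) U(2) C_span_superset[of M] by blast
  then show ?thesis
    unfolding U.full_lattice_UNIV_iff using w Ur
    by (intro exI[of _ m] exI[of _ w]) (auto simp: indep_def zspan_def)
qed

end

text \<open>Over the rationals the set \<open>{1}\<close> is independent in the complex numbers, so
  the value at 1 extends to a linear functional. It serves to retract complex coordinates to
  rational ones.\<close>

lemma exists_rational_functional:
  "\<exists>\<phi> :: complex \<Rightarrow> rat. (\<forall>x y. \<phi> (x + y) = \<phi> x + \<phi> y) \<and> (\<forall>r x. \<phi> (of_rat r * x) = r * \<phi> x) \<and> \<phi> 1 = 1"
proof -
  interpret vector_space_pair "\<lambda>(r::rat) (c::complex). of_rat r * c" "\<lambda>(r::rat) s. r * s :: rat"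
    by unfold_locales (simp_all add: algebra_simps of_rat_add of_rat_mult)
  have "\<not> vs1.dependent {1}" by (simp add: vs1.dependent_single)
  from linear_independent_extend[OF this, of "\<lambda>_. 1"] obtain g
    where g: "Vector_Spaces.linear (\<lambda>(r::rat) (c::complex). of_rat r * c) (\<lambda>(r::rat) s. r * s) g" "g 1 = 1"
    by auto
  then show ?thesis
    using linear_add[OF g(1)] linear_scale[OF g(1)] by (intro exI[of _ g]) auto
qed

section \<open>Coordinates in a basis, rational points and integral endomorphisms\<close>

locale based_space = complex_space +
  fixes v :: "nat \<Rightarrow> 'a" and n :: nat
  assumes ind: "indep V v n" and spanning: "\<forall>x\<in>carrier V. \<exists>c. x = comb V v c n"
begin

definition coord :: "'a \<Rightarrow> nat \<Rightarrow> complex" where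
  "coord x = (SOME c. x = comb V v c n)"

text \<open>The map \<open>g\<close> need not be linear over the complex numbers. With
  \<open>cnj\<close> this becomes complex conjugation, with a rational functional the retraction
  onto the rational points.\<close>

definition cmap :: "(complex \<Rightarrow> complex) \<Rightarrow> 'a \<Rightarrow> 'a" where
  "cmap g x = comb V v (\<lambda>i. g (coord x i)) n"

lemmas v_closed = indep_closed[OF ind]

lemma comb_coord: "x \<in> carrier V \<Longrightarrow> comb V v (coord x) n = x"
  unfolding coord_def using spanning someI_ex[of "\<lambda>c. x = comb V v c n"] by auto

lemma coord_comb: "i < n \<Longrightarrow> coord (comb V v c n) i = c i"
  using comb_coord[OF comb_closed[OF v_closed]] indep_unique[OF ind] by metis

lemma coord_add:
  assumes "x \<in> carrier V" "y \<in> carrier V" "i < n"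
  shows "coord (x \<oplus> y) i = coord x i + coord y i"
proof -
  have "x \<oplus> y = comb V v (\<lambda>i. coord x i + coord y i) n"
    using assms by (simp add: comb_add[OF v_closed] comb_coord)
  then show ?thesis using coord_comb[OF assms(3)] by simp
qed

lemma coord_smult:
  assumes "x \<in> carrier V" "i < n"
  shows "coord (c \<odot> x) i = c * coord x i"
proof -
  have "c \<odot> x = comb V v (\<lambda>i. c * coord x i) n"
    using assms by (simp add: comb_smult[OF v_closed] comb_coord)
  then show ?thesis using coord_comb[OF assms(2)] by simp
qed

lemma eq_iff_coord:
  "x \<in> carrier V \<Longrightarrow> y \<in> carrier V \<Longrightarrow> x = y \<longleftrightarrow> (\<forall>i<n. coord x i = coord y i)"
  using comb_coord comb_cong[of n "coord x" "coord y" v v V] by metis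

lemma coord_zero: "i < n \<Longrightarrow> coord \<zero> i = 0"
  using coord_smult[of \<zero> i 0] by simp

lemma cmap_closed: "cmap g x \<in> carrier V"
  by (simp add: cmap_def comb_closed[OF v_closed])

lemma coord_cmap: "i < n \<Longrightarrow> coord (cmap g x) i = g (coord x i)"
  by (simp add: cmap_def coord_comb)

lemma cmap_add:
  assumes "\<And>a b. g (a + b) = g a + g b" "x \<in> carrier V" "y \<in> carrier V"
  shows "cmap g (x \<oplus> y) = cmap g x \<oplus> cmap g y"
  using assms by (subst eq_iff_coord) (auto simp: cmap_closed coord_add coord_cmap)

lemma zspan_iff: "x \<in> carrier V \<Longrightarrow> x \<in> zspan V v n \<longleftrightarrow> (\<forall>i<n. coord x i \<in> \<int>)"
proof
  assume "x \<in> zspan V v n"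
  then show "\<forall>i<n. coord x i \<in> \<int>" by (auto simp: coord_comb elim: zspanE)
next
  assume x: "x \<in> carrier V" and "\<forall>i<n. coord x i \<in> \<int>"
  then have "\<forall>i\<in>{..<n}. \<exists>k. coord x i = of_int k" by (auto elim!: Ints_cases)
  then obtain k where k: "\<forall>i\<in>{..<n}. coord x i = of_int (k i)" by metis
  have "comb V v (coord x) n = comb V v (\<lambda>i. of_int (k i)) n"
    by (rule comb_cong) (use k in auto)
  then show "x \<in> zspan V v n" using comb_coord[OF x] zspanI by metis
qed

lemma coord_rational:
  assumes "x \<in> carrier V" "m > 0" "of_nat m \<odot> x \<in> zspan V v n" "i < n"
  shows "\<exists>q. coord x i = of_rat q"
proof -
  have "coord (of_nat m \<odot> x) i \<in> \<int>" using assms by (simp add: zspan_iff)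
  then obtain k where "of_nat m * coord x i = of_int k"
    using assms by (auto simp: coord_smult elim: Ints_cases)
  then have "coord x i = of_rat (of_int k / of_nat m)"
    using assms by (simp add: of_rat_divide field_simps)
  then show ?thesis ..
qed

text \<open>A \<open>Q\<close>-linear functional on \<open>C\<close> with value \<open>1\<close> at \<open>1\<close> induces a \<open>Q\<close>-linear projection of \<open>V\<close>
  onto the rational points, and it maps \<open>W \<otimes> C\<close> to \<open>W\<close>.\<close>

lemma C_span_rational:
  assumes W: "W \<subseteq> carrier V" "\<zero> \<in> W" "\<forall>x\<in>W. \<forall>y\<in>W. x \<oplus> y \<in> W"
      "\<forall>r. \<forall>x\<in>W. of_rat r \<odot> x \<in> W"
    and rat: "\<forall>x\<in>W. \<forall>i<n. \<exists>q. coord x i = of_rat q"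
    and x: "x \<in> C_span V W" "\<forall>i<n. \<exists>q. coord x i = of_rat q"
  shows "x \<in> W"
proof -
  obtain \<phi> :: "complex \<Rightarrow> rat" where phi: "\<And>x y. \<phi> (x + y) = \<phi> x + \<phi> y"
    "\<And>r x. \<phi> (of_rat r * x) = r * \<phi> x" "\<phi> 1 = 1" using exists_rational_functional by blast
  define P where "P = cmap (\<lambda>c. of_rat (\<phi> c))"
  have proj: "P (c \<odot> y) = of_rat (\<phi> c) \<odot> y"
    if y: "y \<in> carrier V" "\<forall>i<n. \<exists>q. coord y i = of_rat q" for c y
  proof (subst eq_iff_coord)
    show "\<forall>i<n. coord (P (c \<odot> y)) i = coord (of_rat (\<phi> c) \<odot> y) i"
    proof (intro allI impI)
      fix i assume i: "i < n"
      with y obtain q where "coord y i = of_rat q" by blast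
      with i y show "coord (P (c \<odot> y)) i = coord (of_rat (\<phi> c) \<odot> y) i"
        using phi(2)[of q c] by (simp add: P_def coord_cmap coord_smult of_rat_mult mult.commute)
    qed
  qed (use y in \<open>simp_all add: P_def cmap_closed\<close>)
  have Padd: "P (y \<oplus> z) = P y \<oplus> P z" if "y \<in> carrier V" "z \<in> carrier V" for y z
    unfolding P_def using that by (intro cmap_add) (simp_all add: phi of_rat_add)
  \<comment> \<open>\<open>P\<close> is linear over the rationals only. Quantifying over all
    multiples \<open>c \<odot> y\<close> is what makes this set a complex subspace.\<close>
  have "C_subspace {y \<in> carrier V. \<forall>c. P (c \<odot> y) \<in> W} V"
  proof (rule subspaceI)
    have "P \<zero> = \<zero>" using proj[of \<zero> 0] by (auto simp: coord_zero intro!: exI[of _ 0])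
    then show "\<zero> \<in> {y \<in> carrier V. \<forall>c. P (c \<odot> y) \<in> W}" using W by simp
  qed (auto simp: Padd smult_r_distr W)
  moreover have "W \<subseteq> {y \<in> carrier V. \<forall>c. P (c \<odot> y) \<in> W}"
    using W rat by (auto simp: proj)
  ultimately have "x \<in> {y \<in> carrier V. \<forall>c. P (c \<odot> y) \<in> W}" using C_span_minimal x by blast
  then have "x \<in> carrier V" "P (1 \<odot> x) \<in> W" by blast+
  then show "x \<in> W" using proj[of x 1] x by (simp add: phi)
qed

text \<open>The vectors are added to the kernel one at a time. If \<open>t\<close>, the image of the
  next vector, is nonzero, let \<open>d\<close> be a nonzero coordinate of it, at position
  \<open>b\<close>; then \<open>d\<close> times \<open>T x\<close> minus the coordinate of
  \<open>T x\<close> at \<open>b\<close> times \<open>t\<close> vanishes exactly when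
  \<open>T x\<close> is a multiple of \<open>t\<close>. Multiplying by \<open>d\<close> instead of
  dividing by it keeps the map integral.\<close>

lemma integral_endomorphism_with_kernel:
  assumes "\<forall>j<m. w j \<in> zspan V v n"
  shows "\<exists>T\<in>C_linear V V. T ` zspan V v n \<subseteq> zspan V v n \<and>
    (\<forall>x\<in>carrier V. T x = \<zero> \<longleftrightarrow> x \<in> range (\<lambda>c. comb V w c m))"
  using assms
proof (induction m)
  case 0
  show ?case by (rule bexI[of _ id]) (auto simp: C_linear_def)
next
  case (Suc m)
  then obtain T where T: "T \<in> C_linear V V" "T ` zspan V v n \<subseteq> zspan V v n"
    and ker: "\<forall>x\<in>carrier V. T x = \<zero> \<longleftrightarrow> x \<in> range (\<lambda>c. comb V w c m)" by auto
  note TD = C_linearD[OF T(1)]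
  have zc: "zspan V v n \<subseteq> carrier V" using zspan_subgroup[OF v_closed] by (simp add: subgroup_iff)
  have wcl: "\<forall>j<Suc m. w j \<in> carrier V" using Suc.prems zc by blast
  then have wcl': "\<forall>j<m. w j \<in> carrier V" and wm: "w m \<in> carrier V" by simp_all
  define t where "t = T (w m)"
  have t: "t \<in> zspan V v n" using T(2) Suc.prems by (auto simp: t_def)
  then have tc: "t \<in> carrier V" using zc by blast
  show ?case
  proof (cases "t = \<zero>")
    case True
    then have "w m \<in> range (\<lambda>c. comb V w c m)" using ker wm by (simp add: t_def)
    then obtain e where e: "w m = comb V w e m" by blast
    have "range (\<lambda>c. comb V w c (Suc m)) = range (\<lambda>c. comb V w c m)"
    proof (rule equalityI; rule subsetI)
      fix x assume "x \<in> range (\<lambda>c. comb V w c (Suc m))"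
      then obtain c where "x = comb V w c (Suc m)" by blast
      then have "x = comb V w (\<lambda>i. c i + c m * e i) m"
        by (simp add: comb_add[OF wcl'] comb_smult[OF wcl'] e)
      then show "x \<in> range (\<lambda>c. comb V w c m)" by blast
    next
      fix x assume "x \<in> range (\<lambda>c. comb V w c m)"
      then obtain c where c: "x = comb V w c m" by blast
      have "x = comb V w (c(m := 0)) (Suc m)"
        using comb_cong[of m "c(m := 0)" c w w V] wm comb_closed[OF wcl'] by (simp add: c)
      then show "x \<in> range (\<lambda>c. comb V w c (Suc m))" by blast
    qed
    then show ?thesis using T ker by (intro bexI[of _ T]) simp_all
  next
    case False
    then obtain b where b: "b < n" "coord t b \<noteq> 0" using tc eq_iff_coord[of t \<zero>] coord_zero by auto
    define d where "d = coord t b"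
    have d: "d \<in> \<int>" "d \<noteq> 0" using t b tc by (simp_all add: zspan_iff d_def)
    define T' where "T' x = d \<odot> T x \<oplus> (- coord (T x) b) \<odot> t" for x
    have lin: "T' \<in> C_linear V V"
    proof (rule C_linearI)
      fix x y assume xy: "x \<in> carrier V" "y \<in> carrier V"
      then show "T' (x \<oplus> y) = T' x \<oplus> T' y"
        using TD tc b smult_l_distr[OF tc, of "- coord (T x) b" "- coord (T y) b"]
        by (simp add: T'_def coord_add smult_r_distr a_ac)
    next
      fix c x assume x: "x \<in> carrier V"
      then show "T' (c \<odot> x) = c \<odot> T' x"
        using TD tc b by (simp add: T'_def coord_smult smult_r_distr mult_ac)
    qed (use TD tc in \<open>simp add: T'_def\<close>)
    have "T' ` zspan V v n \<subseteq> zspan V v n"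
    proof safe
      fix x assume x: "x \<in> zspan V v n"
      then have "T x \<in> zspan V v n" "x \<in> carrier V" using T(2) zc by blast+
      then show "T' x \<in> zspan V v n"
        using TD lin[THEN C_linearD(1)] t tc d b
        by (simp add: zspan_iff T'_def coord_add coord_smult)
    qed
    moreover have "T' x = \<zero> \<longleftrightarrow> x \<in> range (\<lambda>c. comb V w c (Suc m))" if x: "x \<in> carrier V" for x
    proof
      assume 0: "T' x = \<zero>"
      \<comment> \<open>The kernel condition says that \<open>T x\<close> is
        \<open>e \<odot> t\<close>, so \<open>x\<close> minus \<open>e\<close> times
        \<open>w m\<close> lies in the old kernel.\<close>
      define e where "e = coord (T x) b / d"
      have "T (x \<oplus> (-e) \<odot> w m) = (1/d) \<odot> T' x"
        using TD x wm tc d by (simp add: T'_def t_def[symmetric] smult_r_distr e_def)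
      then have "T (x \<oplus> (-e) \<odot> w m) = \<zero>" using 0 by simp
      then obtain c where c: "x \<oplus> (-e) \<odot> w m = comb V w c m" using ker x wm by auto
      have "comb V w (c(m := e)) (Suc m) = (x \<oplus> (-e) \<odot> w m) \<oplus> e \<odot> w m"
        using comb_cong[of m "c(m := e)" c w w V] by (simp add: c)
      also have "\<dots> = x"
        using x wm smult_l_distr[OF wm, of "-e" e] by (simp add: a_assoc)
      finally have "x = comb V w (c(m := e)) (Suc m)" by simp
      then show "x \<in> range (\<lambda>c. comb V w c (Suc m))" by blast
    next
      assume "x \<in> range (\<lambda>c. comb V w c (Suc m))"
      then obtain c where c: "x = comb V w c (Suc m)" by blast
      have "T (comb V w c m) = \<zero>" using ker comb_closed[OF wcl'] by blast
      then have "T x = c m \<odot> t" using TD wm comb_closed[OF wcl'] tc by (simp add: c t_def)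
      then show "T' x = \<zero>"
        using tc b smult_l_distr[OF tc, of "d * c m" "- (c m * d)"]
        by (simp add: T'_def coord_smult d_def mult.commute)
    qed
    ultimately show ?thesis using lin by (intro bexI[of _ T']) simp_all
  qed
qed

end

section \<open>Lattices in quotient spaces\<close>

context quotient_space
begin

lemma quot_comb:
  "\<forall>i<n. v i \<in> carrier V \<Longrightarrow> comb (quot_space V N) (\<lambda>i. N +> v i) c n = N +> comb V v c n"
  by (induction n) (simp_all add: quot_zero' quot_smult quot_add comb_closed)

text \<open>\<open>V/N\<close> is isomorphic to the image of an integral endomorphism with kernel \<open>N\<close>, and this
  reduces the claim to sublattices.\<close>

lemma full_lattice_quot:
  assumes L: "full_lattice UNIV V L" and NL: "N = C_span V (L \<inter> N)"
  shows "full_lattice UNIV (quot_space V N) ((\<lambda>x. N +> x) ` L)"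
proof -
  from L obtain n v where v: "indep V v n" "L = zspan V v n"
    and sp: "\<forall>x\<in>carrier V. \<exists>c. x = comb V v c n" unfolding full_lattice_UNIV_iff by blast
  interpret based_space V v n by unfold_locales fact+
  interpret Q: complex_space "quot_space V N" by (rule complex_space.intro) (rule C_space_quot)
  have Lsub: "subgroup L (add_monoid V)" by (rule full_lattice_subgroup[OF L])
  have "subgroup (L \<inter> N) (add_monoid V)"
    by (rule subgroup_Int[OF Lsub subspace_imp_subgroup[OF N]])
  from subgroup_of_zspan[OF v(1) this] v(2) obtain m w where w: "indep V w m" "L \<inter> N = zspan V w m"
    by blast
  have Nr: "N = range (\<lambda>c. comb V w c m)"
    by (subst NL) (simp add: w(2) C_span_zspan[OF indep_closed[OF w(1)]])
  have "w j \<in> zspan V v n" if "j < m" for j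
    using zspan_mem[OF indep_closed[OF w(1)] that] w(2) v(2) by blast
  with integral_endomorphism_with_kernel[of m w] obtain T
    where T: "T \<in> C_linear V V" "T ` L \<subseteq> L" and ker: "\<forall>x\<in>carrier V. T x = \<zero> \<longleftrightarrow> x \<in> N"
    unfolding v(2) Nr by blast
  note TD = C_linearD[OF T(1)] and Lc = Lsub[unfolded subgroup_iff]
  have T0: "T \<zero> = \<zero>" by (rule C_linear_zero[OF T(1) C_space C_space])
  have "subgroup (T ` L) (add_monoid V)"
    unfolding subgroup_iff
  proof (intro conjI ballI)
    show "T ` L \<subseteq> carrier V" using T(2) Lc by blast
    show "\<zero> \<in> T ` L" using T0 Lc by (intro image_eqI[of _ _ \<zero>]) simp_all
    fix x assume "x \<in> T ` L"
    then obtain a where a: "a \<in> L" "x = T a" by blast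
    then show "(-1) \<odot> x \<in> T ` L"
      using TD(3)[of a "-1"] Lc by (intro image_eqI[of _ _ "(-1) \<odot> a"]) auto
    fix y assume "y \<in> T ` L"
    then obtain b where b: "b \<in> L" "y = T b" by blast
    have "a \<in> carrier V" "b \<in> carrier V" using a b Lc by blast+
    then show "x \<oplus> y \<in> T ` L"
      using a b TD(2)[of a b] Lc by (intro image_eqI[of _ _ "a \<oplus> b"]) auto
  qed
  from subgroup_of_zspan[OF v(1) this] v(2) T(2) obtain k t where t: "indep V t k" "T ` L = zspan V t k"
    by blast
  \<comment> \<open>Lifts to \<open>L\<close> of a basis of the image lattice. Their cosets will be
    the basis of the quotient lattice.\<close>
  have "\<forall>i\<in>{..<k}. \<exists>u. u \<in> L \<and> t i = T u"
    using zspan_mem[OF indep_closed[OF t(1)]] t(2) by blast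
  then obtain u where u: "\<forall>i\<in>{..<k}. u i \<in> L \<and> t i = T (u i)" by metis
  then have uc: "\<forall>i<k. u i \<in> carrier V" using Lc by blast
  have Tc: "T (comb V u c k) = comb V t c k" for c
    unfolding C_linear_comb[OF T(1) C_space C_space uc] by (rule comb_cong) (use u in auto)
  \<comment> \<open>Since \<open>T\<close> has kernel \<open>N\<close>, it separates cosets, and
    every statement about \<open>V/N\<close> can be tested after applying \<open>T\<close>.\<close>
  have eqT: "N +> x = N +> y \<longleftrightarrow> T x = T y" if "x \<in> carrier V" "y \<in> carrier V" for x y
    using that bspec[OF ker, of "x \<ominus> y"] TD(1) C_linear_diff[OF T(1) C_space C_space, of x y]
      diff_eq_zero_iff[of "T x" "T y"] by (simp add: coset_eq_iff)
  have "indep (quot_space V N) (\<lambda>i. N +> u i) k"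
    unfolding indep_def
  proof (intro conjI allI impI)
    show "N +> u i \<in> carrier (quot_space V N)" if "i < k" for i using uc that by (simp add: quot_carrier)
    fix c i assume "comb (quot_space V N) (\<lambda>i. N +> u i) c k = \<zero>\<^bsub>quot_space V N\<^esub>" "i < k"
    then have "T (comb V u c k) = T \<zero>"
      using uc eqT[of "comb V u c k" \<zero>] by (simp add: quot_comb quot_zero' comb_closed)
    then have "comb V t c k = \<zero>" by (simp add: Tc T0)
    then show "c i = 0" using t(1) \<open>i < k\<close> unfolding indep_def by blast
  qed
  moreover have "(\<lambda>x. N +> x) ` L = zspan (quot_space V N) (\<lambda>i. N +> u i) k"
  proof (rule equalityI; rule subsetI)
    fix P assume "P \<in> (\<lambda>x. N +> x) ` L"
    then obtain x where x: "x \<in> L" "P = N +> x" by blast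
    then have "T x \<in> zspan V t k" using t(2) by blast
    then obtain l where "T x = comb V t (\<lambda>i. of_int (l i)) k" by (rule zspanE)
    then have "P = N +> comb V u (\<lambda>i. of_int (l i)) k"
      using x(2) eqT[OF subsetD[OF conjunct1[OF Lc] x(1)] comb_closed[OF uc]] Tc by simp
    then show "P \<in> zspan (quot_space V N) (\<lambda>i. N +> u i) k"
      by (auto simp: zspan_def quot_comb[OF uc])
  next
    fix P assume "P \<in> zspan (quot_space V N) (\<lambda>i. N +> u i) k"
    then obtain l where "P = N +> comb V u (\<lambda>i. of_int (l i)) k"
      by (auto simp: zspan_def quot_comb[OF uc])
    moreover have "comb V u (\<lambda>i. of_int (l i)) k \<in> L" using comb_subgroup[OF Lsub, of k u l] u by simp
    ultimately show "P \<in> (\<lambda>x. N +> x) ` L" by blast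
  qed
  moreover have "\<exists>c. P = comb (quot_space V N) (\<lambda>i. N +> u i) c k"
    if P: "P \<in> carrier (quot_space V N)" for P
  proof -
    obtain x where x: "x \<in> carrier V" "P = N +> x" using P by (auto simp: quot_carrier)
    obtain c where "x = comb V v c n" using sp x by blast
    then have "T x = comb V (\<lambda>i. T (v i)) c n" using C_linear_comb[OF T(1) C_space C_space v_closed] by simp
    moreover have "\<exists>e. comb V (\<lambda>i. T (v i)) c n = comb V t e k"
    proof (rule comb_of_combs[OF indep_closed[OF t(1)]])
      show "\<exists>c. T (v j) = comb V t c k" if "j < n" for j
        using zspan_mem[OF v_closed that] v(2) t(2) by (auto elim: zspanE)
    qed
    ultimately obtain e where "T x = T (comb V u e k)" using Tc by metis
    then have "P = N +> comb V u e k" using x eqT comb_closed[OF uc] by simp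
    then show ?thesis using quot_comb[OF uc] by metis
  qed
  ultimately show ?thesis unfolding Q.full_lattice_UNIV_iff by blast
qed

end

subsection \<open>Complex conjugation and rational subspaces\<close>

text \<open>Hodge records and bare modules have different types and cannot be compared by equality.
  The vector space notions look at four fields only, so agreement of these carries results
  over.\<close>

definition same_ops ::
  "(complex, 'v, 'm) module_scheme \<Rightarrow> (complex, 'v, 'n) module_scheme \<Rightarrow> bool" where
  "same_ops V V' \<longleftrightarrow> carrier V = carrier V' \<and> ring.add V = ring.add V' \<and> ring.zero V = ring.zero V' \<and> module.smult V = module.smult V'"

lemma same_ops_C_space: "same_ops V V' \<Longrightarrow> C_space V \<Longrightarrow> C_space V'"
proof -
  assume s: "same_ops V V'" and "C_space V"
  then interpret complex_space V by unfold_locales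
  show "C_space V'"
    by (rule C_spaceI)
      (use s in \<open>simp_all add: same_ops_def a_ac smult_l_distr smult_r_distr
          eq_commute[of "carrier V"] eq_commute[of "ring.add V"] eq_commute[of "ring.zero V"] eq_commute[of "module.smult V"]\<close>)
qed

lemma same_ops_full_lattice: "same_ops V V' \<Longrightarrow> full_lattice K V L \<longleftrightarrow> full_lattice K V' L"
  by (simp add: same_ops_def full_lattice_def lin_comb_def finsum_def finprod_def)

lemma same_ops_C_subspace: "same_ops V V' \<Longrightarrow> C_subspace U V \<longleftrightarrow> C_subspace U V'"
  by (simp add: same_ops_def submodule_def submodule_axioms_def subgroup_def m_inv_def)

lemma same_ops_C_span: "same_ops V V' \<Longrightarrow> C_span V S = C_span V' S"
  by (simp add: C_span_def same_ops_C_subspace)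

lemma (in complex_space) sub_C_subspace:
  assumes "C_subspace U V"
  shows "C_subspace S (V\<lparr>carrier := U\<rparr>) \<longleftrightarrow> C_subspace S V \<and> S \<subseteq> U"
proof -
  interpret U: complex_space "V\<lparr>carrier := U\<rparr>"
    by (rule complex_space.intro[OF C_space_sub[OF assms]])
  show ?thesis using subspace_subset[OF assms] by (auto simp: U.subspace_iff subspace_iff)
qed

lemma (in complex_space) C_span_sub:
  assumes U: "C_subspace U V" and S: "S \<subseteq> U"
  shows "C_span (V\<lparr>carrier := U\<rparr>) S = C_span V S"
proof -
  interpret U: complex_space "V\<lparr>carrier := U\<rparr>"
    by (rule complex_space.intro[OF C_space_sub[OF U]])
  have S': "S \<subseteq> carrier V" using S subspace_subset[OF U] by simp
  show ?thesis
  proof (rule equalityI)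
    have "C_subspace (C_span V S) (V\<lparr>carrier := U\<rparr>)"
      using C_span_subspace[OF S'] C_span_minimal[OF U S] by (simp add: sub_C_subspace[OF U])
    then show "C_span (V\<lparr>carrier := U\<rparr>) S \<subseteq> C_span V S" by (rule U.C_span_minimal) (rule C_span_superset)
    have "C_subspace (C_span (V\<lparr>carrier := U\<rparr>) S) (V\<lparr>carrier := U\<rparr>)"
      by (rule U.C_span_subspace) (simp add: S)
    then show "C_span V S \<subseteq> C_span (V\<lparr>carrier := U\<rparr>) S"
      unfolding sub_C_subspace[OF U] by (intro C_span_minimal U.C_span_superset) simp
  qed
qed

text \<open>The property under the definite description in \<open>cconj\<close>, separated from it
  so that existence and uniqueness can be proved.\<close>

definition is_conj :: "'a mhs \<Rightarrow> ('a \<Rightarrow> 'a) \<Rightarrow> bool" where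
  "is_conj H \<sigma> \<longleftrightarrow> \<sigma> \<in> carrier H \<rightarrow>\<^sub>E carrier H \<and>
     (\<forall>x\<in>carrier H. \<forall>y\<in>carrier H. \<sigma> (x \<oplus>\<^bsub>H\<^esub> y) = \<sigma> x \<oplus>\<^bsub>H\<^esub> \<sigma> y) \<and>
     (\<forall>c. \<forall>x\<in>carrier H. \<sigma> (c \<odot>\<^bsub>H\<^esub> x) = cnj c \<odot>\<^bsub>H\<^esub> \<sigma> x) \<and>
     (\<forall>x\<in>HZ H. \<sigma> x = x)"

locale lattice_space = complex_space H for H :: "'a mhs" (structure) +
  assumes lattice: "full_lattice UNIV H (HZ H)"
begin

lemmas HZ_subgroup = full_lattice_subgroup[OF lattice]

lemma HZ_closed: "x \<in> HZ H \<Longrightarrow> x \<in> carrier H"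
  using HZ_subgroup by (auto simp: subgroup_iff)

lemma HZ_subset: "HZ H \<subseteq> carrier H"
  using HZ_closed by blast

text \<open>Antilinear maps that agree on the lattice agree on its span, which is
  everything.\<close>

lemma is_conj_unique:
  assumes "is_conj H \<sigma>" "is_conj H \<tau>"
  shows "\<sigma> = \<tau>"
proof -
  note s = assms(1)[unfolded is_conj_def] and t = assms(2)[unfolded is_conj_def]
  have "\<sigma> x = \<tau> x" if "x \<in> carrier H" for x
  proof -
    have "x \<in> C_span H (HZ H)" using that full_lattice_span[OF lattice] by simp
    then show ?thesis using HZ_subset
    proof (induction rule: C_span_induct)
      case zero
      have "\<sigma> (0 \<odot> \<zero>) = cnj 0 \<odot> \<sigma> \<zero>" "\<tau> (0 \<odot> \<zero>) = cnj 0 \<odot> \<tau> \<zero>" using s t zero_closed by blast+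
      moreover have "\<sigma> \<zero> \<in> carrier H" "\<tau> \<zero> \<in> carrier H" using s t zero_closed by auto
      ultimately show ?case by simp
    next
      case (add x y)
      then show ?case using s t full_lattice_span[OF lattice] by simp
    next
      case (smult c x)
      then show ?case using s t full_lattice_span[OF lattice] by simp
    qed (use s t in auto)
  qed
  then show ?thesis using s t by (intro PiE_ext[of \<sigma> "carrier H" "\<lambda>_. carrier H"]) auto
qed

text \<open>Existence comes from conjugating the coordinates in a basis of the lattice: lattice
  points have integral, hence real, coordinates and are fixed.\<close>

lemma is_conj_cconj: "is_conj H (cconj H)"
proof -
  from lattice obtain n v where v: "indep H v n" "HZ H = zspan H v n"
    and sp: "\<forall>x\<in>carrier H. \<exists>c. x = comb H v c n" unfolding full_lattice_UNIV_iff by blast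
  interpret based_space H v n by unfold_locales fact+
  have fix_int: "cmap cnj x = x" if "x \<in> HZ H" for x
    using that HZ_closed[OF that] zspan_iff[of x] unfolding v(2)
    by (subst eq_iff_coord) (auto simp: cmap_closed coord_cmap elim!: Ints_cases)
  have "is_conj H (restrict (cmap cnj) (carrier H))"
    unfolding is_conj_def
  proof (intro conjI ballI allI)
    fix c x assume x: "x \<in> carrier H"
    have "cmap cnj (c \<odot> x) = cnj c \<odot> cmap cnj x"
      using x by (subst eq_iff_coord) (auto simp: cmap_closed coord_cmap coord_smult)
    then show "restrict (cmap cnj) (carrier H) (c \<odot> x) = cnj c \<odot> restrict (cmap cnj) (carrier H) x"
      using x by simp
  qed (auto simp: cmap_closed cmap_add HZ_closed fix_int)
  then have "\<exists>!\<sigma>. is_conj H \<sigma>" using is_conj_unique by blast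
  then show ?thesis unfolding cconj_def is_conj_def[symmetric] by (rule theI')
qed

lemma cconj_eqI: "is_conj H \<sigma> \<Longrightarrow> cconj H = \<sigma>"
  using is_conj_unique[OF is_conj_cconj] by blast

abbreviation conj ("\<sigma>") where "\<sigma> \<equiv> cconj H"

lemma conj_closed [simp]: "x \<in> carrier H \<Longrightarrow> \<sigma> x \<in> carrier H"
  and conj_add: "x \<in> carrier H \<Longrightarrow> y \<in> carrier H \<Longrightarrow> \<sigma> (x \<oplus> y) = \<sigma> x \<oplus> \<sigma> y"
  and conj_smult: "x \<in> carrier H \<Longrightarrow> \<sigma> (c \<odot> x) = cnj c \<odot> \<sigma> x"
  and conj_HZ: "x \<in> HZ H \<Longrightarrow> \<sigma> x = x"
  using is_conj_cconj by (auto simp: is_conj_def)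

lemma conj_zero: "\<sigma> \<zero> = \<zero>"
  using conj_smult[of \<zero> 0] by simp

lemma conj_diff: "x \<in> carrier H \<Longrightarrow> y \<in> carrier H \<Longrightarrow> \<sigma> (x \<ominus> y) = \<sigma> x \<ominus> \<sigma> y"
  by (simp add: diff_eq conj_add conj_smult)

lemma conj_conj [simp]: "x \<in> carrier H \<Longrightarrow> \<sigma> (\<sigma> x) = x"
proof -
  assume "x \<in> carrier H"
  then have "x \<in> C_span H (HZ H)" using full_lattice_span[OF lattice] by simp
  then show ?thesis using HZ_subset
    by (induction rule: C_span_induct)
      (simp_all add: full_lattice_span[OF lattice] conj_zero conj_add conj_smult conj_HZ)
qed

lemma HQ_closed: "x \<in> HQ H \<Longrightarrow> x \<in> carrier H"
  by (simp add: HQ_def)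

lemma HZ_HQ: "x \<in> HZ H \<Longrightarrow> x \<in> HQ H"
  using HZ_closed by (auto simp: HQ_def intro!: exI[of _ "1::nat"])

lemma HQ_add: 
  assumes "x \<in> HQ H" "y \<in> HQ H"
  shows "x \<oplus> y \<in> HQ H"
proof -
  from assms obtain m n :: nat where x: "x \<in> carrier H" "m > 0" "of_nat m \<odot> x \<in> HZ H"
    and y: "y \<in> carrier H" "n > 0" "of_nat n \<odot> y \<in> HZ H" by (auto simp: HQ_def)
  have "of_int (int n) \<odot> (of_nat m \<odot> x) \<in> HZ H" "of_int (int m) \<odot> (of_nat n \<odot> y) \<in> HZ H"
    by (rule subgroup_int_smult[OF HZ_subgroup] x y)+
  then have "of_int (int n) \<odot> (of_nat m \<odot> x) \<oplus> of_int (int m) \<odot> (of_nat n \<odot> y) \<in> HZ H"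
    using HZ_subgroup by (simp add: subgroup_iff)
  then have "of_nat (n * m) \<odot> (x \<oplus> y) \<in> HZ H" using x y by (simp add: smult_r_distr mult.commute)
  then show ?thesis using x y unfolding HQ_def by (auto intro!: exI[of _ "n * m"])
qed

lemma HQ_smult:
  assumes "x \<in> HQ H"
  shows "of_rat r \<odot> x \<in> HQ H"
proof -
  from assms obtain m :: nat where x: "x \<in> carrier H" "m > 0" "of_nat m \<odot> x \<in> HZ H"
    by (auto simp: HQ_def)
  obtain a b where r: "r = of_int a / of_int b" "b > 0"
    by (metis Fract_of_int_quotient Rat_cases)
  have "of_int a \<odot> (of_nat m \<odot> x) \<in> HZ H" by (rule subgroup_int_smult[OF HZ_subgroup x(3)])
  moreover have "of_nat (nat b * m) \<odot> (of_rat r \<odot> x) = of_int a \<odot> (of_nat m \<odot> x)"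
    using x r by (simp add: of_rat_divide mult.commute)
  ultimately have "of_nat (nat b * m) \<odot> (of_rat r \<odot> x) \<in> HZ H" by simp
  then show ?thesis using x r unfolding HQ_def by (auto intro!: exI[of _ "nat b * m"])
qed

lemma C_span_HQ: "C_span H (HQ H) = carrier H"
proof (rule equalityI)
  show "C_span H (HQ H) \<subseteq> carrier H" using HQ_closed by (intro C_span_carrier) auto
  have "HZ H \<subseteq> HQ H" using HZ_HQ by auto
  from C_span_mono[OF this] show "carrier H \<subseteq> C_span H (HQ H)"
    using full_lattice_span[OF lattice] by simp
qed

text \<open>The subspaces defined over the rationals. Phrased by lattice points, the condition makes
  \<open>HZ H \<inter> U\<close> a full lattice in \<open>U\<close>.\<close>

definition rat_sub :: "'a set \<Rightarrow> bool" where
  "rat_sub U \<longleftrightarrow> C_subspace U H \<and> U = C_span H (HZ H \<inter> U)"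

lemma rat_subI:
  assumes "C_subspace U H" "U \<subseteq> C_span H (HZ H \<inter> U)"
  shows "rat_sub U"
  using assms C_span_minimal[OF assms(1), of "HZ H \<inter> U"] by (auto simp: rat_sub_def)

lemma rat_sub_subspace: "rat_sub U \<Longrightarrow> C_subspace U H"
  by (simp add: rat_sub_def)

lemma rat_sub_closed: "rat_sub U \<Longrightarrow> x \<in> U \<Longrightarrow> x \<in> carrier H"
  using subspace_subset[OF rat_sub_subspace] by blast

text \<open>Clearing denominators replaces each rational generator by a lattice point on the same
  line.\<close>

lemma rat_sub_C_span:
  assumes "W \<subseteq> HQ H"
  shows "rat_sub (C_span H W)"
proof (rule rat_subI)
  have W: "W \<subseteq> carrier H" using assms HQ_closed by blast
  show sub: "C_subspace (C_span H W) H" by (rule C_span_subspace[OF W])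
  let ?S = "C_span H (HZ H \<inter> C_span H W)"
  have S: "C_subspace ?S H" using HZ_subset by (intro C_span_subspace) auto
  have "w \<in> ?S" if w: "w \<in> W" for w
  proof -
    obtain n :: nat where n: "n > 0" "of_nat n \<odot> w \<in> HZ H" "w \<in> carrier H"
      using assms w by (auto simp: HQ_def)
    have "of_nat n \<odot> w \<in> C_span H W"
      by (rule subspace_smult[OF sub subsetD[OF C_span_superset w]])
    with n(2) have "of_nat n \<odot> w \<in> HZ H \<inter> C_span H W" by blast
    then have "of_nat n \<odot> w \<in> ?S" by (rule subsetD[OF C_span_superset])
    from subspace_smult[OF S this, of "1 / of_nat n"] n show ?thesis by simp
  qed
  then show "C_span H W \<subseteq> ?S" by (intro C_span_minimal[OF S]) auto
qed

lemma rat_sub_conj: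
  assumes "rat_sub U" "x \<in> U"
  shows "\<sigma> x \<in> U"
proof -
  have U: "C_span H (HZ H \<inter> U) = U" using assms by (simp add: rat_sub_def)
  have x: "x \<in> C_span H (HZ H \<inter> U)" and S: "HZ H \<inter> U \<subseteq> carrier H" using assms U HZ_subset by auto
  note sub = rat_sub_subspace[OF assms(1)]
  show ?thesis using x S
  proof (induction rule: C_span_induct)
    case (add x y)
    then show ?case
      using rat_sub_closed[OF assms(1)] subspace_add[OF sub] by (simp add: U conj_add)
  next
    case (smult c x)
    then show ?case
      using rat_sub_closed[OF assms(1)] subspace_smult[OF sub] by (simp add: U conj_smult)
  qed (simp_all add: conj_zero conj_HZ subspace_zero[OF sub])
qed

lemma rat_sub_union:
  assumes "\<And>U. U \<in> \<U> \<Longrightarrow> rat_sub U"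
  shows "rat_sub (C_span H (\<Union>\<U>))"
proof (rule rat_subI)
  have c: "\<Union>\<U> \<subseteq> carrier H" using assms rat_sub_closed by blast
  show sub: "C_subspace (C_span H (\<Union>\<U>)) H" by (rule C_span_subspace[OF c])
  let ?S = "C_span H (HZ H \<inter> C_span H (\<Union>\<U>))"
  have S: "C_subspace ?S H" using HZ_subset by (intro C_span_subspace) auto
  have "U \<subseteq> ?S" if "U \<in> \<U>" for U
  proof -
    have "HZ H \<inter> U \<subseteq> HZ H \<inter> C_span H (\<Union>\<U>)" using that C_span_superset[of "\<Union>\<U>"] by blast
    from C_span_mono[OF this] show ?thesis using assms[OF that] unfolding rat_sub_def by blast
  qed
  then show "C_span H (\<Union>\<U>) \<subseteq> ?S" by (intro C_span_minimal[OF S]) auto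
qed

text \<open>Complexification creates no new rational points. This is how \<open>Wt\<close> is
  recovered from its complex span \<open>WC\<close>.\<close>

lemma C_span_Int_HQ:
  assumes W: "W \<subseteq> HQ H" "subgroup W (add_monoid H)" "\<forall>r. \<forall>x\<in>W. of_rat r \<odot> x \<in> W"
    and x: "x \<in> C_span H W" "x \<in> HQ H"
  shows "x \<in> W"
proof -
  from lattice obtain n v where v: "indep H v n" "HZ H = zspan H v n"
    and sp: "\<forall>x\<in>carrier H. \<exists>c. x = comb H v c n" unfolding full_lattice_UNIV_iff by blast
  interpret based_space H v n by unfold_locales fact+
  have rat: "\<forall>i<n. \<exists>q. coord x i = of_rat q" if "x \<in> HQ H" for x
    using that coord_rational v(2) by (auto simp: HQ_def)
  show ?thesis
  proof (rule C_span_rational[OF _ _ _ W(3) _ x(1) rat[OF x(2)]])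
    show "\<forall>x\<in>W. \<forall>i<n. \<exists>q. coord x i = of_rat q" using W(1) rat by blast
  qed (use W(2) in \<open>simp_all add: subgroup_iff\<close>)
qed

end

subsection \<open>Subquotients\<close>

lemma sub_mhs_simps [simp]:
  "carrier (sub_mhs H U) = U" "ring.add (sub_mhs H U) = ring.add H" "ring.zero (sub_mhs H U) = ring.zero H"
  "module.smult (sub_mhs H U) = module.smult H" "HZ (sub_mhs H U) = HZ H \<inter> U"
  "Wt (sub_mhs H U) k = Wt H k \<inter> U" "Fil (sub_mhs H U) k = Fil H k \<inter> U"
  by (simp_all add: sub_mhs_def)

lemma sub_mhs_same_ops: "same_ops (H\<lparr>carrier := U\<rparr>) (sub_mhs H U)"
  by (simp add: same_ops_def)

lemma quot_mhs_simps [simp]: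
  "carrier (quot_mhs H N) = carrier (quot_space H N)" "ring.add (quot_mhs H N) = ring.add (quot_space H N)"
  "ring.zero (quot_mhs H N) = ring.zero (quot_space H N)" "module.smult (quot_mhs H N) = module.smult (quot_space H N)"
  "HZ (quot_mhs H N) = (\<lambda>x. N +>\<^bsub>H\<^esub> x) ` HZ H" "Wt (quot_mhs H N) k = (\<lambda>x. N +>\<^bsub>H\<^esub> x) ` Wt H k"
  "Fil (quot_mhs H N) k = (\<lambda>x. N +>\<^bsub>H\<^esub> x) ` Fil H k"
  by (simp_all add: quot_mhs_def module.defs)

lemma quot_mhs_same_ops: "same_ops (quot_space H N) (quot_mhs H N)"
  by (simp add: same_ops_def)

lemma coset_same_ops:
  "same_ops V V' \<Longrightarrow> a_r_coset V = a_r_coset V'" "same_ops V V' \<Longrightarrow> set_add V = set_add V'"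
  by (auto simp: same_ops_def fun_eq_iff a_r_coset_def r_coset_def set_add_def set_mult_def)

lemma quot_space_same_ops: "same_ops V V' \<Longrightarrow> quot_space V N = quot_space V' N"
  using coset_same_ops[of V V']
  by (simp add: quot_space_def A_RCOSETS_def RCOSETS_def r_coset_def same_ops_def fun_eq_iff)

lemma sub_mhs_coset [simp]:
  "a_r_coset (sub_mhs H U) = a_r_coset H" "set_add (sub_mhs H U) = set_add H"
  by (auto simp: fun_eq_iff a_r_coset_def r_coset_def set_add_def set_mult_def)

text \<open>No condition on Hodge types enters: rationality of \<open>U\<close> and \<open>N\<close>
  already gives \<open>U/N\<close> a lattice and a conjugation. The graded pieces,
  \<open>H'/W\<^sub>2\<^sub>p\<^sub>-\<^sub>2\<close> and \<open>H''/H'\<close> are all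
  instances.\<close>

locale subquotient = lattice_space +
  fixes U N
  assumes rU: "rat_sub U" and rN: "rat_sub N" and NU: "N \<subseteq> U"
begin

abbreviation "Q \<equiv> subquot H U N"

lemmas subU = rat_sub_subspace[OF rU] and subN = rat_sub_subspace[OF rN]

sublocale quot: quotient_space H N
  by (rule quotient_space.intro[OF complex_space_axioms quotient_space_axioms.intro[OF subN]])

lemma U_closed: "x \<in> U \<Longrightarrow> x \<in> carrier H"
  using rat_sub_closed[OF rU] .

interpretation sub: quotient_space "H\<lparr>carrier := U\<rparr>" N
  by (intro quotient_space.intro complex_space.intro quotient_space_axioms.intro)
    (simp_all add: C_space_sub[OF subU] sub_C_subspace[OF subU] subN NU)

lemma subquot_quot_space: "same_ops (quot_space (H\<lparr>carrier := U\<rparr>) N) Q"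
  unfolding subquot_def using quot_mhs_same_ops quot_space_same_ops[OF sub_mhs_same_ops] by metis

lemma C_space_Q: "C_space Q"
  by (rule same_ops_C_space[OF subquot_quot_space sub.C_space_quot])

lemma lattice_Q: "full_lattice UNIV Q (HZ Q)"
proof -
  have "full_lattice UNIV (H\<lparr>carrier := U\<rparr>) (HZ H \<inter> U)"
    using rU subU by (intro full_lattice_sub[OF lattice] subgroup_Int[OF HZ_subgroup subspace_imp_subgroup])
      (auto simp: rat_sub_def)
  moreover have "N = C_span (H\<lparr>carrier := U\<rparr>) (HZ H \<inter> U \<inter> N)"
  proof -
    have "HZ H \<inter> U \<inter> N = HZ H \<inter> N" "HZ H \<inter> N \<subseteq> U" using NU by auto
    then show ?thesis using rN C_span_sub[OF subU, of "HZ H \<inter> N"] unfolding rat_sub_def by metis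
  qed
  ultimately have "full_lattice UNIV (quot_space (H\<lparr>carrier := U\<rparr>) N) ((\<lambda>x. N +> x) ` (HZ H \<inter> U))"
    using sub.full_lattice_quot by simp
  then show ?thesis
    using same_ops_full_lattice[OF subquot_quot_space] by (simp add: subquot_def)
qed

sublocale Q: lattice_space Q
  by unfold_locales (rule C_space_Q lattice_Q)+

lemma Q_carrier: "carrier Q = (\<lambda>x. N +> x) ` U"
  using sub.quot_carrier by (simp add: subquot_def quot_space_same_ops[OF sub_mhs_same_ops, symmetric])

lemma Q_zero: "\<zero>\<^bsub>Q\<^esub> = N"
  by (simp add: subquot_def quot_space_def)

lemma Q_zero': "\<zero>\<^bsub>Q\<^esub> = N +> \<zero>"
  using Q_zero quot.coset_zero subspace_zero[OF subN] by simp

lemma Q_add: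
  "x \<in> carrier H \<Longrightarrow> y \<in> carrier H \<Longrightarrow> (N +> x) \<oplus>\<^bsub>Q\<^esub> (N +> y) = N +> (x \<oplus> y)"
  using quot.coset_add by (simp add: subquot_def quot_space_def)

lemma Q_smult: "x \<in> carrier H \<Longrightarrow> c \<odot>\<^bsub>Q\<^esub> (N +> x) = N +> (c \<odot> x)"
  using quot.coset_smult by (simp add: subquot_def quot_space_def)

lemma Q_HZ: "HZ Q = (\<lambda>x. N +> x) ` (HZ H \<inter> U)"
  by (simp add: subquot_def)

lemma Q_Wt: "Wt Q k = (\<lambda>x. N +> x) ` (Wt H k \<inter> U)"
  by (simp add: subquot_def)

lemma Q_Fil: "Fil Q k = (\<lambda>x. N +> x) ` (Fil H k \<inter> U)"
  by (simp add: subquot_def)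

lemma Q_closed: "x \<in> U \<Longrightarrow> N +> x \<in> carrier Q"
  by (simp add: Q_carrier)

lemma Q_diff: "x \<in> U \<Longrightarrow> y \<in> U \<Longrightarrow> (N +> x) \<ominus>\<^bsub>Q\<^esub> (N +> y) = N +> (x \<ominus> y)"
  by (simp add: Q.diff_eq Q_closed Q_smult Q_add U_closed diff_eq)

lemma Q_eq: "x \<in> U \<Longrightarrow> y \<in> U \<Longrightarrow> N +> x = N +> y \<longleftrightarrow> x \<ominus> y \<in> N"
  by (simp add: quot.coset_eq_iff U_closed)

text \<open>A rational subspace is stable under conjugation, so conjugation descends to cosets of
  \<open>N\<close>. The descended map is antilinear and fixes the image lattice, and by uniqueness
  it is the conjugation of the quotient.\<close>

lemma Q_conj: "x \<in> U \<Longrightarrow> cconj Q (N +> x) = N +> \<sigma> x"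
proof -
  assume x: "x \<in> U"
  define \<tau> where "\<tau> = (\<lambda>P\<in>carrier Q. N +> \<sigma> (SOME y. y \<in> U \<and> N +> y = P))"
  have tau: "\<tau> (N +> y) = N +> \<sigma> y" if y: "y \<in> U" for y
  proof -
    let ?z = "SOME z. z \<in> U \<and> N +> z = N +> y"
    have z: "?z \<in> U" "N +> ?z = N +> y"
      using someI[of "\<lambda>z. z \<in> U \<and> N +> z = N +> y" y] y by auto
    then have "?z \<ominus> y \<in> N" using y by (simp add: Q_eq)
    then have "\<sigma> (?z \<ominus> y) \<in> N" by (rule rat_sub_conj[OF rN])
    then have "N +> \<sigma> ?z = N +> \<sigma> y"
      using y z by (simp add: quot.coset_eq_iff U_closed conj_diff)
    then show ?thesis using y by (simp add: \<tau>_def Q_closed)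
  qed
  have "is_conj Q \<tau>"
    unfolding is_conj_def
  proof (intro conjI ballI allI)
    show "\<tau> \<in> carrier Q \<rightarrow>\<^sub>E carrier Q"
    proof (rule PiE_I)
      fix P assume "P \<in> carrier Q"
      then show "\<tau> P \<in> carrier Q" by (auto simp: Q_carrier tau rat_sub_conj[OF rU])
    qed (simp add: \<tau>_def)
    fix P R assume "P \<in> carrier Q" "R \<in> carrier Q"
    then obtain y z where "y \<in> U" "P = N +> y" "z \<in> U" "R = N +> z" unfolding Q_carrier by blast
    then show "\<tau> (P \<oplus>\<^bsub>Q\<^esub> R) = \<tau> P \<oplus>\<^bsub>Q\<^esub> \<tau> R"
      by (simp add: Q_add tau U_closed conj_add subspace_add[OF subU])
  next
    fix c P assume "P \<in> carrier Q"
    then obtain y where "y \<in> U" "P = N +> y" unfolding Q_carrier by blast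
    then show "\<tau> (c \<odot>\<^bsub>Q\<^esub> P) = cnj c \<odot>\<^bsub>Q\<^esub> \<tau> P"
      by (simp add: Q_smult tau U_closed conj_smult subspace_smult[OF subU])
  next
    fix P assume "P \<in> HZ Q"
    then obtain y where "y \<in> HZ H" "y \<in> U" "P = N +> y" unfolding Q_HZ by blast
    then show "\<tau> P = P" by (simp add: tau conj_HZ)
  qed
  then have "cconj Q = \<tau>" by (rule Q.cconj_eqI)
  with tau[OF x] show ?thesis by (simp only:)
qed

end

subsection \<open>Opposed filtrations and pure Hodge structures\<close>

lemma ball_image: "(\<forall>y\<in>f ` A. P y) \<longleftrightarrow> (\<forall>x\<in>A. P (f x))"
  by blast

lemma bex_image: "(\<exists>y\<in>f ` A. P y) \<longleftrightarrow> (\<exists>x\<in>A. P (f x))"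
  by blast

definition finite_filtration :: "'a mhs \<Rightarrow> bool" where
  "finite_filtration H \<longleftrightarrow> (\<forall>k. C_subspace (Fil H k) H) \<and> antimono (Fil H) \<and>
     (\<exists>k. Fil H k = {\<zero>\<^bsub>H\<^esub>}) \<and> (\<exists>k. Fil H k = carrier H)"

definition pure :: "'a mhs \<Rightarrow> int \<Rightarrow> bool" where
  "pure G n \<longleftrightarrow> C_space G \<and> full_lattice UNIV G (HZ G) \<and>
     (\<forall>k. Wt G k = (if k < n then {\<zero>\<^bsub>G\<^esub>} else HQ G)) \<and> finite_filtration G \<and> opposed G n"

context lattice_space
begin

lemma opposed_iff:
  assumes "\<And>k. C_subspace (Fil H k) H"
  shows "opposed H n \<longleftrightarrow> (\<forall>a b. a + b = n + 1 \<longrightarrow>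
    (\<forall>f\<in>Fil H a. \<forall>f'\<in>Fil H b. f = \<sigma> f' \<longrightarrow> f = \<zero>) \<and>
    (\<forall>x\<in>carrier H. \<exists>f\<in>Fil H a. \<exists>f'\<in>Fil H b. x = f \<oplus> \<sigma> f'))"
proof -
  have 1: "Fil H a \<inter> \<sigma> ` Fil H b = {\<zero>} \<longleftrightarrow> (\<forall>f\<in>Fil H a. \<forall>f'\<in>Fil H b. f = \<sigma> f' \<longrightarrow> f = \<zero>)" for a b
  proof -
    have "\<zero> \<in> Fil H a" "\<zero> \<in> \<sigma> ` Fil H b"
      using subspace_zero[OF assms] conj_zero by (simp, metis imageI)
    then show ?thesis by blast
  qed
  have cl: "f \<in> carrier H" if "f \<in> Fil H a" for f a using subspace_subset[OF assms] that by blast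
  have 2: "set_add H (Fil H a) (\<sigma> ` Fil H b) = carrier H \<longleftrightarrow>
    (\<forall>x\<in>carrier H. \<exists>f\<in>Fil H a. \<exists>f'\<in>Fil H b. x = f \<oplus> \<sigma> f')" for a b
  proof -
    have mem: "x \<in> set_add H (Fil H a) (\<sigma> ` Fil H b) \<longleftrightarrow> (\<exists>f\<in>Fil H a. \<exists>f'\<in>Fil H b. x = f \<oplus> \<sigma> f')" for x
      by (auto simp: set_add_eq)
    have "x \<in> carrier H" if "x \<in> set_add H (Fil H a) (\<sigma> ` Fil H b)" for x
      using that unfolding mem by (auto simp: cl)
    then have "set_add H (Fil H a) (\<sigma> ` Fil H b) = carrier H \<longleftrightarrow>
        (\<forall>x\<in>carrier H. x \<in> set_add H (Fil H a) (\<sigma> ` Fil H b))" by blast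
    then show ?thesis unfolding mem .
  qed
  show ?thesis unfolding opposed_def 1 2 ..
qed

end

context subquotient
begin

lemma Q_C_subspace: "C_subspace S H \<Longrightarrow> C_subspace ((\<lambda>x. N +> x) ` (S \<inter> U)) Q"
proof (rule Q.subspaceI)
  assume S: "C_subspace S H"
  show "(\<lambda>x. N +> x) ` (S \<inter> U) \<subseteq> carrier Q" by (auto simp: Q_carrier)
  show "\<zero>\<^bsub>Q\<^esub> \<in> (\<lambda>x. N +> x) ` (S \<inter> U)"
    unfolding Q_zero' using subspace_zero[OF S] subspace_zero[OF subU] by blast
  fix P assume "P \<in> (\<lambda>x. N +> x) ` (S \<inter> U)"
  then obtain x where x: "x \<in> S" "x \<in> U" "P = N +> x" by blast
  then show "c \<odot>\<^bsub>Q\<^esub> P \<in> (\<lambda>x. N +> x) ` (S \<inter> U)" for c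
    using subspace_smult[OF S x(1), of c] subspace_smult[OF subU x(2), of c]
    by (simp add: Q_smult U_closed)
  fix R assume "R \<in> (\<lambda>x. N +> x) ` (S \<inter> U)"
  then obtain y where y: "y \<in> S" "y \<in> U" "R = N +> y" by blast
  then show "P \<oplus>\<^bsub>Q\<^esub> R \<in> (\<lambda>x. N +> x) ` (S \<inter> U)"
    using x subspace_add[OF S x(1) y(1)] subspace_add[OF subU x(2) y(2)]
    by (simp add: Q_add U_closed)
qed

lemma Q_finite_filtration: "finite_filtration H \<Longrightarrow> finite_filtration Q"
  unfolding finite_filtration_def
proof (elim conjE, intro conjI allI)
  assume sub: "\<forall>k. C_subspace (Fil H k) H" and anti: "antimono (Fil H)"
    and 0: "\<exists>k. Fil H k = {\<zero>}" and 1: "\<exists>k. Fil H k = carrier H"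
  show "C_subspace (Fil Q k) Q" for k unfolding Q_Fil using sub Q_C_subspace by blast
  show "antimono (Fil Q)" using anti unfolding antimono_def Q_Fil by blast
  from 0 obtain k where "Fil H k = {\<zero>}" ..
  then have "Fil Q k = {\<zero>\<^bsub>Q\<^esub>}" using subspace_zero[OF subU] by (simp add: Q_Fil Q_zero')
  then show "\<exists>k. Fil Q k = {\<zero>\<^bsub>Q\<^esub>}" ..
  from 1 obtain k where "Fil H k = carrier H" ..
  then have "Fil Q k = carrier Q" using subspace_subset[OF subU] by (simp add: Q_Fil Q_carrier Int_absorb1)
  then show "\<exists>k. Fil Q k = carrier Q" ..
qed

text \<open>Opposedness of the graded pieces is tested in \<open>H\<close> itself, by congruences
  modulo \<open>N\<close> between elements of \<open>U\<close>.\<close>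

lemma opposed_Q_iff:
  assumes "\<And>k. C_subspace (Fil H k) H"
  shows "opposed Q n \<longleftrightarrow> (\<forall>a b. a + b = n + 1 \<longrightarrow>
    (\<forall>f\<in>Fil H a \<inter> U. \<forall>f'\<in>Fil H b \<inter> U. f \<ominus> \<sigma> f' \<in> N \<longrightarrow> f \<in> N) \<and>
    (\<forall>x\<in>U. \<exists>f\<in>Fil H a \<inter> U. \<exists>f'\<in>Fil H b \<inter> U. x \<ominus> (f \<oplus> \<sigma> f') \<in> N))"
proof -
  have sub: "C_subspace (Fil Q k) Q" for k unfolding Q_Fil by (rule Q_C_subspace[OF assms])
  have 1: "N +> f = cconj Q (N +> f') \<longleftrightarrow> f \<ominus> \<sigma> f' \<in> N" if "f \<in> U" "f' \<in> U" for f f'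
    using that by (simp add: Q_conj Q_eq rat_sub_conj[OF rU])
  have 2: "N +> x = (N +> f) \<oplus>\<^bsub>Q\<^esub> cconj Q (N +> f') \<longleftrightarrow> x \<ominus> (f \<oplus> \<sigma> f') \<in> N"
    if "x \<in> U" "f \<in> U" "f' \<in> U" for x f f'
    using that by (simp add: Q_conj Q_eq Q_add U_closed rat_sub_conj[OF rU] subspace_add[OF subU])
  have 3: "N +> f = \<zero>\<^bsub>Q\<^esub> \<longleftrightarrow> f \<in> N" if "f \<in> U" for f
    using that by (simp add: Q_zero quot.coset_eq_N_iff U_closed)
  show ?thesis
    unfolding Q.opposed_iff[OF sub] Q_Fil Q_carrier ball_image bex_image
    by (intro all_cong1 imp_cong conj_cong ball_cong bex_cong refl) (auto simp only: Int_iff 1 2 3)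
qed

lemma Q_HQ_subset: "(\<lambda>x. N +> x) ` (HQ H \<inter> U) \<subseteq> HQ Q"
proof safe
  fix x assume "x \<in> HQ H" "x \<in> U"
  then show "N +> x \<in> HQ Q"
    using subspace_smult[OF subU] by (auto simp: HQ_def Q_closed Q_smult U_closed Q_HZ)
qed

text \<open>If \<open>n\<close> times a class is represented by a lattice point \<open>z\<close> of
  \<open>U\<close>, then \<open>z\<close> divided by \<open>n\<close> is a rational representative
  of the class.\<close>

lemma Q_HQ: "HQ Q = (\<lambda>x. N +> x) ` (HQ H \<inter> U)"
proof (rule equalityI[OF _ Q_HQ_subset]; rule subsetI)
  fix P assume "P \<in> HQ Q"
  then obtain x and n :: nat where x: "x \<in> U" "P = N +> x" and n: "n > 0" "of_nat n \<odot>\<^bsub>Q\<^esub> P \<in> HZ Q"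
    by (auto simp: HQ_def Q_carrier)
  then obtain z where z: "z \<in> HZ H" "z \<in> U" "of_nat n \<odot>\<^bsub>Q\<^esub> P = N +> z" by (auto simp: Q_HZ)
  define y where "y = (1 / of_nat n) \<odot> z"
  have yU: "y \<in> U" unfolding y_def by (rule subspace_smult[OF subU z(2)])
  have "y \<in> HQ H" using n z HZ_closed by (auto simp: HQ_def y_def intro!: exI[of _ n])
  moreover have "P = N +> y"
  proof -
    have "(1 / of_nat n) \<odot>\<^bsub>Q\<^esub> (of_nat n \<odot>\<^bsub>Q\<^esub> P) = N +> y"
      unfolding z(3) y_def by (rule Q_smult[OF U_closed[OF z(2)]])
    then show ?thesis using n x Q_closed by simp
  qed
  ultimately show "P \<in> (\<lambda>x. N +> x) ` (HQ H \<inter> U)" using yU by blast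
qed

end

lemma gr_subquot: "gr H k = subquot H (WC H k) (WC H (k - 1))"
  by (simp add: gr_def subquot_def)

text \<open>The data of a mixed Hodge structure except for the opposedness.\<close>

locale filtered_lattice = lattice_space +
  assumes Wt: "\<And>k. Wt H k \<subseteq> HQ H" "\<And>k. subgroup (Wt H k) (add_monoid H)"
      "\<And>k r x. x \<in> Wt H k \<Longrightarrow> of_rat r \<odot> x \<in> Wt H k"
    and Wt_mono: "mono (Wt H)" and Wt_0: "\<exists>k. Wt H k = {\<zero>}" and Wt_HQ: "\<exists>k. Wt H k = HQ H"
    and fil: "finite_filtration H"
begin

lemma Fil_subspace: "C_subspace (Fil H k) H"
  and Fil_antimono: "a \<le> b \<Longrightarrow> Fil H b \<subseteq> Fil H a"
  using fil by (auto simp: finite_filtration_def antimono_def)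

lemma Fil_closed: "x \<in> Fil H k \<Longrightarrow> x \<in> carrier H"
  using subspace_subset[OF Fil_subspace] by blast

lemma rat_sub_WC: "rat_sub (WC H k)"
  unfolding WC_def by (rule rat_sub_C_span[OF Wt(1)])

lemma WC_mono: "k \<le> l \<Longrightarrow> WC H k \<subseteq> WC H l"
  unfolding WC_def by (rule C_span_mono) (rule monoD[OF Wt_mono])

lemma Wt_WC: "Wt H k \<subseteq> WC H k"
  unfolding WC_def by (rule C_span_superset)

lemma WC_HQ: "x \<in> WC H k \<Longrightarrow> x \<in> HQ H \<Longrightarrow> x \<in> Wt H k"
  unfolding WC_def by (rule C_span_Int_HQ[OF Wt(1,2)]) (auto simp: Wt(3))

lemma subquotient_WC: "k \<le> l \<Longrightarrow> subquotient H (WC H l) (WC H k)"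
  by (intro subquotient.intro subquotient_axioms.intro lattice_space_axioms rat_sub_WC WC_mono)

lemma MHS_iff: "MHS H \<longleftrightarrow> (\<forall>k. opposed (gr H k) k)"
  using C_space lattice Wt Wt_mono Wt_0 Wt_HQ fil
  unfolding MHS_def finite_filtration_def by blast

lemma opposed_gr_trivial:
  assumes eq: "WC H k = WC H (k - 1)"
  shows "opposed (gr H k) k"
proof -
  interpret gr: subquotient H "WC H k" "WC H (k - 1)" by (rule subquotient_WC) simp
  have "\<exists>f\<in>Fil H a \<inter> WC H k. \<exists>f'\<in>Fil H b \<inter> WC H k. x \<ominus> (f \<oplus> \<sigma> f') \<in> WC H (k - 1)"
    if "x \<in> WC H k" for a b x
  proof -
    have "\<zero> \<in> Fil H c \<inter> WC H k" for c
      using subspace_zero[OF Fil_subspace] subspace_zero[OF gr.subU] by simp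
    moreover have "x \<ominus> (\<zero> \<oplus> \<sigma> \<zero>) \<in> WC H (k - 1)"
      using that gr.U_closed eq by (simp add: conj_zero diff_eq)
    ultimately show ?thesis by blast
  qed
  then show ?thesis unfolding gr_subquot gr.opposed_Q_iff[OF Fil_subspace] using eq by blast
qed

end

lemma MHS_filtered: "MHS H \<Longrightarrow> filtered_lattice H"
  by (intro filtered_lattice.intro lattice_space.intro complex_space.intro lattice_space_axioms.intro
      filtered_lattice_axioms.intro)
    (simp_all add: MHS_def finite_filtration_def)

text \<open>Weights below \<open>k\<close> are divided out. From \<open>k\<close> on,
  \<open>Wt\<close> contains all rational points of \<open>WC H k\<close>, because these lie in
  \<open>Wt H k\<close> by \<open>WC_HQ\<close>.\<close>

lemma gr_pure:
  assumes "MHS H"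
  shows "pure (gr H k) k"
proof -
  interpret filtered_lattice H by (rule MHS_filtered[OF assms])
  interpret gr: subquotient H "WC H k" "WC H (k - 1)" by (rule subquotient_WC) simp
  have "Wt gr.Q l = (if l < k then {\<zero>\<^bsub>gr.Q\<^esub>} else HQ gr.Q)" for l
  proof (cases "l < k")
    case True
    have "Wt H l \<subseteq> WC H (k - 1)" using Wt_WC WC_mono[of l "k - 1"] True by auto
    then have "Wt H l \<inter> WC H k \<subseteq> WC H (k - 1)" by blast
    moreover have "\<zero>\<^bsub>H\<^esub> \<in> Wt H l \<inter> WC H k"
      using Wt(2) subspace_zero[OF gr.subU] by (simp add: subgroup_iff)
    ultimately have "(\<lambda>x. WC H (k - 1) +>\<^bsub>H\<^esub> x) ` (Wt H l \<inter> WC H k) = {WC H (k - 1)}"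
      using gr.quot.coset_zero by (auto simp: image_iff)
    then show ?thesis using True by (simp add: gr.Q_Wt gr.Q_zero)
  next
    case False
    have "Wt H l \<inter> WC H k = HQ H \<inter> WC H k"
      using Wt(1) WC_HQ[of _ k] monoD[OF Wt_mono, of k l] False by fastforce
    then show ?thesis using False by (simp add: gr.Q_Wt gr.Q_HQ)
  qed
  moreover have "opposed gr.Q k" using assms by (simp add: MHS_def gr_subquot)
  ultimately show ?thesis
    unfolding gr_subquot pure_def using gr.C_space_Q gr.lattice_Q gr.Q_finite_filtration[OF fil] by blast
qed

text \<open>Opposedness is left out, so that it can be characterised for the substructures of a pure
  structure, which satisfy everything else as soon as they are rational.\<close>

locale pure_space = lattice_space +
  fixes n :: int
  assumes fil': "finite_filtration H"
    and Wt_pure: "\<And>k. Wt H k = (if k < n then {\<zero>} else HQ H)"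
begin

sublocale filtered_lattice H
proof (intro filtered_lattice.intro filtered_lattice_axioms.intro lattice_space_axioms)
  show "Wt H k \<subseteq> HQ H" "subgroup (Wt H k) (add_monoid H)" for k
  proof -
    have 0: "\<zero> \<in> HQ H" using HZ_HQ HZ_subgroup by (simp add: subgroup_iff)
    then show "Wt H k \<subseteq> HQ H" by (simp add: Wt_pure)
    have "subgroup (HQ H) (add_monoid H)"
      using 0 HQ_closed HQ_add HQ_smult[of _ "-1"] by (auto simp: subgroup_iff)
    then show "subgroup (Wt H k) (add_monoid H)"
      using subspace_imp_subgroup[OF subspace_trivial] by (simp add: Wt_pure)
  qed
  have "\<zero> \<in> HQ H" using HZ_HQ HZ_subgroup by (simp add: subgroup_iff)
  then show "mono (Wt H)" by (intro monoI) (simp add: Wt_pure)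
  show "\<exists>k. Wt H k = {\<zero>}" by (rule exI[of _ "n - 1"]) (simp add: Wt_pure)
  show "\<exists>k. Wt H k = HQ H" by (rule exI[of _ n]) (simp add: Wt_pure)
qed (auto simp: Wt_pure HQ_smult fil' split: if_splits)

lemma WC_pure: "WC H k = (if k < n then {\<zero>} else carrier H)"
  using C_span_HQ C_span_eq[OF subspace_trivial] by (simp add: WC_def Wt_pure)

lemma opposed_gr: "opposed (gr H n) n \<longleftrightarrow> opposed H n"
proof -
  interpret gr: subquotient H "WC H n" "WC H (n - 1)" by (rule subquotient_WC) simp
  have "opposed (gr H n) n \<longleftrightarrow> (\<forall>a b. a + b = n + 1 \<longrightarrow>
    (\<forall>f\<in>Fil H a. \<forall>f'\<in>Fil H b. f \<ominus> \<sigma> f' = \<zero> \<longrightarrow> f = \<zero>) \<and>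
    (\<forall>x\<in>carrier H. \<exists>f\<in>Fil H a. \<exists>f'\<in>Fil H b. x \<ominus> (f \<oplus> \<sigma> f') = \<zero>))"
    unfolding gr_subquot
    unfolding gr.opposed_Q_iff[OF Fil_subspace]
    unfolding WC_pure using subspace_subset[OF Fil_subspace] by (simp add: Int_absorb2)
  also have "\<dots> \<longleftrightarrow> opposed H n"
    unfolding opposed_iff[OF Fil_subspace]
    by (intro all_cong1 imp_cong conj_cong ball_cong bex_cong refl)
      (simp_all add: diff_eq_zero_iff Fil_closed)
  finally show ?thesis .
qed

text \<open>All graded pieces except the one of weight \<open>n\<close> vanish, and that one is
  \<open>H\<close> itself.\<close>

lemma MHS_pure_iff: "MHS H \<longleftrightarrow> opposed H n"
proof -
  have "opposed (gr H k) k" if "k \<noteq> n" for k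
    by (rule opposed_gr_trivial) (use that in \<open>auto simp: WC_pure\<close>)
  then show ?thesis unfolding MHS_iff using opposed_gr by metis
qed

end

lemma pure_spaceI: "pure G n \<Longrightarrow> pure_space G n"
  by (intro pure_space.intro lattice_space.intro complex_space.intro lattice_space_axioms.intro
      pure_space_axioms.intro)
    (simp_all add: pure_def)

lemma pure_MHS:
  assumes "pure G n"
  shows "MHS G"
  using pure_space.MHS_pure_iff[OF pure_spaceI[OF assms]] assms by (simp add: pure_def)

lemma (in pure_space) pure_iff: "pure H n \<longleftrightarrow> opposed H n"
  using C_space lattice Wt_pure fil' by (simp add: pure_def)

context pure_space
begin

lemma sub_mhs_C_space: "C_subspace U H \<Longrightarrow> C_space (sub_mhs H U)"
  by (rule same_ops_C_space[OF sub_mhs_same_ops C_space_sub])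

lemma sub_mhs_HQ: "C_subspace U H \<Longrightarrow> HQ (sub_mhs H U) = HQ H \<inter> U"
  using subspace_subset[of U] subspace_smult[of U] by (fastforce simp: HQ_def)

lemma sub_mhs_subspace: "C_subspace U H \<Longrightarrow> C_subspace S (sub_mhs H U) \<longleftrightarrow> C_subspace S H \<and> S \<subseteq> U"
  using same_ops_C_subspace[OF sub_mhs_same_ops[of U H]] sub_C_subspace by metis

lemma sub_mhs_filtration:
  assumes U: "C_subspace U H"
  shows "finite_filtration (sub_mhs H U)"
  unfolding finite_filtration_def
proof (intro conjI allI)
  show "C_subspace (Fil (sub_mhs H U) k) (sub_mhs H U)" for k
    using subspace_Int[OF Fil_subspace U] by (simp add: sub_mhs_subspace[OF U])
  show "antimono (Fil (sub_mhs H U))" using Fil_antimono unfolding antimono_def by auto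
  obtain k l where "Fil H k = {\<zero>}" "Fil H l = carrier H" using fil by (auto simp: finite_filtration_def)
  then show "\<exists>k. Fil (sub_mhs H U) k = {\<zero>\<^bsub>sub_mhs H U\<^esub>}" "\<exists>k. Fil (sub_mhs H U) k = carrier (sub_mhs H U)"
    using subspace_zero[OF U] subspace_subset[OF U] by (auto intro: exI[of _ k] exI[of _ l])
qed

lemma sub_mhs_pure_space:
  assumes U: "C_subspace U H" and L: "full_lattice UNIV (sub_mhs H U) (HZ H \<inter> U)"
  shows "pure_space (sub_mhs H U) n"
proof (intro pure_space.intro lattice_space.intro complex_space.intro lattice_space_axioms.intro
      pure_space_axioms.intro)
  show "Wt (sub_mhs H U) k = (if k < n then {\<zero>\<^bsub>sub_mhs H U\<^esub>} else HQ (sub_mhs H U))" for k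
    using subspace_zero[OF U] by (simp add: Wt_pure sub_mhs_HQ[OF U])
qed (use L in \<open>simp_all add: sub_mhs_C_space U sub_mhs_filtration\<close>)

lemma sub_mhs_rat_sub:
  assumes U: "C_subspace U H"
  shows "full_lattice UNIV (sub_mhs H U) (HZ H \<inter> U) \<longleftrightarrow> rat_sub U"
proof
  assume L: "full_lattice UNIV (sub_mhs H U) (HZ H \<inter> U)"
  interpret U: complex_space "sub_mhs H U" by unfold_locales (rule sub_mhs_C_space[OF U])
  have "C_span (sub_mhs H U) (HZ H \<inter> U) = U" using U.full_lattice_span[OF L] by simp
  then show "rat_sub U"
    using same_ops_C_span[OF sub_mhs_same_ops[of U H]] C_span_sub[OF U, of "HZ H \<inter> U"] U
    by (simp add: rat_sub_def)
next
  assume "rat_sub U"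
  then show "full_lattice UNIV (sub_mhs H U) (HZ H \<inter> U)"
    unfolding same_ops_full_lattice[OF sub_mhs_same_ops, symmetric]
    using U by (intro full_lattice_sub[OF lattice] subgroup_Int[OF HZ_subgroup subspace_imp_subgroup])
      (auto simp: rat_sub_def)
qed

lemma sub_mhs_conj:
  assumes U: "rat_sub U" and x: "x \<in> U"
  shows "cconj (sub_mhs H U) x = \<sigma> x"
proof -
  note sU = rat_sub_subspace[OF U]
  interpret U: lattice_space "sub_mhs H U"
    using sub_mhs_rat_sub[OF sU] U
    by (intro lattice_space.intro complex_space.intro lattice_space_axioms.intro) (simp_all add: sub_mhs_C_space sU)
  have "is_conj (sub_mhs H U) (restrict \<sigma> U)"
    unfolding is_conj_def
    using rat_sub_conj[OF U] rat_sub_closed[OF U] subspace_add[OF sU] subspace_smult[OF sU]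
    by (simp add: conj_add conj_smult conj_HZ)
  then show ?thesis using U.cconj_eqI x by simp
qed

lemma sub_mhs_pure_iff:
  assumes U: "rat_sub U"
  shows "pure (sub_mhs H U) n \<longleftrightarrow> (\<forall>a b. a + b = n + 1 \<longrightarrow>
    (\<forall>f\<in>Fil H a \<inter> U. \<forall>f'\<in>Fil H b \<inter> U. f = \<sigma> f' \<longrightarrow> f = \<zero>) \<and>
    (\<forall>x\<in>U. \<exists>f\<in>Fil H a \<inter> U. \<exists>f'\<in>Fil H b \<inter> U. x = f \<oplus> \<sigma> f'))"
proof -
  note sU = rat_sub_subspace[OF U]
  interpret U: pure_space "sub_mhs H U" n
    using sub_mhs_rat_sub[OF sU] U by (intro sub_mhs_pure_space) (auto simp: sU)
  show ?thesis
    unfolding U.pure_iff U.opposed_iff[OF U.Fil_subspace]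
    by (intro all_cong1 imp_cong conj_cong ball_cong bex_cong) (simp_all add: sub_mhs_conj[OF U])
qed

text \<open>A subspace inherits a pure weight filtration and a finite Hodge filtration. What remains
  to be asked is a full lattice, which is rationality, and opposedness.\<close>

lemma MHS_sub_mhs_iff:
  assumes "C_subspace U H"
  shows "MHS (sub_mhs H U) \<longleftrightarrow> rat_sub U \<and> pure (sub_mhs H U) n"
proof -
  have "MHS (sub_mhs H U) \<Longrightarrow> full_lattice UNIV (sub_mhs H U) (HZ H \<inter> U)" by (simp add: MHS_def)
  then show ?thesis
    using sub_mhs_rat_sub[OF assms] sub_mhs_pure_space[OF assms] pure_MHS
      pure_space.MHS_pure_iff pure_space.pure_iff by metis
qed

end

subsection \<open>Classes of extensions of a Tate structure\<close>

lemma tate_gen_nonzero [simp]: "tate_gen m \<noteq> 0"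
  by (simp add: tate_gen_def)

lemma tate_simps [simp]:
  "carrier (tate m) = UNIV" "x \<oplus>\<^bsub>tate m\<^esub> y = x + y" "\<zero>\<^bsub>tate m\<^esub> = 0" "c \<odot>\<^bsub>tate m\<^esub> x = c * x"
  "HZ (tate m) = range (\<lambda>n::int. of_int n * tate_gen m)"
  "Wt (tate m) k = (if - 2 * m \<le> k then range (\<lambda>r::rat. of_rat r * tate_gen m) else {0})"
  "Fil (tate m) k = (if k \<le> - m then UNIV else {0})"
  by (simp_all add: tate_def)

lemma C_space_tate: "C_space (tate m)"
  by (rule C_spaceI) (simp_all add: algebra_simps)

lemma tate_gen_mem:
  "tate_gen (- p) \<in> HZ (tate (- p))" "k \<le> p \<Longrightarrow> tate_gen (- p) \<in> Fil (tate (- p)) k"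
  "2 * p \<le> k \<Longrightarrow> tate_gen (- p) \<in> Wt (tate (- p)) k"
  by (auto intro: range_eqI[of _ _ "1::int"] range_eqI[of _ _ "1::rat"])

text \<open>\<open>D\<close> has class \<open>a\<close> modulo \<open>F\<^sup>p + A\<^sub>Z\<close>.\<close>

definition ext_class :: "int \<Rightarrow> ('a, 'e, complex) ext_data \<Rightarrow> 'a \<Rightarrow> bool" where
  "ext_class p D a \<longleftrightarrow> (case D of (E, i, q) \<Rightarrow> \<exists>s\<in>Fil E p. \<exists>z\<in>HZ E.
     q s = tate_gen (- p) \<and> q z = tate_gen (- p) \<and> i a = s \<ominus>\<^bsub>E\<^esub> z)"

lemma ext_classI:
  assumes "s \<in> Fil E p" "z \<in> HZ E" "q s = tate_gen (- p)" "q z = tate_gen (- p)" "i a = s \<ominus>\<^bsub>E\<^esub> z"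
  shows "ext_class p (E, i, q) a"
  using assms unfolding ext_class_def prod.case by blast

definition class_eq :: "int \<Rightarrow> 'a mhs \<Rightarrow> 'a \<Rightarrow> 'a \<Rightarrow> bool" where
  "class_eq p A a b \<longleftrightarrow> (\<exists>f\<in>Fil A p. \<exists>z\<in>HZ A. a \<ominus>\<^bsub>A\<^esub> b = f \<oplus>\<^bsub>A\<^esub> z)"

text \<open>Morphisms without the extensionality demanded by \<open>mhs_hom\<close>, so that the
  identity and the addition map qualify.\<close>

definition mhs_map :: "'a mhs \<Rightarrow> 'b mhs \<Rightarrow> ('a \<Rightarrow> 'b) \<Rightarrow> bool" where
  "mhs_map A B f \<longleftrightarrow> f \<in> C_linear A B \<and> f ` HZ A \<subseteq> HZ B \<and> (\<forall>k. f ` Wt A k \<subseteq> Wt B k \<and> f ` Fil A k \<subseteq> Fil B k)"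

lemma mhs_hom_iff: "f \<in> mhs_hom A B \<longleftrightarrow> f \<in> extensional (carrier A) \<and> mhs_map A B f"
  by (auto simp: mhs_hom_def mhs_map_def)

lemma mhs_mapD:
  assumes "mhs_map A B f"
  shows "f \<in> C_linear A B" "x \<in> HZ A \<Longrightarrow> f x \<in> HZ B" "x \<in> Wt A k \<Longrightarrow> f x \<in> Wt B k"
    "x \<in> Fil A k \<Longrightarrow> f x \<in> Fil B k"
  using assms unfolding mhs_map_def by blast+

text \<open>The part of the structure of an extension of \<open>Z(-p)\<close> by \<open>A\<close> on which its push-outs depend.\<close>

locale tate_ext = A: complex_space A + E: complex_space E
  for p :: int and A :: "'a mhs" and E :: "'e mhs" and i :: "'a \<Rightarrow> 'e" and q :: "'e \<Rightarrow> complex" +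
  assumes i_lin: "i \<in> C_linear A E" and q_lin: "q \<in> C_linear E (tate (- p))"
    and i_inj: "inj_on i (carrier A)"
    and ker: "\<And>x. x \<in> carrier E \<Longrightarrow> q x = 0 \<Longrightarrow> \<exists>a\<in>carrier A. x = i a"
    and q_i: "\<And>a. a \<in> carrier A \<Longrightarrow> q (i a) = 0"
    and HZ_sub: "subgroup (HZ E) (add_monoid E)"
    and q_HZ: "\<And>x. x \<in> HZ E \<Longrightarrow> \<exists>m::int. q x = of_int m * tate_gen (- p)"
    and i_HZ: "\<And>a. a \<in> carrier A \<Longrightarrow> i a \<in> HZ E \<Longrightarrow> a \<in> HZ A"
    and Fil_sub: "\<And>k. C_subspace (Fil E k) E" and Fil_anti: "\<And>k l. k \<le> l \<Longrightarrow> Fil E l \<subseteq> Fil E k"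
    and q_Fil: "\<And>k x. x \<in> Fil E k \<Longrightarrow> p < k \<Longrightarrow> q x = 0"
    and i_Fil: "\<And>k a. a \<in> carrier A \<Longrightarrow> i a \<in> Fil E k \<Longrightarrow> a \<in> Fil A k"
    and Wt_HQ: "\<And>k. Wt E k \<subseteq> HQ E"
    and q_Wt: "\<And>k x. x \<in> Wt E k \<Longrightarrow> k < 2 * p \<Longrightarrow> q x = 0"
    and q_Wt': "\<And>k x. x \<in> Wt E k \<Longrightarrow> \<exists>r. q x = of_rat r * tate_gen (- p)"
    and i_Wt: "\<And>k a. a \<in> carrier A \<Longrightarrow> i a \<in> Wt E k \<Longrightarrow> a \<in> Wt A k"
    and HQ_Wt: "\<And>k. 2 * p \<le> k \<Longrightarrow> HQ A \<subseteq> Wt A k"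
begin

abbreviation (input) tgen where "tgen \<equiv> tate_gen (- p)"

lemmas iD = C_linearD[OF i_lin] and qD = C_linearD[OF q_lin, simplified]

lemma i_HQ:
  assumes "a \<in> carrier A" "i a \<in> HQ E"
  shows "a \<in> HQ A"
proof -
  from assms(2) obtain n :: nat where n: "n > 0" "of_nat n \<odot>\<^bsub>E\<^esub> i a \<in> HZ E" by (auto simp: HQ_def)
  then have "of_nat n \<odot>\<^bsub>A\<^esub> a \<in> HZ A"
    using assms(1) iD(3)[OF assms(1), of "of_nat n"] by (intro i_HZ) simp_all
  then show ?thesis using n assms by (auto simp: HQ_def)
qed

lemma HZ_closed: "x \<in> HZ E \<Longrightarrow> x \<in> carrier E"
  using HZ_sub by (auto simp: E.subgroup_iff)

lemma Fil_closed: "x \<in> Fil E k \<Longrightarrow> x \<in> carrier E"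
  using E.subspace_subset[OF Fil_sub] by blast

lemma q_diff: "x \<in> carrier E \<Longrightarrow> y \<in> carrier E \<Longrightarrow> q (x \<ominus>\<^bsub>E\<^esub> y) = q x - q y"
  using qD by (simp add: E.diff_eq)

text \<open>Two lifts of the generator in \<open>F\<^sup>p\<close> differ by an element of the
  kernel, which lies in \<open>F\<^sup>p A\<close> by strictness of \<open>i\<close>; two integral
  lifts differ in the same way by a lattice point of \<open>A\<close>.\<close>

lemma ext_class_unique:
  assumes "ext_class p (E, i, q) a" "ext_class p (E, i, q) b" "a \<in> carrier A" "b \<in> carrier A"
  shows "class_eq p A a b"
proof -
  from assms obtain s z s' z' where s: "s \<in> Fil E p" "z \<in> HZ E" "q s = tgen" "q z = tgen" "i a = s \<ominus>\<^bsub>E\<^esub> z"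
    and s': "s' \<in> Fil E p" "z' \<in> HZ E" "q s' = tgen" "q z' = tgen" "i b = s' \<ominus>\<^bsub>E\<^esub> z'"
    by (auto simp: ext_class_def)
  note cl = Fil_closed[OF s(1)] Fil_closed[OF s'(1)] HZ_closed[OF s(2)] HZ_closed[OF s'(2)]
  have fs: "s \<ominus>\<^bsub>E\<^esub> s' \<in> Fil E p" by (rule E.subspace_diff[OF Fil_sub s(1) s'(1)])
  have zs: "z' \<ominus>\<^bsub>E\<^esub> z \<in> HZ E" by (rule E.subgroup_diff[OF HZ_sub s'(2) s(2)])
  obtain f where f: "f \<in> carrier A" "s \<ominus>\<^bsub>E\<^esub> s' = i f" using ker[of "s \<ominus>\<^bsub>E\<^esub> s'"] cl s s' by (auto simp: q_diff)
  obtain y where y: "y \<in> carrier A" "z' \<ominus>\<^bsub>E\<^esub> z = i y" using ker[of "z' \<ominus>\<^bsub>E\<^esub> z"] cl s s' by (auto simp: q_diff)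
  obtain F where F: "E.frame F s s' z z'" using E.frame_exists cl by metis
  have "i (a \<ominus>\<^bsub>A\<^esub> b) = (s \<ominus>\<^bsub>E\<^esub> z) \<ominus>\<^bsub>E\<^esub> (s' \<ominus>\<^bsub>E\<^esub> z')"
    using C_linear_diff[OF i_lin A.C_space E.C_space assms(3,4)] s s' by simp
  also have "\<dots> = (s \<ominus>\<^bsub>E\<^esub> s') \<oplus>\<^bsub>E\<^esub> (z' \<ominus>\<^bsub>E\<^esub> z)"
    unfolding E.frame_atoms[OF F] by (simp add: E.frame_simps[OF F])
  also have "\<dots> = i (f \<oplus>\<^bsub>A\<^esub> y)" using f y iD by simp
  finally have "a \<ominus>\<^bsub>A\<^esub> b = f \<oplus>\<^bsub>A\<^esub> y" using i_inj assms f y by (simp add: inj_on_eq_iff)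
  then show ?thesis
    using i_Fil[OF f(1)] i_HZ[OF y(1)] fs zs f y unfolding class_eq_def by auto
qed

end

lemma extensionsD:
  assumes "(E, i, q) \<in> extensions T A"
  shows "MHS E" "short_exact A i E q T" "i \<in> mhs_hom A E" "q \<in> mhs_hom E T"
  using assms by (simp_all add: extensions_def short_exact_def)

lemma short_exactD:
  assumes "short_exact A i E q C"
  shows "i \<in> mhs_hom A E" "q \<in> mhs_hom E C" "inj_on i (carrier A)"
    "i ` carrier A = {x \<in> carrier E. q x = \<zero>\<^bsub>C\<^esub>}" "q ` carrier E = carrier C"
    "i ` HZ A = i ` carrier A \<inter> HZ E" "q ` HZ E = HZ C"
    "i ` Wt A k = i ` carrier A \<inter> Wt E k" "q ` Wt E k = Wt C k"
    "i ` Fil A k = i ` carrier A \<inter> Fil E k" "q ` Fil E k = Fil C k"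
proof -
  note a = assms[unfolded short_exact_def]
  show "i \<in> mhs_hom A E" by (rule a[THEN conjunct1])
  note a = a[THEN conjunct2]
  show "q \<in> mhs_hom E C" by (rule a[THEN conjunct1])
  note a = a[THEN conjunct2]
  show "inj_on i (carrier A)" by (rule a[THEN conjunct1])
  note a = a[THEN conjunct2]
  show "i ` carrier A = {x \<in> carrier E. q x = \<zero>\<^bsub>C\<^esub>}" by (rule a[THEN conjunct1])
  note a = a[THEN conjunct2]
  show "q ` carrier E = carrier C" by (rule a[THEN conjunct1])
  note a = a[THEN conjunct2]
  show "i ` HZ A = i ` carrier A \<inter> HZ E" by (rule a[THEN conjunct1])
  note a = a[THEN conjunct2]
  show "q ` HZ E = HZ C" by (rule a[THEN conjunct1])
  note a = a[THEN conjunct2, THEN spec, of k]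
  show "i ` Wt A k = i ` carrier A \<inter> Wt E k" by (rule a[THEN conjunct1])
  note a = a[THEN conjunct2]
  show "q ` Wt E k = Wt C k" by (rule a[THEN conjunct1])
  note a = a[THEN conjunct2]
  show "i ` Fil A k = i ` carrier A \<inter> Fil E k" by (rule a[THEN conjunct1])
  show "q ` Fil E k = Fil C k" by (rule a[THEN conjunct2])
qed

lemma extension_tate_ext:
  assumes A: "pure A (2 * p - 1)" and E: "(E, i, q) \<in> extensions (tate (- p)) A"
  shows "tate_ext p A E i q"
proof -
  interpret A: pure_space A "2 * p - 1" by (rule pure_spaceI[OF A])
  interpret E: filtered_lattice E by (rule MHS_filtered[OF extensionsD(1)[OF E]])
  note se = short_exactD[OF extensionsD(2)[OF E]]
  have i: "mhs_map A E i" and q: "mhs_map E (tate (- p)) q"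
    using extensionsD(3,4)[OF E] by (auto simp: mhs_hom_iff)
  note inj = se(3)
  have im: "i ` carrier A = {x \<in> carrier E. q x = 0}" using se(4) by simp
  have strict: "a \<in> S" if "a \<in> carrier A" "i a \<in> S'" "i ` S = i ` carrier A \<inter> S'" "S \<subseteq> carrier A" for a S S'
    using that inj by (metis IntI imageI inj_on_image_mem_iff)
  show ?thesis
  proof (intro tate_ext.intro tate_ext_axioms.intro A.complex_space_axioms E.complex_space_axioms)
    show "i \<in> C_linear A E" "q \<in> C_linear E (tate (- p))" using i q by (auto simp: mhs_map_def)
    show "inj_on i (carrier A)" by (rule inj)
    show "\<exists>a\<in>carrier A. x = i a" if "x \<in> carrier E" "q x = 0" for x using im that by blast
    show "q (i a) = 0" if "a \<in> carrier A" for a using im that by blast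
    show "subgroup (HZ E) (add_monoid E)" by (rule E.HZ_subgroup)
    show "\<exists>m::int. q x = of_int m * tate_gen (- p)" if "x \<in> HZ E" for x
      using mhs_mapD(2)[OF q that] by auto
    show "a \<in> HZ A" if "a \<in> carrier A" "i a \<in> HZ E" for a
      by (rule strict[OF that se(6) A.HZ_subset])
    show "C_subspace (Fil E k) E" "k \<le> l \<Longrightarrow> Fil E l \<subseteq> Fil E k" for k l
      by (rule E.Fil_subspace, rule E.Fil_antimono)
    show "q x = 0" if "x \<in> Fil E k" "p < k" for x k using mhs_mapD(4)[OF q that(1)] that by simp
    show "a \<in> Fil A k" if "a \<in> carrier A" "i a \<in> Fil E k" for a k
      by (rule strict[OF that se(10) A.subspace_subset[OF A.Fil_subspace]])
    show "Wt E k \<subseteq> HQ E" for k by (rule E.Wt)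
    show "q x = 0" if "x \<in> Wt E k" "k < 2 * p" for x k using mhs_mapD(3)[OF q that(1)] that by simp
    show "\<exists>r. q x = of_rat r * tate_gen (- p)" if "x \<in> Wt E k" for x k
      using mhs_mapD(3)[OF q that] by (auto split: if_splits intro: exI[of _ 0])
    show "a \<in> Wt A k" if "a \<in> carrier A" "i a \<in> Wt E k" for a k
      by (rule strict[OF that se(8)]) (use A.Wt(1)[of k] A.HQ_closed in blast)
    show "HQ A \<subseteq> Wt A k" if "2 * p \<le> k" for k using that by (simp add: A.Wt_pure)
  qed
qed

text \<open>Exactness on \<open>F\<^sup>p\<close> and on lattices lifts the generator of
  \<open>Z(-p)\<close> to both, and the difference of the two lifts dies in the quotient.\<close>

lemma ext_class_exists:
  assumes A: "pure A (2 * p - 1)" and D: "D \<in> extensions (tate (- p)) A"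
  shows "\<exists>a\<in>carrier A. ext_class p D a"
proof -
  obtain E i q where D': "D = (E, i, q)" by (cases D)
  interpret tate_ext p A E i q by (rule extension_tate_ext[OF A]) (use D D' in simp)
  note se = short_exactD[OF extensionsD(2)[OF D[unfolded D']]]
  have "tate_gen (- p) \<in> q ` Fil E p" "tate_gen (- p) \<in> q ` HZ E"
    unfolding se using tate_gen_mem(1,2) by blast+
  then obtain s z where s: "s \<in> Fil E p" "z \<in> HZ E" "q s = tgen" "q z = tgen" by (metis imageE)
  then have "q (s \<ominus>\<^bsub>E\<^esub> z) = 0" by (simp add: q_diff Fil_closed HZ_closed)
  then obtain a where a: "a \<in> carrier A" "i a = s \<ominus>\<^bsub>E\<^esub> z"
    using ker[of "s \<ominus>\<^bsub>E\<^esub> z"] s by (auto simp: Fil_closed HZ_closed)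
  have "ext_class p (E, i, q) a" by (rule ext_classI) (use s a in auto)
  then show ?thesis unfolding D' using a(1) by blast
qed

text \<open>A change of the class by \<open>f \<oplus> y\<close> with \<open>f\<close> in
  \<open>F\<^sup>p\<close> and \<open>y\<close> integral is absorbed by moving the Hodge lift by
  \<open>i f\<close> and the integral lift by minus \<open>i y\<close>.\<close>

lemma ext_class_cong:
  assumes A: "pure A (2 * p - 1)" and D: "D \<in> extensions (tate (- p)) A"
    and a: "ext_class p D a" "a \<in> carrier A" "b \<in> carrier A" "class_eq p A b a"
  shows "ext_class p D b"
proof -
  obtain E i q where D': "D = (E, i, q)" by (cases D)
  interpret tate_ext p A E i q by (rule extension_tate_ext[OF A]) (use D D' in simp)
  interpret P: pure_space A "2 * p - 1" by (rule pure_spaceI[OF A])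
  have i: "mhs_map A E i" using extensionsD(3)[OF D[unfolded D']] by (auto simp: mhs_hom_iff)
  from a obtain s z where s: "s \<in> Fil E p" "z \<in> HZ E" "q s = tgen" "q z = tgen" "i a = s \<ominus>\<^bsub>E\<^esub> z"
    by (auto simp: ext_class_def D')
  from a obtain f y where f: "f \<in> Fil A p" "y \<in> HZ A" "b \<ominus>\<^bsub>A\<^esub> a = f \<oplus>\<^bsub>A\<^esub> y" by (auto simp: class_eq_def)
  note cl = P.Fil_closed[OF f(1)] P.HZ_closed[OF f(2)] and cl' = Fil_closed[OF s(1)] HZ_closed[OF s(2)]
  have ify: "i f \<in> Fil E p" "i y \<in> HZ E" using mhs_mapD[OF i] f by blast+
  obtain F where F: "A.frame F a b a a" using A.frame_exists[OF a(2,3,2,2)] by blast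
  have "b = (b \<ominus>\<^bsub>A\<^esub> a) \<oplus>\<^bsub>A\<^esub> a" unfolding A.frame_atoms[OF F] by (simp add: A.frame_simps[OF F])
  then have "b = (f \<oplus>\<^bsub>A\<^esub> y) \<oplus>\<^bsub>A\<^esub> a" unfolding f(3) .
  then have "i b = (i f \<oplus>\<^bsub>E\<^esub> i y) \<oplus>\<^bsub>E\<^esub> (s \<ominus>\<^bsub>E\<^esub> z)"
    using iD cl a(2) s(5) by simp
  also obtain F where F: "E.frame F (i f) (i y) s z"
    using E.frame_exists[OF iD(1)[OF cl(1)] iD(1)[OF cl(2)] cl'] by blast
  have "(i f \<oplus>\<^bsub>E\<^esub> i y) \<oplus>\<^bsub>E\<^esub> (s \<ominus>\<^bsub>E\<^esub> z) = (s \<oplus>\<^bsub>E\<^esub> i f) \<ominus>\<^bsub>E\<^esub> (z \<ominus>\<^bsub>E\<^esub> i y)"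
    unfolding E.frame_atoms[OF F] by (simp add: E.frame_simps[OF F])
  finally have "i b = (s \<oplus>\<^bsub>E\<^esub> i f) \<ominus>\<^bsub>E\<^esub> (z \<ominus>\<^bsub>E\<^esub> i y)" .
  moreover have "s \<oplus>\<^bsub>E\<^esub> i f \<in> Fil E p" by (rule E.subspace_add[OF Fil_sub s(1) ify(1)])
  moreover have "z \<ominus>\<^bsub>E\<^esub> i y \<in> HZ E" by (rule E.subgroup_diff[OF HZ_sub s(2) ify(2)])
  moreover have "q (s \<oplus>\<^bsub>E\<^esub> i f) = tgen" "q (z \<ominus>\<^bsub>E\<^esub> i y) = tgen"
    using cl cl' iD(1) s q_i by (simp_all add: q_diff qD)
  ultimately show ?thesis unfolding D' ext_class_def by (simp only: prod.case) blast
qed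

text \<open>A morphism over \<open>f\<close> carries lifts to lifts, so its target has class
  \<open>f a\<close>. Conversely, if lifts \<open>s'\<close> and \<open>z'\<close> in the target
  differ by \<open>i' (f a)\<close>, let the map be \<open>f\<close> on the kernel and send
  \<open>z\<close> to \<open>z'\<close>. Then \<open>s\<close>, which is \<open>i a\<close> plus
  \<open>z\<close>, goes to \<open>s'\<close>; so the integral lift gives compatibility with
  lattices and weights, the Hodge lift compatibility with \<open>F\<close>.\<close>

lemma (in tate_ext) push_class_eq:
  assumes a: "ext_class p (E, i, q) a" "a \<in> carrier A" and f: "mhs_map A B f"
    and B: "pure B (2 * p - 1)"
  shows "push_class (tate (- p)) A f B (E, i, q) = {P \<in> extensions (tate (- p)) B. ext_class p P (f a)}"
proof -
  interpret B: pure_space B "2 * p - 1" by (rule pure_spaceI[OF B])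
  note fD = mhs_mapD[OF f] and fL = C_linearD[OF mhs_mapD(1)[OF f]]
  from a obtain s z where s: "s \<in> Fil E p" "z \<in> HZ E" "q s = tgen" "q z = tgen" "i a = s \<ominus>\<^bsub>E\<^esub> z"
    by (auto simp: ext_class_def)
  note cl = Fil_closed[OF s(1)] HZ_closed[OF s(2)]
  have "ext_morphism A f (E, i, q) P \<longleftrightarrow> ext_class p P (f a)" if P: "P \<in> extensions (tate (- p)) B" for P
  proof -
    obtain E' i' q' where P': "P = (E', i', q')" by (cases P)
    interpret P: tate_ext p B E' i' q' by (rule extension_tate_ext[OF B]) (use P P' in simp)
    note PE = extensionsD[OF P[unfolded P']] and se = short_exactD[OF extensionsD(2)[OF P[unfolded P']]]
    interpret E': filtered_lattice E' by (rule MHS_filtered[OF PE(1)])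
    show ?thesis
    proof
      assume "ext_morphism A f (E, i, q) P"
      then obtain \<phi> where phi: "\<phi> \<in> mhs_hom E E'" "\<forall>a\<in>carrier A. \<phi> (i a) = i' (f a)"
        "\<forall>x\<in>carrier E. q' (\<phi> x) = q x" by (auto simp: ext_morphism_def P')
      have m: "mhs_map E E' \<phi>" using phi(1) by (simp add: mhs_hom_iff)
      have "i' (f a) = \<phi> (s \<ominus>\<^bsub>E\<^esub> z)" using phi(2) a s(5) by metis
      also have "\<dots> = \<phi> s \<ominus>\<^bsub>E'\<^esub> \<phi> z"
        by (rule C_linear_diff[OF mhs_mapD(1)[OF m] E.C_space P.E.C_space cl])
      finally show "ext_class p P (f a)"
        using mhs_mapD[OF m] s phi(3) cl unfolding P' by (intro ext_classI[of "\<phi> s" _ _ "\<phi> z"]) auto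
    next
      assume "ext_class p P (f a)"
      then obtain s' z' where s': "s' \<in> Fil E' p" "z' \<in> HZ E'" "q' s' = tgen" "q' z' = tgen"
        "i' (f a) = s' \<ominus>\<^bsub>E'\<^esub> z'" by (auto simp: ext_class_def P')
      note cl' = P.Fil_closed[OF s'(1)] P.HZ_closed[OF s'(2)]
      \<comment> \<open>The integral lift need not be one that was chosen in the weight filtration.
        It differs from such a lift by a rational element of \<open>B\<close>, and all rational
        elements of \<open>B\<close> have weight at most 2p - 1.\<close>
      have z'Wt: "z' \<in> Wt E' k" if k: "2 * p \<le> k" for k
      proof -
        have "tgen \<in> q' ` Wt E' k" unfolding se by (rule tate_gen_mem(3)[OF k])
        then obtain w where w: "w \<in> Wt E' k" "q' w = tgen" by (metis imageE)
        have wQ: "w \<in> HQ E'" using w E'.Wt(1) by blast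
        have wc: "w \<in> carrier E'" by (rule E'.HQ_closed[OF wQ])
        obtain b where b: "b \<in> carrier B" "z' \<ominus>\<^bsub>E'\<^esub> w = i' b"
          using P.ker[of "z' \<ominus>\<^bsub>E'\<^esub> w"] cl' wc w s' by (auto simp: P.q_diff)
        have "z' \<ominus>\<^bsub>E'\<^esub> w \<in> HQ E'"
          using E'.HQ_add[OF E'.HZ_HQ[OF s'(2)] E'.HQ_smult[OF wQ, of "-1"]] cl' wc
          by (simp add: P.E.diff_eq)
        then have "b \<in> HQ B" using P.i_HQ b by simp
        then have "b \<in> Wt B k" using P.HQ_Wt[OF k] by blast
        moreover have "mhs_map B E' i'" using PE(3) by (simp add: mhs_hom_iff)
        ultimately have "i' b \<in> Wt E' k" by (rule mhs_mapD(3)[rotated])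
        then have "w \<oplus>\<^bsub>E'\<^esub> (z' \<ominus>\<^bsub>E'\<^esub> w) \<in> Wt E' k"
          using w E'.Wt(2)[of k] b by (simp add: P.E.subgroup_iff)
        moreover obtain F where F: "P.E.frame F w z' w w" using P.E.frame_exists wc cl' by metis
        have "w \<oplus>\<^bsub>E'\<^esub> (z' \<ominus>\<^bsub>E'\<^esub> w) = z'"
          unfolding P.E.frame_atoms[OF F] by (simp add: P.E.frame_simps[OF F])
        ultimately show ?thesis by simp
      qed
      \<comment> \<open>\<open>E\<close> is the direct sum of the kernel and the line through the
        integral lift \<open>z\<close>; \<open>r\<close> and \<open>coef\<close> are the two
        components.\<close>
      define coef where "coef x = q x / tgen" for x
      define r where "r x = (THE y. y \<in> carrier A \<and> x = i y \<oplus>\<^bsub>E\<^esub> coef x \<odot>\<^bsub>E\<^esub> z)" for x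
      have r: "r x \<in> carrier A" "x = i (r x) \<oplus>\<^bsub>E\<^esub> coef x \<odot>\<^bsub>E\<^esub> z" if x: "x \<in> carrier E" for x
      proof -
        have "q (x \<ominus>\<^bsub>E\<^esub> coef x \<odot>\<^bsub>E\<^esub> z) = 0" using x cl s by (simp add: q_diff qD coef_def)
        then obtain y where y: "y \<in> carrier A" "x \<ominus>\<^bsub>E\<^esub> coef x \<odot>\<^bsub>E\<^esub> z = i y"
          using ker[of "x \<ominus>\<^bsub>E\<^esub> coef x \<odot>\<^bsub>E\<^esub> z"] x cl by auto
        have "(x \<ominus>\<^bsub>E\<^esub> coef x \<odot>\<^bsub>E\<^esub> z) \<oplus>\<^bsub>E\<^esub> coef x \<odot>\<^bsub>E\<^esub> z = x"
          using x cl by (simp add: E.diff_add_cancel)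
        then have ex: "y \<in> carrier A \<and> x = i y \<oplus>\<^bsub>E\<^esub> coef x \<odot>\<^bsub>E\<^esub> z" using y by simp
        have "r x = y"
          unfolding r_def
        proof (rule the_equality, rule ex)
          fix y' assume y': "y' \<in> carrier A \<and> x = i y' \<oplus>\<^bsub>E\<^esub> coef x \<odot>\<^bsub>E\<^esub> z"
          then have "i y' \<oplus>\<^bsub>E\<^esub> coef x \<odot>\<^bsub>E\<^esub> z = i y \<oplus>\<^bsub>E\<^esub> coef x \<odot>\<^bsub>E\<^esub> z" using ex by simp
          then have "i y' = i y"
            using iD(1)[OF conjunct1[OF y']] iD(1)[OF y(1)] cl E.add.right_cancel by simp
          then show "y' = y" using i_inj y' y by (simp add: inj_on_eq_iff)
        qed
        with ex show "r x \<in> carrier A" "x = i (r x) \<oplus>\<^bsub>E\<^esub> coef x \<odot>\<^bsub>E\<^esub> z" by simp_all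
      qed
      have r_eq: "r x = y" if "y \<in> carrier A" "x = i y \<oplus>\<^bsub>E\<^esub> c \<odot>\<^bsub>E\<^esub> z" for x y c
      proof -
        have xc: "x \<in> carrier E" using that iD(1) cl by simp
        have "coef x = c" using that cl s iD(1) q_i by (simp add: coef_def qD)
        then have "i (r x) \<oplus>\<^bsub>E\<^esub> c \<odot>\<^bsub>E\<^esub> z = i y \<oplus>\<^bsub>E\<^esub> c \<odot>\<^bsub>E\<^esub> z" using r(2)[OF xc] that by simp
        then have "i (r x) = i y"
          using iD(1)[OF r(1)[OF xc]] iD(1)[OF that(1)] cl E.add.right_cancel by simp
        then show ?thesis using i_inj r(1)[OF xc] that by (simp add: inj_on_eq_iff)
      qed
      have coef_add: "coef (x \<oplus>\<^bsub>E\<^esub> y) = coef x + coef y" if "x \<in> carrier E" "y \<in> carrier E" for x y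
        using that qD by (simp add: coef_def add_divide_distrib)
      have coef_smult: "coef (c \<odot>\<^bsub>E\<^esub> x) = c * coef x" if "x \<in> carrier E" for c x
        using that qD by (simp add: coef_def)
      have r_add: "r (x \<oplus>\<^bsub>E\<^esub> y) = r x \<oplus>\<^bsub>A\<^esub> r y" if x: "x \<in> carrier E" and y: "y \<in> carrier E" for x y
      proof (rule r_eq)
        have "x \<oplus>\<^bsub>E\<^esub> y = (i (r x) \<oplus>\<^bsub>E\<^esub> coef x \<odot>\<^bsub>E\<^esub> z) \<oplus>\<^bsub>E\<^esub> (i (r y) \<oplus>\<^bsub>E\<^esub> coef y \<odot>\<^bsub>E\<^esub> z)"
          using r[OF x] r[OF y] by simp
        also have "\<dots> = i (r x \<oplus>\<^bsub>A\<^esub> r y) \<oplus>\<^bsub>E\<^esub> (coef x + coef y) \<odot>\<^bsub>E\<^esub> z"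
          using r(1)[OF x] r(1)[OF y] cl iD by (simp add: E.smult_l_distr E.a_ac)
        finally show "x \<oplus>\<^bsub>E\<^esub> y = i (r x \<oplus>\<^bsub>A\<^esub> r y) \<oplus>\<^bsub>E\<^esub> (coef x + coef y) \<odot>\<^bsub>E\<^esub> z" .
      qed (use r(1)[OF x] r(1)[OF y] in simp)
      have r_smult: "r (c \<odot>\<^bsub>E\<^esub> x) = c \<odot>\<^bsub>A\<^esub> r x" if x: "x \<in> carrier E" for c x
      proof (rule r_eq)
        have "c \<odot>\<^bsub>E\<^esub> x = c \<odot>\<^bsub>E\<^esub> (i (r x) \<oplus>\<^bsub>E\<^esub> coef x \<odot>\<^bsub>E\<^esub> z)" using r[OF x] by simp
        also have "\<dots> = i (c \<odot>\<^bsub>A\<^esub> r x) \<oplus>\<^bsub>E\<^esub> (c * coef x) \<odot>\<^bsub>E\<^esub> z"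
          using r(1)[OF x] cl iD by (simp add: E.smult_r_distr)
        finally show "c \<odot>\<^bsub>E\<^esub> x = i (c \<odot>\<^bsub>A\<^esub> r x) \<oplus>\<^bsub>E\<^esub> (c * coef x) \<odot>\<^bsub>E\<^esub> z" .
      qed (use r(1)[OF x] in simp)
      define \<phi> where "\<phi> = (\<lambda>x\<in>carrier E. i' (f (r x)) \<oplus>\<^bsub>E'\<^esub> coef x \<odot>\<^bsub>E'\<^esub> z')"
      have i': "mhs_map B E' i'" using PE(3) by (simp add: mhs_hom_iff)
      note i'D = mhs_mapD[OF i']
      have lin: "\<phi> \<in> C_linear E E'"
      proof (rule C_linearI)
        show "\<phi> x \<in> carrier E'" if "x \<in> carrier E" for x
          using that r(1)[OF that] fL P.iD cl' by (simp add: \<phi>_def)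
        show "\<phi> (x \<oplus>\<^bsub>E\<^esub> y) = \<phi> x \<oplus>\<^bsub>E'\<^esub> \<phi> y" if x: "x \<in> carrier E" and y: "y \<in> carrier E" for x y
          using x y r(1)[OF x] r(1)[OF y] fL P.iD cl'
          by (simp add: \<phi>_def r_add coef_add P.E.smult_l_distr P.E.a_ac)
        show "\<phi> (c \<odot>\<^bsub>E\<^esub> x) = c \<odot>\<^bsub>E'\<^esub> \<phi> x" if x: "x \<in> carrier E" for c x
          using x r(1)[OF x] fL P.iD cl'
          by (simp add: \<phi>_def r_smult coef_smult P.E.smult_r_distr)
      qed
      have coefHZ: "\<exists>m. coef x = of_int m" if "x \<in> HZ E" for x
        using q_HZ[OF that] by (auto simp: coef_def)
      have ir: "i (r x) = x \<ominus>\<^bsub>E\<^esub> coef x \<odot>\<^bsub>E\<^esub> z" if x: "x \<in> carrier E" for x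
      proof -
        have ic: "i (r x) \<in> carrier E" using iD(1) r(1)[OF x] by simp
        have "i (r x) = (i (r x) \<oplus>\<^bsub>E\<^esub> coef x \<odot>\<^bsub>E\<^esub> z) \<ominus>\<^bsub>E\<^esub> coef x \<odot>\<^bsub>E\<^esub> z"
          using ic cl by (simp add: E.add_diff_cancel)
        then show ?thesis using r(2)[OF x] by simp
      qed
      have "\<phi> x \<in> HZ E'" if x: "x \<in> HZ E" for x
      proof -
        note xc = HZ_closed[OF x]
        obtain m where m: "coef x = of_int m" using coefHZ[OF x] by blast
        have "i (r x) \<in> HZ E"
          unfolding ir[OF xc] m by (intro E.subgroup_diff[OF HZ_sub x] E.subgroup_int_smult[OF HZ_sub s(2)])
        then have "r x \<in> HZ A" using i_HZ r(1)[OF xc] by blast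
        then have "i' (f (r x)) \<in> HZ E'" using fD i'D by blast
        moreover have "coef x \<odot>\<^bsub>E'\<^esub> z' \<in> HZ E'"
          unfolding m by (rule P.E.subgroup_int_smult[OF P.HZ_sub s'(2)])
        ultimately show ?thesis using xc P.HZ_sub by (simp add: \<phi>_def P.E.subgroup_iff)
      qed
      moreover have "\<phi> x \<in> Wt E' k" if x: "x \<in> Wt E k" for x k
      proof -
        have xQ: "x \<in> HQ E" using x Wt_HQ by blast
        then have xc: "x \<in> carrier E" by (simp add: HQ_def)
        show ?thesis
        proof (cases "k < 2 * p")
          case True
          then have c: "coef x = 0" using q_Wt[OF x] by (simp add: coef_def)
          then have "i (r x) \<in> Wt E k" using ir[OF xc] x xc cl by (simp add: E.diff_eq)
          then have "r x \<in> Wt A k" using i_Wt r(1)[OF xc] by blast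
          then have "i' (f (r x)) \<in> Wt E' k" using fD i'D by blast
          then show ?thesis using c xc cl' P.iD(1) fL(1) r(1)[OF xc] by (simp add: \<phi>_def)
        next
          case False
          then have k: "2 * p \<le> k" by simp
          obtain \<rho> where rho: "coef x = of_rat \<rho>" using q_Wt'[OF x] by (auto simp: coef_def)
          \<comment> \<open>Denominators of \<open>x\<close> and of its coefficient: clearing both
            makes the kernel component of \<open>x\<close> a rational point.\<close>
          obtain n m :: nat and l :: int where n: "n > 0" "of_nat n \<odot>\<^bsub>E\<^esub> x \<in> HZ E"
            and m: "m > 0" "of_nat m * coef x = of_int l"
          proof -
            obtain u v where "\<rho> = of_int u / of_int v" "v > 0" by (metis Fract_of_int_quotient Rat_cases)
            then have "of_nat (nat v) * coef x = of_int u" "nat v > 0" by (simp_all add: rho of_rat_divide)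
            moreover obtain n :: nat where "n > 0" "of_nat n \<odot>\<^bsub>E\<^esub> x \<in> HZ E" using xQ by (auto simp: HQ_def)
            ultimately show ?thesis using that[of n "nat v" u] by blast
          qed
          have "of_nat (n * m) \<odot>\<^bsub>E\<^esub> i (r x)
              = of_int (int m) \<odot>\<^bsub>E\<^esub> (of_nat n \<odot>\<^bsub>E\<^esub> x) \<ominus>\<^bsub>E\<^esub> of_int (int n * l) \<odot>\<^bsub>E\<^esub> z"
            using xc cl m(2)[symmetric] by (simp add: ir[OF xc] E.diff_eq E.smult_r_distr mult_ac)
          also have "\<dots> \<in> HZ E"
            by (intro E.subgroup_diff[OF HZ_sub] E.subgroup_int_smult[OF HZ_sub] n s)
          finally have "i (r x) \<in> HQ E"
            using n m iD(1)[OF r(1)[OF xc]] unfolding HQ_def by (auto intro!: exI[of _ "n * m"])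
          then have "r x \<in> Wt A k" using i_HQ[OF r(1)[OF xc]] HQ_Wt[OF k] by blast
          then have "i' (f (r x)) \<in> Wt E' k" using fD i'D by blast
          moreover have "coef x \<odot>\<^bsub>E'\<^esub> z' \<in> Wt E' k" unfolding rho by (rule E'.Wt(3)[OF z'Wt[OF k]])
          ultimately show ?thesis using xc E'.Wt(2)[of k] by (simp add: \<phi>_def P.E.subgroup_iff)
        qed
      qed
      moreover have "\<phi> x \<in> Fil E' k" if x: "x \<in> Fil E k" for x k
      proof -
        note xc = Fil_closed[OF x]
        show ?thesis
        proof (cases "p < k")
          case True
          then have c: "coef x = 0" using q_Fil[OF x] by (simp add: coef_def)
          then have "i (r x) \<in> Fil E k" using ir[OF xc] x xc cl by (simp add: E.diff_eq)
          then have "r x \<in> Fil A k" using i_Fil r(1)[OF xc] by blast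
          then have "i' (f (r x)) \<in> Fil E' k" using fD i'D by blast
          then show ?thesis using c xc cl' P.iD(1) fL(1) r(1)[OF xc] by (simp add: \<phi>_def)
        next
          case False
          \<comment> \<open>For \<open>k \<le> p\<close> the decomposition is taken along
            \<open>s\<close> instead of \<open>z\<close>. The kernel component then becomes
            \<open>y\<close>, and \<open>i y\<close> is a difference of elements of
            \<open>F\<^sup>k\<close>.\<close>
          define y where "y = r x \<ominus>\<^bsub>A\<^esub> coef x \<odot>\<^bsub>A\<^esub> a"
          have yc: "y \<in> carrier A" using r(1)[OF xc] a by (simp add: y_def)
          have "i y = x \<ominus>\<^bsub>E\<^esub> coef x \<odot>\<^bsub>E\<^esub> s"
          proof -
            obtain F where F: "E.frame F x s z x" using E.frame_exists[OF xc cl xc] by blast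
            have id: "(x \<ominus>\<^bsub>E\<^esub> c \<odot>\<^bsub>E\<^esub> z) \<ominus>\<^bsub>E\<^esub> c \<odot>\<^bsub>E\<^esub> (s \<ominus>\<^bsub>E\<^esub> z) = x \<ominus>\<^bsub>E\<^esub> c \<odot>\<^bsub>E\<^esub> s" for c
              unfolding E.frame_atoms(1-3)[OF F] by (simp add: E.frame_simps[OF F] algebra_simps)
            have "i y = (x \<ominus>\<^bsub>E\<^esub> coef x \<odot>\<^bsub>E\<^esub> z) \<ominus>\<^bsub>E\<^esub> coef x \<odot>\<^bsub>E\<^esub> (s \<ominus>\<^bsub>E\<^esub> z)"
              unfolding y_def
              using C_linear_diff[OF i_lin A.C_space E.C_space r(1)[OF xc], of "coef x \<odot>\<^bsub>A\<^esub> a"] a iD s(5) ir[OF xc]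
              by simp
            also have "\<dots> = x \<ominus>\<^bsub>E\<^esub> coef x \<odot>\<^bsub>E\<^esub> s"
              by (rule id)
            finally show ?thesis .
          qed
          also have "\<dots> \<in> Fil E k"
            using s(1) Fil_anti[of k p] False
            by (intro E.subspace_diff[OF Fil_sub x] E.subspace_smult[OF Fil_sub]) auto
          finally have "y \<in> Fil A k" using i_Fil yc by blast
          then have 1: "i' (f y) \<in> Fil E' k" using fD i'D by blast
          have 2: "coef x \<odot>\<^bsub>E'\<^esub> s' \<in> Fil E' k"
            using s'(1) P.Fil_anti[of k p] False by (intro P.E.subspace_smult[OF P.Fil_sub]) auto
          have fc: "f (r x) \<in> carrier B" "f a \<in> carrier B" using fL(1) r(1)[OF xc] a by simp_all
          have "f y = f (r x) \<ominus>\<^bsub>B\<^esub> coef x \<odot>\<^bsub>B\<^esub> f a"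
            unfolding y_def
            using C_linear_diff[OF fD(1) A.C_space B.C_space r(1)[OF xc], of "coef x \<odot>\<^bsub>A\<^esub> a"] a fL by simp
          then have "i' (f y) = i' (f (r x)) \<ominus>\<^bsub>E'\<^esub> coef x \<odot>\<^bsub>E'\<^esub> (s' \<ominus>\<^bsub>E'\<^esub> z')"
            using C_linear_diff[OF P.i_lin B.C_space P.E.C_space fc(1), of "coef x \<odot>\<^bsub>B\<^esub> f a"] fc P.iD s'(5)
            by simp
          moreover obtain F where F: "P.E.frame F (i' (f (r x))) s' z' s'"
            using P.E.frame_exists[OF P.iD(1)[OF fc(1)] cl' cl'(1)] by blast
          have "(i' (f (r x)) \<ominus>\<^bsub>E'\<^esub> coef x \<odot>\<^bsub>E'\<^esub> (s' \<ominus>\<^bsub>E'\<^esub> z')) \<oplus>\<^bsub>E'\<^esub> coef x \<odot>\<^bsub>E'\<^esub> s'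
              = i' (f (r x)) \<oplus>\<^bsub>E'\<^esub> coef x \<odot>\<^bsub>E'\<^esub> z'"
            unfolding P.E.frame_atoms(1-3)[OF F] by (simp add: P.E.frame_simps[OF F] algebra_simps)
          ultimately have "\<phi> x = i' (f y) \<oplus>\<^bsub>E'\<^esub> coef x \<odot>\<^bsub>E'\<^esub> s'" using xc by (simp add: \<phi>_def)
          then show ?thesis using P.E.subspace_add[OF P.Fil_sub 1 2] by simp
        qed
      qed
      moreover have "\<phi> \<in> extensional (carrier E)" by (simp add: \<phi>_def)
      ultimately have hom: "\<phi> \<in> mhs_hom E E'"
        unfolding mhs_hom_iff mhs_map_def using lin by blast
      have onA: "\<phi> (i b) = i' (f b)" if b: "b \<in> carrier A" for b
      proof -
        have ib: "i b \<in> carrier E" using iD(1)[OF b] .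
        have c: "coef (i b) = 0" using q_i[OF b] by (simp add: coef_def)
        have "r (i b) = b" using ib cl by (intro r_eq[where c=0] b) simp
        then show ?thesis using ib c cl' P.iD(1)[OF fL(1)[OF b]] by (simp add: \<phi>_def)
      qed
      have onE: "q' (\<phi> x) = q x" if x: "x \<in> carrier E" for x
        using x cl' s'(4) P.iD(1) fL(1) r(1)[OF x] P.q_i by (simp add: \<phi>_def P.qD coef_def)
      show "ext_morphism A f (E, i, q) P"
        unfolding ext_morphism_def P' prod.case by (intro bexI[OF _ hom] conjI ballI onA onE)
    qed
  qed
  then show ?thesis by (auto simp: push_class_def)
qed

subsection \<open>The standard extension with a given class\<close>

lemma prod_mhs_simps [simp]:
  "carrier (prod_mhs A B) = carrier A \<times> carrier B"
  "\<zero>\<^bsub>prod_mhs A B\<^esub> = (\<zero>\<^bsub>A\<^esub>, \<zero>\<^bsub>B\<^esub>)"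
  "(x, y) \<oplus>\<^bsub>prod_mhs A B\<^esub> (x', y') = (x \<oplus>\<^bsub>A\<^esub> x', y \<oplus>\<^bsub>B\<^esub> y')"
  "c \<odot>\<^bsub>prod_mhs A B\<^esub> (x, y) = (c \<odot>\<^bsub>A\<^esub> x, c \<odot>\<^bsub>B\<^esub> y)"
  "HZ (prod_mhs A B) = HZ A \<times> HZ B" "Wt (prod_mhs A B) k = Wt A k \<times> Wt B k"
  "Fil (prod_mhs A B) k = Fil A k \<times> Fil B k"
  by (simp_all add: prod_mhs_def)

lemma C_space_prod:
  assumes "C_space A" "C_space B"
  shows "C_space (prod_mhs A B)"
proof -
  interpret A: complex_space A by unfold_locales fact
  interpret B: complex_space B by unfold_locales fact
  show ?thesis
    by (rule C_spaceI)
      (auto simp: A.a_ac B.a_ac A.smult_l_distr B.smult_l_distr A.smult_r_distr B.smult_r_distr)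
qed

lemma common_multiple:
  assumes "complex_space A" "complex_space B" "subgroup (HZ A) (add_monoid A)" "subgroup (HZ B) (add_monoid B)"
    and "x \<in> HQ A" "y \<in> HQ B"
  shows "\<exists>n::nat. n > 0 \<and> of_nat n \<odot>\<^bsub>A\<^esub> x \<in> HZ A \<and> of_nat n \<odot>\<^bsub>B\<^esub> y \<in> HZ B"
proof -
  interpret A: complex_space A by fact
  interpret B: complex_space B by fact
  obtain k m :: nat where k: "k > 0" "of_nat k \<odot>\<^bsub>A\<^esub> x \<in> HZ A" "x \<in> carrier A"
    and m: "m > 0" "of_nat m \<odot>\<^bsub>B\<^esub> y \<in> HZ B" "y \<in> carrier B"
    using assms(5,6) by (auto simp: HQ_def)
  have "of_int (int m) \<odot>\<^bsub>A\<^esub> (of_nat k \<odot>\<^bsub>A\<^esub> x) \<in> HZ A"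
    by (rule A.subgroup_int_smult[OF assms(3) k(2)])
  moreover have "of_int (int k) \<odot>\<^bsub>B\<^esub> (of_nat m \<odot>\<^bsub>B\<^esub> y) \<in> HZ B"
    by (rule B.subgroup_int_smult[OF assms(4) m(2)])
  ultimately show ?thesis using k m by (intro exI[of _ "k * m"]) (simp add: mult.commute)
qed

lemma HZ_tate_subgroup: "subgroup (HZ (tate m)) (add_monoid (tate m))"
proof -
  interpret complex_space "tate m" by unfold_locales (rule C_space_tate)
  show ?thesis
    unfolding subgroup_iff
  proof (intro conjI ballI)
    show "\<zero>\<^bsub>tate m\<^esub> \<in> HZ (tate m)" by (auto intro: range_eqI[of _ _ 0])
    fix x assume "x \<in> HZ (tate m)"
    then obtain k where k: "x = of_int k * tate_gen m" by auto
    then show "(-1) \<odot>\<^bsub>tate m\<^esub> x \<in> HZ (tate m)" by (auto intro: range_eqI[of _ _ "- k"])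
    fix y assume "y \<in> HZ (tate m)"
    then obtain l where l: "y = of_int l * tate_gen m" by auto
    then show "x \<oplus>\<^bsub>tate m\<^esub> y \<in> HZ (tate m)"
      using k by (auto simp: algebra_simps intro: range_eqI[of _ _ "k + l"])
  qed simp
qed

lemma HQ_tate: "HQ (tate m) = range (\<lambda>r::rat. of_rat r * tate_gen m)"
proof (rule equalityI; rule subsetI)
  fix t assume "t \<in> HQ (tate m)"
  then obtain n :: nat and k :: int where n: "n > 0" "of_nat n * t = of_int k * tate_gen m"
    by (auto simp: HQ_def)
  then have "t = of_rat (of_int k / of_nat n) * tate_gen m" by (simp add: of_rat_divide field_simps)
  then show "t \<in> range (\<lambda>r::rat. of_rat r * tate_gen m)" by blast
next
  fix t assume "t \<in> range (\<lambda>r::rat. of_rat r * tate_gen m)"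
  then obtain r where r: "t = of_rat r * tate_gen m" by blast
  obtain a b where ab: "r = of_int a / of_int b" "b > 0" by (metis Fract_of_int_quotient Rat_cases)
  then have "of_nat (nat b) * t = of_int a * tate_gen m" by (simp add: r of_rat_divide)
  then show "t \<in> HQ (tate m)" using ab by (auto simp: HQ_def intro!: exI[of _ "nat b"])
qed

text \<open>Lattice and weights are those of the direct sum, while the Hodge filtration is tilted to
  contain \<open>(a, g)\<close>, where \<open>g\<close> is the generator of \<open>Z(-p)\<close>.
  The integral lift of \<open>g\<close> is \<open>(\<zero>, g)\<close>, so the two lifts differ by
  \<open>a\<close>.\<close>

definition std_mid :: "int \<Rightarrow> 'a mhs \<Rightarrow> 'a \<Rightarrow> ('a \<times> complex) mhs" where
  "std_mid p A a = (prod_mhs A (tate (- p)))\<lparr>Fil :=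
     (\<lambda>k. {(x \<oplus>\<^bsub>A\<^esub> c \<odot>\<^bsub>A\<^esub> a, c * tate_gen (- p)) | x c. x \<in> Fil A k \<and> (k \<le> p \<or> c = 0)})\<rparr>"

definition std_ext :: "int \<Rightarrow> 'a mhs \<Rightarrow> 'a \<Rightarrow> ('a, 'a \<times> complex, complex) ext_data" where
  "std_ext p A a = (std_mid p A a, (\<lambda>x\<in>carrier A. (x, 0)), (\<lambda>y\<in>carrier (std_mid p A a). snd y))"

lemma std_mid_simps [simp]:
  "carrier (std_mid p A a) = carrier A \<times> UNIV" "\<zero>\<^bsub>std_mid p A a\<^esub> = (\<zero>\<^bsub>A\<^esub>, 0)"
  "(x, t) \<oplus>\<^bsub>std_mid p A a\<^esub> (x', t') = (x \<oplus>\<^bsub>A\<^esub> x', t + t')"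
  "c \<odot>\<^bsub>std_mid p A a\<^esub> (x, t) = (c \<odot>\<^bsub>A\<^esub> x, c * t)"
  "HZ (std_mid p A a) = HZ A \<times> HZ (tate (- p))"
  by (simp_all add: std_mid_def prod_mhs_def del: tate_simps(5))

lemma std_mid_Wt: "Wt (std_mid p A a) k = Wt A k \<times> Wt (tate (- p)) k"
  by (simp add: std_mid_def prod_mhs_def del: tate_simps(6))

lemma std_mid_Fil:
  "(y, t) \<in> Fil (std_mid p A a) k \<longleftrightarrow>
     (\<exists>x c. y = x \<oplus>\<^bsub>A\<^esub> c \<odot>\<^bsub>A\<^esub> a \<and> t = c * tate_gen (- p) \<and> x \<in> Fil A k \<and> (k \<le> p \<or> c = 0))"
  by (simp add: std_mid_def)

locale odd_hodge = pure_space H "2 * p - 1" for H (structure) and p :: int +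
  assumes opp: "opposed H (2 * p - 1)"
begin

abbreviation (input) g where "g \<equiv> tate_gen (- p)"
abbreviation T where "T \<equiv> tate (- p)"

lemma pure_H: "pure H (2 * p - 1)"
  using opp pure_iff by blast

context
  fixes a assumes a: "a \<in> carrier H"
begin

interpretation E: complex_space "std_mid p H a"
proof
  have "same_ops (prod_mhs H T) (std_mid p H a)" by (simp add: same_ops_def std_mid_def)
  then show "C_space (std_mid p H a)" by (rule same_ops_C_space) (intro C_space_prod C_space C_space_tate)
qed

interpretation E: lattice_space "std_mid p H a"
proof (intro lattice_space.intro lattice_space_axioms.intro E.complex_space_axioms)
  from lattice obtain n v where v: "indep H v n" "HZ H = zspan H v n"
    and sp: "\<forall>x\<in>carrier H. \<exists>c. x = comb H v c n" unfolding full_lattice_UNIV_iff by blast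
  note cl = indep_closed[OF v(1)]
  define v' where "v' i = (if i < n then (v i, 0) else (\<zero>, g))" for i
  have "comb (std_mid p H a) v' c m = (comb H v c m, 0)" if "m \<le> n" for c m
    using that by (induction m) (simp_all add: v'_def)
  then have combE: "comb (std_mid p H a) v' c (Suc n) = (comb H v c n, c n * g)" for c
    using comb_closed[OF cl] by (simp add: v'_def)
  have "indep (std_mid p H a) v' (Suc n)"
    unfolding indep_def combE
    using cl v(1) by (auto simp: v'_def indep_def less_Suc_eq)
  moreover have "HZ (std_mid p H a) = zspan (std_mid p H a) v' (Suc n)"
  proof (rule equalityI; rule subsetI)
    fix y assume "y \<in> HZ (std_mid p H a)"
    then obtain x m where x: "x \<in> zspan H v n" and y: "y = (x, of_int m * g)" using v(2) by auto
    then obtain k where "x = comb H v (\<lambda>i. of_int (k i)) n" by (auto elim: zspanE)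
    moreover have "comb H v (\<lambda>i. of_int ((k(n := m)) i)) n = comb H v (\<lambda>i. of_int (k i)) n"
      by (rule comb_cong) auto
    ultimately have "y = comb (std_mid p H a) v' (\<lambda>i. of_int ((k(n := m)) i)) (Suc n)"
      unfolding combE y by simp
    then show "y \<in> zspan (std_mid p H a) v' (Suc n)" using zspanI by metis
  next
    fix y assume "y \<in> zspan (std_mid p H a) v' (Suc n)"
    then obtain k where "y = comb (std_mid p H a) v' (\<lambda>i. of_int (k i)) (Suc n)" by (rule zspanE)
    then show "y \<in> HZ (std_mid p H a)" unfolding combE by (simp add: v(2) zspanI)
  qed
  moreover have "\<exists>c. y = comb (std_mid p H a) v' c (Suc n)" if y: "y \<in> carrier (std_mid p H a)" for y
  proof -
    obtain c where c: "fst y = comb H v c n" using sp y by auto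
    moreover have "comb H v (c(n := snd y / g)) n = comb H v c n"
      by (rule comb_cong) auto
    ultimately have "y = comb (std_mid p H a) v' (c(n := snd y / g)) (Suc n)"
      unfolding combE by (simp add: prod_eq_iff)
    then show ?thesis by (intro exI[of _ "c(n := snd y / g)"])
  qed
  ultimately show "full_lattice UNIV (std_mid p H a) (HZ (std_mid p H a))"
    unfolding E.full_lattice_UNIV_iff by blast
qed

text \<open>The second coordinate is conjugated relative to the lattice generated by
  \<open>g\<close>. As a power of \<open>2 * pi * \<i>\<close>, the number \<open>g\<close> is not
  real in general, and this differs from \<open>cnj\<close> on the complex numbers.\<close>

lemma std_conj: "y \<in> carrier H \<Longrightarrow> cconj (std_mid p H a) (y, t) = (\<sigma> y, cnj (t / g) * g)"
proof -
  assume y: "y \<in> carrier H"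
  have "is_conj (std_mid p H a) (\<lambda>(y, t)\<in>carrier (std_mid p H a). (\<sigma> y, cnj (t / g) * g))"
    unfolding is_conj_def
    by (auto simp: conj_add conj_smult conj_HZ HZ_closed algebra_simps add_divide_distrib)
  from E.cconj_eqI[OF this] y show ?thesis by simp
qed

lemma std_HQ: "HQ (std_mid p H a) = HQ H \<times> HQ T"
proof (rule equalityI; rule subsetI)
  fix y assume "y \<in> HQ (std_mid p H a)"
  then show "y \<in> HQ H \<times> HQ T" by (cases y) (auto simp: HQ_def)
next
  fix y assume y: "y \<in> HQ H \<times> HQ T"
  then obtain x t where x: "y = (x, t)" "x \<in> HQ H" "t \<in> HQ T" by blast
  have "complex_space T" by unfold_locales (rule C_space_tate)
  from common_multiple[OF complex_space_axioms this HZ_subgroup HZ_tate_subgroup x(2,3)]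
  obtain n :: nat where "n > 0" "of_nat n \<odot> x \<in> HZ H" "of_nat n \<odot>\<^bsub>T\<^esub> t \<in> HZ T" by blast
  then show "y \<in> HQ (std_mid p H a)"
    using x HQ_closed by (auto simp: HQ_def[of "std_mid p H a"] simp del: tate_simps(5) intro!: exI[of _ n])
qed

lemma std_Wt: "Wt (std_mid p H a) k = (if k < 2 * p - 1 then {\<zero>\<^bsub>std_mid p H a\<^esub>}
   else if k < 2 * p then HQ H \<times> {0} else HQ (std_mid p H a))"
  by (auto simp: std_mid_Wt Wt_pure std_HQ HQ_tate)

lemma std_Fil_0: "(y, 0) \<in> Fil (std_mid p H a) k \<longleftrightarrow> y \<in> Fil H k"
proof
  assume "(y, 0) \<in> Fil (std_mid p H a) k"
  then obtain x where "y = x \<oplus> 0 \<odot> a" "x \<in> Fil H k" by (auto simp: std_mid_Fil)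
  then show "y \<in> Fil H k" using a Fil_closed by simp
next
  assume "y \<in> Fil H k"
  then show "(y, 0) \<in> Fil (std_mid p H a) k"
    using a Fil_closed by (auto simp: std_mid_Fil intro!: exI[of _ y] exI[of _ 0])
qed

lemma zero_HQ: "\<zero> \<in> HQ H"
  using HZ_HQ HZ_subgroup by (simp add: subgroup_iff)

lemma std_Fil_subspace: "C_subspace (Fil (std_mid p H a) k) (std_mid p H a)"
proof (rule E.subspaceI)
  show "Fil (std_mid p H a) k \<subseteq> carrier (std_mid p H a)"
    using a Fil_closed by (auto simp: std_mid_Fil)
  show "\<zero>\<^bsub>std_mid p H a\<^esub> \<in> Fil (std_mid p H a) k"
    using a subspace_zero[OF Fil_subspace] by (auto simp: std_mid_Fil intro!: exI[of _ \<zero>] exI[of _ 0])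
  fix y assume "y \<in> Fil (std_mid p H a) k"
  then obtain x c where y: "y = (x \<oplus> c \<odot> a, c * g)" "x \<in> Fil H k" "k \<le> p \<or> c = 0"
    by (cases y) (auto simp: std_mid_Fil)
  show "d \<odot>\<^bsub>std_mid p H a\<^esub> y \<in> Fil (std_mid p H a) k" for d
    using y a Fil_closed[OF y(2)] subspace_smult[OF Fil_subspace y(2), of d]
    by (auto simp: std_mid_Fil smult_r_distr intro!: exI[of _ "d \<odot> x"] exI[of _ "d * c"])
  fix y' assume "y' \<in> Fil (std_mid p H a) k"
  then obtain x' c' where y': "y' = (x' \<oplus> c' \<odot> a, c' * g)" "x' \<in> Fil H k" "k \<le> p \<or> c' = 0"
    by (cases y') (auto simp: std_mid_Fil)
  show "y \<oplus>\<^bsub>std_mid p H a\<^esub> y' \<in> Fil (std_mid p H a) k"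
    using y y' a Fil_closed[OF y(2)] Fil_closed[OF y'(2)] subspace_add[OF Fil_subspace y(2) y'(2)]
    by (auto simp: std_mid_Fil smult_l_distr a_ac algebra_simps
        intro!: exI[of _ "x \<oplus> x'"] exI[of _ "c + c'"])
qed

lemma std_finite_filtration: "finite_filtration (std_mid p H a)"
  unfolding finite_filtration_def
proof (intro conjI allI std_Fil_subspace)
  show "antimono (Fil (std_mid p H a))"
  proof (rule antimonoI, rule subsetI)
    fix k l :: int and y assume "k \<le> l" "y \<in> Fil (std_mid p H a) l"
    then show "y \<in> Fil (std_mid p H a) k"
      using Fil_antimono[of k l] by (cases y) (fastforce simp: std_mid_Fil)
  qed
  obtain k l where k: "Fil H k = {\<zero>}" and l: "Fil H l = carrier H" using fil by (auto simp: finite_filtration_def)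
  \<comment> \<open>The index must exceed \<open>p\<close> as well, since the line through
    \<open>(a, g)\<close> belongs to every step up to \<open>p\<close>. For the same reason the step
    that is everything is taken at \<open>min l p\<close>.\<close>
  have 0: "Fil H (max k (p + 1)) = {\<zero>}"
    using k Fil_antimono[of k "max k (p + 1)"] subspace_zero[OF Fil_subspace] by auto
  have "Fil (std_mid p H a) (max k (p + 1)) = {\<zero>\<^bsub>std_mid p H a\<^esub>}"
  proof (rule Set.set_eqI)
    fix y show "y \<in> Fil (std_mid p H a) (max k (p + 1)) \<longleftrightarrow> y \<in> {\<zero>\<^bsub>std_mid p H a\<^esub>}"
      using a by (cases y) (simp add: std_mid_Fil 0)
  qed
  then show "\<exists>k. Fil (std_mid p H a) k = {\<zero>\<^bsub>std_mid p H a\<^esub>}" ..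
  have 1: "Fil H (min l p) = carrier H"
    using l Fil_antimono[of "min l p" l] subspace_subset[OF Fil_subspace] by fastforce
  have "y \<in> Fil (std_mid p H a) (min l p)" if y: "y \<in> carrier (std_mid p H a)" for y
  proof -
    let ?c = "snd y / g"
    have "fst y = (fst y \<ominus> ?c \<odot> a) \<oplus> ?c \<odot> a" using y a by (auto simp: diff_add_cancel)
    then show ?thesis
      using y a by (cases y) (auto simp: std_mid_Fil 1 intro!: exI[of _ "fst y \<ominus> ?c \<odot> a"] exI[of _ ?c])
  qed
  then have "Fil (std_mid p H a) (min l p) = carrier (std_mid p H a)"
    using E.subspace_subset[OF std_Fil_subspace] by blast
  then show "\<exists>k. Fil (std_mid p H a) k = carrier (std_mid p H a)" ..
qed

interpretation E: filtered_lattice "std_mid p H a"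
proof (intro filtered_lattice.intro filtered_lattice_axioms.intro E.lattice_space_axioms std_finite_filtration)
  have T0: "0 \<in> HQ T" by (auto simp: HQ_tate intro: range_eqI[of _ _ 0])
  have sub: "HQ H \<times> {0} \<subseteq> HQ (std_mid p H a)" using T0 by (auto simp: std_HQ)
  have 0: "\<zero>\<^bsub>std_mid p H a\<^esub> \<in> HQ H \<times> {0}" using zero_HQ by simp
  show "Wt (std_mid p H a) k \<subseteq> HQ (std_mid p H a)" for k using sub 0 by (auto simp: std_Wt)
  show rat: "of_rat r \<odot>\<^bsub>std_mid p H a\<^esub> x \<in> Wt (std_mid p H a) k" if "x \<in> Wt (std_mid p H a) k" for k r x
    using that HQ_smult[of _ r] E.HQ_smult[of x r] by (auto simp: std_Wt split: if_splits simp del: of_rat_minus)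
  show "subgroup (Wt (std_mid p H a) k) (add_monoid (std_mid p H a))" for k
    unfolding E.subgroup_iff
  proof (intro conjI ballI)
    show "Wt (std_mid p H a) k \<subseteq> carrier (std_mid p H a)"
      using E.HQ_closed HQ_closed by (auto simp: std_Wt)
    show "\<zero>\<^bsub>std_mid p H a\<^esub> \<in> Wt (std_mid p H a) k" using sub 0 by (auto simp: std_Wt)
    fix x assume x: "x \<in> Wt (std_mid p H a) k"
    show "(-1) \<odot>\<^bsub>std_mid p H a\<^esub> x \<in> Wt (std_mid p H a) k" using rat[OF x, of "-1"] by simp
    fix y assume "y \<in> Wt (std_mid p H a) k"
    with x show "x \<oplus>\<^bsub>std_mid p H a\<^esub> y \<in> Wt (std_mid p H a) k"
      using HQ_add E.HQ_add[of x y] by (auto simp: std_Wt split: if_splits)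
  qed
  show "mono (Wt (std_mid p H a))" using sub 0 by (intro monoI) (auto simp: std_Wt)
  show "\<exists>k. Wt (std_mid p H a) k = {\<zero>\<^bsub>std_mid p H a\<^esub>}" by (rule exI[of _ "2 * p - 2"]) (simp add: std_Wt)
  show "\<exists>k. Wt (std_mid p H a) k = HQ (std_mid p H a)" by (rule exI[of _ "2 * p"]) (simp add: std_Wt)
qed

lemma std_WC: "WC (std_mid p H a) k = (if k < 2 * p - 1 then {\<zero>\<^bsub>std_mid p H a\<^esub>}
   else if k < 2 * p then carrier H \<times> {0} else carrier (std_mid p H a))"
proof -
  have sub: "C_subspace (carrier H \<times> {0}) (std_mid p H a)" by (rule E.subspaceI) auto
  have "C_span (std_mid p H a) (HQ H \<times> {0}) = carrier H \<times> {0}"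
  proof (rule equalityI)
    show "C_span (std_mid p H a) (HQ H \<times> {0}) \<subseteq> carrier H \<times> {0}"
      using HQ_closed by (intro E.C_span_minimal[OF sub]) auto
    have S: "C_subspace (C_span (std_mid p H a) (HQ H \<times> {0})) (std_mid p H a)" (is "C_subspace ?S _")
      using HQ_closed by (intro E.C_span_subspace) auto
    have "C_subspace {x \<in> carrier H. (x, 0) \<in> ?S} H"
    proof (rule subspaceI)
      show "\<zero> \<in> {x \<in> carrier H. (x, 0) \<in> ?S}" using E.subspace_zero[OF S] by simp
      fix x assume x: "x \<in> {x \<in> carrier H. (x, 0) \<in> ?S}"
      then show "c \<odot> x \<in> {x \<in> carrier H. (x, 0) \<in> ?S}" for c
        using E.subspace_smult[OF S, of "(x, 0)" c] by simp
      fix y assume "y \<in> {x \<in> carrier H. (x, 0) \<in> ?S}"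
      with x show "x \<oplus> y \<in> {x \<in> carrier H. (x, 0) \<in> ?S}"
        using E.subspace_add[OF S, of "(x, 0)" "(y, 0)"] by simp
    qed auto
    moreover have "HQ H \<subseteq> {x \<in> carrier H. (x, 0) \<in> ?S}"
      using HQ_closed E.C_span_superset[of "HQ H \<times> {0}"] by blast
    ultimately have "C_span H (HQ H) \<subseteq> {x \<in> carrier H. (x, 0) \<in> ?S}" by (rule C_span_minimal)
    then show "carrier H \<times> {0} \<subseteq> ?S" using C_span_HQ by auto
  qed
  then show ?thesis
    using E.C_span_eq[OF E.subspace_trivial] E.C_span_HQ by (simp only: WC_def std_Wt split: if_split) simp
qed

lemma std_diff:
  "x \<in> carrier H \<Longrightarrow> y \<in> carrier H \<Longrightarrow> (x, t) \<ominus>\<^bsub>std_mid p H a\<^esub> (y, u) = (x \<ominus> y, t - u)"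
  by (simp add: E.diff_eq diff_eq)

text \<open>The tilt is invisible on graded pieces. In weight 2p - 1 only elements with second
  coordinate zero occur and the piece is \<open>H\<close>; in weight 2p everything is read modulo
  \<open>H\<close>, so \<open>a\<close> disappears and the piece is \<open>Z(-p)\<close>.\<close>

lemma std_MHS: "MHS (std_mid p H a)"
  unfolding E.MHS_iff
proof
  fix k
  consider "k < 2 * p - 1" | "k > 2 * p" | "k = 2 * p - 1" | "k = 2 * p" by linarith
  then show "opposed (gr (std_mid p H a) k) k"
  proof cases
    case 3
    interpret gr: subquotient "std_mid p H a" "WC (std_mid p H a) k" "WC (std_mid p H a) (k - 1)"
      by (rule E.subquotient_WC) simp
    have U: "WC (std_mid p H a) k = carrier H \<times> {0}" and N: "WC (std_mid p H a) (k - 1) = {(\<zero>, 0)}"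
      using 3 by (simp_all add: std_WC)
    have F: "Fil (std_mid p H a) b \<inter> WC (std_mid p H a) k = Fil H b \<times> {0}" for b
      using Fil_closed by (auto simp: U std_Fil_0)
    have *: "(\<forall>f\<in>Fil H b. \<forall>f'\<in>Fil H c. f = \<sigma> f' \<longrightarrow> f = \<zero>) \<and>
      (\<forall>x\<in>carrier H. \<exists>f\<in>Fil H b. \<exists>f'\<in>Fil H c. x = f \<oplus> \<sigma> f')" if "b + c = k + 1" for b c
      using opp that 3 unfolding opposed_iff[OF Fil_subspace] by simp
    show ?thesis
      unfolding gr_subquot
      unfolding gr.opposed_Q_iff[OF E.Fil_subspace] F
      unfolding U N
    proof (intro allI impI conjI ballI)
      fix b c f f' assume bc: "b + c = k + 1" and f: "f \<in> Fil H b \<times> {0}" "f' \<in> Fil H c \<times> {0}"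
        "f \<ominus>\<^bsub>std_mid p H a\<^esub> cconj (std_mid p H a) f' \<in> {(\<zero>, 0)}"
      then obtain x y where xy: "f = (x, 0)" "f' = (y, 0)" "x \<in> Fil H b" "y \<in> Fil H c" by auto
      then have "x = \<sigma> y" using f Fil_closed by (simp add: std_conj std_diff diff_eq_zero_iff)
      then show "f \<in> {(\<zero>, 0)}" using *[OF bc] xy by auto
    next
      fix b c :: int and y :: "'a \<times> complex"
      assume bc: "b + c = k + 1" and y: "y \<in> carrier H \<times> {0}"
      then obtain f f' where f: "f \<in> Fil H b" "f' \<in> Fil H c" "fst y = f \<oplus> \<sigma> f'" using *[OF bc] by auto
      have "y \<ominus>\<^bsub>std_mid p H a\<^esub> ((f, 0) \<oplus>\<^bsub>std_mid p H a\<^esub> cconj (std_mid p H a) (f', 0)) = (\<zero>, 0)"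
        using y f Fil_closed by (cases y) (simp add: std_conj std_diff diff_eq_zero_iff)
      then show "\<exists>f\<in>Fil H b \<times> {0}. \<exists>f'\<in>Fil H c \<times> {0}.
          y \<ominus>\<^bsub>std_mid p H a\<^esub> (f \<oplus>\<^bsub>std_mid p H a\<^esub> cconj (std_mid p H a) f') \<in> {(\<zero>, 0)}"
        using f by auto
    qed
  next
    case 4
    interpret gr: subquotient "std_mid p H a" "WC (std_mid p H a) k" "WC (std_mid p H a) (k - 1)"
      by (rule E.subquotient_WC) simp
    have U: "WC (std_mid p H a) k = carrier (std_mid p H a)" and N: "WC (std_mid p H a) (k - 1) = carrier H \<times> {0}"
      using 4 by (simp_all add: std_WC)
    have F: "Fil (std_mid p H a) b \<inter> WC (std_mid p H a) k = Fil (std_mid p H a) b" for b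
      unfolding U using E.subspace_subset[OF E.Fil_subspace] by blast
    have mem: "(c \<odot> a, c * g) \<in> Fil (std_mid p H a) b" if "b \<le> p" for b c
      using that a subspace_zero[OF Fil_subspace] by (auto simp: std_mid_Fil intro!: exI[of _ \<zero>])
    show ?thesis
      unfolding gr_subquot
      unfolding gr.opposed_Q_iff[OF E.Fil_subspace] F
      unfolding U N
    proof (intro allI impI conjI ballI)
      fix b c f f' assume bc: "b + c = k + 1" and f: "f \<in> Fil (std_mid p H a) b" "f' \<in> Fil (std_mid p H a) c"
        "f \<ominus>\<^bsub>std_mid p H a\<^esub> cconj (std_mid p H a) f' \<in> carrier H \<times> {0}"
      then obtain x d x' d' where x: "f = (x \<oplus> d \<odot> a, d * g)" "x \<in> Fil H b" "b \<le> p \<or> d = 0"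
        and x': "f' = (x' \<oplus> d' \<odot> a, d' * g)" "x' \<in> Fil H c" "c \<le> p \<or> d' = 0"
        by (cases f, cases f') (auto simp: std_mid_Fil)
      have "d * g - cnj d' * g = 0"
        using f(3) a Fil_closed[OF x(2)] Fil_closed[OF x'(2)] unfolding x(1) x'(1)
        by (simp add: std_conj std_diff)
      then have "d = cnj d'" by simp
      \<comment> \<open>The indices satisfy \<open>b + c = 2 * p + 1\<close>, so one of them is
        larger than \<open>p\<close>, and that step of the filtration has no component along the
        generator.\<close>
      then have "d = 0" using x(3) x'(3) bc 4 by auto
      then show "f \<in> carrier H \<times> {0}" using a Fil_closed[OF x(2)] by (simp add: x(1))
    next
      fix b c :: int and y :: "'a \<times> complex"
      assume bc: "b + c = k + 1" and y: "y \<in> carrier (std_mid p H a)"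
      show "\<exists>f\<in>Fil (std_mid p H a) b. \<exists>f'\<in>Fil (std_mid p H a) c.
          y \<ominus>\<^bsub>std_mid p H a\<^esub> (f \<oplus>\<^bsub>std_mid p H a\<^esub> cconj (std_mid p H a) f') \<in> carrier H \<times> {0}"
      proof (cases "b \<le> p")
        case True
        have "y \<ominus>\<^bsub>std_mid p H a\<^esub> (((snd y / g) \<odot> a, (snd y / g) * g) \<oplus>\<^bsub>std_mid p H a\<^esub>
            cconj (std_mid p H a) \<zero>\<^bsub>std_mid p H a\<^esub>) \<in> carrier H \<times> {0}"
          using y a by (cases y) (simp add: std_conj std_diff)
        then show ?thesis by (intro bexI[OF bexI[OF _ E.subspace_zero[OF E.Fil_subspace]] mem[OF True]])
      next
        case False
        then have c: "c \<le> p" using bc 4 by simp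
        have "y \<ominus>\<^bsub>std_mid p H a\<^esub> (\<zero>\<^bsub>std_mid p H a\<^esub> \<oplus>\<^bsub>std_mid p H a\<^esub>
            cconj (std_mid p H a) (cnj (snd y / g) \<odot> a, cnj (snd y / g) * g)) \<in> carrier H \<times> {0}"
          using y a by (cases y) (simp add: std_conj std_diff)
        then show ?thesis by (intro bexI[OF bexI[OF _ mem[OF c]] E.subspace_zero[OF E.Fil_subspace]])
      qed
    qed
  qed (rule E.opposed_gr_trivial, simp add: std_WC)+
qed

lemma std_ext_extension: "std_ext p H a \<in> extensions T H"
  unfolding std_ext_def extensions_def
proof (clarify, intro conjI std_MHS)
  let ?i = "\<lambda>x\<in>carrier H. (x, 0::complex)" and ?q = "\<lambda>y\<in>carrier (std_mid p H a). snd y"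
  have strict: "?i ` S = ?i ` carrier H \<inter> S'" if "S \<subseteq> carrier H" "\<And>x. (x, 0) \<in> S' \<longleftrightarrow> x \<in> S" for S S'
    using that by auto
  have iFil: "?i ` Fil H k = ?i ` carrier H \<inter> Fil (std_mid p H a) k" for k
    using Fil_closed std_Fil_0 by (intro strict) auto
  have qFil: "?q ` Fil (std_mid p H a) k = Fil T k" for k
  proof (rule equalityI; rule subsetI)
    fix t assume "t \<in> ?q ` Fil (std_mid p H a) k"
    then obtain y where y: "y \<in> Fil (std_mid p H a) k" "t = ?q y" by blast
    moreover have "y \<in> carrier (std_mid p H a)" using E.subspace_subset[OF std_Fil_subspace] y(1) by blast
    ultimately have "(fst y, t) \<in> Fil (std_mid p H a) k" by simp
    then show "t \<in> Fil T k" by (auto simp: std_mid_Fil)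
  next
    fix t assume t: "t \<in> Fil T k"
    have "((t / g) \<odot> a, t) \<in> Fil (std_mid p H a) k"
      using t a subspace_zero[OF Fil_subspace]
      by (auto simp: std_mid_Fil split: if_splits intro!: exI[of _ \<zero>] exI[of _ "t / g"])
    then show "t \<in> ?q ` Fil (std_mid p H a) k"
      using a by (intro image_eqI[of _ _ "((t / g) \<odot> a, t)"]) auto
  qed
  have z: "\<zero> \<in> HZ H" "\<zero> \<in> Wt H k" for k using HZ_subgroup Wt(2) by (simp_all add: subgroup_iff)
  have T0: "0 \<in> HZ T" "0 \<in> Wt T k" for k by (auto intro: range_eqI[of _ _ 0])
  have iHZ: "?i ` HZ H = ?i ` carrier H \<inter> HZ (std_mid p H a)"
    using HZ_closed T0 by (intro strict) (auto simp del: tate_simps(5))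
  have iWt: "?i ` Wt H k = ?i ` carrier H \<inter> Wt (std_mid p H a) k" for k
    using HQ_closed Wt(1)[of k] T0 by (intro strict) (auto simp: std_mid_Wt simp del: tate_simps(6))
  have qHZ: "?q ` HZ (std_mid p H a) = HZ T"
    using z T0 HZ_closed by (auto simp del: tate_simps(5) intro!: image_eqI[of _ _ "(\<zero>, _)"])
  have qWt: "?q ` Wt (std_mid p H a) k = Wt T k" for k
    using z T0 HQ_closed Wt(1)[of k]
    by (auto simp: std_mid_Wt simp del: tate_simps(6) intro!: image_eqI[of _ _ "(\<zero>, _)"])
  show "short_exact H ?i (std_mid p H a) ?q T"
    unfolding short_exact_def
  proof (intro conjI allI iFil qFil iHZ iWt qHZ qWt)
    show "?i \<in> mhs_hom H (std_mid p H a)"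
      unfolding mhs_hom_iff mhs_map_def using iFil iHZ iWt by (auto intro: C_linearI)
    show "?q \<in> mhs_hom (std_mid p H a) T"
      unfolding mhs_hom_iff mhs_map_def using qFil qHZ qWt by (auto intro!: C_linearI simp del: tate_simps(5,6,7))
    show "inj_on ?i (carrier H)" by (auto intro: inj_onI)
    show "?i ` carrier H = {x \<in> carrier (std_mid p H a). ?q x = \<zero>\<^bsub>T\<^esub>}" by (auto simp: image_iff)
    show "?q ` carrier (std_mid p H a) = carrier T"
      using zero_closed by (auto simp: image_iff simp del: zero_closed)
  qed
qed

lemma std_ext_class: "ext_class p (std_ext p H a) a"
  unfolding std_ext_def
proof (rule ext_classI[of "(a, g)" _ _ "(\<zero>, g)"])
  show "(a, g) \<in> Fil (std_mid p H a) p"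
    using a subspace_zero[OF Fil_subspace] by (auto simp: std_mid_Fil intro!: exI[of _ \<zero>] exI[of _ 1])
  show "(\<zero>, g) \<in> HZ (std_mid p H a)"
    using HZ_subgroup tate_gen_mem(1) by (simp add: subgroup_iff del: tate_simps(5))
qed (use a in \<open>simp_all add: std_diff\<close>)

end

end

subsection \<open>Pull-backs and Baer sums\<close>

lemma fibre_prod_simps [simp]:
  "carrier (fibre_prod A f B h) = {(x, y). x \<in> carrier A \<and> y \<in> carrier B \<and> f x = h y}"
  "\<zero>\<^bsub>fibre_prod A f B h\<^esub> = (\<zero>\<^bsub>A\<^esub>, \<zero>\<^bsub>B\<^esub>)"
  "(x, y) \<oplus>\<^bsub>fibre_prod A f B h\<^esub> (x', y') = (x \<oplus>\<^bsub>A\<^esub> x', y \<oplus>\<^bsub>B\<^esub> y')"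
  "c \<odot>\<^bsub>fibre_prod A f B h\<^esub> (x, y) = (c \<odot>\<^bsub>A\<^esub> x, c \<odot>\<^bsub>B\<^esub> y)"
  "(x, y) \<in> HZ (fibre_prod A f B h) \<longleftrightarrow> x \<in> HZ A \<and> y \<in> HZ B \<and> (x, y) \<in> carrier (fibre_prod A f B h)"
  "(x, y) \<in> Wt (fibre_prod A f B h) k \<longleftrightarrow> x \<in> Wt A k \<and> y \<in> Wt B k \<and> (x, y) \<in> carrier (fibre_prod A f B h)"
  "(x, y) \<in> Fil (fibre_prod A f B h) k \<longleftrightarrow> x \<in> Fil A k \<and> y \<in> Fil B k \<and> (x, y) \<in> carrier (fibre_prod A f B h)"
  by (auto simp: fibre_prod_def)

text \<open>The part of the structure that passes to fibre products componentwise. It is what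
  \<open>tate_ext\<close> asks of the middle term alone, before the maps \<open>i\<close> and
  \<open>q\<close> are considered.\<close>

locale mhs_parts = complex_space V for V :: "'a mhs" (structure) +
  assumes parts_HZ: "subgroup (HZ V) (add_monoid V)"
    and parts_Fil: "\<And>k. C_subspace (Fil V k) V" and parts_anti: "\<And>k l. k \<le> l \<Longrightarrow> Fil V l \<subseteq> Fil V k"
    and parts_Wt: "\<And>k. Wt V k \<subseteq> HQ V"

lemma (in filtered_lattice) mhs_parts: "mhs_parts H"
  by (intro mhs_parts.intro mhs_parts_axioms.intro complex_space_axioms HZ_subgroup Fil_subspace
      Fil_antimono Wt)

lemma mhs_parts_tate: "mhs_parts (tate m)"
proof (intro mhs_parts.intro mhs_parts_axioms.intro complex_space.intro C_space_tate HZ_tate_subgroup)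
  interpret complex_space "tate m" by unfold_locales (rule C_space_tate)
  show "C_subspace (Fil (tate m) k) (tate m)" for k by (rule subspaceI) auto
  show "k \<le> l \<Longrightarrow> Fil (tate m) l \<subseteq> Fil (tate m) k" for k l by auto
  show "Wt (tate m) k \<subseteq> HQ (tate m)" for k by (auto simp: HQ_tate intro: range_eqI[of _ _ 0])
qed

lemma mhs_parts_fibre_prod:
  assumes A: "mhs_parts A" and B: "mhs_parts B" and C: "C_space C"
    and f: "f \<in> C_linear A C" and h: "h \<in> C_linear B C"
  shows "mhs_parts (fibre_prod A f B h)"
proof -
  interpret A: mhs_parts A by fact
  interpret B: mhs_parts B by fact
  interpret C: complex_space C by unfold_locales fact
  note fD = C_linearD[OF f] and hD = C_linearD[OF h]
  have 0: "f \<zero>\<^bsub>A\<^esub> = h \<zero>\<^bsub>B\<^esub>"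
    using C_linear_zero[OF f A.C_space C] C_linear_zero[OF h B.C_space C] by simp
  interpret P: complex_space "fibre_prod A f B h"
  proof
    show "C_space (fibre_prod A f B h)"
      by (rule C_spaceI)
        (auto simp: 0 fD hD A.a_ac B.a_ac A.smult_l_distr B.smult_l_distr A.smult_r_distr B.smult_r_distr)
  qed
  show ?thesis
  proof (intro mhs_parts.intro mhs_parts_axioms.intro P.complex_space_axioms)
    show "subgroup (HZ (fibre_prod A f B h)) (add_monoid (fibre_prod A f B h))"
      unfolding P.subgroup_iff
      using A.parts_HZ B.parts_HZ by (auto simp: 0 fD hD A.subgroup_iff B.subgroup_iff)
    show "C_subspace (Fil (fibre_prod A f B h) k) (fibre_prod A f B h)" for k
      unfolding P.subspace_iff
      using A.parts_Fil[of k] B.parts_Fil[of k] by (auto simp: 0 fD hD A.subspace_iff B.subspace_iff)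
    show "Fil (fibre_prod A f B h) l \<subseteq> Fil (fibre_prod A f B h) k" if "k \<le> l" for k l
      using A.parts_anti[OF that] B.parts_anti[OF that] by auto
    show "Wt (fibre_prod A f B h) k \<subseteq> HQ (fibre_prod A f B h)" for k
    proof (safe)
      fix x y assume xy: "(x, y) \<in> Wt (fibre_prod A f B h) k"
      then have c: "(x, y) \<in> carrier (fibre_prod A f B h)" and "x \<in> HQ A" "y \<in> HQ B"
        using A.parts_Wt[of k] B.parts_Wt[of k] by auto
      from common_multiple[OF A.complex_space_axioms B.complex_space_axioms A.parts_HZ B.parts_HZ this(2,3)]
      obtain n :: nat where "n > 0" "of_nat n \<odot>\<^bsub>A\<^esub> x \<in> HZ A" "of_nat n \<odot>\<^bsub>B\<^esub> y \<in> HZ B" by blast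
      then show "(x, y) \<in> HQ (fibre_prod A f B h)"
        using c by (auto simp: HQ_def fD hD intro!: exI[of _ n])
    qed
  qed
qed

text \<open>After the pull-back the quotient map is the projection to \<open>Z(-p)\<close>, so
  lattice, weights and Hodge filtration of the Tate structure control the second component;
  strictness of \<open>i\<close> controls the kernel.\<close>

lemma pullback_tate_ext:
  assumes A: "complex_space A" and E: "mhs_parts E" and C: "C_space C"
    and i: "i \<in> C_linear A E" "inj_on i (carrier A)" and q: "q \<in> C_linear E C"
    and ker: "\<And>x. x \<in> carrier E \<Longrightarrow> q x = \<zero>\<^bsub>C\<^esub> \<Longrightarrow> \<exists>a\<in>carrier A. x = i a"
    and q_i: "\<And>a. a \<in> carrier A \<Longrightarrow> q (i a) = \<zero>\<^bsub>C\<^esub>"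
    and i_HZ: "\<And>a. a \<in> carrier A \<Longrightarrow> i a \<in> HZ E \<Longrightarrow> a \<in> HZ A"
    and i_Fil: "\<And>k a. a \<in> carrier A \<Longrightarrow> i a \<in> Fil E k \<Longrightarrow> a \<in> Fil A k"
    and i_Wt: "\<And>k a. a \<in> carrier A \<Longrightarrow> i a \<in> Wt E k \<Longrightarrow> a \<in> Wt A k"
    and HQ_Wt: "\<And>k. 2 * p \<le> k \<Longrightarrow> HQ A \<subseteq> Wt A k"
    and f: "f \<in> C_linear (tate (- p)) C"
  shows "tate_ext p A (fibre_prod E q (tate (- p)) f) (\<lambda>a. (i a, 0)) snd"
proof -
  interpret A: complex_space A by fact
  interpret E: mhs_parts E by fact
  interpret P: mhs_parts "fibre_prod E q (tate (- p)) f"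
    by (rule mhs_parts_fibre_prod[OF E mhs_parts_tate C q f])
  note iD = C_linearD[OF i(1)]
  have f0: "f 0 = \<zero>\<^bsub>C\<^esub>" using C_linear_zero[OF f C_space_tate C] by simp
  show ?thesis
  proof (intro tate_ext.intro tate_ext_axioms.intro A P.complex_space_axioms P.parts_HZ P.parts_Fil
      P.parts_anti P.parts_Wt HQ_Wt)
    show "(\<lambda>a. (i a, 0)) \<in> C_linear A (fibre_prod E q (tate (- p)) f)"
      by (rule C_linearI) (simp_all add: iD q_i f0)
    show "snd \<in> C_linear (fibre_prod E q (tate (- p)) f) (tate (- p))"
      by (rule C_linearI) auto
    show "inj_on (\<lambda>a. (i a, 0)) (carrier A)" using i(2) by (auto simp: inj_on_def)
    show "\<exists>a\<in>carrier A. x = (i a, 0)" if "x \<in> carrier (fibre_prod E q (tate (- p)) f)" "snd x = 0" for x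
      using that ker[of "fst x"] f0 by (cases x) auto
    show "\<exists>m::int. snd x = of_int m * tate_gen (- p)" if "x \<in> HZ (fibre_prod E q (tate (- p)) f)" for x
      using that by (cases x) auto
    show "a \<in> HZ A" if "a \<in> carrier A" "(i a, 0) \<in> HZ (fibre_prod E q (tate (- p)) f)" for a
      using that i_HZ by (simp del: tate_simps)
    show "a \<in> Fil A k" if "a \<in> carrier A" "(i a, 0) \<in> Fil (fibre_prod E q (tate (- p)) f) k" for a k
      using that i_Fil by (simp del: tate_simps)
    show "a \<in> Wt A k" if "a \<in> carrier A" "(i a, 0) \<in> Wt (fibre_prod E q (tate (- p)) f) k" for a k
      using that i_Wt by (simp del: tate_simps)
    show "snd x = 0" if "x \<in> Fil (fibre_prod E q (tate (- p)) f) k" "p < k" for x k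
      using that by (cases x) auto
    show "snd x = 0" if "x \<in> Wt (fibre_prod E q (tate (- p)) f) k" "k < 2 * p" for x k
      using that by (cases x) auto
    show "\<exists>r. snd x = of_rat r * tate_gen (- p)" if "x \<in> Wt (fibre_prod E q (tate (- p)) f) k" for x k
      using that by (cases x) (auto split: if_splits intro: exI[of _ 0])
  qed simp
qed

text \<open>The fibre product over \<open>Z(-p)\<close> has kernel \<open>A\<close> plus
  \<open>A\<close>. Its push-out along addition is the Baer sum, and this lemma makes
  \<open>push_class_eq\<close> applicable to it.\<close>

lemma baer_tate_ext:
  assumes A: "pure A (2 * p - 1)" and D: "(E, i, q) \<in> extensions (tate (- p)) A"
    and D': "(E', i', q') \<in> extensions (tate (- p)) A"
  shows "tate_ext p (prod_mhs A A) (fibre_prod E q E' q') (\<lambda>(a, b). (i a, i' b)) (\<lambda>(x, y). q x)"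
proof -
  interpret A: pure_space A "2 * p - 1" by (rule pure_spaceI[OF A])
  interpret D: tate_ext p A E i q by (rule extension_tate_ext[OF A D])
  interpret D': tate_ext p A E' i' q' by (rule extension_tate_ext[OF A D'])
  interpret E: filtered_lattice E by (rule MHS_filtered[OF extensionsD(1)[OF D]])
  interpret E': filtered_lattice E' by (rule MHS_filtered[OF extensionsD(1)[OF D']])
  interpret P: mhs_parts "fibre_prod E q E' q'"
    by (rule mhs_parts_fibre_prod[OF E.mhs_parts E'.mhs_parts C_space_tate D.q_lin D'.q_lin])
  have AA: "complex_space (prod_mhs A A)" by unfold_locales (intro C_space_prod A.C_space)
  show ?thesis
  proof (intro tate_ext.intro tate_ext_axioms.intro AA P.complex_space_axioms P.parts_HZ P.parts_Fil
      P.parts_anti P.parts_Wt)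
    show "(\<lambda>(a, b). (i a, i' b)) \<in> C_linear (prod_mhs A A) (fibre_prod E q E' q')"
      by (rule C_linearI) (auto simp: D.iD D'.iD D.q_i D'.q_i)
    show "(\<lambda>(x, y). q x) \<in> C_linear (fibre_prod E q E' q') (tate (- p))"
      by (rule C_linearI) (auto simp: D.qD)
    show "inj_on (\<lambda>(a, b). (i a, i' b)) (carrier (prod_mhs A A))"
      using D.i_inj D'.i_inj by (auto simp: inj_on_def)
    show "\<exists>a\<in>carrier (prod_mhs A A). x = (\<lambda>(a, b). (i a, i' b)) a"
      if "x \<in> carrier (fibre_prod E q E' q')" "(\<lambda>(x, y). q x) x = 0" for x
      using that D.ker[of "fst x"] D'.ker[of "snd x"] by (cases x) auto
    show "(\<lambda>(x, y). q x) ((\<lambda>(a, b). (i a, i' b)) a) = 0" if "a \<in> carrier (prod_mhs A A)" for a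
      using that D.q_i by auto
    show "\<exists>m::int. (\<lambda>(x, y). q x) x = of_int m * tate_gen (- p)" if "x \<in> HZ (fibre_prod E q E' q')" for x
      using that D.q_HZ[of "fst x"] by (cases x) auto
    show "a \<in> HZ (prod_mhs A A)"
      if "a \<in> carrier (prod_mhs A A)" "(\<lambda>(a, b). (i a, i' b)) a \<in> HZ (fibre_prod E q E' q')" for a
      using that D.i_HZ D'.i_HZ by (cases a) auto
    show "a \<in> Fil (prod_mhs A A) k"
      if "a \<in> carrier (prod_mhs A A)" "(\<lambda>(a, b). (i a, i' b)) a \<in> Fil (fibre_prod E q E' q') k" for a k
      using that D.i_Fil D'.i_Fil by (cases a) auto
    show "a \<in> Wt (prod_mhs A A) k"
      if "a \<in> carrier (prod_mhs A A)" "(\<lambda>(a, b). (i a, i' b)) a \<in> Wt (fibre_prod E q E' q') k" for a k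
      using that D.i_Wt D'.i_Wt by (cases a) auto
    show "(\<lambda>(x, y). q x) x = 0" if "x \<in> Fil (fibre_prod E q E' q') k" "p < k" for x k
      using that D.q_Fil by (cases x) auto
    show "(\<lambda>(x, y). q x) x = 0" if "x \<in> Wt (fibre_prod E q E' q') k" "k < 2 * p" for x k
      using that D.q_Wt by (cases x) auto
    show "\<exists>r. (\<lambda>(x, y). q x) x = of_rat r * tate_gen (- p)" if "x \<in> Wt (fibre_prod E q E' q') k" for x k
      using that D.q_Wt'[of "fst x" k] by (cases x) auto
    show "HQ (prod_mhs A A) \<subseteq> Wt (prod_mhs A A) k" if "2 * p \<le> k" for k
      using that by (auto simp: A.Wt_pure HQ_def)
  qed
qed

subsection \<open>Carlson's isomorphism\<close>

lemma mhs_map_id: "mhs_map A A id"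
  by (auto simp: mhs_map_def C_linear_def)

context odd_hodge
begin

text \<open>This will turn out to be one equivalence class of extensions, and every element of
  \<open>Ext T H\<close> has this form (\<open>Ext_carrier\<close>).\<close>

definition ext_of :: "'a \<Rightarrow> ('a, 'a \<times> complex, complex) ext_data set" where
  "ext_of a = {D \<in> extensions T H. ext_class p D a}"

text \<open>The point of the intermediate Jacobian represented by \<open>a\<close>: first modulo
  \<open>F\<^sup>p\<close>, then modulo the lattice.\<close>

definition pt :: "'a \<Rightarrow> 'a set set" where
  "pt a = J_lattice p H +>\<^bsub>J_space p H\<^esub> (Fil H p +> a)"

interpretation F: quotient_space H "Fil H p"
  by (rule quotient_space.intro[OF complex_space_axioms quotient_space_axioms.intro[OF Fil_subspace]])

sublocale J: complex_space "J_space p H"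
  unfolding J_space_def by (rule complex_space.intro[OF F.C_space_quot])

lemma J_carrier: "carrier (J_space p H) = (\<lambda>x. Fil H p +> x) ` carrier H"
  unfolding J_space_def by (rule F.quot_carrier)

lemma J_add: "x \<in> carrier H \<Longrightarrow> y \<in> carrier H \<Longrightarrow>
    (Fil H p +> x) \<oplus>\<^bsub>J_space p H\<^esub> (Fil H p +> y) = Fil H p +> (x \<oplus> y)"
  unfolding J_space_def by (rule F.quot_add)

lemma J_smult: "x \<in> carrier H \<Longrightarrow> c \<odot>\<^bsub>J_space p H\<^esub> (Fil H p +> x) = Fil H p +> (c \<odot> x)"
  unfolding J_space_def by (rule F.quot_smult)

lemma J_zero: "\<zero>\<^bsub>J_space p H\<^esub> = Fil H p +> \<zero>"
  unfolding J_space_def by (rule F.quot_zero')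

lemma J_eq: "x \<in> carrier H \<Longrightarrow> y \<in> carrier H \<Longrightarrow> Fil H p +> x = Fil H p +> y \<longleftrightarrow> x \<ominus> y \<in> Fil H p"
  by (rule F.coset_eq_iff)

lemma J_diff: "x \<in> carrier H \<Longrightarrow> y \<in> carrier H \<Longrightarrow>
    (Fil H p +> x) \<ominus>\<^bsub>J_space p H\<^esub> (Fil H p +> y) = Fil H p +> (x \<ominus> y)"
  by (simp add: J.diff_eq J_carrier J_smult J_add diff_eq)

lemma J_lattice_subgroup: "subgroup (J_lattice p H) (add_monoid (J_space p H))"
  unfolding J.subgroup_iff J_lattice_def
proof (intro conjI ballI)
  show "(\<lambda>x. Fil H p +> x) ` HZ H \<subseteq> carrier (J_space p H)" using HZ_closed by (auto simp: J_carrier)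
  show "\<zero>\<^bsub>J_space p H\<^esub> \<in> (\<lambda>x. Fil H p +> x) ` HZ H"
    unfolding J_zero using HZ_subgroup by (simp add: subgroup_iff)
  fix P assume "P \<in> (\<lambda>x. Fil H p +> x) ` HZ H"
  then obtain x where x: "x \<in> HZ H" "P = Fil H p +> x" by blast
  then show "(-1) \<odot>\<^bsub>J_space p H\<^esub> P \<in> (\<lambda>x. Fil H p +> x) ` HZ H"
    using HZ_subgroup by (simp add: J_smult HZ_closed subgroup_iff)
  fix R assume "R \<in> (\<lambda>x. Fil H p +> x) ` HZ H"
  then obtain y where y: "y \<in> HZ H" "R = Fil H p +> y" by blast
  with x show "P \<oplus>\<^bsub>J_space p H\<^esub> R \<in> (\<lambda>x. Fil H p +> x) ` HZ H"
    using HZ_subgroup by (simp add: J_add HZ_closed subgroup_iff)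
qed

interpretation L: abelian_subgroup "J_lattice p H" "J_space p H"
  by (rule abelian_subgroupI3[OF _ J.abelian_group_axioms])
    (rule additive_subgroup.intro[OF J_lattice_subgroup])

lemma J_coset_eq:
  assumes "P \<in> carrier (J_space p H)" "R \<in> carrier (J_space p H)"
  shows "J_lattice p H +>\<^bsub>J_space p H\<^esub> P = J_lattice p H +>\<^bsub>J_space p H\<^esub> R \<longleftrightarrow>
    P \<ominus>\<^bsub>J_space p H\<^esub> R \<in> J_lattice p H"
proof -
  have "J_lattice p H +>\<^bsub>J_space p H\<^esub> P = J_lattice p H +>\<^bsub>J_space p H\<^esub> R \<longleftrightarrow>
      P \<in> J_lattice p H +>\<^bsub>J_space p H\<^esub> R"
    using L.a_repr_independence'[of P R] L.a_repr_independenceD[of P R] assms by metis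
  then show ?thesis using L.a_rcos_module[OF assms(2,1)] by (simp add: J.minus_eq)
qed

lemma pt_eq_iff:
  assumes "a \<in> carrier H" "b \<in> carrier H"
  shows "pt a = pt b \<longleftrightarrow> class_eq p H a b"
proof -
  have "pt a = pt b \<longleftrightarrow> Fil H p +> (a \<ominus> b) \<in> J_lattice p H"
    unfolding pt_def using assms by (subst J_coset_eq) (auto simp: J_carrier J_diff)
  also have "\<dots> \<longleftrightarrow> (\<exists>z\<in>HZ H. (a \<ominus> b) \<ominus> z \<in> Fil H p)"
    using assms by (auto simp: J_lattice_def image_iff J_eq HZ_closed)
  also have "\<dots> \<longleftrightarrow> class_eq p H a b"
  proof -
    have "(a \<ominus> b) \<ominus> z \<in> Fil H p \<longleftrightarrow> (\<exists>f\<in>Fil H p. a \<ominus> b = f \<oplus> z)" if z: "z \<in> carrier H" for z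
    proof
      assume "(a \<ominus> b) \<ominus> z \<in> Fil H p"
      moreover have "a \<ominus> b = ((a \<ominus> b) \<ominus> z) \<oplus> z" using assms z by (simp add: diff_add_cancel)
      ultimately show "\<exists>f\<in>Fil H p. a \<ominus> b = f \<oplus> z" by blast
    next
      assume "\<exists>f\<in>Fil H p. a \<ominus> b = f \<oplus> z"
      then show "(a \<ominus> b) \<ominus> z \<in> Fil H p" using z Fil_closed by (auto simp: add_diff_cancel)
    qed
    then show ?thesis unfolding class_eq_def using HZ_closed by blast
  qed
  finally show ?thesis .
qed

lemma pt_carrier: "carrier (J_space p H A_Mod J_lattice p H) = pt ` carrier H"
  by (auto simp: A_FactGroup_def FactGroup_def RCOSETS_def J_carrier pt_def a_r_coset_def[of "J_space p H"])

lemma pt_add: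
  assumes "a \<in> carrier H" "b \<in> carrier H"
  shows "pt a \<otimes>\<^bsub>J_space p H A_Mod J_lattice p H\<^esub> pt b = pt (a \<oplus> b)"
  using L.a_rcos_sum[of "Fil H p +> a" "Fil H p +> b"] assms
  by (simp add: pt_def J_carrier J_add)

lemma class_eq_sym: "a \<in> carrier H \<Longrightarrow> b \<in> carrier H \<Longrightarrow> class_eq p H a b \<Longrightarrow> class_eq p H b a"
  using pt_eq_iff by metis

lemma ext_of_nonempty: "a \<in> carrier H \<Longrightarrow> std_ext p H a \<in> ext_of a"
  using std_ext_extension std_ext_class by (simp add: ext_of_def)

lemma ext_of_unique:
  assumes "D \<in> ext_of a" "D \<in> ext_of b" "a \<in> carrier H" "b \<in> carrier H"
  shows "class_eq p H a b"
proof -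
  obtain E i q where D: "D = (E, i, q)" by (cases D)
  interpret tate_ext p H E i q
    by (rule extension_tate_ext[OF pure_H]) (use assms D in \<open>simp add: ext_of_def\<close>)
  show ?thesis using assms D ext_class_unique by (simp add: ext_of_def)
qed

lemma ext_of_eq_iff:
  assumes "a \<in> carrier H" "b \<in> carrier H"
  shows "ext_of a = ext_of b \<longleftrightarrow> class_eq p H a b"
proof
  show "class_eq p H a b" if "ext_of a = ext_of b"
    using ext_of_unique[OF ext_of_nonempty[OF assms(1)] _ assms] ext_of_nonempty[OF assms(1)] that by simp
  assume *: "class_eq p H a b"
  show "ext_of a = ext_of b"
    unfolding ext_of_def
    using ext_class_cong[OF pure_H _ _ assms(1,2) class_eq_sym[OF assms *]]
      ext_class_cong[OF pure_H _ _ assms(2,1) *] by blast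
qed

lemma ext_of_pt: "a \<in> carrier H \<Longrightarrow> b \<in> carrier H \<Longrightarrow> ext_of a = ext_of b \<longleftrightarrow> pt a = pt b"
  by (simp add: ext_of_eq_iff pt_eq_iff)

lemma extension_ext_of: "D \<in> extensions T H \<Longrightarrow> \<exists>a\<in>carrier H. D \<in> ext_of a"
  using ext_class_exists[OF pure_H] by (simp add: ext_of_def)

lemma push_class_ext_of:
  assumes D: "D \<in> ext_of a" "a \<in> carrier H" and f: "mhs_map H B f" and B: "odd_hodge B p"
  shows "push_class T H f B D = odd_hodge.ext_of B p (f a)"
proof -
  interpret B: odd_hodge B p by fact
  obtain E i q where D': "D = (E, i, q)" by (cases D)
  interpret tate_ext p H E i q
    by (rule extension_tate_ext[OF pure_H]) (use D D' in \<open>simp add: ext_of_def\<close>)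
  show ?thesis
    using push_class_eq[OF _ D(2) f B.pure_H] D by (simp add: ext_of_def B.ext_of_def D')
qed

lemma Ext_map_ext_of:
  assumes a: "a \<in> carrier H" and f: "mhs_map H B f" and B: "odd_hodge B p"
  shows "Ext_map T H f B (ext_of a) = odd_hodge.ext_of B p (f a)"
  unfolding Ext_map_def using push_class_ext_of[OF _ a f B] ext_of_nonempty[OF a] by auto

text \<open>Equivalence of extensions is the push-out along the identity, so the computation of
  push-outs shows that an equivalence class consists of all extensions with the same class modulo
  \<open>F\<^sup>p\<close> and the lattice.\<close>

lemma ext_rel_image:
  assumes "D \<in> ext_of a" "a \<in> carrier H"
  shows "ext_rel T H `` {D} = ext_of a"
proof -
  have "push_class T H id H D = ext_of a"
    using push_class_ext_of[OF assms mhs_map_id odd_hodge_axioms] by simp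
  moreover have "D \<in> extensions T H" using assms by (simp add: ext_of_def)
  ultimately show ?thesis by (auto simp: ext_rel_def push_class_def)
qed

lemma Ext_carrier: "carrier (Ext T H) = ext_of ` carrier H"
proof -
  have "extensions T H // ext_rel T H = ext_of ` carrier H"
  proof (rule equalityI; rule subsetI)
    fix P assume "P \<in> extensions T H // ext_rel T H"
    then obtain D where D: "D \<in> extensions T H" "P = ext_rel T H `` {D}" by (auto elim: quotientE)
    with extension_ext_of ext_rel_image show "P \<in> ext_of ` carrier H" by blast
  next
    fix P assume "P \<in> ext_of ` carrier H"
    then obtain a where a: "a \<in> carrier H" "P = ext_of a" by blast
    then have "P = ext_rel T H `` {std_ext p H a}" using ext_rel_image[OF ext_of_nonempty] by simp
    then show "P \<in> extensions T H // ext_rel T H" using std_ext_extension[OF a(1)] by (auto intro: quotientI)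
  qed
  then show ?thesis by (simp add: Ext_def)
qed

text \<open>Pairs of lifts are lifts in the fibre product. Its class is therefore
  \<open>(a, b)\<close>, which addition sends to \<open>a \<oplus> b\<close>.\<close>

lemma Ext_mult:
  assumes ab: "a \<in> carrier H" "b \<in> carrier H"
  shows "ext_of a \<otimes>\<^bsub>Ext T H\<^esub> ext_of b = ext_of (a \<oplus> b)"
proof -
  have plus: "mhs_map (prod_mhs H H) H (\<lambda>(a, b). a \<oplus> b)"
    unfolding mhs_map_def
  proof (intro conjI allI)
    show "(\<lambda>(a, b). a \<oplus> b) \<in> C_linear (prod_mhs H H) H"
      by (rule C_linearI) (auto simp: a_ac smult_r_distr)
  qed (use HZ_subgroup Wt(2) subspace_add[OF Fil_subspace] in \<open>auto simp: subgroup_iff\<close>)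
  have "push_class T (prod_mhs H H) (\<lambda>(a, b). a \<oplus> b) H (fibre_ext D D') = ext_of (a \<oplus> b)"
    if D: "D \<in> ext_of a" and D': "D' \<in> ext_of b" for D D'
  proof -
    obtain E i q where E: "D = (E, i, q)" by (cases D)
    obtain E' i' q' where E': "D' = (E', i', q')" by (cases D')
    have ext: "(E, i, q) \<in> extensions T H" "(E', i', q') \<in> extensions T H"
      using D D' by (simp_all add: ext_of_def E E')
    interpret D: tate_ext p H E i q by (rule extension_tate_ext[OF pure_H ext(1)])
    interpret D': tate_ext p H E' i' q' by (rule extension_tate_ext[OF pure_H ext(2)])
    interpret P: tate_ext p "prod_mhs H H" "fibre_prod E q E' q'" "\<lambda>(a, b). (i a, i' b)" "\<lambda>(x, y). q x"
      by (rule baer_tate_ext[OF pure_H ext])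
    obtain s z where s: "s \<in> Fil E p" "z \<in> HZ E" "q s = g" "q z = g" "i a = s \<ominus>\<^bsub>E\<^esub> z"
      using D by (auto simp: ext_of_def E ext_class_def)
    obtain s' z' where s': "s' \<in> Fil E' p" "z' \<in> HZ E'" "q' s' = g" "q' z' = g" "i' b = s' \<ominus>\<^bsub>E'\<^esub> z'"
      using D' by (auto simp: ext_of_def E' ext_class_def)
    note cl = D.Fil_closed[OF s(1)] D.HZ_closed[OF s(2)] D'.Fil_closed[OF s'(1)] D'.HZ_closed[OF s'(2)]
    have "ext_class p (fibre_prod E q E' q', \<lambda>(a, b). (i a, i' b), \<lambda>(x, y). q x) (a, b)"
    proof (rule ext_classI[of "(s, s')" _ _ "(z, z')"])
      show "(\<lambda>(a, b). (i a, i' b)) (a, b) = (s, s') \<ominus>\<^bsub>fibre_prod E q E' q'\<^esub> (z, z')"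
        using cl s s' by (simp add: P.E.diff_eq D.E.diff_eq D'.E.diff_eq)
    qed (use cl s s' in simp_all)
    from P.push_class_eq[OF this _ plus pure_H] show ?thesis
      using ab by (simp add: fibre_ext_def E E' ext_of_def)
  qed
  then show ?thesis
    using ext_of_nonempty[OF ab(1)] ext_of_nonempty[OF ab(2)] by (auto simp: Ext_def)
qed

text \<open>A section puts the image of the generator into \<open>F\<^sup>p\<close> and into the
  lattice at once, so both lifts can be chosen equal. Conversely, an extension of class zero
  receives a morphism from the standard extension for \<open>\<zero>\<close>, which is the direct
  sum; its restriction to \<open>Z(-p)\<close> is a section.\<close>

lemma Ext_one: "\<one>\<^bsub>Ext T H\<^esub> = ext_of \<zero>"
proof -
  have "(\<exists>s\<in>mhs_hom T E. \<forall>t\<in>carrier T. q (s t) = t) \<longleftrightarrow> ext_class p (E, i, q) \<zero>"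
    if ext: "(E, i, q) \<in> extensions T H" for E i q
  proof -
    interpret D: tate_ext p H E i q by (rule extension_tate_ext[OF pure_H ext])
    interpret E: filtered_lattice E by (rule MHS_filtered[OF extensionsD(1)[OF ext]])
    have i0: "i \<zero> = \<zero>\<^bsub>E\<^esub>" by (rule C_linear_zero[OF D.i_lin C_space D.E.C_space])
    show ?thesis
    proof
      assume "\<exists>s\<in>mhs_hom T E. \<forall>t\<in>carrier T. q (s t) = t"
      then obtain s where s: "mhs_map T E s" "\<And>t. q (s t) = t" by (auto simp: mhs_hom_iff)
      have g: "s g \<in> Fil E p" "s g \<in> HZ E"
        using mhs_mapD(2,4)[OF s(1)] tate_gen_mem by blast+
      then show "ext_class p (E, i, q) \<zero>"
        using s(2) D.HZ_closed by (intro ext_classI[of "s g" _ _ "s g"]) (auto simp: i0)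
    next
      assume "ext_class p (E, i, q) \<zero>"
      then obtain s z where s: "s \<in> Fil E p" "z \<in> HZ E" "q s = g" "q z = g" "i \<zero> = s \<ominus>\<^bsub>E\<^esub> z"
        by (auto simp: ext_class_def)
      have "s \<ominus>\<^bsub>E\<^esub> z = \<zero>\<^bsub>E\<^esub>" using s(5) i0 by simp
      then have sz: "s = z" using D.E.diff_eq_zero_iff D.Fil_closed[OF s(1)] D.HZ_closed[OF s(2)] by simp
      have zc: "z \<in> carrier E" by (rule D.HZ_closed[OF s(2)])
      obtain D' where "ext_morphism H id (std_ext p H \<zero>) (E, i, q)"
        using ext_rel_image[OF ext_of_nonempty, of \<zero>] \<open>ext_class p (E, i, q) \<zero>\<close> ext
        by (auto simp: ext_of_def ext_rel_def)
      then obtain \<phi> where phi: "\<phi> \<in> mhs_hom (std_mid p H \<zero>) E"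
        "\<forall>x\<in>carrier (std_mid p H \<zero>). q (\<phi> x) = snd x"
        by (auto simp: ext_morphism_def std_ext_def)
      then have m: "mhs_map (std_mid p H \<zero>) E \<phi>" by (simp add: mhs_hom_iff)
      note mD = mhs_mapD[OF m] and mL = C_linearD[OF mhs_mapD(1)[OF m]]
      have "mhs_map T E (\<lambda>t. \<phi> (\<zero>, t))"
        unfolding mhs_map_def
      proof (intro conjI allI)
        show "(\<lambda>t. \<phi> (\<zero>, t)) \<in> C_linear T E"
        proof (rule C_linearI)
          show "\<phi> (\<zero>, x \<oplus>\<^bsub>T\<^esub> y) = \<phi> (\<zero>, x) \<oplus>\<^bsub>E\<^esub> \<phi> (\<zero>, y)" for x y
            using mL(2)[of "(\<zero>, x)" "(\<zero>, y)"] by simp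
          show "\<phi> (\<zero>, c \<odot>\<^bsub>T\<^esub> x) = c \<odot>\<^bsub>E\<^esub> \<phi> (\<zero>, x)" for c x using mL(3)[of "(\<zero>, x)" c] by simp
        qed (use mL(1) in simp)
        show "(\<lambda>t. \<phi> (\<zero>, t)) ` HZ T \<subseteq> HZ E"
          using mD(2) HZ_subgroup by (auto simp: subgroup_iff simp del: tate_simps(5))
        show "(\<lambda>t. \<phi> (\<zero>, t)) ` Wt T k \<subseteq> Wt E k" for k
          using mD(3) Wt(2)[of k] by (auto simp: subgroup_iff std_mid_Wt simp del: tate_simps(6))
        show "(\<lambda>t. \<phi> (\<zero>, t)) ` Fil T k \<subseteq> Fil E k" for k
        proof (rule image_subsetI)
          fix t assume t: "t \<in> Fil T k"
          then have "(\<zero>, t) \<in> Fil (std_mid p H \<zero>) k"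
            using subspace_zero[OF Fil_subspace]
            unfolding std_mid_Fil by (intro exI[of _ \<zero>] exI[of _ "t / g"]) (auto split: if_splits)
          then show "\<phi> (\<zero>, t) \<in> Fil E k" by (rule mD(4))
        qed
      qed
      then have "(\<lambda>t. \<phi> (\<zero>, t)) \<in> mhs_hom T E" by (simp add: mhs_hom_iff)
      then show "\<exists>s\<in>mhs_hom T E. \<forall>t\<in>carrier T. q (s t) = t" using phi(2) by (intro bexI) auto
    qed
  qed
  then show ?thesis by (auto simp: Ext_def ext_of_def)
qed

text \<open>All representatives and all choices of lifts give the same point, which is what the
  definite description in \<open>carlson\<close> relies on.\<close>

lemma carlson_ext_of:
  assumes a: "a \<in> carrier H"
  shows "carlson p H (ext_of a) = pt a"
proof -
  have 1: "(\<exists>(E, i, q)\<in>ext_of a. \<exists>s\<in>Fil E p. \<exists>z\<in>HZ E. \<exists>a\<in>carrier H.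
      q s = g \<and> q z = g \<and> i a = s \<ominus>\<^bsub>E\<^esub> z \<and> t = J_lattice p H +>\<^bsub>J_space p H\<^esub> (Fil H p +> a))
    \<longleftrightarrow> (\<exists>D\<in>ext_of a. \<exists>b\<in>carrier H. ext_class p D b \<and> t = pt b)" for t
    unfolding ext_class_def pt_def by fastforce
  have 2: "(\<exists>D\<in>ext_of a. \<exists>b\<in>carrier H. ext_class p D b \<and> t = pt b) \<longleftrightarrow> t = pt a" for t
  proof
    assume "\<exists>D\<in>ext_of a. \<exists>b\<in>carrier H. ext_class p D b \<and> t = pt b"
    then obtain D b where D: "D \<in> ext_of a" "b \<in> carrier H" "ext_class p D b" "t = pt b" by blast
    then have "D \<in> ext_of b" by (simp add: ext_of_def)
    then show "t = pt a" using ext_of_unique[OF _ D(1) D(2) a] D(4) pt_eq_iff[OF D(2) a] by simp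
  next
    assume "t = pt a"
    then show "\<exists>D\<in>ext_of a. \<exists>b\<in>carrier H. ext_class p D b \<and> t = pt b"
      using ext_of_nonempty[OF a] a std_ext_class[OF a]
      by (intro bexI[of _ "std_ext p H a"] bexI[of _ a]) simp_all
  qed
  show ?thesis unfolding carlson_def 1 2 by (rule the_eq_trivial)
qed

lemma carlson_iso: "carlson p H \<in> iso (Ext T H) (J_space p H A_Mod J_lattice p H)"
proof (rule isoI)
  show "carlson p H \<in> hom (Ext T H) (J_space p H A_Mod J_lattice p H)"
  proof (rule homI)
    show "carlson p H P \<in> carrier (J_space p H A_Mod J_lattice p H)" if "P \<in> carrier (Ext T H)" for P
      using that by (auto simp: Ext_carrier pt_carrier carlson_ext_of)
    show "carlson p H (P \<otimes>\<^bsub>Ext T H\<^esub> R) =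
        carlson p H P \<otimes>\<^bsub>J_space p H A_Mod J_lattice p H\<^esub> carlson p H R"
      if "P \<in> carrier (Ext T H)" "R \<in> carrier (Ext T H)" for P R
    proof -
      from that obtain a b where "a \<in> carrier H" "P = ext_of a" "b \<in> carrier H" "R = ext_of b"
        unfolding Ext_carrier by blast
      then show ?thesis using Ext_mult[of a b] pt_add[of a b] by (simp add: carlson_ext_of)
    qed
  qed
  show "bij_betw (carlson p H) (carrier (Ext T H)) (carrier (J_space p H A_Mod J_lattice p H))"
    unfolding bij_betw_def Ext_carrier pt_carrier
  proof
    show "inj_on (carlson p H) (ext_of ` carrier H)"
    proof (rule inj_onI)
      fix P R assume "P \<in> ext_of ` carrier H" "R \<in> ext_of ` carrier H" "carlson p H P = carlson p H R"
      then obtain a b where "a \<in> carrier H" "P = ext_of a" "b \<in> carrier H" "R = ext_of b" "pt a = pt b"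
        by (auto simp: carlson_ext_of)
      then show "P = R" using ext_of_pt by simp
    qed
    show "carlson p H ` ext_of ` carrier H = pt ` carrier H"
      unfolding image_image by (rule image_cong) (simp_all add: carlson_ext_of)
  qed
qed

end

subsection \<open>The intermediate Jacobian\<close>

lemma (in complex_space) add_diff_add:
  assumes "x \<in> carrier V" "y \<in> carrier V" "z \<in> carrier V"
  shows "(x \<oplus> z) \<ominus> (y \<oplus> z) = x \<ominus> y"
proof -
  obtain F where F: "frame F x y z x" using frame_exists[OF assms assms(1)] by blast
  show ?thesis unfolding frame_atoms(1-3)[OF F] by (simp add: frame_simps[OF F])
qed

context lattice_space
begin

lemma conj_fixed_comb:
  assumes "\<forall>i<m. w i \<in> HZ H" "\<forall>i<m. c i \<in> \<real>"
  shows "\<sigma> (comb H w c m) = comb H w c m"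
  using assms
proof (induction m)
  case (Suc m)
  have "comb H w c m \<in> carrier H" using Suc.prems HZ_closed by (intro comb_closed) simp
  then show ?case
    using Suc by (simp add: conj_add conj_smult conj_HZ HZ_closed Reals_cnj_iff)
qed (simp add: conj_zero)

lemma real_coordinates:
  assumes "indep H v n" "HZ H = zspan H v n" "\<sigma> (comb H v c n) = comb H v c n" "i < n"
  shows "c i \<in> \<real>"
proof -
  note cl = indep_closed[OF assms(1)]
  have v: "\<forall>i<n. v i \<in> HZ H" using zspan_mem[OF cl] assms(2) by simp
  have "\<sigma> (comb H v c m) = comb H v (\<lambda>i. cnj (c i)) m" if "m \<le> n" for m
    using that v
    by (induction m) (simp_all add: conj_zero conj_add conj_smult conj_HZ HZ_closed comb_closed)
  then have "comb H v (\<lambda>i. cnj (c i)) n = comb H v c n" using assms(3) by simp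
  from indep_unique[OF assms(1) this assms(4)] show ?thesis by (simp add: Reals_cnj_iff)
qed

end

context odd_hodge
begin

text \<open>Opposedness in weight 2p - 1 is used with both indices equal to \<open>p\<close>, as
  \<open>p + p = (2 * p - 1) + 1\<close>. Thus \<open>H\<close> is the direct sum of
  \<open>F\<^sup>p\<close> and its conjugate, and here \<open>f\<close> lies in both.\<close>

lemma Fp_real:
  assumes "f \<in> Fil H p" "f' \<in> Fil H p" "f = \<sigma> f'"
  shows "f = \<zero>"
  using opp assms unfolding opposed_iff[OF Fil_subspace] by (auto dest!: spec[of _ p])

lemma Fp_decomp:
  assumes "x \<in> carrier H"
  obtains f f' where "f \<in> Fil H p" "f' \<in> Fil H p" "x = f \<oplus> \<sigma> f'"
proof -
  have "\<exists>f\<in>Fil H p. \<exists>f'\<in>Fil H p. x = f \<oplus> \<sigma> f'"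
    using opp assms unfolding opposed_iff[OF Fil_subspace] by (auto dest!: spec[of _ p])
  then show ?thesis using that by blast
qed

lemma Fp_unique:
  assumes "f \<in> Fil H p" "f' \<in> Fil H p" "h \<in> Fil H p" "h' \<in> Fil H p" "f \<oplus> \<sigma> f' = h \<oplus> \<sigma> h'"
  shows "f = h" "f' = h'"
proof -
  have c: "f \<in> carrier H" "f' \<in> carrier H" "h \<in> carrier H" "h' \<in> carrier H"
    using assms Fil_closed by auto
  have cc: "\<sigma> f' \<in> carrier H" "\<sigma> h' \<in> carrier H" using c by auto
  obtain F where F: "frame F f (\<sigma> f') h (\<sigma> h')" using frame_exists[OF c(1) cc(1) c(3) cc(2)] by blast
  have "f \<ominus> h = (f \<oplus> \<sigma> f') \<ominus> (h \<oplus> \<sigma> f')"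
    unfolding frame_atoms[OF F] by (simp add: frame_simps[OF F])
  also have "\<dots> = \<sigma> (h' \<ominus> f')"
  proof -
    have "(h \<oplus> \<sigma> h') \<ominus> (h \<oplus> \<sigma> f') = \<sigma> h' \<ominus> \<sigma> f'"
      unfolding frame_atoms[OF F] by (simp add: frame_simps[OF F])
    then show ?thesis using assms(5) c by (simp add: conj_diff)
  qed
  finally have eq: "f \<ominus> h = \<sigma> (h' \<ominus> f')" .
  have "f \<ominus> h = \<zero>"
    by (rule Fp_real[OF subspace_diff[OF Fil_subspace assms(1,3)] subspace_diff[OF Fil_subspace assms(4,2)] eq])
  then show "f = h" using c diff_eq_zero_iff by blast
  have "h' \<ominus> f' = \<sigma> (\<sigma> (h' \<ominus> f'))" using c by simp
  also have "\<dots> = \<zero>" using eq \<open>f \<ominus> h = \<zero>\<close> conj_zero by simp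
  finally have "h' \<ominus> f' = \<zero>" .
  then show "f' = h'" using c diff_eq_zero_iff by metis
qed

lemma J_comb:
  "\<forall>i<n. v i \<in> carrier H \<Longrightarrow> comb (J_space p H) (\<lambda>i. Fil H p +> v i) c n = Fil H p +> comb H v c n"
  by (induction n) (simp_all add: J_zero J_smult J_add comb_closed)

text \<open>The real points of \<open>H\<close> map bijectively to \<open>H/F\<^sup>p\<close>: a
  real vector in \<open>F\<^sup>p\<close> is zero, and every coset has a real representative. So a
  basis of the lattice becomes a real basis of the tangent space.\<close>

lemma J_complex_torus: "complex_torus (J_space p H) (J_lattice p H)"
  unfolding complex_torus_def
proof (intro conjI J.C_space)
  from lattice obtain n v where v: "indep H v n" "HZ H = zspan H v n"
    and sp: "\<forall>x\<in>carrier H. \<exists>c. x = comb H v c n" unfolding full_lattice_UNIV_iff by blast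
  note cl = indep_closed[OF v(1)]
  have vZ: "\<forall>i<n. v i \<in> HZ H" using zspan_mem[OF cl] v(2) by simp
  have "full_lattice \<real> (J_space p H) (zspan (J_space p H) (\<lambda>i. Fil H p +> v i) n)"
  proof (rule J.full_latticeI)
    show "\<forall>i<n. Fil H p +> v i \<in> carrier (J_space p H)" using cl by (simp add: J_carrier)
    show "\<forall>x\<in>carrier (J_space p H). \<exists>c. (\<forall>i<n. c i \<in> \<real>) \<and>
        x = comb (J_space p H) (\<lambda>i. Fil H p +> v i) c n"
    proof
      fix P assume "P \<in> carrier (J_space p H)"
      then obtain x where x: "x \<in> carrier H" "P = Fil H p +> x" by (auto simp: J_carrier)
      obtain f f' where f: "f \<in> Fil H p" "f' \<in> Fil H p" "x = f \<oplus> \<sigma> f'" using Fp_decomp[OF x(1)] .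
      have fc: "f \<in> carrier H" "f' \<in> carrier H" "\<sigma> f' \<in> carrier H" using f Fil_closed by auto
      \<comment> \<open>Replacing \<open>f\<close> by \<open>f'\<close> in the splitting of
        \<open>x\<close> changes \<open>x\<close> by an element of \<open>F\<^sup>p\<close> and
        makes it real.\<close>
      define y where "y = f' \<oplus> \<sigma> f'"
      have y: "y \<in> carrier H" "\<sigma> y = y" using fc by (simp_all add: y_def conj_add a_comm)
      obtain c where c: "y = comb H v c n" using sp y by blast
      have "\<forall>i<n. c i \<in> \<real>" using real_coordinates[OF v] y c by simp
      moreover have "x \<ominus> y = f \<ominus> f'" unfolding f(3) y_def by (rule add_diff_add[OF fc])
      then have "P = Fil H p +> y"
        using x y subspace_diff[OF Fil_subspace f(1,2)] by (simp add: J_eq)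
      ultimately show "\<exists>c. (\<forall>i<n. c i \<in> \<real>) \<and> P = comb (J_space p H) (\<lambda>i. Fil H p +> v i) c n"
        using c J_comb[OF cl] by auto
    qed
    show "\<forall>c. (\<forall>i<n. c i \<in> \<real>) \<longrightarrow>
        comb (J_space p H) (\<lambda>i. Fil H p +> v i) c n = \<zero>\<^bsub>J_space p H\<^esub> \<longrightarrow> (\<forall>i<n. c i = 0)"
    proof (intro allI impI)
      fix c i assume c: "\<forall>i<n. c i \<in> \<real>" and i: "i < n"
        and 0: "comb (J_space p H) (\<lambda>i. Fil H p +> v i) c n = \<zero>\<^bsub>J_space p H\<^esub>"
      have "comb H v c n \<in> Fil H p"
        using 0 J_comb[OF cl] comb_closed[OF cl] by (simp add: J_zero J_eq diff_eq)
      then have "comb H v c n = \<zero>" using Fp_real conj_fixed_comb[OF vZ c] by metis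
      then show "c i = 0" using v(1) i unfolding indep_def by blast
    qed
  qed (auto elim!: Ints_cases)
  moreover have "J_lattice p H = zspan (J_space p H) (\<lambda>i. Fil H p +> v i) n"
    by (simp add: J_lattice_def v(2) zspan_def J_comb[OF cl] image_image)
  ultimately show "full_lattice \<real> (J_space p H) (J_lattice p H)" by simp
qed

subsection \<open>The largest sub-Hodge structure of type \<open>{(p-1,p), (p,p-1)}\<close>\<close>

text \<open>A working form of being a sub-Hodge structure of type \<open>{(p-1,p), (p,p-1)}\<close>;
  the equivalence is \<open>level_one_iff\<close>. Besides rationality and the bound on types, only
  the splitting at index \<open>p\<close> has to be verified.\<close>

definition level_one :: "'a set \<Rightarrow> bool" where
  "level_one U \<longleftrightarrow> rat_sub U \<and> U \<subseteq> Fil H (p - 1) \<and>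
     (\<forall>x\<in>U. \<exists>f\<in>Fil H p \<inter> U. \<exists>f'\<in>Fil H p \<inter> U. x = f \<oplus> \<sigma> f')"

text \<open>If \<open>a + b = 2 * p\<close> and the two indices are not both \<open>p\<close>, one
  of them is at most \<open>p - 1\<close>. The corresponding step of the filtration contains all of
  \<open>U\<close>, and a splitting with one part zero will do.\<close>

lemma level_one_pure:
  assumes "level_one U"
  shows "pure (sub_mhs H U) (2 * p - 1)"
proof -
  have U: "rat_sub U" "U \<subseteq> Fil H (p - 1)"
    and dec: "\<forall>x\<in>U. \<exists>f\<in>Fil H p \<inter> U. \<exists>f'\<in>Fil H p \<inter> U. x = f \<oplus> \<sigma> f'"
    using assms by (auto simp: level_one_def)
  note sU = rat_sub_subspace[OF U(1)]
  show ?thesis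
    unfolding sub_mhs_pure_iff[OF U(1)]
  proof (intro allI impI conjI ballI)
    fix a b f f' assume "a + b = 2 * p - 1 + 1" "f \<in> Fil H a \<inter> U" "f' \<in> Fil H b \<inter> U" "f = \<sigma> f'"
    then show "f = \<zero>" using opp unfolding opposed_iff[OF Fil_subspace] by blast
  next
    fix a b :: int and x assume ab: "a + b = 2 * p - 1 + 1" and x: "x \<in> U"
    have xc: "x \<in> carrier H" by (rule rat_sub_closed[OF U(1) x])
    have z: "\<zero> \<in> Fil H c \<inter> U" for c using subspace_zero[OF Fil_subspace] subspace_zero[OF sU] by blast
    consider "a = p \<and> b = p" | "a \<le> p - 1" | "b \<le> p - 1" using ab by linarith
    then show "\<exists>f\<in>Fil H a \<inter> U. \<exists>f'\<in>Fil H b \<inter> U. x = f \<oplus> \<sigma> f'"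
    proof cases
      case 1
      then show ?thesis using dec x by blast
    next
      case 2
      have "x \<in> Fil H a \<inter> U" using x U(2) Fil_antimono[OF 2] by blast
      moreover have "x = x \<oplus> \<sigma> \<zero>" using xc by (simp add: conj_zero)
      ultimately show ?thesis using z by blast
    next
      case 3
      have "\<sigma> x \<in> Fil H b \<inter> U" using rat_sub_conj[OF U(1) x] U(2) Fil_antimono[OF 3] by blast
      moreover have "x = \<zero> \<oplus> \<sigma> (\<sigma> x)" using xc by simp
      ultimately show ?thesis using z by blast
    qed
  qed
qed

text \<open>\<open>U\<close> is stable under conjugation and contained in
  \<open>F\<^sup>p\<^sup>-\<^sup>1\<close>. Hence an element of \<open>F\<^sup>p\<close> in
  \<open>U\<close> has type \<open>(p, p - 1)\<close> and its conjugate has type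
  \<open>(p - 1, p)\<close>, so the splitting is the Hodge decomposition.\<close>

lemma level_one_iff:
  "level_one U \<longleftrightarrow> C_subspace U H \<and> MHS (sub_mhs H U) \<and>
     U = set_add H (hodge_comp (sub_mhs H U) (p - 1) p) (hodge_comp (sub_mhs H U) p (p - 1))"
proof
  assume lo: "level_one U"
  then have U: "rat_sub U" "U \<subseteq> Fil H (p - 1)"
    and dec: "\<forall>x\<in>U. \<exists>f\<in>Fil H p \<inter> U. \<exists>f'\<in>Fil H p \<inter> U. x = f \<oplus> \<sigma> f'"
    by (auto simp: level_one_def)
  note sU = rat_sub_subspace[OF U(1)]
  have MHS: "MHS (sub_mhs H U)" using MHS_sub_mhs_iff[OF sU] U level_one_pure[OF lo] by blast
  let ?A = "hodge_comp (sub_mhs H U) (p - 1) p" and ?B = "hodge_comp (sub_mhs H U) p (p - 1)"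
  have "x \<in> set_add H ?A ?B" if x: "x \<in> U" for x
  proof -
    obtain f f' where f: "f \<in> Fil H p" "f \<in> U" "f' \<in> Fil H p" "f' \<in> U" "x = f \<oplus> \<sigma> f'" using dec x by blast
    have c: "f \<in> carrier H" "f' \<in> carrier H" using f rat_sub_closed[OF U(1)] by auto
    have s: "\<sigma> f \<in> U" "\<sigma> f' \<in> U" using rat_sub_conj[OF U(1)] f by auto
    have "\<sigma> f' \<in> ?A"
      using s f U(2) by (auto simp: hodge_comp_def sub_mhs_conj[OF U(1)] intro!: image_eqI[of _ _ f'])
    moreover have "f \<in> ?B"
      using s f U(2) c by (auto simp: hodge_comp_def sub_mhs_conj[OF U(1)] intro!: image_eqI[of _ _ "\<sigma> f"])
    moreover have "x = \<sigma> f' \<oplus> f" using f c by (simp add: a_comm)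
    ultimately show ?thesis unfolding set_add_eq by blast
  qed
  moreover have "set_add H ?A ?B \<subseteq> U"
    using subspace_add[OF sU] by (auto simp: set_add_eq hodge_comp_def)
  ultimately show "C_subspace U H \<and> MHS (sub_mhs H U) \<and> U = set_add H ?A ?B" using sU MHS by blast
next
  let ?A = "hodge_comp (sub_mhs H U) (p - 1) p" and ?B = "hodge_comp (sub_mhs H U) p (p - 1)"
  assume *: "C_subspace U H \<and> MHS (sub_mhs H U) \<and> U = set_add H ?A ?B"
  then have U: "rat_sub U" and pU: "pure (sub_mhs H U) (2 * p - 1)" using MHS_sub_mhs_iff by blast+
  have "x \<in> Fil H (p - 1)" if "x \<in> U" for x
  proof -
    from * that obtain y z where "y \<in> ?A" "z \<in> ?B" "x = y \<oplus> z" unfolding set_add_eq by blast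
    then show ?thesis
      using Fil_antimono[of "p - 1" p] subspace_add[OF Fil_subspace] by (auto simp: hodge_comp_def)
  qed
  moreover have "\<exists>f\<in>Fil H p \<inter> U. \<exists>f'\<in>Fil H p \<inter> U. x = f \<oplus> \<sigma> f'" if "x \<in> U" for x
    using pU that unfolding sub_mhs_pure_iff[OF U] by (auto dest!: spec[of _ p])
  ultimately show "level_one U" using U by (auto simp: level_one_def)
qed

text \<open>The splitting passes to sums and to multiples, with the scalar conjugated on the second
  part, so it need only be checked on generators.\<close>

lemma decomposition_C_span:
  assumes "S \<subseteq> carrier H"
    and "\<And>x. x \<in> S \<Longrightarrow> \<exists>f\<in>Fil H p \<inter> C_span H S. \<exists>f'\<in>Fil H p \<inter> C_span H S. x = f \<oplus> \<sigma> f'"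
    and "x \<in> C_span H S"
  shows "\<exists>f\<in>Fil H p \<inter> C_span H S. \<exists>f'\<in>Fil H p \<inter> C_span H S. x = f \<oplus> \<sigma> f'"
proof -
  let ?K = "C_span H S"
  have sFK: "C_subspace (Fil H p \<inter> ?K) H" by (rule subspace_Int[OF Fil_subspace C_span_subspace[OF assms(1)]])
  show ?thesis using assms(3,1)
  proof (induction rule: C_span_induct)
    case (base x)
    then show ?case by (rule assms(2))
  next
    case zero
    show ?case using subspace_zero[OF sFK] by (intro bexI[of _ \<zero>]) (simp_all add: conj_zero)
  next
    case (add x y)
    then obtain f f' h h' where f: "f \<in> Fil H p \<inter> ?K" "f' \<in> Fil H p \<inter> ?K" "x = f \<oplus> \<sigma> f'"
      and h: "h \<in> Fil H p \<inter> ?K" "h' \<in> Fil H p \<inter> ?K" "y = h \<oplus> \<sigma> h'" by blast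
    have c: "f \<in> carrier H" "f' \<in> carrier H" "h \<in> carrier H" "h' \<in> carrier H"
      using f h Fil_closed by auto
    have "x \<oplus> y = (f \<oplus> h) \<oplus> \<sigma> (f' \<oplus> h')" using f h c by (simp add: conj_add a_ac)
    then show ?case using subspace_add[OF sFK f(1) h(1)] subspace_add[OF sFK f(2) h(2)] by blast
  next
    case (smult d x)
    then obtain f f' where f: "f \<in> Fil H p \<inter> ?K" "f' \<in> Fil H p \<inter> ?K" "x = f \<oplus> \<sigma> f'" by blast
    have c: "f \<in> carrier H" "f' \<in> carrier H" using f Fil_closed by auto
    have "d \<odot> x = d \<odot> f \<oplus> \<sigma> (cnj d \<odot> f')" using f c by (simp add: conj_smult smult_r_distr)
    then show ?case using subspace_smult[OF sFK f(1), of d] subspace_smult[OF sFK f(2), of "cnj d"] by blast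
  qed
qed

lemma level_one_union:
  assumes "\<And>U. U \<in> \<U> \<Longrightarrow> level_one U"
  shows "level_one (C_span H (\<Union>\<U>))"
proof -
  have rU: "rat_sub U" if "U \<in> \<U>" for U using assms[OF that] by (simp add: level_one_def)
  have sc: "\<Union>\<U> \<subseteq> carrier H" using rat_sub_closed[OF rU] by blast
  let ?K = "C_span H (\<Union>\<U>)"
  have K: "rat_sub ?K" by (rule rat_sub_union) (rule rU)
  note sK = rat_sub_subspace[OF K]
  have "\<Union>\<U> \<subseteq> Fil H (p - 1)" using assms by (auto simp: level_one_def)
  then have 1: "?K \<subseteq> Fil H (p - 1)" by (rule C_span_minimal[OF Fil_subspace])
  have "\<exists>f\<in>Fil H p \<inter> ?K. \<exists>f'\<in>Fil H p \<inter> ?K. x = f \<oplus> \<sigma> f'" if "x \<in> ?K" for x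
  proof (rule decomposition_C_span[OF sc _ that])
    fix x assume "x \<in> \<Union>\<U>"
    then obtain U where U: "U \<in> \<U>" "x \<in> U" by blast
    then obtain f f' where "f \<in> Fil H p \<inter> U" "f' \<in> Fil H p \<inter> U" "x = f \<oplus> \<sigma> f'"
      using assms[OF U(1)] unfolding level_one_def by blast
    moreover have "U \<subseteq> ?K" using U(1) C_span_superset[of "\<Union>\<U>"] by blast
    ultimately show "\<exists>f\<in>Fil H p \<inter> ?K. \<exists>f'\<in>Fil H p \<inter> ?K. x = f \<oplus> \<sigma> f'" by blast
  qed
  then show ?thesis using K 1 by (auto simp: level_one_def)
qed

text \<open>The sum of all substructures of level one is again of level one, so the maximum
  described by \<open>GREATEST\<close> exists.\<close>

lemma
  shows Ha_level_one: "level_one (Ha_sub p H)"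
    and Ha_greatest: "level_one U \<Longrightarrow> U \<subseteq> Ha_sub p H"
proof -
  let ?K = "C_span H (\<Union>{U. level_one U})"
  have K: "level_one ?K" by (rule level_one_union) simp
  have le: "U \<subseteq> ?K" if "level_one U" for U using that C_span_superset[of "\<Union>{U. level_one U}"] by blast
  have "Ha_sub p H = ?K"
    unfolding Ha_sub_def level_one_iff[symmetric] by (rule Greatest_equality[of level_one, OF K]) (rule le)
  then show "level_one (Ha_sub p H)" "level_one U \<Longrightarrow> U \<subseteq> Ha_sub p H" using K le by simp_all
qed

text \<open>The tangent space of a subtorus with horizontal tangent space is the real span of its lattice,
  and stability under \<open>\<i>\<close> makes the complex span of the lattice a sub-Hodge structure.\<close>

lemma horizontal_subtorus:
  assumes U: "C_subspace U (J_space p H)" "U \<subseteq> J_horizontal p H"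
    and L: "full_lattice \<real> (sub_space (J_space p H) U) (J_lattice p H \<inter> U)"
  shows "U \<subseteq> (\<lambda>x. Fil H p +> x) ` Ha_sub p H"
proof -
  interpret U: complex_space "sub_space (J_space p H) U"
    unfolding sub_space_def by (rule complex_space.intro[OF J.C_space_sub[OF U(1)]])
  obtain n w where w: "\<forall>i<n. w i \<in> carrier (sub_space (J_space p H) U)"
    "J_lattice p H \<inter> U = zspan (sub_space (J_space p H) U) w n"
    and sp: "\<forall>x\<in>carrier (sub_space (J_space p H) U). \<exists>c. (\<forall>i<n. c i \<in> \<real>) \<and> x = comb (sub_space (J_space p H) U) w c n"
    by (rule U.full_latticeE[OF L]) auto
  \<comment> \<open>The lattice points of \<open>H\<close> above the lattice of the subtorus; their
    complex span is the candidate for a substructure of level one.\<close>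
  define UZ where "UZ = {z \<in> HZ H. Fil H p +> z \<in> U}"
  have UZc: "UZ \<subseteq> carrier H" using HZ_closed by (auto simp: UZ_def)
  have "\<forall>i\<in>{..<n}. \<exists>z. z \<in> UZ \<and> w i = Fil H p +> z"
  proof
    fix i assume i: "i \<in> {..<n}"
    have "w i \<in> J_lattice p H \<inter> U" unfolding w(2) by (rule U.zspan_mem[OF w(1)]) (use i in simp)
    then show "\<exists>z. z \<in> UZ \<and> w i = Fil H p +> z" by (auto simp: J_lattice_def UZ_def)
  qed
  then obtain z where z: "\<forall>i\<in>{..<n}. z i \<in> UZ \<and> w i = Fil H p +> z i" by metis
  then have zc: "\<forall>i<n. z i \<in> carrier H" and zZ: "\<forall>i<n. z i \<in> HZ H"
    using UZc by (auto simp: UZ_def)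
  let ?K = "C_span H UZ"
  have K: "rat_sub ?K" by (rule rat_sub_C_span) (auto simp: UZ_def HZ_HQ)
  note sK = rat_sub_subspace[OF K]
  have zK: "comb H z c n \<in> ?K" for c
    using z C_span_superset[of UZ] by (intro comb_subspace[OF sK]) auto
  have U_real: "\<exists>c. (\<forall>i<n. c i \<in> \<real>) \<and> P = Fil H p +> comb H z c n" if P: "P \<in> U" for P
  proof -
    from sp P obtain c where c: "\<forall>i<n. c i \<in> \<real>" "P = comb (sub_space (J_space p H) U) w c n"
      by (auto simp: sub_space_def)
    have "P = comb (J_space p H) (\<lambda>i. Fil H p +> z i) c n"
      unfolding c(2) sub_space_def comb_sub by (rule comb_cong) (use z in auto)
    then show ?thesis using c J_comb[OF zc] by auto
  qed
  have "UZ \<subseteq> Fil H (p - 1)"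
  proof
    fix x assume x: "x \<in> UZ"
    then have "Fil H p +> x \<in> J_horizontal p H" using U(2) by (auto simp: UZ_def)
    then obtain y where y: "y \<in> Fil H (p - 1)" "Fil H p +> x = Fil H p +> y" by (auto simp: J_horizontal_def)
    have xc: "x \<in> carrier H" "y \<in> carrier H" using x UZc y Fil_closed by auto
    then have "x \<ominus> y \<in> Fil H (p - 1)" using y(2) J_eq Fil_antimono[of "p - 1" p] by auto
    from subspace_add[OF Fil_subspace this y(1)] show "x \<in> Fil H (p - 1)"
      using xc by (simp add: diff_add_cancel)
  qed
  then have K1: "?K \<subseteq> Fil H (p - 1)" by (rule C_span_minimal[OF Fil_subspace])
  have sFK: "C_subspace (Fil H p \<inter> ?K) H" by (rule subspace_Int[OF Fil_subspace sK])
  have "\<exists>f\<in>Fil H p \<inter> ?K. \<exists>f'\<in>Fil H p \<inter> ?K. x = f \<oplus> \<sigma> f'" if "x \<in> ?K" for x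
  proof (rule decomposition_C_span[OF UZc _ that])
    fix x assume base: "x \<in> UZ"
    then have x: "x \<in> HZ H" "Fil H p +> x \<in> U" by (auto simp: UZ_def)
    have xc: "x \<in> carrier H" "\<sigma> x = x" using x HZ_closed conj_HZ by auto
    \<comment> \<open>This is where the complex structure of the subtorus enters: the coset of \<i>
      times \<open>x\<close> lies in \<open>U\<close> again, and so it has a real representative in
      the span of the lattice points, although \<i> times \<open>x\<close> is itself purely
      imaginary.\<close>
    have "\<i> \<odot>\<^bsub>J_space p H\<^esub> (Fil H p +> x) \<in> U" by (rule J.subspace_smult[OF U(1) x(2)])
    then have "Fil H p +> (\<i> \<odot> x) \<in> U" using xc by (simp add: J_smult)
    from U_real[OF this] obtain c where c: "\<forall>i<n. c i \<in> \<real>" "Fil H p +> (\<i> \<odot> x) = Fil H p +> comb H z c n"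
      by blast
    define y where "y = comb H z c n"
    have y: "y \<in> carrier H" "\<sigma> y = y" "y \<in> ?K"
      using zK[of c] conj_fixed_comb[OF zZ c(1)] comb_closed[OF zc] by (simp_all add: y_def)
    define f where "f = \<i> \<odot> x \<ominus> y"
    have "f \<in> Fil H p" using c(2) xc y(1) by (simp add: f_def J_eq y_def[symmetric])
    moreover have "f \<in> ?K"
      unfolding f_def by (intro subspace_diff[OF sK subspace_smult[OF sK] y(3)] subsetD[OF C_span_superset base])
    ultimately have f: "f \<in> Fil H p \<inter> ?K" by blast
    have fc: "f \<in> carrier H" using xc y by (simp add: f_def)
    have sf: "\<sigma> f = (- \<i>) \<odot> x \<ominus> y" using xc y by (simp add: f_def conj_diff conj_smult)
    obtain F where F: "frame F x y x y" using frame_exists[OF xc(1) y(1) xc(1) y(1)] by blast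
    \<comment> \<open>Eliminating \<open>y\<close> from \<open>f\<close> and its conjugate leaves
      \<open>x\<close> as their difference divided by \<open>2 * \<i>\<close>.\<close>
    have "x = (- \<i> / 2) \<odot> (\<i> \<odot> x \<ominus> y) \<oplus> (\<i> / 2) \<odot> ((- \<i>) \<odot> x \<ominus> y)"
      unfolding frame_atoms(1,2)[OF F] by (simp add: frame_simps[OF F])
    also have "\<dots> = (- \<i> / 2) \<odot> f \<oplus> \<sigma> ((- \<i> / 2) \<odot> f)"
      using fc by (simp add: conj_smult sf) (simp add: f_def)
    finally show "\<exists>f\<in>Fil H p \<inter> ?K. \<exists>f'\<in>Fil H p \<inter> ?K. x = f \<oplus> \<sigma> f'"
      using subspace_smult[OF sFK f, of "- \<i> / 2"] by blast
  qed
  then have "level_one ?K" using K K1 by (auto simp: level_one_def)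
  then have "?K \<subseteq> Ha_sub p H" by (rule Ha_greatest)
  then show ?thesis using U_real zK by blast
qed

end

subsection \<open>Abelian varieties\<close>

lemma abelian_variety_transport:
  assumes V: "abelian_variety V L" and V': "C_space V'" and f: "f \<in> C_linear V V'"
    and bij: "bij_betw f (carrier V) (carrier V')" and L': "L' = f ` L"
  shows "abelian_variety V' L'"
proof -
  from V have sV: "C_space V" and L: "full_lattice \<real> V L" and ex: "\<exists>h. riemann_form V L h"
    by (simp_all add: abelian_variety_def complex_torus_def)
  interpret V: complex_space V by unfold_locales fact
  interpret V': complex_space V' by unfold_locales fact
  note fD = C_linearD[OF f]
  have inj: "inj_on f (carrier V)" and surj: "f ` carrier V = carrier V'"
    using bij by (auto simp: bij_betw_def)
  obtain n v where v: "\<forall>i<n. v i \<in> carrier V" "L = zspan V v n"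
    and sp: "\<forall>x\<in>carrier V. \<exists>c. (\<forall>i<n. c i \<in> \<real>) \<and> x = comb V v c n"
    and ind: "\<forall>c. (\<forall>i<n. c i \<in> \<real>) \<longrightarrow> comb V v c n = \<zero>\<^bsub>V\<^esub> \<longrightarrow> (\<forall>i<n. c i = 0)"
    by (rule V.full_latticeE[OF L]) auto
  have fc: "comb V' (\<lambda>i. f (v i)) c n = f (comb V v c n)" for c
    by (rule C_linear_comb[OF f sV V' v(1), symmetric])
  have "full_lattice \<real> V' (zspan V' (\<lambda>i. f (v i)) n)"
  proof (rule V'.full_latticeI)
    show "\<forall>x\<in>carrier V'. \<exists>c. (\<forall>i<n. c i \<in> \<real>) \<and> x = comb V' (\<lambda>i. f (v i)) c n"
    proof
      fix x assume "x \<in> carrier V'"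
      then obtain y where y: "y \<in> carrier V" "x = f y" unfolding surj[symmetric] by blast
      obtain c where "\<forall>i<n. c i \<in> \<real>" "y = comb V v c n" using bspec[OF sp y(1)] by blast
      then show "\<exists>c. (\<forall>i<n. c i \<in> \<real>) \<and> x = comb V' (\<lambda>i. f (v i)) c n"
        unfolding fc using y(2) by blast
    qed
    show "\<forall>c. (\<forall>i<n. c i \<in> \<real>) \<longrightarrow> comb V' (\<lambda>i. f (v i)) c n = \<zero>\<^bsub>V'\<^esub> \<longrightarrow> (\<forall>i<n. c i = 0)"
    proof (intro allI impI)
      fix c i assume c: "\<forall>i<n. c i \<in> \<real>" "comb V' (\<lambda>i. f (v i)) c n = \<zero>\<^bsub>V'\<^esub>" "i < n"
      then have "f (comb V v c n) = f \<zero>\<^bsub>V\<^esub>" using C_linear_zero[OF f sV V'] by (simp add: fc)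
      then have "comb V v c n = \<zero>\<^bsub>V\<^esub>" using inj V.comb_closed[OF v(1)] by (simp add: inj_on_eq_iff)
      then show "c i = 0" using ind c by blast
    qed
  qed (use v fD in \<open>auto elim!: Ints_cases\<close>)
  moreover have "zspan V' (\<lambda>i. f (v i)) n = L'"
    by (simp add: L' v(2) zspan_def fc image_image)
  ultimately have torus: "complex_torus V' L'" using V' by (simp add: complex_torus_def)
  define \<psi> where "\<psi> = inv_into (carrier V) f"
  have psi: "\<psi> x \<in> carrier V" "f (\<psi> x) = x" if "x \<in> carrier V'" for x
    using that surj by (auto simp: \<psi>_def inv_into_into f_inv_into_f)
  have psi_f: "\<psi> (f x) = x" if "x \<in> carrier V" for x using inj that by (simp add: \<psi>_def)
  have psi_add: "\<psi> (x \<oplus>\<^bsub>V'\<^esub> y) = \<psi> x \<oplus>\<^bsub>V\<^esub> \<psi> y" if "x \<in> carrier V'" "y \<in> carrier V'" for x y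
    using psi_f[of "\<psi> x \<oplus>\<^bsub>V\<^esub> \<psi> y"] psi[OF that(1)] psi[OF that(2)] fD by simp
  have psi_smult: "\<psi> (c \<odot>\<^bsub>V'\<^esub> x) = c \<odot>\<^bsub>V\<^esub> \<psi> x" if "x \<in> carrier V'" for c x
    using psi_f[of "c \<odot>\<^bsub>V\<^esub> \<psi> x"] psi[OF that] fD by simp
  have psi_0: "\<psi> x = \<zero>\<^bsub>V\<^esub> \<Longrightarrow> x = \<zero>\<^bsub>V'\<^esub>" if "x \<in> carrier V'" for x
    using psi(2)[OF that] C_linear_zero[OF f sV V'] by simp
  obtain h where h: "riemann_form V L h" using ex by blast
  note h = h[unfolded riemann_form_def]
  have h_add: "h (x \<oplus>\<^bsub>V\<^esub> y) z = h x z + h y z" if "x \<in> carrier V" "y \<in> carrier V" "z \<in> carrier V" for x y z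
    using h that by blast
  have h_smult: "h (c \<odot>\<^bsub>V\<^esub> x) y = c * h x y" if "x \<in> carrier V" "y \<in> carrier V" for c x y
    using h that by blast
  have h_sym: "h y x = cnj (h x y)" if "x \<in> carrier V" "y \<in> carrier V" for x y using h that by blast
  have h_pos: "Re (h x x) > 0" if "x \<in> carrier V" "x \<noteq> \<zero>\<^bsub>V\<^esub>" for x using h that by blast
  have h_int: "Im (h x y) \<in> \<int>" if "x \<in> L" "y \<in> L" for x y using h that by blast
  have Lc: "x \<in> carrier V" if "x \<in> L" for x
    using V.zspan_subgroup[OF v(1)] v(2) that by (auto simp: V.subgroup_iff)
  have "riemann_form V' L' (\<lambda>x y. h (\<psi> x) (\<psi> y))"
    unfolding riemann_form_def
  proof (intro conjI ballI allI)
    fix x y assume xy: "x \<in> carrier V'" "y \<in> carrier V'"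
    note p = psi(1)[OF xy(1)] psi(1)[OF xy(2)]
    show "h (\<psi> (x \<oplus>\<^bsub>V'\<^esub> y)) (\<psi> z) = h (\<psi> x) (\<psi> z) + h (\<psi> y) (\<psi> z)" if "z \<in> carrier V'" for z
      using h_add[OF p psi(1)[OF that]] by (simp add: psi_add[OF xy])
    show "h (\<psi> (c \<odot>\<^bsub>V'\<^esub> x)) (\<psi> y) = c * h (\<psi> x) (\<psi> y)" for c
      using h_smult[OF p] by (simp add: psi_smult[OF xy(1)])
    show "h (\<psi> y) (\<psi> x) = cnj (h (\<psi> x) (\<psi> y))" by (rule h_sym[OF p])
  next
    fix x assume x: "x \<in> carrier V' - {\<zero>\<^bsub>V'\<^esub>}"
    then have "\<psi> x \<noteq> \<zero>\<^bsub>V\<^esub>" using psi_0[of x] by auto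
    with x show "Re (h (\<psi> x) (\<psi> x)) > 0" using psi(1)[of x] by (intro h_pos) simp_all
  next
    fix x y assume "x \<in> L'" "y \<in> L'"
    then obtain a b where "a \<in> L" "x = f a" "b \<in> L" "y = f b" unfolding L' by blast
    then show "Im (h (\<psi> x) (\<psi> y)) \<in> \<int>" using psi_f[OF Lc] h_int by simp
  qed
  with torus show ?thesis by (auto simp: abelian_variety_def)
qed

lemma polarizationD:
  fixes G (structure)
  assumes "polarization G n S"
  shows "x \<in> carrier G \<Longrightarrow> y \<in> carrier G \<Longrightarrow> z \<in> carrier G \<Longrightarrow> S (x \<oplus> y) z = S x z + S y z"
    and "x \<in> carrier G \<Longrightarrow> y \<in> carrier G \<Longrightarrow> S (c \<odot> x) y = c * S x y"
    and "x \<in> carrier G \<Longrightarrow> y \<in> carrier G \<Longrightarrow> S y x = (- 1) powi n * S x y"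
    and "x \<in> HZ G \<Longrightarrow> y \<in> HZ G \<Longrightarrow> S x y \<in> \<int>"
    and "a + b = n \<Longrightarrow> a' + b' = n \<Longrightarrow> (a', b') \<noteq> (b, a) \<Longrightarrow> x \<in> hodge_comp G a b \<Longrightarrow>
      y \<in> hodge_comp G a' b' \<Longrightarrow> S x y = 0"
    and "a + b = n \<Longrightarrow> x \<in> hodge_comp G a b - {\<zero>} \<Longrightarrow>
      \<i> powi (a - b) * S x (cconj G x) \<in> \<real> \<and> Re (\<i> powi (a - b) * S x (cconj G x)) > 0"
proof -
  note S = assms[unfolded polarization_def]
  show "x \<in> carrier G \<Longrightarrow> y \<in> carrier G \<Longrightarrow> z \<in> carrier G \<Longrightarrow> S (x \<oplus> y) z = S x z + S y z"
    by (rule S[THEN conjunct1, rule_format])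
  note S = S[THEN conjunct2]
  show "x \<in> carrier G \<Longrightarrow> y \<in> carrier G \<Longrightarrow> S (c \<odot> x) y = c * S x y"
    by (rule S[THEN conjunct1, rule_format])
  note S = S[THEN conjunct2]
  show "x \<in> carrier G \<Longrightarrow> y \<in> carrier G \<Longrightarrow> S y x = (- 1) powi n * S x y"
    by (rule S[THEN conjunct1, rule_format])
  note S = S[THEN conjunct2]
  show "x \<in> HZ G \<Longrightarrow> y \<in> HZ G \<Longrightarrow> S x y \<in> \<int>" by (rule S[THEN conjunct1, rule_format])
  note S = S[THEN conjunct2]
  show "a + b = n \<Longrightarrow> a' + b' = n \<Longrightarrow> (a', b') \<noteq> (b, a) \<Longrightarrow> x \<in> hodge_comp G a b \<Longrightarrow>
      y \<in> hodge_comp G a' b' \<Longrightarrow> S x y = 0"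
    by (rule S[THEN conjunct1, rule_format, of a b a' b']) simp_all
  show "a + b = n \<Longrightarrow> x \<in> hodge_comp G a b - {\<zero>} \<Longrightarrow>
      \<i> powi (a - b) * S x (cconj G x) \<in> \<real> \<and> Re (\<i> powi (a - b) * S x (cconj G x)) > 0"
    by (rule S[THEN conjunct2, rule_format])
qed

context odd_hodge
begin

interpretation F: quotient_space H "Fil H p"
  by (rule quotient_space.intro[OF complex_space_axioms quotient_space_axioms.intro[OF Fil_subspace]])

text \<open>If \<open>H\<close> has level one, then complex conjugation identifies \<open>F\<^sup>p\<close> with \<open>H\<^sup>p\<^sup>-\<^sup>1\<^sup>,\<^sup>p\<close>, the tangent space
  of the intermediate Jacobian, and the polarization defines a Riemann form there.\<close>

lemma J_riemann_form:
  assumes lo: "carrier H \<subseteq> Fil H (p - 1)" and S: "polarization H (2 * p - 1) S"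
  shows "\<exists>h. riemann_form (J_space p H) (J_lattice p H) h"
proof -
  have odd: "(- 1) powi (2 * p - 1) = (-1 :: complex)"
    by (simp add: power_int_diff power_int_mult)
  note S_add = polarizationD(1)[OF S] and S_smult = polarizationD(2)[OF S]
    and S_HZ = polarizationD(4)[OF S]
  have S_alt: "S y x = - S x y" if "x \<in> carrier H" "y \<in> carrier H" for x y
    using polarizationD(3)[OF S that] odd by simp
  have S_type: "S x y = 0" if "x \<in> hodge_comp H (p - 1) p" "y \<in> hodge_comp H (p - 1) p" for x y
    by (rule polarizationD(5)[OF S _ _ _ that]) simp_all
  have S_pos: "Re (- \<i> * S x (\<sigma> x)) > 0" if "x \<in> hodge_comp H (p - 1) p" "x \<noteq> \<zero>" for x
    using polarizationD(6)[OF S, of "p - 1" p x] that by (simp add: power_int_minus)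
  have S_add': "S z (x \<oplus> y) = S z x + S z y" if "x \<in> carrier H" "y \<in> carrier H" "z \<in> carrier H" for x y z
    using S_alt[of "x \<oplus> y" z] S_alt[of x z] S_alt[of y z] S_add that by simp
  have S_smult': "S y (c \<odot> x) = c * S y x" if "x \<in> carrier H" "y \<in> carrier H" for c x y
    using S_alt[of "c \<odot> x" y] S_alt[of x y] S_smult that by simp
  have S_0: "S \<zero> y = 0" "S y \<zero> = 0" if "y \<in> carrier H" for y
    using S_smult[of \<zero> y 0] S_smult'[of \<zero> y 0] that by simp_all
  note HZs = full_lattice_span[OF lattice]
  \<comment> \<open>Integrality on the lattice makes \<open>S\<close> compatible with conjugation.
    This is shown for one lattice argument and then extended in the second argument, since the
    lattice spans.\<close>
  have S_cnj1: "cnj (S x y) = S (\<sigma> x) y" if y: "y \<in> HZ H" and x: "x \<in> carrier H" for x y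
  proof -
    note yc = HZ_closed[OF y]
    from x have "x \<in> C_span H (HZ H)" using HZs by simp
    then show ?thesis using HZ_subset
    proof (induction rule: C_span_induct)
      case (base x)
      then show ?case using S_HZ[OF base y] by (auto simp: conj_HZ elim!: Ints_cases)
    qed (simp_all add: HZs yc S_0 conj_zero S_add conj_add S_smult conj_smult)
  qed
  have S_cnj: "cnj (S x y) = S (\<sigma> x) (\<sigma> y)" if x: "x \<in> carrier H" and y: "y \<in> carrier H" for x y
  proof -
    from y have "y \<in> C_span H (HZ H)" using HZs by simp
    then show ?thesis using HZ_subset
    proof (induction rule: C_span_induct)
      case (base y)
      then show ?case using S_cnj1[OF base x] by (simp add: conj_HZ)
    qed (simp_all add: HZs x S_0 conj_zero S_add' conj_add S_smult' conj_smult)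
  qed
  have anti: "\<sigma> f \<in> hodge_comp H (p - 1) p" if "f \<in> Fil H p" for f
    using that Fil_closed[OF that] lo by (auto simp: hodge_comp_def)
  \<comment> \<open>\<open>k P\<close> is the vector of \<open>F\<^sup>p\<close> whose conjugate
    represents the tangent vector \<open>P\<close>. It is antilinear in \<open>P\<close>, which
    makes the form below sesquilinear.\<close>
  define k where "k P = (THE f. f \<in> Fil H p \<and> Fil H p +> \<sigma> f = P)" for P
  have k_eq: "k (Fil H p +> \<sigma> f) = f" if f: "f \<in> Fil H p" for f
    unfolding k_def
  proof (rule the_equality)
    fix f' assume f': "f' \<in> Fil H p \<and> Fil H p +> \<sigma> f' = Fil H p +> \<sigma> f"
    have c: "f \<in> carrier H" "f' \<in> carrier H" using f f' Fil_closed by auto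
    have "\<sigma> (f' \<ominus> f) \<in> Fil H p" using f' c by (simp add: J_eq conj_diff)
    then have "\<sigma> (f' \<ominus> f) = \<zero>" using Fp_real[of "\<sigma> (f' \<ominus> f)" "f' \<ominus> f"] f f' subspace_diff[OF Fil_subspace] by simp
    then have "\<sigma> f' = \<sigma> f" using c by (simp add: conj_diff diff_eq_zero_iff)
    then have "\<sigma> (\<sigma> f') = \<sigma> (\<sigma> f)" by simp
    then show "f' = f" using c by simp
  qed (simp add: f)
  have k_ex: "\<exists>f\<in>Fil H p. P = Fil H p +> \<sigma> f" if P: "P \<in> carrier (J_space p H)" for P
  proof -
    obtain x where x: "x \<in> carrier H" "P = Fil H p +> x" using P by (auto simp: J_carrier)
    obtain f f' where f: "f \<in> Fil H p" "f' \<in> Fil H p" "x = f \<oplus> \<sigma> f'" using Fp_decomp[OF x(1)] .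
    have c: "f \<in> carrier H" "\<sigma> f' \<in> carrier H" using f Fil_closed by auto
    have "x \<ominus> \<sigma> f' = f" unfolding f(3) by (rule add_diff_cancel[OF c])
    then have "P = Fil H p +> \<sigma> f'" using x c f by (simp add: J_eq)
    then show ?thesis using f by blast
  qed
  have k: "k P \<in> Fil H p" "Fil H p +> \<sigma> (k P) = P" if "P \<in> carrier (J_space p H)" for P
    using k_ex[OF that] k_eq by auto
  have k_add: "k (P \<oplus>\<^bsub>J_space p H\<^esub> R) = k P \<oplus> k R"
    if P: "P \<in> carrier (J_space p H)" and R: "R \<in> carrier (J_space p H)" for P R
  proof -
    have c: "k P \<in> carrier H" "k R \<in> carrier H" using k(1)[OF P] k(1)[OF R] Fil_closed by auto
    have "P \<oplus>\<^bsub>J_space p H\<^esub> R = (Fil H p +> \<sigma> (k P)) \<oplus>\<^bsub>J_space p H\<^esub> (Fil H p +> \<sigma> (k R))"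
      using k(2)[OF P] k(2)[OF R] by simp
    also have "\<dots> = Fil H p +> \<sigma> (k P \<oplus> k R)" using c by (simp add: J_add conj_add)
    finally show ?thesis using k_eq[OF subspace_add[OF Fil_subspace k(1)[OF P] k(1)[OF R]]] by simp
  qed
  have k_smult: "k (c \<odot>\<^bsub>J_space p H\<^esub> P) = cnj c \<odot> k P" if P: "P \<in> carrier (J_space p H)" for c P
  proof -
    have kc: "k P \<in> carrier H" using k(1)[OF P] Fil_closed by auto
    have "c \<odot>\<^bsub>J_space p H\<^esub> P = c \<odot>\<^bsub>J_space p H\<^esub> (Fil H p +> \<sigma> (k P))" using k(2)[OF P] by simp
    also have "\<dots> = Fil H p +> \<sigma> (cnj c \<odot> k P)" using kc by (simp add: J_smult conj_smult)
    finally show ?thesis using k_eq[OF subspace_smult[OF Fil_subspace k(1)[OF P], of "cnj c"]] by simp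
  qed
  have kc: "k P \<in> carrier H" if "P \<in> carrier (J_space p H)" for P using k(1)[OF that] Fil_closed by auto
  have k_HZ: "\<exists>x\<in>HZ H. x = \<sigma> (k P) \<oplus> k P \<and> P \<in> carrier (J_space p H)" if P: "P \<in> J_lattice p H" for P
  proof -
    obtain x where x: "x \<in> HZ H" "P = Fil H p +> x" using P by (auto simp: J_lattice_def)
    note xc = HZ_closed[OF x(1)]
    obtain f f' where f: "f \<in> Fil H p" "f' \<in> Fil H p" "x = f \<oplus> \<sigma> f'" using Fp_decomp[OF xc] .
    have c: "f \<in> carrier H" "f' \<in> carrier H" "\<sigma> f' \<in> carrier H" using f Fil_closed by auto
    have "\<sigma> x = f' \<oplus> \<sigma> f" unfolding f(3) using c by (simp add: conj_add a_comm)
    then have "f \<oplus> \<sigma> f' = f' \<oplus> \<sigma> f" using conj_HZ[OF x(1)] f(3) by simp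
    from Fp_unique(1)[OF f(1,2,2,1) this] have ff: "f = f'" .
    have "x \<ominus> \<sigma> f' = f" unfolding f(3) by (rule add_diff_cancel[OF c(1,3)])
    then have "P = Fil H p +> \<sigma> f'" using x xc c f by (simp add: J_eq)
    then have "k P = f'" using k_eq[OF f(2)] by simp
    then have "x = \<sigma> (k P) \<oplus> k P" using f(3) ff c by (simp add: a_comm)
    then show ?thesis using x xc by (auto simp: J_carrier)
  qed
  \<comment> \<open>The factor \<open>- \<i>\<close> is the sign
    \<open>\<i> powi ((p - 1) - p)\<close> of the polarization on
    \<open>H\<^sup>p\<^sup>-\<^sup>1\<^sup>,\<^sup>p\<close> and gives positivity. The factor 2
    comes from integrality: for lattice points the value of \<open>S\<close> is twice the real part
    of the mixed term, and this is minus the imaginary part of the form.\<close>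
  have "riemann_form (J_space p H) (J_lattice p H) (\<lambda>P R. - 2 * \<i> * S (\<sigma> (k P)) (k R))"
    unfolding riemann_form_def
  proof (intro conjI ballI allI)
    fix P R assume P: "P \<in> carrier (J_space p H)" and R: "R \<in> carrier (J_space p H)"
    note c = kc[OF P] kc[OF R]
    show "- 2 * \<i> * S (\<sigma> (k (P \<oplus>\<^bsub>J_space p H\<^esub> R))) (k Q)
        = - 2 * \<i> * S (\<sigma> (k P)) (k Q) + - 2 * \<i> * S (\<sigma> (k R)) (k Q)"
      if Q: "Q \<in> carrier (J_space p H)" for Q
      using c kc[OF Q] by (simp add: k_add[OF P R] conj_add S_add algebra_simps)
    show "- 2 * \<i> * S (\<sigma> (k (d \<odot>\<^bsub>J_space p H\<^esub> P))) (k R) = d * (- 2 * \<i> * S (\<sigma> (k P)) (k R))" for d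
      using c by (simp add: k_smult[OF P] conj_smult S_smult)
    show "- 2 * \<i> * S (\<sigma> (k R)) (k P) = cnj (- 2 * \<i> * S (\<sigma> (k P)) (k R))"
      using c S_cnj[of "\<sigma> (k P)" "k R"] S_alt[of "k P" "\<sigma> (k R)"] by simp
  next
    fix P assume "P \<in> carrier (J_space p H) - {\<zero>\<^bsub>J_space p H\<^esub>}"
    then have P: "P \<in> carrier (J_space p H)" and P0: "P \<noteq> \<zero>\<^bsub>J_space p H\<^esub>" by auto
    have "\<sigma> (k P) \<noteq> \<zero>"
    proof
      assume "\<sigma> (k P) = \<zero>"
      then have "P = \<zero>\<^bsub>J_space p H\<^esub>" unfolding J_zero using k(2)[OF P] by simp
      with P0 show False ..
    qed
    from S_pos[OF anti[OF k(1)[OF P]] this] show "Re (- 2 * \<i> * S (\<sigma> (k P)) (k P)) > 0"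
      using kc[OF P] by simp
  next
    fix P R assume P: "P \<in> J_lattice p H" and R: "R \<in> J_lattice p H"
    obtain x where x: "x \<in> HZ H" "x = \<sigma> (k P) \<oplus> k P" and P': "P \<in> carrier (J_space p H)"
      using k_HZ[OF P] by blast
    obtain y where y: "y \<in> HZ H" "y = \<sigma> (k R) \<oplus> k R" and R': "R \<in> carrier (J_space p H)"
      using k_HZ[OF R] by blast
    note c = kc[OF P'] kc[OF R']
    \<comment> \<open>By the condition on types \<open>S\<close> vanishes on two vectors of type
      \<open>(p - 1, p)\<close>, and by conjugation on two of type \<open>(p, p - 1)\<close>. Only
      the two mixed terms survive, and they are conjugate to each other.\<close>
    have z1: "S (\<sigma> (k P)) (\<sigma> (k R)) = 0" by (rule S_type[OF anti[OF k(1)[OF P']] anti[OF k(1)[OF R']]])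
    have z2: "S (k P) (k R) = 0" using S_cnj[of "\<sigma> (k P)" "\<sigma> (k R)"] z1 c by simp
    have z3: "S (k P) (\<sigma> (k R)) = cnj (S (\<sigma> (k P)) (k R))" using S_cnj[of "\<sigma> (k P)" "k R"] c by simp
    have "S x y = S (\<sigma> (k P)) (k R) + cnj (S (\<sigma> (k P)) (k R))"
      unfolding x(2) y(2) using c by (simp add: S_add S_add' z1 z2 z3)
    then have "S x y = of_real (2 * Re (S (\<sigma> (k P)) (k R)))" by (simp add: complex_add_cnj)
    moreover obtain m where "S x y = of_int m" using S_HZ[OF x(1) y(1)] by (auto elim: Ints_cases)
    ultimately have "of_real (2 * Re (S (\<sigma> (k P)) (k R))) = (of_real (of_int m) :: complex)" by simp
    then have "2 * Re (S (\<sigma> (k P)) (k R)) = of_int m" by (simp only: of_real_eq_iff)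
    then have "Im (- 2 * \<i> * S (\<sigma> (k P)) (k R)) = of_int (- m)" by simp
    then show "Im (- 2 * \<i> * S (\<sigma> (k P)) (k R)) \<in> \<int>" by (simp only: Ints_of_int)
  qed
  then show ?thesis by blast
qed

section \<open>The intermediate Jacobian of a level-one substructure inside that of the whole
  structure\<close>

lemma level_one_odd_hodge:
  assumes "level_one U"
  shows "odd_hodge (sub_mhs H U) p"
  using pure_spaceI[OF level_one_pure[OF assms]] level_one_pure[OF assms]
  by (intro odd_hodge.intro odd_hodge_axioms.intro) (simp_all add: pure_def)

lemma polarization_sub:
  assumes U: "rat_sub U" and S: "polarization H n S"
  shows "polarization (sub_mhs H U) n S"
proof -
  have hc: "hodge_comp (sub_mhs H U) a b \<subseteq> hodge_comp H a b" for a b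
    using sub_mhs_conj[OF U] by (auto simp: hodge_comp_def)
  have hU: "hodge_comp (sub_mhs H U) a b \<subseteq> U" for a b by (auto simp: hodge_comp_def)
  have c: "x \<in> carrier H" if "x \<in> U" for x by (rule rat_sub_closed[OF U that])
  show ?thesis
    unfolding polarization_def
  proof (intro conjI ballI allI impI)
    fix a b a' b' x y
    assume "a + b = n \<and> a' + b' = n \<and> (a', b') \<noteq> (b, a)"
      "x \<in> hodge_comp (sub_mhs H U) a b" "y \<in> hodge_comp (sub_mhs H U) a' b'"
    then show "S x y = 0" using polarizationD(5)[OF S, of a b a' b' x y] hc by blast
  next
    fix a b x assume *: "a + b = n" "x \<in> hodge_comp (sub_mhs H U) a b - {\<zero>\<^bsub>sub_mhs H U\<^esub>}"
    then have "x \<in> hodge_comp H a b - {\<zero>}" "x \<in> U" using subsetD[OF hc] subsetD[OF hU] by auto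
    then show "\<i> powi (a - b) * S x (cconj (sub_mhs H U) x) \<in> \<real>"
      "Re (\<i> powi (a - b) * S x (cconj (sub_mhs H U) x)) > 0"
      using polarizationD(6)[OF S *(1)] sub_mhs_conj[OF U] by simp_all
  next
    fix x y assume "x \<in> carrier (sub_mhs H U)" "y \<in> carrier (sub_mhs H U)"
    then have xy: "x \<in> carrier H" "y \<in> carrier H" using c by simp_all
    show "S y x = (- 1) powi n * S x y" by (rule polarizationD(3)[OF S xy])
  qed (use c in \<open>simp_all add: polarizationD(1,2,4)[OF S]\<close>)
qed

lemma level_one_abelian_variety:
  assumes U: "level_one U" and S: "polarizable H (2 * p - 1)"
  shows "abelian_variety (J_space p (sub_mhs H U)) (J_lattice p (sub_mhs H U))"
proof -
  interpret U: odd_hodge "sub_mhs H U" p by (rule level_one_odd_hodge[OF U])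
  obtain S where "polarization H (2 * p - 1) S" using S by (auto simp: polarizable_def)
  then have "polarization (sub_mhs H U) (2 * p - 1) S" using U by (intro polarization_sub) (auto simp: level_one_def)
  moreover have "carrier (sub_mhs H U) \<subseteq> Fil (sub_mhs H U) (p - 1)" using U by (simp add: level_one_def)
  ultimately have "\<exists>h. riemann_form (J_space p (sub_mhs H U)) (J_lattice p (sub_mhs H U)) h"
    by (rule U.J_riemann_form[rotated])
  then show ?thesis unfolding abelian_variety_def using U.J_complex_torus by blast
qed

text \<open>The linear map from \<open>U/(F\<^sup>p \<inter> U)\<close> to
  \<open>H/F\<^sup>p\<close> induced by the inclusion. A coset is sent to the larger coset
  containing it, which avoids choosing representatives.\<close>

definition J_incl :: "'a set \<Rightarrow> 'a set" where
  "J_incl P = set_add H (Fil H p) P"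

context
  fixes U assumes U: "level_one U"
begin

interpretation U: odd_hodge "sub_mhs H U" p by (rule level_one_odd_hodge[OF U])

lemmas level_one_rat = conjunct1[OF U[unfolded level_one_def]]

lemma level_one_closed: "x \<in> U \<Longrightarrow> x \<in> carrier H"
  by (rule rat_sub_closed[OF level_one_rat])

lemma J_incl_coset: "x \<in> U \<Longrightarrow> J_incl (Fil (sub_mhs H U) p +>\<^bsub>sub_mhs H U\<^esub> x) = Fil H p +> x"
proof -
  assume x: "x \<in> U"
  have xc: "x \<in> carrier H" by (rule level_one_closed[OF x])
  show ?thesis
  proof (rule Set.set_eqI)
    fix y
    have "y \<in> J_incl (Fil (sub_mhs H U) p +>\<^bsub>sub_mhs H U\<^esub> x) \<longleftrightarrow>
        (\<exists>f\<in>Fil H p. \<exists>f'\<in>Fil H p \<inter> U. y = f \<oplus> (f' \<oplus> x))"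
      by (auto simp: J_incl_def set_add_eq a_r_coset_def' )
    also have "\<dots> \<longleftrightarrow> (\<exists>f\<in>Fil H p. y = f \<oplus> x)"
    proof safe
      fix f f' assume f: "f \<in> Fil H p" "f' \<in> Fil H p" "f' \<in> U"
      have "f \<oplus> (f' \<oplus> x) = (f \<oplus> f') \<oplus> x" using f Fil_closed xc by (simp add: a_assoc)
      then show "\<exists>h\<in>Fil H p. f \<oplus> (f' \<oplus> x) = h \<oplus> x" using subspace_add[OF Fil_subspace f(1,2)] by blast
    next
      fix f assume f: "f \<in> Fil H p"
      have "\<zero> \<in> Fil H p \<inter> U"
        using subspace_zero[OF Fil_subspace] subspace_zero[OF rat_sub_subspace[OF level_one_rat]] by simp
      moreover have "f \<oplus> x = f \<oplus> (\<zero> \<oplus> x)" using xc by simp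
      ultimately show "\<exists>h\<in>Fil H p. \<exists>f'\<in>Fil H p \<inter> U. f \<oplus> x = h \<oplus> (f' \<oplus> x)" using f by blast
    qed
    finally show "y \<in> J_incl (Fil (sub_mhs H U) p +>\<^bsub>sub_mhs H U\<^esub> x) \<longleftrightarrow> y \<in> Fil H p +> x"
      by (auto simp: a_r_coset_def')
  qed
qed

lemmas J_incl_coset' = J_incl_coset[simplified]

lemma J_incl_linear: "J_incl \<in> C_linear (J_space p (sub_mhs H U)) (J_space p H)"
proof (rule C_linearI)
  fix P assume P: "P \<in> carrier (J_space p (sub_mhs H U))"
  then obtain x where x: "x \<in> U" "P = Fil (sub_mhs H U) p +>\<^bsub>sub_mhs H U\<^esub> x" by (auto simp: U.J_carrier)
  then show "J_incl P \<in> carrier (J_space p H)" using level_one_closed by (simp add: J_incl_coset' J_carrier)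
  have cx: "c \<odot> x \<in> U" for c using subspace_smult[OF rat_sub_subspace[OF level_one_rat] x(1)] .
  show "J_incl (c \<odot>\<^bsub>J_space p (sub_mhs H U)\<^esub> P) = c \<odot>\<^bsub>J_space p H\<^esub> J_incl P" for c
    using x U.J_smult[of x c] J_incl_coset'[OF cx[of c]] level_one_closed[OF x(1)]
    by (simp add: J_incl_coset' J_smult)
  fix R assume "R \<in> carrier (J_space p (sub_mhs H U))"
  then obtain y where y: "y \<in> U" "R = Fil (sub_mhs H U) p +>\<^bsub>sub_mhs H U\<^esub> y" by (auto simp: U.J_carrier)
  have xy: "x \<oplus> y \<in> U" using subspace_add[OF rat_sub_subspace[OF level_one_rat] x(1) y(1)] .
  show "J_incl (P \<oplus>\<^bsub>J_space p (sub_mhs H U)\<^esub> R) = J_incl P \<oplus>\<^bsub>J_space p H\<^esub> J_incl R"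
    using x y U.J_add[of x y] J_incl_coset'[OF xy] level_one_closed
    by (simp add: J_incl_coset' J_add)
qed

lemma J_incl_inj: "inj_on J_incl (carrier (J_space p (sub_mhs H U)))"
proof (rule inj_onI)
  fix P R assume "P \<in> carrier (J_space p (sub_mhs H U))" "R \<in> carrier (J_space p (sub_mhs H U))"
    and eq: "J_incl P = J_incl R"
  then obtain x y where x: "x \<in> U" "P = Fil (sub_mhs H U) p +>\<^bsub>sub_mhs H U\<^esub> x"
    and y: "y \<in> U" "R = Fil (sub_mhs H U) p +>\<^bsub>sub_mhs H U\<^esub> y" by (auto simp: U.J_carrier)
  note c = level_one_closed[OF x(1)] level_one_closed[OF y(1)]
  have "Fil H p +> x = Fil H p +> y" using eq x y J_incl_coset by metis
  then have "x \<ominus> y \<in> Fil H p" using c by (simp add: J_eq)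
  moreover have "x \<ominus> y \<in> U" by (rule subspace_diff[OF rat_sub_subspace[OF level_one_rat] x(1) y(1)])
  moreover have "x \<ominus>\<^bsub>sub_mhs H U\<^esub> y = x \<ominus> y" using x y c U.diff_eq[of x y] by (simp add: diff_eq)
  ultimately show "P = R" using x y U.J_eq[of x y] by simp
qed

lemma J_incl_image: "J_incl ` carrier (J_space p (sub_mhs H U)) = (\<lambda>x. Fil H p +> x) ` U"
  unfolding U.J_carrier image_image by (rule image_cong) (use J_incl_coset in simp_all)

text \<open>Write \<open>u = f \<oplus> \<sigma> f'\<close> inside \<open>U\<close> and let
  \<open>h\<close> be the difference of \<open>x\<close> and \<open>u\<close>. Then \<open>x\<close>
  has the components \<open>h \<oplus> f\<close> and \<open>f'\<close> in \<open>F\<^sup>p\<close>.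
  As \<open>x\<close> is fixed by conjugation, uniqueness of the splitting makes them equal, and
  \<open>x = f' \<oplus> \<sigma> f'\<close> lies in \<open>U\<close>.\<close>

lemma level_one_HZ:
  assumes "x \<in> HZ H" "u \<in> U" "x \<ominus> u \<in> Fil H p"
  shows "x \<in> U"
proof -
  obtain f f' where f: "f \<in> Fil H p \<inter> U" "f' \<in> Fil H p \<inter> U" "u = f \<oplus> \<sigma> f'"
    using U assms(2) unfolding level_one_def by blast
  note xc = HZ_closed[OF assms(1)] and uc = level_one_closed[OF assms(2)]
  have c: "f \<in> carrier H" "f' \<in> carrier H" "\<sigma> f' \<in> carrier H" using f Fil_closed by auto
  define h where "h = x \<ominus> u"
  have h: "h \<in> Fil H p" "h \<in> carrier H" using assms(3) xc uc by (simp_all add: h_def)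
  have "x = (h \<oplus> f) \<oplus> \<sigma> f'"
  proof -
    have "x = h \<oplus> u" unfolding h_def using xc uc by (simp add: diff_add_cancel)
    then show ?thesis unfolding f(3) using h c by (simp add: a_assoc)
  qed
  moreover have hf: "h \<oplus> f \<in> Fil H p" using f h by (intro subspace_add[OF Fil_subspace]) auto
  moreover have "\<sigma> x = f' \<oplus> \<sigma> (h \<oplus> f)"
    using calculation(1) h c by (simp add: conj_add a_comm)
  ultimately have "(h \<oplus> f) \<oplus> \<sigma> f' = f' \<oplus> \<sigma> (h \<oplus> f)" using conj_HZ[OF assms(1)] by simp
  from Fp_unique(1)[OF hf _ _ hf this] f have "h \<oplus> f = f'" by simp
  then have "x = f' \<oplus> \<sigma> f'" using \<open>x = (h \<oplus> f) \<oplus> \<sigma> f'\<close> by simp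
  then show "x \<in> U"
    using f rat_sub_conj[OF level_one_rat] subspace_add[OF rat_sub_subspace[OF level_one_rat]] by simp
qed

text \<open>A lattice point of \<open>H\<close> whose coset comes from \<open>U\<close> is itself in
  \<open>U\<close> by \<open>level_one_HZ\<close>. So the lattice of the smaller torus is the whole
  intersection, and the map of tori is injective.\<close>

lemma J_incl_lattice:
  "J_incl ` J_lattice p (sub_mhs H U) = J_lattice p H \<inter> (\<lambda>x. Fil H p +> x) ` U"
proof (rule equalityI; rule subsetI)
  fix P assume "P \<in> J_incl ` J_lattice p (sub_mhs H U)"
  then obtain x where x: "x \<in> HZ H" "x \<in> U" "P = J_incl (Fil (sub_mhs H U) p +>\<^bsub>sub_mhs H U\<^esub> x)"
    by (auto simp: J_lattice_def)
  then show "P \<in> J_lattice p H \<inter> (\<lambda>x. Fil H p +> x) ` U"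
    using J_incl_coset[OF x(2)] by (auto simp: J_lattice_def)
next
  fix P assume "P \<in> J_lattice p H \<inter> (\<lambda>x. Fil H p +> x) ` U"
  then obtain x u where x: "x \<in> HZ H" "P = Fil H p +> x" and u: "u \<in> U" "Fil H p +> x = Fil H p +> u"
    by (auto simp: J_lattice_def)
  have xU: "x \<in> U"
    using level_one_HZ[OF x(1) u(1)] u(2) HZ_closed[OF x(1)] level_one_closed[OF u(1)] by (simp add: J_eq)
  have "P = J_incl (Fil (sub_mhs H U) p +>\<^bsub>sub_mhs H U\<^esub> x)" using x J_incl_coset[OF xU] by simp
  then show "P \<in> J_incl ` J_lattice p (sub_mhs H U)" using x xU by (auto simp: J_lattice_def)
qed

lemma level_one_abelian_subvariety:
  assumes S: "polarizable H (2 * p - 1)"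
  shows "abelian_subvariety (J_space p H) (J_lattice p H) (J_horizontal p H) (pt ` U)"
  unfolding abelian_subvariety_def
proof (intro exI[of _ "(\<lambda>x. Fil H p +> x) ` U"] conjI)
  let ?U = "(\<lambda>x. Fil H p +> x) ` U"
  note sU = rat_sub_subspace[OF level_one_rat]
  show sub: "C_subspace ?U (J_space p H)"
  proof (rule J.subspaceI)
    show "?U \<subseteq> carrier (J_space p H)" using level_one_closed by (auto simp: J_carrier)
    show "\<zero>\<^bsub>J_space p H\<^esub> \<in> ?U" unfolding J_zero using subspace_zero[OF sU] by blast
    fix P assume "P \<in> ?U"
    then obtain x where x: "x \<in> U" "P = Fil H p +> x" by blast
    then show "c \<odot>\<^bsub>J_space p H\<^esub> P \<in> ?U" for c
      using subspace_smult[OF sU x(1), of c] level_one_closed[OF x(1)] by (simp add: J_smult)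
    fix R assume "R \<in> ?U"
    then obtain y where y: "y \<in> U" "R = Fil H p +> y" by blast
    show "P \<oplus>\<^bsub>J_space p H\<^esub> R \<in> ?U"
      using x y subspace_add[OF sU x(1) y(1)] level_one_closed by (simp add: J_add)
  qed
  show "?U \<subseteq> J_horizontal p H" using U by (auto simp: level_one_def J_horizontal_def)
  show "pt ` U = (\<lambda>u. J_lattice p H +>\<^bsub>J_space p H\<^esub> u) ` ?U" by (simp add: pt_def image_image)
  have lin: "J_incl \<in> C_linear (J_space p (sub_mhs H U)) (sub_space (J_space p H) ?U)"
    using J_incl_linear J_incl_image by (auto simp: C_linear_def sub_space_def)
  have bij: "bij_betw J_incl (carrier (J_space p (sub_mhs H U))) (carrier (sub_space (J_space p H) ?U))"
    using J_incl_inj J_incl_image by (simp add: bij_betw_def sub_space_def)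
  have "C_space (sub_space (J_space p H) ?U)"
    unfolding sub_space_def by (rule J.C_space_sub[OF sub])
  then show "abelian_variety (sub_space (J_space p H) ?U) (J_lattice p H \<inter> ?U)"
    by (rule abelian_variety_transport[OF level_one_abelian_variety[OF U S] _ lin bij J_incl_lattice[symmetric]])
qed

end

lemma abelian_subvariety_subset:
  assumes "abelian_subvariety (J_space p H) (J_lattice p H) (J_horizontal p H) B"
  shows "B \<subseteq> pt ` Ha_sub p H"
proof -
  from assms obtain U where U: "C_subspace U (J_space p H)" "U \<subseteq> J_horizontal p H"
    and av: "abelian_variety (sub_space (J_space p H) U) (J_lattice p H \<inter> U)"
    and B: "B = (\<lambda>u. J_lattice p H +>\<^bsub>J_space p H\<^esub> u) ` U" unfolding abelian_subvariety_def by blast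
  from av have "full_lattice \<real> (sub_space (J_space p H) U) (J_lattice p H \<inter> U)"
    by (simp add: abelian_variety_def complex_torus_def)
  then have "U \<subseteq> (\<lambda>x. Fil H p +> x) ` Ha_sub p H" by (rule horizontal_subtorus[OF U])
  then have "B \<subseteq> (\<lambda>u. J_lattice p H +>\<^bsub>J_space p H\<^esub> u) ` (\<lambda>x. Fil H p +> x) ` Ha_sub p H"
    unfolding B by (rule image_mono)
  also have "\<dots> = pt ` Ha_sub p H" by (simp add: image_image pt_def)
  finally show ?thesis .
qed

end

subsection \<open>Preimages of sub-Hodge structures\<close>

text \<open>\<open>subquot_preimage\<close> is an equality of records, so the ring fields, which
  mean nothing for modules, have to agree too.\<close>

lemma mhs_other_fields:
  "monoid.mult (sub_mhs H U) = monoid.mult H" "one (sub_mhs H U) = one H" "mhs.more (sub_mhs H U) = mhs.more H"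
  "monoid.mult (quot_mhs H N) = undefined" "one (quot_mhs H N) = undefined" "mhs.more (quot_mhs H N) = ()"
  by (simp_all add: sub_mhs_def quot_mhs_def quot_space_def module.defs)

context subquotient
begin

definition preimage :: "'a set set \<Rightarrow> 'a set" where
  "preimage R = {x \<in> U. N +> x \<in> R}"

lemma N_preimage:
  assumes "C_subspace R Q"
  shows "N \<subseteq> preimage R"
proof
  fix x assume x: "x \<in> N"
  then have "N +> x = \<zero>\<^bsub>Q\<^esub>" by (simp add: Q_zero quot.coset_zero)
  then show "x \<in> preimage R" using x NU Q.subspace_zero[OF assms] by (auto simp: preimage_def)
qed

lemma preimage_subspace:
  assumes R: "C_subspace R Q"
  shows "C_subspace (preimage R) H"
proof (rule subspaceI)
  show "preimage R \<subseteq> carrier H" using U_closed by (auto simp: preimage_def)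
  show "\<zero> \<in> preimage R" using N_preimage[OF R] subspace_zero[OF subN] by blast
  fix x assume x: "x \<in> preimage R"
  then show "c \<odot> x \<in> preimage R" for c
    using Q.subspace_smult[OF R, of "N +> x" c] subspace_smult[OF subU, of x c]
    by (simp add: preimage_def Q_smult U_closed)
  fix y assume "y \<in> preimage R"
  with x show "x \<oplus> y \<in> preimage R"
    using Q.subspace_add[OF R, of "N +> x" "N +> y"] subspace_add[OF subU, of x y]
    by (simp add: preimage_def Q_add U_closed)
qed

text \<open>The span of the lattice points of the preimage contains \<open>N\<close>, which is
  rational, and it maps onto \<open>R\<close>, because lattice points of the quotient lift to
  lattice points of \<open>U\<close>.\<close>

lemma preimage_rat_sub:
  assumes R: "Q.rat_sub R"
  shows "rat_sub (preimage R)"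
proof (rule rat_subI)
  note sR = Q.rat_sub_subspace[OF R]
  show "C_subspace (preimage R) H" by (rule preimage_subspace[OF sR])
  let ?S = "C_span H (HZ H \<inter> preimage R)"
  have sS: "C_subspace ?S H" using HZ_subset by (intro C_span_subspace) auto
  have SX: "?S \<subseteq> preimage R" by (rule C_span_minimal[OF preimage_subspace[OF sR]]) simp
  have SU: "x \<in> U" if "x \<in> ?S" for x using SX that by (auto simp: preimage_def)
  have NS: "N \<subseteq> ?S"
  proof -
    have "HZ H \<inter> N \<subseteq> HZ H \<inter> preimage R" using N_preimage[OF sR] by blast
    from C_span_mono[OF this] show ?thesis using rN by (simp add: rat_sub_def)
  qed
  have "C_subspace ((\<lambda>x. N +> x) ` (?S \<inter> U)) Q" by (rule Q_C_subspace[OF sS])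
  moreover have "HZ Q \<inter> R \<subseteq> (\<lambda>x. N +> x) ` (?S \<inter> U)"
  proof
    fix P assume P: "P \<in> HZ Q \<inter> R"
    then obtain z where z: "z \<in> HZ H" "z \<in> U" "P = N +> z" by (auto simp: Q_HZ)
    then have "z \<in> HZ H \<inter> preimage R" using P by (simp add: preimage_def)
    from subsetD[OF C_span_superset this] z show "P \<in> (\<lambda>x. N +> x) ` (?S \<inter> U)" by blast
  qed
  ultimately have "C_span Q (HZ Q \<inter> R) \<subseteq> (\<lambda>x. N +> x) ` (?S \<inter> U)" by (rule Q.C_span_minimal)
  then have RS: "R \<subseteq> (\<lambda>x. N +> x) ` (?S \<inter> U)" using R by (simp add: Q.rat_sub_def)
  show "preimage R \<subseteq> ?S"
  proof
    fix x assume x: "x \<in> preimage R"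
    then have xU: "x \<in> U" and "N +> x \<in> R" by (auto simp: preimage_def)
    then obtain y where y: "y \<in> ?S" "y \<in> U" "N +> x = N +> y" using RS by blast
    then have "x \<ominus> y \<in> ?S" using NS xU Q_eq by blast
    from subspace_add[OF sS this y(1)] show "x \<in> ?S"
      using U_closed[OF xU] U_closed[OF y(2)] by (simp add: diff_add_cancel)
  qed
qed

lemma image_preimage: "R \<subseteq> carrier Q \<Longrightarrow> (\<lambda>x. N +> x) ` (S \<inter> preimage R) = (\<lambda>x. N +> x) ` (S \<inter> U) \<inter> R"
  by (auto simp: preimage_def)

text \<open>An equality and not just an isomorphism:
  \<open>H'/W\<^sub>2\<^sub>p\<^sub>-\<^sub>2\<close> is literally the substructure of the graded
  piece on \<open>HA\<close>, and results on level-one substructures apply to it directly.\<close>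

lemma subquot_preimage:
  assumes R: "R \<subseteq> carrier Q"
  shows "subquot H (preimage R) N = sub_mhs Q R"
proof -
  have "carrier (subquot H (preimage R) N) = (\<lambda>x. N +> x) ` preimage R"
    by (auto simp: subquot_def quot_space_def A_RCOSETS_def')
  also have "\<dots> = R" using R unfolding Q_carrier by (auto simp: preimage_def)
  finally have "carrier (subquot H (preimage R) N) = R" .
  moreover have "HZ (subquot H (preimage R) N) = HZ Q \<inter> R"
    "Wt (subquot H (preimage R) N) = (\<lambda>k. Wt Q k \<inter> R)" "Fil (subquot H (preimage R) N) = (\<lambda>k. Fil Q k \<inter> R)"
    using image_preimage[OF R] by (auto simp: subquot_def fun_eq_iff)
  ultimately show ?thesis
    by (intro mhs.equality) (simp_all add: subquot_def quot_space_def mhs_other_fields fun_eq_iff)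
qed

end

lemma (in quotient_space) set_add_coset:
  assumes "C_subspace M V" "N \<subseteq> M" "x \<in> carrier V"
  shows "set_add V M (N +> x) = M +> x"
proof -
  interpret M: quotient_space V M
    by (rule quotient_space.intro[OF complex_space_axioms quotient_space_axioms.intro[OF assms(1)]])
  show ?thesis
  proof (rule equalityI; rule subsetI)
    fix y assume "y \<in> set_add V M (N +> x)"
    then obtain m k where m: "m \<in> M" "k \<in> N" "y = m \<oplus> (k \<oplus> x)" by (auto simp: set_add_eq a_r_coset_def')
    then have "y = (m \<oplus> k) \<oplus> x" using assms by (simp add: a_assoc)
    moreover have "m \<oplus> k \<in> M" using m assms(2) subspace_add[OF assms(1)] by blast
    ultimately show "y \<in> M +> x" by (auto simp: a_r_coset_def')
  next
    fix y assume "y \<in> M +> x"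
    then obtain m where m: "m \<in> M" "y = m \<oplus> x" by (auto simp: a_r_coset_def')
    moreover have "x \<in> N +> x" using assms(3) by (simp add: mem_coset subspace_zero[OF N])
    ultimately show "y \<in> set_add V M (N +> x)" unfolding set_add_eq by blast
  qed
qed

subsection \<open>Homomorphisms from a Tate structure\<close>

lemma tate_hom_eval:
  assumes "f \<in> mhs_hom (tate (- p)) C"
  shows "f t = (t / tate_gen (- p)) \<odot>\<^bsub>C\<^esub> f (tate_gen (- p))"
  using C_linearD(3)[OF mhs_mapD(1), of "tate (- p)" C f "tate_gen (- p)" "t / tate_gen (- p)"] assms
  by (simp add: mhs_hom_iff)

lemma tate_hom_eqI:
  assumes "f \<in> mhs_hom (tate (- p)) C" "f' \<in> mhs_hom (tate (- p)) C"
    "f (tate_gen (- p)) = f' (tate_gen (- p))"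
  shows "f = f'"
proof
  fix t show "f t = f' t" using tate_hom_eval[OF assms(1), of t] tate_hom_eval[OF assms(2), of t] assms(3) by simp
qed

lemma Hom_simps:
  "carrier (Hom A B) = mhs_hom A B" "f \<otimes>\<^bsub>Hom A B\<^esub> h = (\<lambda>x\<in>carrier A. f x \<oplus>\<^bsub>B\<^esub> h x)"
  "\<one>\<^bsub>Hom A B\<^esub> = (\<lambda>x\<in>carrier A. \<zero>\<^bsub>B\<^esub>)"
  by (simp_all add: Hom_def)

text \<open>The exact sequence with terms \<open>M/N\<close>, \<open>U/N\<close> and
  \<open>U/M\<close>. It is used twice, with the weight filtration for \<open>e\<^sup>p\<close> and
  with \<open>H'\<close> and \<open>H''\<close> in place of \<open>M\<close> and \<open>U\<close>
  for \<open>h\<^sup>p\<close>.\<close>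

locale three_step = filtered_lattice H for H :: "'a mhs" (structure) +
  fixes N M U
  assumes rN: "rat_sub N" and rM: "rat_sub M" and rU: "rat_sub U" and NM: "N \<subseteq> M" and MU: "M \<subseteq> U"
begin

sublocale A: subquotient H M N
  by (intro subquotient.intro subquotient_axioms.intro lattice_space_axioms rN rM NM)

sublocale E: subquotient H U N
  using MU NM by (intro subquotient.intro subquotient_axioms.intro lattice_space_axioms rN rU) auto

sublocale C: subquotient H U M
  by (intro subquotient.intro subquotient_axioms.intro lattice_space_axioms rM rU MU)

lemma induced_coset:
  "x \<in> U \<Longrightarrow> induced H U N M (N +> x) = M +> x"
  "x \<in> M \<Longrightarrow> induced H M N N (N +> x) = N +> x"
  using A.quot.set_add_coset[OF A.subU NM] A.quot.set_add_coset[OF A.subN order_refl]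
  by (simp_all add: induced_def E.Q_closed A.Q_closed E.U_closed A.U_closed)

lemma MU': "x \<in> M \<Longrightarrow> x \<in> U"
  using MU by blast

lemma induced_linear:
  "induced H U N M \<in> C_linear E.Q C.Q" "induced H M N N \<in> C_linear A.Q E.Q"
proof -
  show "induced H U N M \<in> C_linear E.Q C.Q"
  proof (rule C_linearI)
    fix P assume P: "P \<in> carrier E.Q"
    then obtain x where x: "x \<in> U" "P = N +> x" by (auto simp: E.Q_carrier)
    then show "induced H U N M P \<in> carrier C.Q" by (simp add: induced_coset C.Q_closed)
    show "induced H U N M (c \<odot>\<^bsub>E.Q\<^esub> P) = c \<odot>\<^bsub>C.Q\<^esub> induced H U N M P" for c
      using x subspace_smult[OF E.subU x(1), of c] by (simp add: induced_coset E.Q_smult C.Q_smult E.U_closed)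
    fix R assume "R \<in> carrier E.Q"
    then obtain y where y: "y \<in> U" "R = N +> y" by (auto simp: E.Q_carrier)
    show "induced H U N M (P \<oplus>\<^bsub>E.Q\<^esub> R) = induced H U N M P \<oplus>\<^bsub>C.Q\<^esub> induced H U N M R"
      using x y subspace_add[OF E.subU x(1) y(1)] by (simp add: induced_coset E.Q_add C.Q_add E.U_closed)
  qed
  show "induced H M N N \<in> C_linear A.Q E.Q"
  proof (rule C_linearI)
    fix P assume P: "P \<in> carrier A.Q"
    then obtain x where x: "x \<in> M" "P = N +> x" by (auto simp: A.Q_carrier)
    then show "induced H M N N P \<in> carrier E.Q" by (simp add: induced_coset E.Q_closed MU')
    show "induced H M N N (c \<odot>\<^bsub>A.Q\<^esub> P) = c \<odot>\<^bsub>E.Q\<^esub> induced H M N N P" for c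
      using x subspace_smult[OF A.subU x(1), of c] by (simp add: induced_coset E.Q_smult A.Q_smult A.U_closed)
    fix R assume "R \<in> carrier A.Q"
    then obtain y where y: "y \<in> M" "R = N +> y" by (auto simp: A.Q_carrier)
    show "induced H M N N (P \<oplus>\<^bsub>A.Q\<^esub> R) = induced H M N N P \<oplus>\<^bsub>E.Q\<^esub> induced H M N N R"
      using x y subspace_add[OF A.subU x(1) y(1)] by (simp add: induced_coset E.Q_add A.Q_add A.U_closed)
  qed
qed

text \<open>An element of \<open>U\<close> congruent modulo \<open>N\<close> to an element of
  \<open>M\<close> lies in \<open>M\<close>, since \<open>N\<close> does. So lattice and filtrations
  of \<open>M/N\<close> are those induced from \<open>U/N\<close>.\<close>

lemma induced_strict:
  assumes "P \<in> carrier A.Q" "induced H M N N P \<in> (\<lambda>x. N +> x) ` (S \<inter> U)"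
  shows "P \<in> (\<lambda>x. N +> x) ` (S \<inter> M)"
proof -
  obtain x where x: "x \<in> M" "P = N +> x" using assms(1) by (auto simp: A.Q_carrier)
  then obtain y where y: "y \<in> S" "y \<in> U" "N +> y = N +> x" using assms(2) by (auto simp: induced_coset)
  have "y \<ominus> x \<in> M" using y x NM E.Q_eq[of y x] MU' by auto
  from subspace_add[OF A.subU this x(1)] have "y \<in> M"
    using E.U_closed[OF y(2)] A.U_closed[OF x(1)] by (simp add: diff_add_cancel)
  then show ?thesis using x y by blast
qed

lemma E_parts: "mhs_parts E.Q"
proof (intro mhs_parts.intro mhs_parts_axioms.intro E.Q.complex_space_axioms E.Q.HZ_subgroup)
  show "C_subspace (Fil E.Q k) E.Q" for k unfolding E.Q_Fil by (rule E.Q_C_subspace[OF Fil_subspace])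
  show "Fil E.Q l \<subseteq> Fil E.Q k" if "k \<le> l" for k l unfolding E.Q_Fil using Fil_antimono[OF that] by blast
  show "Wt E.Q k \<subseteq> HQ E.Q" for k unfolding E.Q_Wt E.Q_HQ using Wt(1)[of k] by blast
qed

text \<open>The cosets of \<open>s\<close> and \<open>z\<close>, each paired with the generator, are
  a Hodge lift and an integral lift in the pulled-back extension. Their difference is the coset of
  \<open>s \<ominus> z\<close> in the kernel.\<close>

lemma connecting_eq:
  assumes A: "odd_hodge A.Q p" and f: "f \<in> mhs_hom (tate (- p)) C.Q"
    and s: "s \<in> Fil H p" "s \<in> U" "M +> s = f (tate_gen (- p))"
    and z: "z \<in> HZ H" "z \<in> U" "M +> z = f (tate_gen (- p))"
  shows "s \<ominus> z \<in> M" "connecting (tate (- p)) A.Q (induced H M N N) E.Q (induced H U N M) f =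
    odd_hodge.ext_of A.Q p (N +> (s \<ominus> z))"
proof -
  interpret odd: odd_hodge A.Q p by (rule A)
  show sz: "s \<ominus> z \<in> M" using s z C.Q_eq by metis
  have f': "mhs_map (tate (- p)) C.Q f" using f by (simp add: mhs_hom_iff)
  interpret X: tate_ext p A.Q "fibre_prod E.Q (induced H U N M) (tate (- p)) f" "\<lambda>P. (induced H M N N P, 0)" snd
  proof (rule pullback_tate_ext[OF A.Q.complex_space_axioms E_parts C.C_space_Q induced_linear(2) _ induced_linear(1)])
    show "inj_on (induced H M N N) (carrier A.Q)"
      by (rule inj_onI) (auto simp: A.Q_carrier induced_coset)
    show "\<exists>P\<in>carrier A.Q. R = induced H M N N P"
      if R: "R \<in> carrier E.Q" "induced H U N M R = \<zero>\<^bsub>C.Q\<^esub>" for R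
    proof -
      obtain x where x: "x \<in> U" "R = N +> x" using R(1) by (auto simp: E.Q_carrier)
      then have "x \<in> M" using R(2) C.quot.coset_eq_N_iff[of x] by (simp add: induced_coset C.Q_zero E.U_closed)
      then show ?thesis using x by (auto simp: A.Q_carrier induced_coset)
    qed
    show "induced H U N M (induced H M N N P) = \<zero>\<^bsub>C.Q\<^esub>" if P: "P \<in> carrier A.Q" for P
    proof -
      obtain x where "x \<in> M" "P = N +> x" using P by (auto simp: A.Q_carrier)
      then show ?thesis using C.quot.coset_zero by (simp add: induced_coset MU' C.Q_zero)
    qed
    show "P \<in> HZ A.Q" if "P \<in> carrier A.Q" "induced H M N N P \<in> HZ E.Q" for P
      using induced_strict[OF that(1)] that(2) by (simp add: A.Q_HZ E.Q_HZ)
    show "P \<in> Fil A.Q k" if "P \<in> carrier A.Q" "induced H M N N P \<in> Fil E.Q k" for P k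
      using induced_strict[OF that(1)] that(2) by (simp add: A.Q_Fil E.Q_Fil)
    show "P \<in> Wt A.Q k" if "P \<in> carrier A.Q" "induced H M N N P \<in> Wt E.Q k" for P k
      using induced_strict[OF that(1)] that(2) by (simp add: A.Q_Wt E.Q_Wt)
    show "HQ A.Q \<subseteq> Wt A.Q k" if "2 * p \<le> k" for k using that by (simp add: odd.Wt_pure)
    show "f \<in> C_linear (tate (- p)) C.Q" by (rule mhs_mapD(1)[OF f'])
  qed
  let ?g = "tate_gen (- p)"
  have szE: "N +> s \<in> carrier E.Q" "N +> z \<in> carrier E.Q" using s z by (simp_all add: E.Q_closed)
  have "ext_class p (fibre_prod E.Q (induced H U N M) (tate (- p)) f, \<lambda>P. (induced H M N N P, 0), snd)
      (N +> (s \<ominus> z))"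
  proof (rule ext_classI[of "(N +> s, ?g)" _ _ "(N +> z, ?g)"])
    show "(N +> s, ?g) \<in> Fil (fibre_prod E.Q (induced H U N M) (tate (- p)) f) p"
      using s szE by (auto simp: E.Q_Fil induced_coset)
    show "(N +> z, ?g) \<in> HZ (fibre_prod E.Q (induced H U N M) (tate (- p)) f)"
      using z szE tate_gen_mem(1)[of p] by (auto simp: E.Q_HZ induced_coset simp del: tate_simps(5))
    show "(induced H M N N (N +> (s \<ominus> z)), 0) =
        (N +> s, ?g) \<ominus>\<^bsub>fibre_prod E.Q (induced H U N M) (tate (- p)) f\<^esub> (N +> z, ?g)"
    proof -
      have "(N +> s, ?g) \<ominus>\<^bsub>fibre_prod E.Q (induced H U N M) (tate (- p)) f\<^esub> (N +> z, ?g) =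
          ((N +> s) \<ominus>\<^bsub>E.Q\<^esub> (N +> z), 0)"
        using szE s z by (simp add: X.E.diff_eq E.Q.diff_eq induced_coset)
      then show ?thesis unfolding induced_coset(2)[OF sz] E.Q_diff[OF s(2) z(2)] by simp
    qed
  qed simp_all
  from X.push_class_eq[OF this A.Q_closed[OF sz] mhs_map_id odd.pure_H]
  show "connecting (tate (- p)) A.Q (induced H M N N) E.Q (induced H U N M) f =
      odd_hodge.ext_of A.Q p (N +> (s \<ominus> z))"
    by (simp add: connecting_def odd.ext_of_def)
qed

lemma tate_hom_lifts:
  assumes "f \<in> mhs_hom (tate (- p)) C.Q"
  obtains s z where "s \<in> Fil H p" "s \<in> U" "M +> s = f (tate_gen (- p))"
    and "z \<in> HZ H" "z \<in> U" "M +> z = f (tate_gen (- p))"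
proof -
  have f': "mhs_map (tate (- p)) C.Q f" using assms by (simp add: mhs_hom_iff)
  have "f (tate_gen (- p)) \<in> Fil C.Q p" "f (tate_gen (- p)) \<in> HZ C.Q"
    using mhs_mapD(2,4)[OF f'] tate_gen_mem(1,2)[of p] by blast+
  then obtain s z where "s \<in> Fil H p \<inter> U" "f (tate_gen (- p)) = M +> s"
    "z \<in> HZ H \<inter> U" "f (tate_gen (- p)) = M +> z" unfolding C.Q_Fil C.Q_HZ by (elim imageE)
  then show ?thesis by (intro that[of s z]) simp_all
qed

text \<open>A class with a lift in \<open>F\<^sup>p\<close> and an integral lift determines a
  morphism from \<open>Z(-p)\<close>. Weights take care of themselves: an integral vector in
  \<open>WC H (2 * p)\<close> lies in \<open>Wt H (2 * p)\<close>.\<close>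

lemma tate_hom_exists:
  assumes s: "s \<in> Fil H p" "s \<in> U" and z: "z \<in> HZ H" "z \<in> U" and eq: "M +> s = M +> z"
    and U2: "U \<subseteq> WC H (2 * p)"
  shows "\<exists>f\<in>mhs_hom (tate (- p)) C.Q. f (tate_gen (- p)) = M +> z"
proof -
  let ?f = "\<lambda>t. (t / tate_gen (- p)) \<odot>\<^bsub>C.Q\<^esub> (M +> z)"
  have zc: "M +> z \<in> carrier C.Q" by (rule C.Q_closed[OF z(2)])
  have "mhs_map (tate (- p)) C.Q ?f"
    unfolding mhs_map_def
  proof (intro conjI allI)
    show "?f \<in> C_linear (tate (- p)) C.Q"
      by (rule C_linearI) (simp_all add: zc C.Q.smult_l_distr add_divide_distrib)
    show "?f ` HZ (tate (- p)) \<subseteq> HZ C.Q"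
    proof (rule image_subsetI)
      fix t assume "t \<in> HZ (tate (- p))"
      then obtain m where "t / tate_gen (- p) = of_int m" by auto
      moreover have "M +> z \<in> HZ C.Q" using z by (auto simp: C.Q_HZ)
      ultimately show "?f t \<in> HZ C.Q" using C.Q.subgroup_int_smult[OF C.Q.HZ_subgroup] by simp
    qed
    show "?f ` Wt (tate (- p)) k \<subseteq> Wt C.Q k" for k
    proof (rule image_subsetI)
      fix t assume t: "t \<in> Wt (tate (- p)) k"
      show "?f t \<in> Wt C.Q k"
      proof (cases "2 * p \<le> k")
        case True
        then obtain r where r: "t / tate_gen (- p) = of_rat r" using t by auto
        have "z \<in> Wt H (2 * p)" using z U2 by (intro WC_HQ HZ_HQ) auto
        then have "z \<in> Wt H k" using monoD[OF Wt_mono True] by blast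
        then have "of_rat r \<odot> z \<in> Wt H k \<inter> U" using Wt(3) subspace_smult[OF C.subU z(2)] by blast
        then show ?thesis using r z by (auto simp: C.Q_Wt C.Q_smult C.U_closed)
      next
        case False
        then have "?f t = \<zero>\<^bsub>C.Q\<^esub>" using t zc by simp
        moreover have "\<zero> \<in> Wt H k \<inter> U" using Wt(2)[of k] subspace_zero[OF C.subU] by (simp add: subgroup_iff)
        ultimately show ?thesis by (auto simp: C.Q_Wt C.Q_zero')
      qed
    qed
    show "?f ` Fil (tate (- p)) k \<subseteq> Fil C.Q k" for k
    proof (rule image_subsetI)
      fix t assume t: "t \<in> Fil (tate (- p)) k"
      have "\<exists>d. ?f t = M +> (d \<odot> s) \<and> d \<odot> s \<in> Fil H k"
      proof (cases "k \<le> p")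
        case True
        then have "s \<in> Fil H k" using Fil_antimono[OF True] s by blast
        then have "(t / tate_gen (- p)) \<odot> s \<in> Fil H k" by (rule subspace_smult[OF Fil_subspace])
        moreover have "?f t = M +> ((t / tate_gen (- p)) \<odot> s)"
          unfolding eq[symmetric] by (rule C.Q_smult[OF C.U_closed[OF s(2)]])
        ultimately show ?thesis by blast
      next
        case False
        then have "t = 0" using t by simp
        then have "?f t = M +> (0 \<odot> s)" "0 \<odot> s \<in> Fil H k"
          using zc C.U_closed[OF s(2)] subspace_zero[OF Fil_subspace] by (simp_all add: C.Q_zero')
        then show ?thesis by blast
      qed
      then show "?f t \<in> Fil C.Q k" using subspace_smult[OF C.subU s(2)] by (auto simp: C.Q_Fil)
    qed
  qed
  then have "?f \<in> mhs_hom (tate (- p)) C.Q" by (simp add: mhs_hom_iff)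
  then show ?thesis using zc by (intro bexI[of _ ?f]) simp_all
qed

text \<open>The sum of two morphisms is the morphism built from the sums of their lifts, so that
  \<open>tate_hom_exists\<close> supplies all compatibilities.\<close>

lemma Hom_closed:
  assumes "f \<in> mhs_hom (tate (- p)) C.Q" "h \<in> mhs_hom (tate (- p)) C.Q" "U \<subseteq> WC H (2 * p)"
  shows "f \<otimes>\<^bsub>Hom (tate (- p)) C.Q\<^esub> h \<in> mhs_hom (tate (- p)) C.Q"
proof -
  obtain s z where s: "s \<in> Fil H p" "s \<in> U" "M +> s = f (tate_gen (- p))"
    "z \<in> HZ H" "z \<in> U" "M +> z = f (tate_gen (- p))" by (rule tate_hom_lifts[OF assms(1)])
  obtain s' z' where s': "s' \<in> Fil H p" "s' \<in> U" "M +> s' = h (tate_gen (- p))"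
    "z' \<in> HZ H" "z' \<in> U" "M +> z' = h (tate_gen (- p))" by (rule tate_hom_lifts[OF assms(2)])
  note c = C.U_closed[OF s(2)] C.U_closed[OF s(5)] C.U_closed[OF s'(2)] C.U_closed[OF s'(5)]
  have "z \<oplus> z' \<in> HZ H" using s s' HZ_subgroup by (simp add: subgroup_iff)
  moreover have "M +> (s \<oplus> s') = M +> (z \<oplus> z')"
    using C.Q_add[OF c(1,3)] C.Q_add[OF c(2,4)] s s' by simp
  ultimately obtain k where k: "k \<in> mhs_hom (tate (- p)) C.Q" "k (tate_gen (- p)) = M +> (z \<oplus> z')"
    using tate_hom_exists[of "s \<oplus> s'" p "z \<oplus> z'"] subspace_add[OF Fil_subspace s(1) s'(1)]
      subspace_add[OF C.subU s(2) s'(2)] subspace_add[OF C.subU s(5) s'(5)] assms(3) by blast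
  have "k t = f t \<oplus>\<^bsub>C.Q\<^esub> h t" for t
  proof -
    have "k t = (t / tate_gen (- p)) \<odot>\<^bsub>C.Q\<^esub> ((M +> z) \<oplus>\<^bsub>C.Q\<^esub> (M +> z'))"
      using tate_hom_eval[OF k(1), of t] k(2) C.Q_add[OF c(2,4)] by simp
    also have "\<dots> = f t \<oplus>\<^bsub>C.Q\<^esub> h t"
      using tate_hom_eval[OF assms(1), of t] tate_hom_eval[OF assms(2), of t] s s'
        C.Q.smult_r_distr[OF C.Q_closed[OF s(5)] C.Q_closed[OF s'(5)]] by simp
    finally show ?thesis .
  qed
  then have "f \<otimes>\<^bsub>Hom (tate (- p)) C.Q\<^esub> h = k" by (simp add: Hom_simps fun_eq_iff)
  then show ?thesis using k by simp
qed

lemma Hom_comm_group: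
  assumes U2: "U \<subseteq> WC H (2 * p)"
  shows "comm_group (Hom (tate (- p)) C.Q)"
proof -
  have cl: "f t \<in> carrier C.Q" if "f \<in> mhs_hom (tate (- p)) C.Q" for f t
    using C_linearD(1)[OF mhs_mapD(1), of "tate (- p)" C.Q f t] that by (simp add: mhs_hom_iff)
  have z: "\<zero> \<in> Fil H p" "\<zero> \<in> U" "\<zero> \<in> HZ H"
    using subspace_zero[OF Fil_subspace] subspace_zero[OF C.subU] HZ_subgroup by (simp_all add: subgroup_iff)
  obtain o' where o': "o' \<in> mhs_hom (tate (- p)) C.Q" "o' (tate_gen (- p)) = \<zero>\<^bsub>C.Q\<^esub>"
    using tate_hom_exists[OF z(1,2) z(3,2) refl U2] by (auto simp: C.Q_zero')
  have "o' t = \<zero>\<^bsub>C.Q\<^esub>" for t using tate_hom_eval[OF o'(1), of t] o'(2) by simp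
  then have "o' = (\<lambda>t. \<zero>\<^bsub>C.Q\<^esub>)" by (rule ext)
  then have one: "\<one>\<^bsub>Hom (tate (- p)) C.Q\<^esub> \<in> mhs_hom (tate (- p)) C.Q"
    using o'(1) by (simp add: Hom_simps restrict_UNIV)
  show ?thesis
  proof (rule comm_groupI; (simp only: Hom_simps(1))?)
    show "\<one>\<^bsub>Hom (tate (- p)) C.Q\<^esub> \<in> mhs_hom (tate (- p)) C.Q" by (rule one)
    fix f assume f: "f \<in> mhs_hom (tate (- p)) C.Q"
    show "\<one>\<^bsub>Hom (tate (- p)) C.Q\<^esub> \<otimes>\<^bsub>Hom (tate (- p)) C.Q\<^esub> f = f"
      using cl[OF f] by (simp add: Hom_simps fun_eq_iff)
    obtain s z where s: "s \<in> Fil H p" "s \<in> U" "M +> s = f (tate_gen (- p))"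
      "z \<in> HZ H" "z \<in> U" "M +> z = f (tate_gen (- p))" by (rule tate_hom_lifts[OF f])
    have eq: "M +> ((-1) \<odot> s) = M +> ((-1) \<odot> z)"
      using s C.Q_smult[OF C.U_closed[OF s(2)], of "-1"] C.Q_smult[OF C.U_closed[OF s(5)], of "-1"] by simp
    have zz: "(-1) \<odot> z \<in> HZ H" using s HZ_subgroup by (simp add: subgroup_iff)
    from tate_hom_exists[OF subspace_smult[OF Fil_subspace s(1)] subspace_smult[OF C.subU s(2)] zz
        subspace_smult[OF C.subU s(5)] eq U2]
    obtain k where k: "k \<in> mhs_hom (tate (- p)) C.Q" "k (tate_gen (- p)) = M +> ((-1) \<odot> z)" by blast
    have "k t \<oplus>\<^bsub>C.Q\<^esub> f t = \<zero>\<^bsub>C.Q\<^esub>" for t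
    proof -
      have "k t = (-1) \<odot>\<^bsub>C.Q\<^esub> f t"
      proof -
        have "f (tate_gen (- p)) \<in> carrier C.Q" by (rule cl[OF f])
        moreover have "k (tate_gen (- p)) = (-1) \<odot>\<^bsub>C.Q\<^esub> f (tate_gen (- p))"
          using k(2) s(6) C.Q_smult[OF C.U_closed[OF s(5)], of "-1"] by simp
        ultimately show ?thesis
          using tate_hom_eval[OF k(1), of t] tate_hom_eval[OF f, of t] by simp
      qed
      then show ?thesis using C.Q.smult_l_distr[OF cl[OF f], of "-1" 1 t] cl[OF f] by simp
    qed
    then show "\<exists>y\<in>mhs_hom (tate (- p)) C.Q. y \<otimes>\<^bsub>Hom (tate (- p)) C.Q\<^esub> f = \<one>\<^bsub>Hom (tate (- p)) C.Q\<^esub>"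
      using k(1) by (intro bexI[of _ k]) (simp_all add: Hom_simps fun_eq_iff)
    fix h assume h: "h \<in> mhs_hom (tate (- p)) C.Q"
    show "f \<otimes>\<^bsub>Hom (tate (- p)) C.Q\<^esub> h \<in> mhs_hom (tate (- p)) C.Q" by (rule Hom_closed[OF f h U2])
    show "f \<otimes>\<^bsub>Hom (tate (- p)) C.Q\<^esub> h = h \<otimes>\<^bsub>Hom (tate (- p)) C.Q\<^esub> f"
      using cl[OF f] cl[OF h] by (simp add: Hom_simps fun_eq_iff C.Q.a_comm)
    fix k assume k: "k \<in> mhs_hom (tate (- p)) C.Q"
    show "f \<otimes>\<^bsub>Hom (tate (- p)) C.Q\<^esub> h \<otimes>\<^bsub>Hom (tate (- p)) C.Q\<^esub> k =
        f \<otimes>\<^bsub>Hom (tate (- p)) C.Q\<^esub> (h \<otimes>\<^bsub>Hom (tate (- p)) C.Q\<^esub> k)"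
      using cl[OF f] cl[OF h] cl[OF k] by (simp add: Hom_simps fun_eq_iff C.Q.a_assoc)
  qed
qed

end

text \<open>The image is a subgroup of a lattice and has an integral basis. Coordinates in that
  basis identify the group with a free abelian group on finitely many generators.\<close>

lemma free_of_lattice_embedding:
  fixes G :: "('g, 'k) monoid_scheme"
  assumes V: "C_space V" and L: "full_lattice UNIV V L" and G: "comm_group G"
    and e: "\<And>x. x \<in> carrier G \<Longrightarrow> e x \<in> L" "\<And>x y. x \<in> carrier G \<Longrightarrow> y \<in> carrier G \<Longrightarrow> e (x \<otimes>\<^bsub>G\<^esub> y) = e x \<oplus>\<^bsub>V\<^esub> e y"
    and inj: "inj_on e (carrier G)"
  shows "\<exists>S::nat set. finite S \<and> G \<cong> free_Abelian_group S"
proof -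
  interpret V: complex_space V by unfold_locales fact
  interpret G: comm_group G by fact
  have Lc: "x \<in> carrier V" if "x \<in> L" for x using V.full_lattice_subgroup[OF L] that by (auto simp: V.subgroup_iff)
  have ec: "e x \<in> carrier V" if "x \<in> carrier G" for x using Lc e(1) that by blast
  have e1: "e \<one>\<^bsub>G\<^esub> = \<zero>\<^bsub>V\<^esub>"
  proof -
    have "e \<one>\<^bsub>G\<^esub> \<oplus>\<^bsub>V\<^esub> e \<one>\<^bsub>G\<^esub> = e \<one>\<^bsub>G\<^esub>" using e(2)[of "\<one>\<^bsub>G\<^esub>" "\<one>\<^bsub>G\<^esub>"] by simp
    then show ?thesis using ec[of "\<one>\<^bsub>G\<^esub>"] V.add.r_cancel_one' by simp
  qed
  have einv: "e (inv\<^bsub>G\<^esub> x) = (-1) \<odot>\<^bsub>V\<^esub> e x" if x: "x \<in> carrier G" for x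
  proof -
    have "e (inv\<^bsub>G\<^esub> x) \<oplus>\<^bsub>V\<^esub> e x = \<zero>\<^bsub>V\<^esub>" using e(2)[of "inv\<^bsub>G\<^esub> x" x] x e1 by simp
    then have "\<ominus>\<^bsub>V\<^esub> e x = e (inv\<^bsub>G\<^esub> x)" using ec[OF x] ec[of "inv\<^bsub>G\<^esub> x"] x by (intro V.minus_equality) simp_all
    then show ?thesis using ec[OF x] by (simp add: V.neg_eq)
  qed
  have "subgroup (e ` carrier G) (add_monoid V)"
    unfolding V.subgroup_iff
  proof (intro conjI ballI)
    show "e ` carrier G \<subseteq> carrier V" using ec by blast
    show "\<zero>\<^bsub>V\<^esub> \<in> e ` carrier G" using e1 G.one_closed by (intro image_eqI[of _ _ "\<one>\<^bsub>G\<^esub>"]) simp_all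
    fix x assume "x \<in> e ` carrier G"
    then obtain a where a: "a \<in> carrier G" "x = e a" by blast
    then show "(-1) \<odot>\<^bsub>V\<^esub> x \<in> e ` carrier G" using einv[OF a(1)] by (intro image_eqI[of _ _ "inv\<^bsub>G\<^esub> a"]) simp_all
    fix y assume "y \<in> e ` carrier G"
    then obtain b where b: "b \<in> carrier G" "y = e b" by blast
    then show "x \<oplus>\<^bsub>V\<^esub> y \<in> e ` carrier G"
      using a e(2)[OF a(1) b(1)] by (intro image_eqI[of _ _ "a \<otimes>\<^bsub>G\<^esub> b"]) simp_all
  qed
  moreover obtain n v where v: "indep V v n" "L = zspan V v n"
    using L unfolding V.full_lattice_UNIV_iff by blast
  moreover have "e ` carrier G \<subseteq> L" using e(1) by blast
  ultimately obtain m w where w: "indep V w m" "e ` carrier G = zspan V w m"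
    using V.subgroup_of_zspan[of v n "e ` carrier G"] by blast
  note cl = V.indep_closed[OF w(1)]
  let ?F = "free_Abelian_group {..<m}"
  define \<theta> where "\<theta> x = comb V w (\<lambda>i. of_int (Poly_Mapping.lookup x i)) m" for x :: "nat \<Rightarrow>\<^sub>0 int"
  have th_inj: "inj_on \<theta> (carrier ?F)"
  proof (rule inj_onI)
    fix x y assume xy: "x \<in> carrier ?F" "y \<in> carrier ?F" and eq: "\<theta> x = \<theta> y"
    have "Poly_Mapping.lookup x i = Poly_Mapping.lookup y i" for i
    proof (cases "i < m")
      case True
      from V.indep_unique[OF w(1) eq[unfolded \<theta>_def] True] show ?thesis by simp
    next
      case False
      then have "i \<notin> Poly_Mapping.keys x" "i \<notin> Poly_Mapping.keys y" using xy by auto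
      then show ?thesis by (simp add: in_keys_iff)
    qed
    then show "x = y" by (simp add: poly_mapping_eqI)
  qed
  have th_im: "\<theta> ` carrier ?F = e ` carrier G"
    unfolding w(2)
  proof (rule equalityI; rule subsetI)
    fix y assume "y \<in> \<theta> ` carrier ?F"
    then show "y \<in> zspan V w m" by (auto simp: \<theta>_def zspan_def)
  next
    fix y assume "y \<in> zspan V w m"
    then obtain k where k: "y = comb V w (\<lambda>i. of_int (k i)) m" by (rule zspanE)
    have fin: "finite {i. (if i < m then k i else 0) \<noteq> 0}" by (rule finite_subset[of _ "{..<m}"]) auto
    define x where "x = Abs_poly_mapping (\<lambda>i. if i < m then k i else 0)"
    have look: "Poly_Mapping.lookup x = (\<lambda>i. if i < m then k i else 0)"
      unfolding x_def using fin by (simp add: lookup_Abs_poly_mapping)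
    have "x \<in> carrier ?F" using look by (auto simp: in_keys_iff split: if_splits)
    moreover have "\<theta> x = y" unfolding \<theta>_def k look by (rule comb_cong) simp_all
    ultimately show "y \<in> \<theta> ` carrier ?F" by blast
  qed
  have th_add: "\<theta> (x + y) = \<theta> x \<oplus>\<^bsub>V\<^esub> \<theta> y" for x y
    using V.comb_add[OF cl, of "\<lambda>i. of_int (Poly_Mapping.lookup x i)" "\<lambda>i. of_int (Poly_Mapping.lookup y i)"]
    by (simp add: \<theta>_def lookup_add)
  define k where "k x = inv_into (carrier ?F) \<theta> (e x)" for x
  have k: "k x \<in> carrier ?F" "\<theta> (k x) = e x" if "x \<in> carrier G" for x
  proof -
    have "e x \<in> \<theta> ` carrier ?F" unfolding th_im using that by blast
    then show "k x \<in> carrier ?F" "\<theta> (k x) = e x" unfolding k_def by (rule inv_into_into, rule f_inv_into_f)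
  qed
  have addF: "x + y \<in> carrier ?F" if "x \<in> carrier ?F" "y \<in> carrier ?F" for x y
    using that Poly_Mapping.keys_add[of x y] by auto
  have "k \<in> iso G ?F"
  proof (rule isoI)
    show "k \<in> hom G ?F"
    proof (rule homI)
      fix x y assume x: "x \<in> carrier G" and y: "y \<in> carrier G"
      have "\<theta> (k (x \<otimes>\<^bsub>G\<^esub> y)) = \<theta> (k x + k y)" using k x y e(2) by (simp add: th_add)
      then have "k (x \<otimes>\<^bsub>G\<^esub> y) = k x + k y"
        using th_inj k(1)[OF G.m_closed[OF x y]] addF[OF k(1)[OF x] k(1)[OF y]] by (simp only: inj_on_eq_iff)
      then show "k (x \<otimes>\<^bsub>G\<^esub> y) = k x \<otimes>\<^bsub>?F\<^esub> k y" by simp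
    qed (rule k)
    show "bij_betw k (carrier G) (carrier ?F)"
      unfolding bij_betw_def
    proof
      show "inj_on k (carrier G)"
      proof (rule inj_onI)
        fix x y assume xy: "x \<in> carrier G" "y \<in> carrier G" "k x = k y"
        then have "e x = e y" using k(2)[OF xy(1)] k(2)[OF xy(2)] by simp
        then show "x = y" using inj xy by (simp only: inj_on_eq_iff)
      qed
      show "k ` carrier G = carrier ?F"
      proof (rule equalityI; rule subsetI)
        fix y assume y: "y \<in> carrier ?F"
        then have "\<theta> y \<in> e ` carrier G" using th_im by blast
        then obtain x where x: "x \<in> carrier G" "\<theta> y = e x" by blast
        then have "k x = y" using inv_into_f_f[OF th_inj y] by (simp add: k_def)
        then show "y \<in> k ` carrier G" using x(1) by blast
      next
        fix y assume "y \<in> k ` carrier G"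
        then obtain x where "x \<in> carrier G" "y = k x" by blast
        then show "y \<in> carrier ?F" using k(1) by simp
      qed
    qed
  qed
  then have "G \<cong> ?F" by (rule is_isoI)
  then show ?thesis by (intro exI[of _ "{..<m}"]) simp
qed

subsection \<open>The maps \<open>e\<^sup>p\<close> and \<open>h\<^sup>p\<close>\<close>

lemma odd_hodgeI: "pure G (2 * p - 1) \<Longrightarrow> odd_hodge G p"
  using pure_spaceI by (intro odd_hodge.intro odd_hodge_axioms.intro) (auto simp: pure_def)

lemma torus_quot_zero:
  assumes "abelian_variety V L"
  shows "abelian_variety (quot_space V {\<zero>\<^bsub>V\<^esub>}) ((\<lambda>x. {\<zero>\<^bsub>V\<^esub>} +>\<^bsub>V\<^esub> x) ` L)"
proof -
  interpret V: complex_space V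
    using assms by unfold_locales (simp add: abelian_variety_def complex_torus_def)
  interpret quot: quotient_space V "{\<zero>\<^bsub>V\<^esub>}"
    by (rule quotient_space.intro[OF V.complex_space_axioms quotient_space_axioms.intro[OF V.subspace_trivial]])
  have "(\<lambda>x. {\<zero>\<^bsub>V\<^esub>} +>\<^bsub>V\<^esub> x) \<in> C_linear V (quot_space V {\<zero>\<^bsub>V\<^esub>})"
    by (rule C_linearI) (simp_all add: quot.quot_carrier quot.quot_add quot.quot_smult)
  moreover have "bij_betw (\<lambda>x. {\<zero>\<^bsub>V\<^esub>} +>\<^bsub>V\<^esub> x) (carrier V) (carrier (quot_space V {\<zero>\<^bsub>V\<^esub>}))"
    unfolding bij_betw_def quot.quot_carrier
    by (auto intro!: inj_onI simp: quot.coset_eq_iff V.diff_eq_zero_iff)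
  ultimately show ?thesis by (rule abelian_variety_transport[OF assms quot.C_space_quot _ _ refl])
qed

text \<open>An abelian variety is semi-abelian with toric part zero.\<close>

lemma abelian_imp_semi_abelian:
  assumes "abelian_variety V L"
  shows "semi_abelian_variety V {\<zero>\<^bsub>V\<^esub>} L"
proof -
  have torus: "C_space V" "full_lattice \<real> V L"
    using assms by (simp_all add: abelian_variety_def complex_torus_def)
  interpret V: complex_space V by unfold_locales (rule torus)
  obtain n v where v: "\<forall>i<n. v i \<in> carrier V" "L = zspan V v n" by (rule V.full_latticeE[OF torus(2)]) auto
  have L: "subgroup L (add_monoid V)" unfolding v(2) by (rule V.zspan_subgroup[OF v(1)])
  interpret Z: complex_space "V\<lparr>carrier := {\<zero>\<^bsub>V\<^esub>}\<rparr>"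
    by (rule complex_space.intro[OF V.C_space_sub[OF V.subspace_trivial]])
  \<comment> \<open>The lattice of the zero space has the empty basis; at length 0 no value of the
    family \<open>undefined\<close> is ever used.\<close>
  have "full_lattice UNIV (V\<lparr>carrier := {\<zero>\<^bsub>V\<^esub>}\<rparr>) (zspan (V\<lparr>carrier := {\<zero>\<^bsub>V\<^esub>}\<rparr>) undefined 0)"
    by (rule Z.full_latticeI) simp_all
  moreover have "zspan (V\<lparr>carrier := {\<zero>\<^bsub>V\<^esub>}\<rparr>) undefined 0 = L \<inter> {\<zero>\<^bsub>V\<^esub>}"
    using L by (auto simp: zspan_def V.subgroup_iff)
  ultimately have "full_lattice UNIV (sub_space V {\<zero>\<^bsub>V\<^esub>}) (L \<inter> {\<zero>\<^bsub>V\<^esub>})" by (simp add: sub_space_def)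
  then show ?thesis
    unfolding semi_abelian_variety_def
    using torus(1) V.subspace_trivial L torus_quot_zero[OF assms] by blast
qed

section \<open>Comparison of \<open>h\<^sup>p\<close> with \<open>e\<^sup>p\<close> for a given
  \<open>H\<close>\<close>

locale weight_step = filtered_lattice H for H :: "'a mhs" (structure) and p :: int +
  assumes MHS_H: "MHS H" and pol: "polarizable (gr H (2 * p - 1)) (2 * p - 1)"
begin

abbreviation "N \<equiv> WC H (2 * p - 2)"
abbreviation "M \<equiv> WC H (2 * p - 1)"
abbreviation "U \<equiv> WC H (2 * p)"
abbreviation (input) "g \<equiv> tate_gen (- p)"
abbreviation "T \<equiv> tate (- p)"
abbreviation "H' \<equiv> H1 H p"
abbreviation "H'' \<equiv> H2 H p"

sublocale e: three_step H N M U
  by (intro three_step.intro three_step_axioms.intro filtered_lattice_axioms rat_sub_WC WC_mono) simp_all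

abbreviation "G \<equiv> subquot H M N"
abbreviation "K \<equiv> subquot H U M"

lemma gr_odd: "gr H (2 * p - 1) = G"
  by (simp add: gr_subquot)

lemma gr_even: "gr H (2 * p) = K"
  by (simp add: gr_subquot)

sublocale G: odd_hodge G p
  by (rule odd_hodgeI) (use gr_pure[OF MHS_H, of "2 * p - 1"] gr_odd in simp)

abbreviation "HA \<equiv> Ha_sub p G"

lemmas HA_rat = G.level_one_rat[OF G.Ha_level_one]

lemma HA_subset: "HA \<subseteq> carrier G"
  using e.A.Q.rat_sub_closed[OF HA_rat] by blast

lemma H1_preimage: "H' = e.A.preimage HA"
  by (simp add: H1_def e.A.preimage_def gr_odd)

lemma H2_preimage: "H'' = e.C.preimage (Hpp_sub p K)"
  by (simp add: H2_def e.C.preimage_def gr_even)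

text \<open>Every value of a morphism from \<open>Z(-p)\<close> is a multiple of its value at the
  generator, and that value is a lattice point. So the span in \<open>Hpp_sub\<close> is spanned by
  lattice points.\<close>

lemma Hpp_rat: "e.C.Q.rat_sub (Hpp_sub p K)"
  and Hpp_mem: "f \<in> mhs_hom T K \<Longrightarrow> f g \<in> Hpp_sub p K"
proof -
  let ?S = "{f t | f t. f \<in> mhs_hom T K \<and> t \<in> carrier T}" and ?S' = "{f g | f. f \<in> mhs_hom T K}"
  have cl: "f t \<in> carrier K" if "f \<in> mhs_hom T K" for f t
    using C_linearD(1)[OF mhs_mapD(1), of T K f t] that by (simp add: mhs_hom_iff)
  have Sc: "?S \<subseteq> carrier K" using cl by blast
  have S'c: "?S' \<subseteq> carrier K" using cl by blast
  have "?S \<subseteq> C_span K ?S'"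
  proof
    fix P assume "P \<in> ?S"
    then obtain f t where f: "f \<in> mhs_hom T K" "P = f t" by blast
    have "f g \<in> C_span K ?S'" by (rule subsetD[OF e.C.Q.C_span_superset]) (use f in blast)
    then show "P \<in> C_span K ?S'"
      unfolding f(2) tate_hom_eval[OF f(1), of t]
      by (rule e.C.Q.subspace_smult[OF e.C.Q.C_span_subspace[OF S'c]])
  qed
  then have "C_span K ?S \<subseteq> C_span K ?S'" by (rule e.C.Q.C_span_minimal[OF e.C.Q.C_span_subspace[OF S'c]])
  moreover have "C_span K ?S' \<subseteq> C_span K ?S" by (rule e.C.Q.C_span_mono) auto
  ultimately have eq: "Hpp_sub p K = C_span K ?S'" unfolding Hpp_sub_def by (rule equalityI)
  have "?S' \<subseteq> HQ K"
  proof
    fix P assume "P \<in> ?S'"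
    then obtain f where f: "mhs_map T K f" "P = f g" by (auto simp: mhs_hom_iff)
    then show "P \<in> HQ K" using mhs_mapD(2)[OF f(1) tate_gen_mem(1)] e.C.Q.HZ_HQ by simp
  qed
  then show "e.C.Q.rat_sub (Hpp_sub p K)" unfolding eq by (rule e.C.Q.rat_sub_C_span)
  show "f g \<in> Hpp_sub p K" if "f \<in> mhs_hom T K"
    unfolding eq by (rule subsetD[OF e.C.Q.C_span_superset]) (use that in blast)
qed

lemma
  shows H1_rat: "rat_sub H'" and H2_rat: "rat_sub H''" and N_H1: "N \<subseteq> H'" and H1_M: "H' \<subseteq> M"
    and M_H2: "M \<subseteq> H''" and H2_U: "H'' \<subseteq> U"
proof -
  show "rat_sub H'" "rat_sub H''"
    unfolding H1_preimage H2_preimage by (rule e.A.preimage_rat_sub[OF HA_rat] e.C.preimage_rat_sub[OF Hpp_rat])+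
  show "N \<subseteq> H'" unfolding H1_preimage by (rule e.A.N_preimage[OF e.A.Q.rat_sub_subspace[OF HA_rat]])
  show "M \<subseteq> H''" unfolding H2_preimage by (rule e.C.N_preimage[OF e.C.Q.rat_sub_subspace[OF Hpp_rat]])
  show "H' \<subseteq> M" "H'' \<subseteq> U" by (auto simp: H1_def H2_def)
qed

sublocale h: three_step H N H' H''
  using H1_M M_H2
  by (intro three_step.intro three_step_axioms.intro filtered_lattice_axioms rat_sub_WC H1_rat H2_rat N_H1) auto

abbreviation "G' \<equiv> subquot H H' N"
abbreviation "K' \<equiv> subquot H H'' H'"

lemma G'_eq: "G' = sub_mhs G HA"
  unfolding H1_preimage by (rule e.A.subquot_preimage[OF HA_subset])

sublocale G': odd_hodge G' p
  unfolding G'_eq by (rule G.level_one_odd_hodge[OF G.Ha_level_one])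

lemma G'_carrier: "carrier G' = HA"
  by (simp add: G'_eq)

lemma HA_mem: "x \<in> M \<Longrightarrow> N +> x \<in> HA \<longleftrightarrow> x \<in> H'"
  by (simp add: H1_def gr_odd)

lemma e_map_eq:
  assumes "f \<in> mhs_hom T K" "s \<in> Fil H p" "s \<in> U" "M +> s = f g" "z \<in> HZ H" "z \<in> U" "M +> z = f g"
  shows "e_map H p f = G.ext_of (N +> (s \<ominus> z))" "s \<ominus> z \<in> M"
  using e.connecting_eq[OF G.odd_hodge_axioms assms] by (simp_all add: e_map_def gr_odd)

lemma h_map_eq:
  assumes "f \<in> mhs_hom T K'" "s \<in> Fil H p" "s \<in> H''" "H' +> s = f g" "z \<in> HZ H" "z \<in> H''" "H' +> z = f g"
  shows "h_map H p f = G'.ext_of (N +> (s \<ominus> z))" "s \<ominus> z \<in> H'"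
  using h.connecting_eq[OF G'.odd_hodge_axioms assms] by (simp_all add: h_map_def)

text \<open>As \<open>G'\<close> is the substructure of \<open>G\<close> on \<open>HA\<close>, the
  induced map is the identity on \<open>HA\<close>, and the push-out keeps the representative of the
  class.\<close>

lemma ext_incl_eq:
  assumes "a \<in> HA"
  shows "ext_incl H p (G'.ext_of a) = G.ext_of a"
proof -
  have i: "induced H H' N N P = P" if P: "P \<in> HA" for P
  proof -
    have "P \<in> carrier G'" using P by (simp add: G'_carrier)
    then obtain x where "x \<in> H'" "P = N +> x" by (auto simp: h.A.Q_carrier)
    then show ?thesis using h.induced_coset(2) by simp
  qed
  have "mhs_map G' G (induced H H' N N)"
    unfolding mhs_map_def
  proof (intro conjI allI)
    show "induced H H' N N \<in> C_linear G' G"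
    proof (rule C_linearI)
      fix P assume P: "P \<in> carrier G'"
      show "induced H H' N N P \<in> carrier G" using P HA_subset by (auto simp: G'_carrier i)
      have "c \<odot>\<^bsub>G'\<^esub> P \<in> HA" for c using P h.A.Q.smult_closed[of P c] by (simp add: G'_carrier)
      then show "induced H H' N N (c \<odot>\<^bsub>G'\<^esub> P) = c \<odot>\<^bsub>G\<^esub> induced H H' N N P" for c
        using P by (simp add: G'_carrier i) (simp add: G'_eq)
      fix R assume R: "R \<in> carrier G'"
      have "P \<oplus>\<^bsub>G'\<^esub> R \<in> HA" using P R h.A.Q.a_closed[of P R] by (simp add: G'_carrier)
      then show "induced H H' N N (P \<oplus>\<^bsub>G'\<^esub> R) = induced H H' N N P \<oplus>\<^bsub>G\<^esub> induced H H' N N R"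
        using P R by (simp add: G'_carrier i) (simp add: G'_eq)
    qed
    show "induced H H' N N ` HZ G' \<subseteq> HZ G" using i by (auto simp: G'_eq)
    show "induced H H' N N ` Wt G' k \<subseteq> Wt G k" for k using i by (auto simp: G'_eq)
    show "induced H H' N N ` Fil G' k \<subseteq> Fil G k" for k using i by (auto simp: G'_eq)
  qed
  from G'.Ext_map_ext_of[OF _ this G.odd_hodge_axioms, of a] assms show ?thesis
    by (simp add: ext_incl_def gr_odd G'_carrier i)
qed

lemma hom_incl_eq:
  assumes f: "f \<in> mhs_hom T K'" and s: "s \<in> Fil H p" "s \<in> H''" "H' +> s = f g"
    and z: "z \<in> HZ H" "z \<in> H''" "H' +> z = f g"
  shows "hom_incl H p f \<in> mhs_hom T K" "hom_incl H p f g = M +> z" "M +> s = M +> z"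
proof -
  have ind: "induced H H'' H' M (H' +> x) = M +> x" if "x \<in> H''" for x
    using h.C.quot.set_add_coset[OF e.C.subN H1_M h.C.U_closed[OF that]] that
    by (simp add: induced_def h.C.Q_closed)
  have sU: "s \<in> U" "z \<in> U" using s z H2_U by auto
  show eq: "M +> s = M +> z" using ind[OF s(2)] ind[OF z(2)] s(3) z(3) by simp
  obtain k where k: "k \<in> mhs_hom T K" "k g = M +> z"
    using e.tate_hom_exists[OF s(1) sU(1) z(1) sU(2) eq order_refl] by blast
  have "hom_incl H p f t = k t" for t
  proof -
    have "f t = H' +> ((t / g) \<odot> z)"
      using tate_hom_eval[OF f, of t] z h.C.Q_smult[OF h.C.U_closed[OF z(2)]] by simp
    moreover have "(t / g) \<odot> z \<in> H''" by (rule subspace_smult[OF h.C.subU z(2)])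
    ultimately have "hom_incl H p f t = M +> ((t / g) \<odot> z)" by (simp add: hom_incl_def compose_def ind)
    then show ?thesis
      using tate_hom_eval[OF k(1), of t] k(2) e.C.Q_smult[OF e.C.U_closed[OF sU(2)]] by simp
  qed
  then have "hom_incl H p f = k" by (rule ext)
  then show "hom_incl H p f \<in> mhs_hom T K" "hom_incl H p f g = M +> z" using k by simp_all
qed

text \<open>Lifts of a class to \<open>H''\<close> are also lifts of its image in
  \<open>gr\<^sub>2\<^sub>p\<close>, so one pair \<open>s\<close>, \<open>z\<close> computes both
  connecting maps.\<close>

lemma incl_square: "f \<in> mhs_hom T K' \<Longrightarrow> ext_incl H p (h_map H p f) = e_map H p (hom_incl H p f)"
proof -
  assume f: "f \<in> mhs_hom T K'"
  obtain s z where s: "s \<in> Fil H p" "s \<in> H''" "H' +> s = f g" and z: "z \<in> HZ H" "z \<in> H''" "H' +> z = f g"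
    by (rule h.tate_hom_lifts[OF f])
  note j = hom_incl_eq[OF f s z] and hm = h_map_eq[OF f s z]
  have sU: "s \<in> U" "z \<in> U" using s z H2_U by auto
  have sz: "N +> (s \<ominus> z) \<in> HA" by (rule iffD2[OF HA_mem[OF subsetD[OF H1_M hm(2)]] hm(2)])
  have "M +> s = hom_incl H p f g" "M +> z = hom_incl H p f g" by (simp_all only: j(2,3))
  from e_map_eq(1)[OF j(1) s(1) sU(1) this(1) z(1) sU(2) this(2)]
  show ?thesis unfolding hm(1) ext_incl_eq[OF sz] by (rule sym)
qed

lemma h_map_closed: "f \<in> mhs_hom T K' \<Longrightarrow> h_map H p f \<in> carrier (Ext T G')"
proof -
  assume f: "f \<in> mhs_hom T K'"
  obtain s z where s: "s \<in> Fil H p" "s \<in> H''" "H' +> s = f g" and z: "z \<in> HZ H" "z \<in> H''" "H' +> z = f g"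
    by (rule h.tate_hom_lifts[OF f])
  note hm = h_map_eq[OF f s z]
  show ?thesis unfolding hm(1) G'.Ext_carrier using h.A.Q_closed[OF hm(2)] by blast
qed

lemma hom_incl_closed: "f \<in> mhs_hom T K' \<Longrightarrow> hom_incl H p f \<in> mhs_hom T K"
  by (metis h.tate_hom_lifts hom_incl_eq(1))

lemma mult_lifts:
  assumes f: "f \<in> mhs_hom T K'" "s \<in> H''" "z \<in> H''" "H' +> s = f g" "H' +> z = f g"
    and f': "f' \<in> mhs_hom T K'" "s' \<in> H''" "z' \<in> H''" "H' +> s' = f' g" "H' +> z' = f' g"
  shows "H' +> (s \<oplus> s') = (f \<otimes>\<^bsub>Hom T K'\<^esub> f') g" "H' +> (z \<oplus> z') = (f \<otimes>\<^bsub>Hom T K'\<^esub> f') g"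
    "s \<oplus> s' \<in> H''" "z \<oplus> z' \<in> H''"
  using assms h.C.Q_add[of s s'] h.C.Q_add[of z z'] subspace_add[OF h.C.subU] h.C.U_closed
  by (simp_all add: Hom_simps)

lemma carlson_h_map_hom: "carlson p G' \<circ> h_map H p \<in> hom (Hom T K') (J_space p G' A_Mod J_lattice p G')"
proof (rule homI)
  fix f assume "f \<in> carrier (Hom T K')"
  then have f: "f \<in> mhs_hom T K'" by (simp add: Hom_simps)
  obtain s z where s: "s \<in> Fil H p" "s \<in> H''" "H' +> s = f g" and z: "z \<in> HZ H" "z \<in> H''" "H' +> z = f g"
    by (rule h.tate_hom_lifts[OF f])
  note hm = h_map_eq[OF f s z]
  have c: "(carlson p G' \<circ> h_map H p) f = G'.pt (N +> (s \<ominus> z))"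
    using hm(1) G'.carlson_ext_of[OF h.A.Q_closed[OF hm(2)]] by simp
  then show "(carlson p G' \<circ> h_map H p) f \<in> carrier (J_space p G' A_Mod J_lattice p G')"
    unfolding G'.pt_carrier using h.A.Q_closed[OF hm(2)] by simp
  fix f' assume "f' \<in> carrier (Hom T K')"
  then have f': "f' \<in> mhs_hom T K'" by (simp add: Hom_simps)
  obtain s' z' where s': "s' \<in> Fil H p" "s' \<in> H''" "H' +> s' = f' g"
    and z': "z' \<in> HZ H" "z' \<in> H''" "H' +> z' = f' g" by (rule h.tate_hom_lifts[OF f'])
  note hm' = h_map_eq[OF f' s' z']
  have c': "(carlson p G' \<circ> h_map H p) f' = G'.pt (N +> (s' \<ominus> z'))"
    using hm'(1) G'.carlson_ext_of[OF h.A.Q_closed[OF hm'(2)]] by simp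
  note lifts = mult_lifts[OF f s(2) z(2) s(3) z(3) f' s'(2) z'(2) s'(3) z'(3)]
  have ff: "f \<otimes>\<^bsub>Hom T K'\<^esub> f' \<in> mhs_hom T K'" by (rule h.Hom_closed[OF f f' H2_U])
  have zz: "z \<oplus> z' \<in> HZ H" using z z' HZ_subgroup by (simp add: subgroup_iff)
  note hmm = h_map_eq[OF ff subspace_add[OF Fil_subspace s(1) s'(1)] lifts(3) lifts(1) zz lifts(4) lifts(2)]
  note cl = h.C.U_closed[OF s(2)] h.C.U_closed[OF z(2)] h.C.U_closed[OF s'(2)] h.C.U_closed[OF z'(2)]
  have "(s \<oplus> s') \<ominus> (z \<oplus> z') = (s \<ominus> z) \<oplus> (s' \<ominus> z')"
  proof -
    obtain F where F: "frame F s z s' z'" using frame_exists[OF cl] by blast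
    show ?thesis unfolding frame_atoms[OF F] by (simp add: frame_simps[OF F])
  qed
  then have "N +> ((s \<oplus> s') \<ominus> (z \<oplus> z')) = (N +> (s \<ominus> z)) \<oplus>\<^bsub>G'\<^esub> (N +> (s' \<ominus> z'))"
    using cl by (simp add: h.A.Q_add)
  then have "(carlson p G' \<circ> h_map H p) (f \<otimes>\<^bsub>Hom T K'\<^esub> f') = G'.pt ((N +> (s \<ominus> z)) \<oplus>\<^bsub>G'\<^esub> (N +> (s' \<ominus> z')))"
    using hmm(1) G'.carlson_ext_of[OF h.A.Q_closed[OF hmm(2)]] by simp
  then show "(carlson p G' \<circ> h_map H p) (f \<otimes>\<^bsub>Hom T K'\<^esub> f') =
      (carlson p G' \<circ> h_map H p) f \<otimes>\<^bsub>J_space p G' A_Mod J_lattice p G'\<^esub> (carlson p G' \<circ> h_map H p) f'"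
    unfolding c c' using G'.pt_add[OF h.A.Q_closed[OF hm(2)] h.A.Q_closed[OF hm'(2)]] by simp
qed

lemma hom_incl_mult:
  assumes f: "f \<in> mhs_hom T K'" and f': "f' \<in> mhs_hom T K'"
  shows "hom_incl H p (f \<otimes>\<^bsub>Hom T K'\<^esub> f') = hom_incl H p f \<otimes>\<^bsub>Hom T K\<^esub> hom_incl H p f'"
proof -
  obtain s z where s: "s \<in> Fil H p" "s \<in> H''" "H' +> s = f g" and z: "z \<in> HZ H" "z \<in> H''" "H' +> z = f g"
    by (rule h.tate_hom_lifts[OF f])
  obtain s' z' where s': "s' \<in> Fil H p" "s' \<in> H''" "H' +> s' = f' g"
    and z': "z' \<in> HZ H" "z' \<in> H''" "H' +> z' = f' g" by (rule h.tate_hom_lifts[OF f'])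
  note lifts = mult_lifts[OF f s(2) z(2) s(3) z(3) f' s'(2) z'(2) s'(3) z'(3)]
  have ff: "f \<otimes>\<^bsub>Hom T K'\<^esub> f' \<in> mhs_hom T K'" by (rule h.Hom_closed[OF f f' H2_U])
  have zz: "z \<oplus> z' \<in> HZ H" using z z' HZ_subgroup by (simp add: subgroup_iff)
  note j = hom_incl_eq[OF f s z] and j' = hom_incl_eq[OF f' s' z']
    and jj = hom_incl_eq[OF ff subspace_add[OF Fil_subspace s(1) s'(1)] lifts(3) lifts(1) zz lifts(4) lifts(2)]
  show ?thesis
  proof (rule tate_hom_eqI[OF jj(1) e.Hom_closed[OF j(1) j'(1) order_refl]])
    show "hom_incl H p (f \<otimes>\<^bsub>Hom T K'\<^esub> f') g = (hom_incl H p f \<otimes>\<^bsub>Hom T K\<^esub> hom_incl H p f') g"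
      using jj(2) j(2) j'(2) e.C.Q_add[OF h.C.U_closed[OF z(2)] h.C.U_closed[OF z'(2)]]
      by (simp add: Hom_simps restrict_UNIV)
  qed
qed

text \<open>Two lifts with the same image in \<open>gr\<^sub>2\<^sub>p\<close> differ by a real class of \<open>gr\<^sub>2\<^sub>p\<^sub>-\<^sub>1\<close> in
  \<open>F\<^sup>p + HA\<close>, and such a class lies in \<open>HA\<close>.\<close>

lemma hom_incl_inj: "inj_on (hom_incl H p) (mhs_hom T K')"
proof (rule inj_onI)
  fix f f' assume f: "f \<in> mhs_hom T K'" and f': "f' \<in> mhs_hom T K'" and eq: "hom_incl H p f = hom_incl H p f'"
  obtain s z where s: "s \<in> Fil H p" "s \<in> H''" "H' +> s = f g" and z: "z \<in> HZ H" "z \<in> H''" "H' +> z = f g"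
    by (rule h.tate_hom_lifts[OF f])
  obtain s' z' where s': "s' \<in> Fil H p" "s' \<in> H''" "H' +> s' = f' g"
    and z': "z' \<in> HZ H" "z' \<in> H''" "H' +> z' = f' g" by (rule h.tate_hom_lifts[OF f'])
  note j = hom_incl_eq[OF f s z] and j' = hom_incl_eq[OF f' s' z']
  note cl = h.C.U_closed[OF s(2)] h.C.U_closed[OF z(2)] h.C.U_closed[OF s'(2)] h.C.U_closed[OF z'(2)]
  have Mz: "M +> z = M +> z'" using j(2) j'(2) eq by simp
  then have Ms: "M +> s = M +> s'" using j(3) j'(3) by simp
  have zM: "z \<ominus> z' \<in> M" by (rule iffD1[OF e.C.quot.coset_eq_iff[OF cl(2,4)] Mz])
  have sM: "s \<ominus> s' \<in> M" by (rule iffD1[OF e.C.quot.coset_eq_iff[OF cl(1,3)] Ms])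
  have dz: "(z \<ominus> z') \<ominus> (s \<ominus> s') \<in> H'"
  proof -
    have "(s' \<ominus> z') \<ominus> (s \<ominus> z) \<in> H'"
      by (rule subspace_diff[OF h.A.subU h_map_eq(2)[OF f' s' z'] h_map_eq(2)[OF f s z]])
    moreover obtain F where F: "frame F s z s' z'" using frame_exists[OF cl] by blast
    have "(s' \<ominus> z') \<ominus> (s \<ominus> z) = (z \<ominus> z') \<ominus> (s \<ominus> s')"
      unfolding frame_atoms[OF F] by (simp add: frame_simps[OF F])
    ultimately show ?thesis by simp
  qed
  have "N +> (z \<ominus> z') \<in> HA"
  proof (rule G.level_one_HZ[OF G.Ha_level_one])
    have "z \<ominus> z' \<in> HZ H" by (rule subgroup_diff[OF HZ_subgroup z(1) z'(1)])
    then show "N +> (z \<ominus> z') \<in> HZ G" using zM by (auto simp: e.A.Q_HZ)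
    have dM: "(z \<ominus> z') \<ominus> (s \<ominus> s') \<in> M" by (rule subsetD[OF H1_M dz])
    show "N +> ((z \<ominus> z') \<ominus> (s \<ominus> s')) \<in> HA" by (rule iffD2[OF HA_mem[OF dM] dz])
    have "s \<ominus> s' \<in> Fil H p" by (rule subspace_diff[OF Fil_subspace s(1) s'(1)])
    then have "N +> (s \<ominus> s') \<in> Fil G p" using sM by (auto simp: e.A.Q_Fil)
    moreover have "(z \<ominus> z') \<ominus> ((z \<ominus> z') \<ominus> (s \<ominus> s')) = s \<ominus> s'"
    proof -
      obtain F where F: "frame F s z s' z'" using frame_exists[OF cl] by blast
      show ?thesis unfolding frame_atoms[OF F] by (simp add: frame_simps[OF F])
    qed
    ultimately show "(N +> (z \<ominus> z')) \<ominus>\<^bsub>G\<^esub> (N +> ((z \<ominus> z') \<ominus> (s \<ominus> s'))) \<in> Fil G p"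
      using e.A.Q_diff[OF zM dM] by simp
  qed
  then have "z \<ominus> z' \<in> H'" by (rule iffD1[OF HA_mem[OF zM]])
  then have "H' +> z = H' +> z'" using cl by (simp add: h.C.quot.coset_eq_iff)
  then show "f = f'" using z z' by (intro tate_hom_eqI[OF f f']) simp
qed

lemma ext_incl_image: "ext_incl H p ` carrier (Ext T G') = G.ext_of ` HA"
  unfolding G'.Ext_carrier G'_carrier image_image by (rule image_cong) (simp_all add: ext_incl_eq)

text \<open>One inclusion is the commutative square. For the other, lifts of \<open>f\<close> to
  \<open>H''/H'\<close> are needed, and lifts \<open>s\<close>, \<open>z\<close> in \<open>U\<close>
  give them only if \<open>s \<ominus> z\<close> lies in \<open>H'\<close>, not just in
  \<open>M\<close>. The assumption on \<open>e\<^sup>p\<close> says that this holds up to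
  \<open>F\<^sup>p\<close> and the lattice, which is the freedom in choosing lifts.\<close>

lemma hom_incl_image:
  "hom_incl H p ` mhs_hom T K' = {f \<in> mhs_hom T K. e_map H p f \<in> G.ext_of ` HA}"
proof (rule equalityI; rule subsetI)
  fix f assume "f \<in> hom_incl H p ` mhs_hom T K'"
  then obtain f' where f': "f' \<in> mhs_hom T K'" "f = hom_incl H p f'" by blast
  have "e_map H p f \<in> ext_incl H p ` carrier (Ext T G')"
    using incl_square[OF f'(1)] h_map_closed[OF f'(1)] f'(2) by (metis imageI)
  then show "f \<in> {f \<in> mhs_hom T K. e_map H p f \<in> G.ext_of ` HA}"
    using hom_incl_closed[OF f'(1)] f'(2) by (simp add: ext_incl_image)
next
  fix f assume "f \<in> {f \<in> mhs_hom T K. e_map H p f \<in> G.ext_of ` HA}"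
  then obtain a where f: "f \<in> mhs_hom T K" and a: "a \<in> HA" "e_map H p f = G.ext_of a" by blast
  obtain s z where s: "s \<in> Fil H p" "s \<in> U" "M +> s = f g" and z: "z \<in> HZ H" "z \<in> U" "M +> z = f g"
    by (rule e.tate_hom_lifts[OF f])
  note em = e_map_eq[OF f s z]
  have ac: "a \<in> carrier G" using a HA_subset by blast
  have "G.ext_of (N +> (s \<ominus> z)) = G.ext_of a" unfolding em(1)[symmetric] by (rule a(2))
  then have "class_eq p G (N +> (s \<ominus> z)) a" by (rule iffD1[OF G.ext_of_eq_iff[OF e.A.Q_closed[OF em(2)] ac]])
  then obtain \<phi> \<zeta> where pz: "\<phi> \<in> Fil G p" "\<zeta> \<in> HZ G" "(N +> (s \<ominus> z)) \<ominus>\<^bsub>G\<^esub> a = \<phi> \<oplus>\<^bsub>G\<^esub> \<zeta>"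
    by (auto simp: class_eq_def)
  obtain s1 where s1: "s1 \<in> Fil H p" "s1 \<in> M" "\<phi> = N +> s1" using pz(1) by (auto simp: e.A.Q_Fil)
  obtain z1 where z1: "z1 \<in> HZ H" "z1 \<in> M" "\<zeta> = N +> z1" using pz(2) by (auto simp: e.A.Q_HZ)
  obtain x where x: "x \<in> M" "a = N +> x" using ac by (auto simp: e.A.Q_carrier)
  note cl = e.C.U_closed[OF s(2)] e.C.U_closed[OF z(2)] e.A.U_closed[OF s1(2)] e.A.U_closed[OF z1(2)] e.A.U_closed[OF x(1)]
  \<comment> \<open>The correction splits into \<open>s1\<close> in \<open>F\<^sup>p\<close> and an
    integral \<open>z1\<close>. Subtracting \<open>s1\<close> from \<open>s\<close> and adding
    \<open>z1\<close> to \<open>z\<close> changes the difference to a representative of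
    \<open>a\<close>, and since \<open>s1\<close> and \<open>z1\<close> are in \<open>M\<close>,
    both are still lifts of \<open>f g\<close>.\<close>
  define s2 where "s2 = s \<ominus> s1"
  define z2 where "z2 = z \<oplus> z1"
  have c2: "s2 \<in> carrier H" "z2 \<in> carrier H" using cl by (simp_all add: s2_def z2_def)
  have sz: "s2 \<ominus> z2 = (s \<ominus> z) \<ominus> (s1 \<oplus> z1)"
  proof -
    obtain F where F: "frame F s z s1 z1" using frame_exists[OF cl(1-4)] by blast
    show ?thesis unfolding s2_def z2_def frame_atoms[OF F] by (simp add: frame_simps[OF F])
  qed
  have szM: "s2 \<ominus> z2 \<in> M"
    unfolding sz by (intro subspace_diff[OF e.A.subU em(2)] subspace_add[OF e.A.subU] s1 z1)
  have "N +> (s2 \<ominus> z2) = a"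
  proof -
    have "N +> ((s \<ominus> z) \<ominus> x) = N +> (s1 \<oplus> z1)"
      using pz(3) s1 z1 x cl e.A.Q_diff[OF em(2) x(1)] by (simp add: e.A.Q_add)
    then have "((s \<ominus> z) \<ominus> x) \<ominus> (s1 \<oplus> z1) \<in> N" using cl by (simp add: e.A.quot.coset_eq_iff)
    moreover have "((s \<ominus> z) \<ominus> x) \<ominus> (s1 \<oplus> z1) = (s2 \<ominus> z2) \<ominus> x"
    proof -
      have "s \<ominus> z \<in> carrier H" "s1 \<oplus> z1 \<in> carrier H" using cl by simp_all
      then obtain F where F: "frame F (s \<ominus> z) (s1 \<oplus> z1) x x" using frame_exists[OF _ _ cl(5) cl(5)] by blast
      show ?thesis unfolding sz frame_atoms(1-3)[OF F] by (simp add: frame_simps[OF F])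
    qed
    ultimately show ?thesis using x szM e.A.Q_eq[OF szM x(1)] by simp
  qed
  then have szH: "s2 \<ominus> z2 \<in> H'" using a(1) HA_mem[OF szM] by simp
  have s1M: "s \<ominus> s2 \<in> M"
  proof -
    obtain F where F: "frame F s s1 s s" using frame_exists[OF cl(1) cl(3) cl(1) cl(1)] by blast
    have "s \<ominus> s2 = s1" unfolding s2_def frame_atoms(1,2)[OF F] by (simp add: frame_simps[OF F])
    then show ?thesis using s1 by simp
  qed
  have Ms2: "M +> s2 = f g" using s1M s(3) cl(1) c2(1) e.C.quot.coset_eq_iff by metis
  have "z2 \<ominus> z = z1" unfolding z2_def using cl by (simp add: a_comm add_diff_cancel)
  then have Mz2: "M +> z2 = f g" using z1(2) z(3) cl(2) c2(2) e.C.quot.coset_eq_iff by metis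
  have s2U: "s2 \<in> U" "z2 \<in> U"
    using s z s1 z1 e.MU' subspace_diff[OF e.C.subU] subspace_add[OF e.C.subU] by (auto simp: s2_def z2_def)
  \<comment> \<open>For elements of \<open>U\<close>, membership in \<open>H''\<close> depends only
    on the class modulo \<open>M\<close>, and the class \<open>f g\<close> is a Hodge class.\<close>
  have in2: "s2 \<in> H''" "z2 \<in> H''" using s2U Ms2 Mz2 Hpp_mem[OF f] by (simp_all add: H2_def gr_even)
  have "s2 \<in> Fil H p" unfolding s2_def by (rule subspace_diff[OF Fil_subspace s(1) s1(1)])
  moreover have "z2 \<in> HZ H" using z z1 HZ_subgroup by (simp add: z2_def subgroup_iff)
  moreover have eq: "H' +> s2 = H' +> z2" using szH c2 by (simp add: h.C.quot.coset_eq_iff)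
  ultimately obtain f' where f': "f' \<in> mhs_hom T K'" "f' g = H' +> z2"
    using h.tate_hom_exists[OF _ in2(1) _ in2(2) eq H2_U] by blast
  have "hom_incl H p f' = f"
  proof (rule tate_hom_eqI[OF _ f])
    show "hom_incl H p f' \<in> mhs_hom T K" by (rule hom_incl_closed[OF f'(1)])
    have "H' +> s2 = f' g" unfolding f'(2) by (rule eq)
    from hom_incl_eq(2)[OF f'(1) \<open>s2 \<in> Fil H p\<close> in2(1) this \<open>z2 \<in> HZ H\<close> in2(2) f'(2)[symmetric]]
    show "hom_incl H p f' g = f g" unfolding Mz2 .
  qed
  then show "f \<in> hom_incl H p ` mhs_hom T K'" using f'(1) by blast
qed

text \<open>A morphism is determined by its value at the generator, so together with the injectivity
  of \<open>hom_incl\<close> this evaluation embeds the group into the lattice of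
  \<open>gr\<^sub>2\<^sub>p\<close>.\<close>

lemma Hom_free: "\<exists>S::nat set. finite S \<and> Hom T K' \<cong> free_Abelian_group S"
proof (rule free_of_lattice_embedding[OF e.C.C_space_Q e.C.lattice_Q h.Hom_comm_group[OF H2_U]])
  fix f assume "f \<in> carrier (Hom T K')"
  then have f: "f \<in> mhs_hom T K'" by (simp add: Hom_simps)
  have "mhs_map T K (hom_incl H p f)" using hom_incl_closed[OF f] by (simp add: mhs_hom_iff)
  from mhs_mapD(2)[OF this tate_gen_mem(1)] show "hom_incl H p f g \<in> HZ K" .
  fix f' assume "f' \<in> carrier (Hom T K')"
  then have f': "f' \<in> mhs_hom T K'" by (simp add: Hom_simps)
  show "hom_incl H p (f \<otimes>\<^bsub>Hom T K'\<^esub> f') g = hom_incl H p f g \<oplus>\<^bsub>K\<^esub> hom_incl H p f' g"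
    by (simp add: hom_incl_mult[OF f f']) (simp add: Hom_simps)
next
  show "inj_on (\<lambda>f. hom_incl H p f g) (carrier (Hom T K'))"
  proof (rule inj_onI)
    fix f f' assume f: "f \<in> carrier (Hom T K')" "f' \<in> carrier (Hom T K')"
      and eq: "hom_incl H p f g = hom_incl H p f' g"
    have "f \<in> mhs_hom T K'" "f' \<in> mhs_hom T K'" using f by (simp_all add: Hom_simps)
    then have "hom_incl H p f = hom_incl H p f'"
      by (intro tate_hom_eqI[OF hom_incl_closed hom_incl_closed eq])
    then show "f = f'" using hom_incl_inj f by (simp add: Hom_simps inj_on_eq_iff)
  qed
qed

lemma ext_incl_hom: "ext_incl H p \<in> hom (Ext T G') (Ext T G)"
proof (rule homI)
  fix P assume "P \<in> carrier (Ext T G')"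
  then obtain a where a: "a \<in> HA" "P = G'.ext_of a" unfolding G'.Ext_carrier G'_carrier by blast
  then show "ext_incl H p P \<in> carrier (Ext T G)"
    unfolding G.Ext_carrier using HA_subset by (auto simp: ext_incl_eq)
  fix R assume "R \<in> carrier (Ext T G')"
  then obtain b where b: "b \<in> HA" "R = G'.ext_of b" unfolding G'.Ext_carrier G'_carrier by blast
  have ab: "a \<oplus>\<^bsub>G'\<^esub> b = a \<oplus>\<^bsub>G\<^esub> b" by (simp add: G'_eq)
  have "a \<oplus>\<^bsub>G\<^esub> b \<in> HA" using h.A.Q.a_closed[of a b] a b by (simp add: G'_carrier ab)
  then show "ext_incl H p (P \<otimes>\<^bsub>Ext T G'\<^esub> R) = ext_incl H p P \<otimes>\<^bsub>Ext T G\<^esub> ext_incl H p R"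
    using a b HA_subset G'.Ext_mult[of a b] G.Ext_mult[of a b]
    by (auto simp: G'_carrier ab ext_incl_eq)
qed

text \<open>Injectivity is the injectivity of the homomorphism of intermediate Jacobians.\<close>

lemma pt_inj:
  assumes "a \<in> HA" "b \<in> HA" "G.pt a = G.pt b"
  shows "G'.pt a = G'.pt b"
proof -
  have c: "a \<in> carrier G" "b \<in> carrier G" using assms HA_subset by auto
  have "class_eq p G a b" using assms(3) G.pt_eq_iff[OF c] by simp
  then obtain f y where f: "f \<in> Fil G p" "y \<in> HZ G" "a \<ominus>\<^bsub>G\<^esub> b = f \<oplus>\<^bsub>G\<^esub> y" by (auto simp: class_eq_def)
  note fc = G.Fil_closed[OF f(1)] e.A.Q.HZ_closed[OF f(2)]
  have ab: "a \<ominus>\<^bsub>G\<^esub> b \<in> HA" by (rule e.A.Q.subspace_diff[OF e.A.Q.rat_sub_subspace[OF HA_rat] assms(1,2)])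
  have yeq: "y \<ominus>\<^bsub>G\<^esub> (f \<oplus>\<^bsub>G\<^esub> y) = (-1) \<odot>\<^bsub>G\<^esub> f"
  proof -
    obtain F where F: "e.A.Q.frame F f y f f" using e.A.Q.frame_exists[OF fc fc(1) fc(1)] by blast
    show ?thesis unfolding e.A.Q.frame_atoms(1,2)[OF F] by (simp add: e.A.Q.frame_simps[OF F])
  qed
  have "y \<in> HA"
  proof (rule G.level_one_HZ[OF G.Ha_level_one f(2) ab])
    show "y \<ominus>\<^bsub>G\<^esub> (a \<ominus>\<^bsub>G\<^esub> b) \<in> Fil G p"
      unfolding f(3) yeq by (rule e.A.Q.subspace_smult[OF G.Fil_subspace f(1)])
  qed
  moreover have "f = (a \<ominus>\<^bsub>G\<^esub> b) \<ominus>\<^bsub>G\<^esub> y" unfolding f(3) using fc by (simp add: e.A.Q.add_diff_cancel)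
  then have "f \<in> HA" using e.A.Q.subspace_diff[OF e.A.Q.rat_sub_subspace[OF HA_rat] ab \<open>y \<in> HA\<close>] by simp
  moreover have "a \<ominus>\<^bsub>G'\<^esub> b = a \<ominus>\<^bsub>G\<^esub> b"
    using assms(1,2) c by (simp add: h.A.Q.diff_eq e.A.Q.diff_eq G'_carrier) (simp add: G'_eq)
  ultimately have "class_eq p G' a b"
    using f unfolding class_eq_def by (auto simp: G'_eq)
  then show ?thesis using G'.pt_eq_iff[of a b] assms by (simp add: G'_carrier)
qed

lemma ext_incl_inj: "inj_on (ext_incl H p) (carrier (Ext T G'))"
proof (rule inj_onI)
  fix P R assume "P \<in> carrier (Ext T G')" "R \<in> carrier (Ext T G')" and eq: "ext_incl H p P = ext_incl H p R"
  then obtain a b where a: "a \<in> HA" "P = G'.ext_of a" and b: "b \<in> HA" "R = G'.ext_of b"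
    unfolding G'.Ext_carrier G'_carrier by blast
  have "G.ext_of a = G.ext_of b" using eq a b by (simp add: ext_incl_eq)
  then have "G.pt a = G.pt b" using a b HA_subset G.ext_of_pt by blast
  then have "G'.pt a = G'.pt b" by (rule pt_inj[OF a(1) b(1)])
  then show "P = R" using a b G'.ext_of_pt[of a b] by (simp add: G'_carrier)
qed

text \<open>Through Carlson's isomorphisms the composite takes the point of \<open>a\<close> in the
  small torus to the point of \<open>a\<close> in the large one, and \<open>J_incl\<close> is its
  linear lift.\<close>

lemma torus_hom_incl:
  "torus_hom (J_space p G') (J_lattice p G') (J_space p G) (J_lattice p G)
     (carlson p G \<circ> ext_incl H p \<circ> inv_into (carrier (Ext T G')) (carlson p G'))"
  unfolding torus_hom_def
proof (intro bexI[of _ G.J_incl] ballI)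
  show "G.J_incl \<in> C_linear (J_space p G') (J_space p G)"
    unfolding G'_eq by (rule G.J_incl_linear[OF G.Ha_level_one])
  fix P assume "P \<in> carrier (J_space p G')"
  then obtain a where a: "a \<in> HA" "P = Fil G' p +>\<^bsub>G'\<^esub> a" by (auto simp: G'.J_carrier G'_carrier)
  have a': "a \<in> carrier G'" using a by (simp add: G'_carrier)
  have "J_lattice p G' +>\<^bsub>J_space p G'\<^esub> P = carlson p G' (G'.ext_of a)"
    using G'.carlson_ext_of[OF a'] by (simp add: a(2) G'.pt_def)
  moreover have "G'.ext_of a \<in> carrier (Ext T G')" unfolding G'.Ext_carrier using a' by blast
  moreover have "inj_on (carlson p G') (carrier (Ext T G'))"
    using G'.carlson_iso by (simp add: iso_def bij_betw_def)
  ultimately have "(carlson p G \<circ> ext_incl H p \<circ> inv_into (carrier (Ext T G')) (carlson p G'))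
      (J_lattice p G' +>\<^bsub>J_space p G'\<^esub> P) = carlson p G (G.ext_of a)"
    using a(1) by (simp add: ext_incl_eq)
  also have "\<dots> = G.pt a" using G.carlson_ext_of a(1) HA_subset by blast
  also have "\<dots> = J_lattice p G +>\<^bsub>J_space p G\<^esub> G.J_incl P"
    using G.J_incl_coset[OF G.Ha_level_one a(1)] by (simp add: G.pt_def a(2) G'_eq)
  finally show "(carlson p G \<circ> ext_incl H p \<circ> inv_into (carrier (Ext T G')) (carlson p G'))
      (J_lattice p G' +>\<^bsub>J_space p G'\<^esub> P) = J_lattice p G +>\<^bsub>J_space p G\<^esub> G.J_incl P" .
qed

lemma carlson_image: "carlson p G ` G.ext_of ` HA = G.pt ` HA"
  unfolding image_image by (rule image_cong) (use G.carlson_ext_of HA_subset in auto)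

text \<open>By injectivity of \<open>ext_incl\<close>, a class is killed by \<open>h\<^sup>p\<close>
  exactly when its image is killed by \<open>e\<^sup>p\<close>. Every class killed by
  \<open>e\<^sup>p\<close> occurs, because zero belongs to \<open>HA\<close> and
  \<open>hom_incl_image\<close> then applies.\<close>

lemma kernel_image:
  "hom_incl H p ` kernel (Hom T K') (Ext T G') (h_map H p) = kernel (Hom T K) (Ext T G) (e_map H p)"
proof -
  have z: "\<zero>\<^bsub>G'\<^esub> = \<zero>\<^bsub>G\<^esub>" by (simp add: G'_eq)
  have zA: "\<zero>\<^bsub>G\<^esub> \<in> HA" by (rule e.A.Q.subspace_zero[OF e.A.Q.rat_sub_subspace[OF HA_rat]])
  have one': "\<one>\<^bsub>Ext T G'\<^esub> \<in> carrier (Ext T G')"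
    unfolding G'.Ext_one G'.Ext_carrier G'_carrier z using zA by blast
  have one: "ext_incl H p \<one>\<^bsub>Ext T G'\<^esub> = \<one>\<^bsub>Ext T G\<^esub>"
    unfolding G'.Ext_one G.Ext_one z by (rule ext_incl_eq[OF zA])
  have iff: "h_map H p f = \<one>\<^bsub>Ext T G'\<^esub> \<longleftrightarrow> e_map H p (hom_incl H p f) = \<one>\<^bsub>Ext T G\<^esub>"
    if f: "f \<in> mhs_hom T K'" for f
    using inj_on_eq_iff[OF ext_incl_inj h_map_closed[OF f] one'] incl_square[OF f] one by simp
  show ?thesis
  proof (rule equalityI; rule subsetI)
    fix f assume "f \<in> hom_incl H p ` kernel (Hom T K') (Ext T G') (h_map H p)"
    then obtain f' where "f' \<in> mhs_hom T K'" "h_map H p f' = \<one>\<^bsub>Ext T G'\<^esub>" "f = hom_incl H p f'"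
      by (auto simp: kernel_def Hom_simps)
    then show "f \<in> kernel (Hom T K) (Ext T G) (e_map H p)"
      using iff hom_incl_closed by (simp add: kernel_def Hom_simps)
  next
    fix f assume "f \<in> kernel (Hom T K) (Ext T G) (e_map H p)"
    then have f: "f \<in> mhs_hom T K" "e_map H p f = \<one>\<^bsub>Ext T G\<^esub>" by (simp_all add: kernel_def Hom_simps)
    then have "f \<in> {f \<in> mhs_hom T K. e_map H p f \<in> G.ext_of ` HA}" using zA by (simp add: G.Ext_one)
    then obtain f' where f': "f' \<in> mhs_hom T K'" "f = hom_incl H p f'" unfolding hom_incl_image[symmetric] by blast
    then have "f' \<in> kernel (Hom T K') (Ext T G') (h_map H p)" using f iff by (simp add: kernel_def Hom_simps)
    then show "f \<in> hom_incl H p ` kernel (Hom T K') (Ext T G') (h_map H p)" using f'(2) by blast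
  qed
qed

lemma one_motive_h_map:
  "one_motive (Hom T K') (carlson p G' \<circ> h_map H p) (J_space p G') {\<zero>\<^bsub>J_space p G'\<^esub>} (J_lattice p G')"
  unfolding one_motive_def
proof (intro conjI)
  have "polarizable G (2 * p - 1)" using pol by (simp add: gr_odd)
  then have "abelian_variety (J_space p G') (J_lattice p G')"
    unfolding G'_eq by (rule G.level_one_abelian_variety[OF G.Ha_level_one])
  then show "semi_abelian_variety (J_space p G') {\<zero>\<^bsub>J_space p G'\<^esub>} (J_lattice p G')"
    by (rule abelian_imp_semi_abelian)
qed (rule h.Hom_comm_group[OF H2_U] Hom_free carlson_h_map_hom)+

end

theorem proposition3p2p1:
  fixes H :: "'a mhs" and p :: int
  assumes "MHS H"
    and "\<forall>k<0. Wt H k = {\<zero>\<^bsub>H\<^esub>}"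
    and "p > 0"
    and "polarizable (gr H (2 * p - 1)) (2 * p - 1)"
  shows
    "let T = tate (- p);
         G = gr H (2 * p - 1); V = J_space p G; L = J_lattice p G;
         G' = subquot H (H1 H p) (WC H (2 * p - 2)); V' = J_space p G'; L' = J_lattice p G';
         e = e_map H p; h = h_map H p;
         HomE = Hom T (gr H (2 * p)); ExtE = Ext T G;
         HomH = Hom T (subquot H (H2 H p) (H1 H p)); ExtH = Ext T G';
         \<iota> = ext_incl H p; j = hom_incl H p;
         A = \<iota> ` carrier ExtH
     in
       complex_torus V L \<and> carlson p G \<in> iso ExtE (V A_Mod L) \<and>
       complex_torus V' L' \<and> carlson p G' \<in> iso ExtH (V' A_Mod L') \<and>
       one_motive HomH (carlson p G' \<circ> h) V' {\<zero>\<^bsub>V'\<^esub>} L' \<and>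
       \<iota> \<in> hom ExtH ExtE \<and> inj_on \<iota> (carrier ExtH) \<and>
       torus_hom V' L' V L (carlson p G \<circ> \<iota> \<circ> inv_into (carrier ExtH) (carlson p G')) \<and>
       abelian_subvariety V L (J_horizontal p G) (carlson p G ` A) \<and>
       (\<forall>B. abelian_subvariety V L (J_horizontal p G) B \<longrightarrow> B \<subseteq> carlson p G ` A) \<and>
       j \<in> hom HomH HomE \<and> inj_on j (carrier HomH) \<and>
       j ` carrier HomH = {f \<in> carrier HomE. e f \<in> A} \<and>
       (\<forall>f\<in>carrier HomH. \<iota> (h f) = e (j f)) \<and>
       j ` kernel HomH ExtH h = kernel HomE ExtE e"
proof -
  interpret weight_step H p
    by (intro weight_step.intro weight_step_axioms.intro MHS_filtered assms)
  have pG: "polarizable G (2 * p - 1)" using pol by (simp add: gr_odd)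
  have j: "hom_incl H p \<in> hom (Hom T K') (Hom T K)"
    by (rule homI) (simp_all add: Hom_simps(1) hom_incl_closed hom_incl_mult)
  have A: "abelian_subvariety (J_space p G) (J_lattice p G) (J_horizontal p G) (G.pt ` HA)"
    by (rule G.level_one_abelian_subvariety[OF G.Ha_level_one pG])
  have largest: "\<forall>B. abelian_subvariety (J_space p G) (J_lattice p G) (J_horizontal p G) B \<longrightarrow> B \<subseteq> G.pt ` HA"
    by (intro allI impI) (rule G.abelian_subvariety_subset)
  have square: "\<forall>f\<in>mhs_hom T K'. ext_incl H p (h_map H p f) = e_map H p (hom_incl H p f)"
    by (intro ballI) (rule incl_square)
  note parts = G.J_complex_torus G.carlson_iso G'.J_complex_torus G'.carlson_iso one_motive_h_map
    ext_incl_hom ext_incl_inj torus_hom_incl A largest j hom_incl_inj hom_incl_image square kernel_image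
  show ?thesis
    unfolding Let_def gr_odd gr_even ext_incl_image carlson_image Hom_simps(1)
    by (rule conjI parts)+
qed

end
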